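(* Let $\gamma>0$, $y_\Omega\in L^2(\Omega)$, $\beta\in C(\Gamma)$, $b\in C(\bar\omega)$ and $\mu^*\in L^q(\omega)$ for some $q>2$. For $\nu>0$ define $G^\gamma:L^2(\Gamma)\to L^2(\Gamma)$ by $$G^\gamma(u)=\nu u-\min\big\{\nu\beta,\,-S^*Su+S^*y_\Omega-S^*\chi_{\bar\omega}\max\{0,\mu^*+\gamma(Su-b)\}\big\},$$ and $$M^\gamma(u)v=\nu v+\chi_{\Gamma_F(u,\gamma)}S^*(1+\gamma\chi_{\omega_A(u,\gamma)})Sv,$$ where $\omega_A(u,\gamma)=\{x\in\bar\omega:\ \mu^*+\gamma(Su-b)>0\}$, $$\Gamma_A(u,\gamma)=\big\{x\in\Gamma:\ -S^*Su+S^*y_\Omega-S^*\chi_{\bar\omega}\max\{0,\mu^*+\gamma(Su-b)\}>\nu\beta\big\},\qquad\Gamma_F(u,\gamma)=\Gamma\setminus\Gamma_A(u,\gamma).$$ Then $G^\gamma$ is slantly differentiable, $M^\gamma(u)$ is a slant differential of $G^\gamma$, and for every fixed $\nu>0$, $M^\gamma(u)$ has an inverse in $\mathcal{L}(L^2(\Gamma),L^2(\Gamma))$ uniformly bounded for all $u\in L^2(\Gamma)$. The semismooth Newton method $M^\gamma(u^k)(u^{k+1}-u^k)=-G^\gamma(u^k)$, $k=0,1,2,\dots$, converges locally q-superlinearly in $L^2(\Gamma)$ to the unique solution $u^\gamma$ of $G^\gamma(u^\gamma)=0$ (i.e. whenever $u^0$ is close enough to $u^\gamma$ in $L^2(\G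amma)$).
   Context: $\Omega\subset\mathbb{R}^2$ is a bounded convex domain with polygonal boundary $\Gamma$, and $\omega$ is a domain with $\bar\omega\subset\Omega$. $(\cdot,\cdot)_X$ is the inner product of $L^2(X)$, and $\chi_B$ is the characteristic function of $B$. Let $\Phi=\{\phi\in H^1_0(\Omega):\Delta\phi\in L^2(\Omega)\}$; functions in $\Phi$ have normal derivative $\partial_n\phi\in L^2(\Gamma)$. The continuous linear operator $S:L^2(\Gamma)\to L^2(\Omega)$ is defined by $y=Su$ iff $(y,-\Delta\phi)_\Omega=-(u,\partial_n\phi)_\Gamma$ for all $\phi\in\Phi$ (transposition solution of $-\Delta y=0$ in $\Omega$, $y=u$ on $\Gamma$). Its adjoint $S^*:L^2(\Omega)\to L^2(\Gamma)$ is $S^*z=-\partial_n\phi$, where $\phi\in H^1_0(\Omega)$ is the weak solution of $-\Delta\phi=z$. The function $u^\gamma$ is the unique minimizer over $\{u\in L^2(\Gamma):u\le\beta\text{ a.e.}\}$ of $\frac12\|Su-y_\Omega\|^2_{L^2(\Omega)}+\frac\nu2\|u\|^2_{L^2(\Gamma)}+\frac1{2\gamma}\int_{\bar\omega}\max\{0,\mu^*+\gamma(Su-b)\}^2dx$. A map $F:X\to Y$ between Banach spaces is slantly differentiable with slant differential $M:X\to\mathcal{L}(X,Y)$ if for every $x\in X$, $\|F(x+d)-F(x)-M(x+d)d\|_Y=o(\|d\|_X)$ as $d\to0$. *)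

theory Defs
  imports "HOL-Analysis.Analysis" "HOL-Library.Landau_Symbols"
begin

section \<open>Lebesgue spaces\<close>

text \<open>
  Elements of Lebesgue spaces are handled through representatives; equality in the space is
  equality almost everywhere (\<open>eq_ae\<close>).
\<close>

definition Lp :: "real \<Rightarrow> 'a measure \<Rightarrow> ('a \<Rightarrow> 'b::real_normed_vector) set" where
  "Lp p M = {f \<in> borel_measurable M. integrable M (\<lambda>x. norm (f x) powr p)}"

abbreviation L2 :: "'a measure \<Rightarrow> ('a \<Rightarrow> 'b::real_normed_vector) set" where
  "L2 M \<equiv> Lp 2 M"

definition L2_inner :: "'a measure \<Rightarrow> ('a \<Rightarrow> 'b::real_inner) \<Rightarrow> ('a \<Rightarrow> 'b) \<Rightarrow> real" where
  "L2_inner M f g = (LINT x|M. f x \<bullet> g x)"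

definition L2_norm :: "'a measure \<Rightarrow> ('a \<Rightarrow> 'b::real_inner) \<Rightarrow> real" where
  "L2_norm M f = sqrt (L2_inner M f f)"

definition eq_ae :: "'a measure \<Rightarrow> ('a \<Rightarrow> 'b) \<Rightarrow> ('a \<Rightarrow> 'b) \<Rightarrow> bool" where
  "eq_ae M f g \<longleftrightarrow> (AE x in M. f x = g x)"

text \<open>Functions on representatives that induce a map of the quotient spaces.\<close>

definition L2_map ::
  "'a measure \<Rightarrow> 'b measure \<Rightarrow> (('a \<Rightarrow> real) \<Rightarrow> ('b \<Rightarrow> real)) \<Rightarrow> bool" where
  "L2_map M N F \<longleftrightarrow> (\<forall>u\<in>L2 M. F u \<in> L2 N) \<and>
     (\<forall>u\<in>L2 M. \<forall>v\<in>L2 M. eq_ae M u v \<longrightarrow> eq_ae N (F u) (F v))"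

definition L2_bounded_linear ::
  "'a measure \<Rightarrow> 'b measure \<Rightarrow> (('a \<Rightarrow> real) \<Rightarrow> ('b \<Rightarrow> real)) \<Rightarrow> bool" where
  "L2_bounded_linear M N T \<longleftrightarrow> L2_map M N T \<and>
     (\<forall>u\<in>L2 M. \<forall>v\<in>L2 M. eq_ae N (T (\<lambda>x. u x + v x)) (\<lambda>x. T u x + T v x)) \<and>
     (\<forall>c. \<forall>u\<in>L2 M. eq_ae N (T (\<lambda>x. c * u x)) (\<lambda>x. c * T u x)) \<and>
     (\<exists>C. \<forall>u\<in>L2 M. L2_norm N (T u) \<le> C * L2_norm M u)"

text \<open>
  Slant differentiability of \<open>F : L\<^sup>2(M) \<rightarrow> L\<^sup>2(N)\<close>.  The second conjunct says that \<open>D\<close> depends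
  only on the class of its argument, so that it is a map into the bounded linear operators.
\<close>

definition slant_differential ::
  "'a measure \<Rightarrow> 'b measure \<Rightarrow> (('a \<Rightarrow> real) \<Rightarrow> ('b \<Rightarrow> real)) \<Rightarrow>
   (('a \<Rightarrow> real) \<Rightarrow> ('a \<Rightarrow> real) \<Rightarrow> ('b \<Rightarrow> real)) \<Rightarrow> bool" where
  "slant_differential M N F D \<longleftrightarrow> L2_map M N F \<and>
     (\<forall>u\<in>L2 M. \<forall>u'\<in>L2 M. eq_ae M u u' \<longrightarrow> (\<forall>v\<in>L2 M. eq_ae N (D u v) (D u' v))) \<and>
     (\<forall>u\<in>L2 M. L2_bounded_linear M N (D u)) \<and>
     (\<forall>u\<in>L2 M. \<forall>\<epsilon>>0. \<exists>\<delta>>0. \<forall>d\<in>L2 M. L2_norm M d < \<delta> \<longrightarrow>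
        L2_norm N (\<lambda>x. F (\<lambda>z. u z + d z) x - F u x - D (\<lambda>z. u z + d z) d x)
          \<le> \<epsilon> * L2_norm M d)"

definition slantly_differentiable ::
  "'a measure \<Rightarrow> 'b measure \<Rightarrow> (('a \<Rightarrow> real) \<Rightarrow> ('b \<Rightarrow> real)) \<Rightarrow> bool" where
  "slantly_differentiable M N F \<longleftrightarrow> (\<exists>D. slant_differential M N F D)"


section \<open>Convex polygonal domains and arc length on their boundary\<close>

definition convex_polygonal_domain :: "(real^2) set \<Rightarrow> bool" where
  "convex_polygonal_domain \<Omega> \<longleftrightarrow>
     open \<Omega> \<and> \<Omega> \<noteq> {} \<and> bounded \<Omega> \<and> convex \<Omega> \<and> polytope (closure \<Omega>)"

text \<open>
  The sides of the polygon, each listed exactly once as \<open>(p, q)\<close>: the orientation condition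
  (the domain lies to the left of the line from \<open>p\<close> to \<open>q\<close>) excludes \<open>(q, p)\<close>.
\<close>

definition sides :: "(real^2) set \<Rightarrow> ((real^2) \<times> (real^2)) set" where
  "sides \<Omega> = {(p, q). closed_segment p q facet_of closure \<Omega> \<and>
     (\<forall>x\<in>\<Omega>. 0 < (q$1 - p$1) * (x$2 - p$2) - (q$2 - p$2) * (x$1 - p$1))}"

text \<open>
  Arc length on \<open>\<Gamma> = frontier \<Omega>\<close>: every side \<open>(p, q)\<close> is parametrised over \<open>[0, 1]\<close> with
  constant speed \<open>dist p q\<close>.
\<close>

definition boundary_measure :: "(real^2) set \<Rightarrow> (real^2) measure" where
  "boundary_measure \<Omega> =
     distr
       (density (count_space (sides \<Omega>) \<Otimes>\<^sub>M restrict_space lborel {0..1})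
          (\<lambda>((p, q), t). ennreal (dist p q)))
       (restrict_space borel (frontier \<Omega>))
       (\<lambda>((p, q), t). (1 - t) *\<^sub>R p + t *\<^sub>R q)"


section \<open>Sobolev spaces\<close>

definition partial_deriv :: "2 \<Rightarrow> (real^2 \<Rightarrow> real) \<Rightarrow> real^2 \<Rightarrow> real" where
  "partial_deriv i f x = frechet_derivative f (at x) (axis i 1)"

definition C_infinity :: "(real^2 \<Rightarrow> real) \<Rightarrow> bool" where
  "C_infinity f \<longleftrightarrow> (\<forall>is. \<forall>x. foldr partial_deriv is f differentiable (at x))"

definition grad :: "(real^2 \<Rightarrow> real) \<Rightarrow> real^2 \<Rightarrow> real^2" where
  "grad f x = (\<chi> i. partial_deriv i f x)"

definition test_functions :: "(real^2) set \<Rightarrow> (real^2 \<Rightarrow> real) set" where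
  "test_functions \<Omega> = {\<psi>. C_infinity \<psi> \<and> compact (closure {x. \<psi> x \<noteq> 0}) \<and>
     closure {x. \<psi> x \<noteq> 0} \<subseteq> \<Omega>}"

definition has_weak_gradient ::
  "(real^2) set \<Rightarrow> (real^2 \<Rightarrow> real) \<Rightarrow> (real^2 \<Rightarrow> real^2) \<Rightarrow> bool" where
  "has_weak_gradient \<Omega> u g \<longleftrightarrow> g \<in> L2 (lebesgue_on \<Omega>) \<and>
     (\<forall>\<psi>\<in>test_functions \<Omega>. \<forall>i.
        L2_inner (lebesgue_on \<Omega>) u (partial_deriv i \<psi>)
          = - L2_inner (lebesgue_on \<Omega>) (\<lambda>x. g x $ i) \<psi>)"

definition weak_grad :: "(real^2) set \<Rightarrow> (real^2 \<Rightarrow> real) \<Rightarrow> real^2 \<Rightarrow> real^2" where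
  "weak_grad \<Omega> u = (SOME g. has_weak_gradient \<Omega> u g)"

definition H1 :: "(real^2) set \<Rightarrow> (real^2 \<Rightarrow> real) set" where
  "H1 \<Omega> = {u \<in> L2 (lebesgue_on \<Omega>). \<exists>g. has_weak_gradient \<Omega> u g}"

text \<open>The closure of the test functions in \<open>H\<^sup>1(\<Omega>)\<close>.\<close>

definition H10 :: "(real^2) set \<Rightarrow> (real^2 \<Rightarrow> real) set" where
  "H10 \<Omega> = {u \<in> H1 \<Omega>. \<exists>\<psi>::nat \<Rightarrow> real^2 \<Rightarrow> real.
     (\<forall>k. \<psi> k \<in> test_functions \<Omega>) \<and>
     (\<lambda>k. L2_norm (lebesgue_on \<Omega>) (\<lambda>x. \<psi> k x - u x)) \<longlonglongrightarrow> 0 \<and>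
     (\<lambda>k. L2_norm (lebesgue_on \<Omega>) (\<lambda>x. grad (\<psi> k) x - weak_grad \<Omega> u x)) \<longlonglongrightarrow> 0}"

definition has_weak_laplacian ::
  "(real^2) set \<Rightarrow> (real^2 \<Rightarrow> real) \<Rightarrow> (real^2 \<Rightarrow> real) \<Rightarrow> bool" where
  "has_weak_laplacian \<Omega> u f \<longleftrightarrow> f \<in> L2 (lebesgue_on \<Omega>) \<and>
     (\<forall>\<psi>\<in>test_functions \<Omega>.
        L2_inner (lebesgue_on \<Omega>) u (\<lambda>x. \<Sum>i\<in>UNIV. partial_deriv i (partial_deriv i \<psi>) x)
          = L2_inner (lebesgue_on \<Omega>) f \<psi>)"

definition weak_laplacian :: "(real^2) set \<Rightarrow> (real^2 \<Rightarrow> real) \<Rightarrow> real^2 \<Rightarrow> real" where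
  "weak_laplacian \<Omega> u = (SOME f. has_weak_laplacian \<Omega> u f)"

definition Phi :: "(real^2) set \<Rightarrow> (real^2 \<Rightarrow> real) set" where
  "Phi \<Omega> = {\<phi> \<in> H10 \<Omega>. \<exists>f. has_weak_laplacian \<Omega> \<phi> f}"

text \<open>
  The normal derivative in \<open>L\<^sup>2(\<Gamma>)\<close>, as usual for functions with square integrable Laplacian,
  is the one given by Green's formula; the restrictions of functions in \<open>C\<^sup>\<infinity>(\<real>\<^sup>2)\<close> to \<open>\<Omega>\<close> are
  dense in \<open>H\<^sup>1(\<Omega>)\<close> and their restrictions to \<open>\<Gamma>\<close> are dense in \<open>L\<^sup>2(\<Gamma>)\<close>.
\<close>

definition has_normal_derivative ::
  "(real^2) set \<Rightarrow> (real^2 \<Rightarrow> real) \<Rightarrow> (real^2 \<Rightarrow> real) \<Rightarrow> bool" where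
  "has_normal_derivative \<Omega> \<phi> g \<longleftrightarrow> g \<in> L2 (boundary_measure \<Omega>) \<and>
     (\<forall>\<psi>. C_infinity \<psi> \<longrightarrow>
        L2_inner (boundary_measure \<Omega>) g \<psi>
          = L2_inner (lebesgue_on \<Omega>) (weak_grad \<Omega> \<phi>) (grad \<psi>)
            + L2_inner (lebesgue_on \<Omega>) (weak_laplacian \<Omega> \<phi>) \<psi>)"

definition normal_derivative :: "(real^2) set \<Rightarrow> (real^2 \<Rightarrow> real) \<Rightarrow> real^2 \<Rightarrow> real" where
  "normal_derivative \<Omega> \<phi> = (SOME g. has_normal_derivative \<Omega> \<phi> g)"


section \<open>The control-to-state operator and its adjoint\<close>

definition transposition_solution ::
  "(real^2) set \<Rightarrow> (real^2 \<Rightarrow> real) \<Rightarrow> (real^2 \<Rightarrow> real) \<Rightarrow> bool" where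
  "transposition_solution \<Omega> u y \<longleftrightarrow> y \<in> L2 (lebesgue_on \<Omega>) \<and>
     (\<forall>\<phi>\<in>Phi \<Omega>. L2_inner (lebesgue_on \<Omega>) y (\<lambda>x. - weak_laplacian \<Omega> \<phi> x)
        = - L2_inner (boundary_measure \<Omega>) u (normal_derivative \<Omega> \<phi>))"

definition S_op :: "(real^2) set \<Rightarrow> (real^2 \<Rightarrow> real) \<Rightarrow> real^2 \<Rightarrow> real" where
  "S_op \<Omega> u = (SOME y. transposition_solution \<Omega> u y)"

definition weak_poisson_solution ::
  "(real^2) set \<Rightarrow> (real^2 \<Rightarrow> real) \<Rightarrow> (real^2 \<Rightarrow> real) \<Rightarrow> bool" where
  "weak_poisson_solution \<Omega> z \<phi> \<longleftrightarrow> \<phi> \<in> H10 \<Omega> \<and>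
     (\<forall>v\<in>H10 \<Omega>. L2_inner (lebesgue_on \<Omega>) (weak_grad \<Omega> \<phi>) (weak_grad \<Omega> v)
        = L2_inner (lebesgue_on \<Omega>) z v)"

definition S_adj :: "(real^2) set \<Rightarrow> (real^2 \<Rightarrow> real) \<Rightarrow> real^2 \<Rightarrow> real" where
  "S_adj \<Omega> z = (\<lambda>x. - normal_derivative \<Omega> (SOME \<phi>. weak_poisson_solution \<Omega> z \<phi>) x)"


section \<open>The regularised control problem and its optimality system\<close>

text \<open>
  Parameters: \<open>y\<^sub>d\<close> is the desired state \<open>y\<^sub>\<Omega>\<close>, \<open>\<mu>\<close> the shift \<open>\<mu>\<^sup>*\<close>, \<open>\<beta>\<close> and \<open>b\<close> the control and
  state bounds.  The shift \<open>\<mu>\<close> enters through its values on \<open>closure \<omega>\<close>, so it is to be taken from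
  \<open>L\<^sup>q(closure \<omega>)\<close>; this is \<open>L\<^sup>q(\<omega>)\<close> whenever the boundary of \<open>\<omega>\<close> is a null set.
\<close>

definition objective ::
  "(real^2) set \<Rightarrow> (real^2) set \<Rightarrow> (real^2 \<Rightarrow> real) \<Rightarrow> (real^2 \<Rightarrow> real) \<Rightarrow> (real^2 \<Rightarrow> real) \<Rightarrow>
   real \<Rightarrow> real \<Rightarrow> (real^2 \<Rightarrow> real) \<Rightarrow> real" where
  "objective \<Omega> \<omega> y\<^sub>d b \<mu> \<gamma> \<nu> u =
     1/2 * (L2_norm (lebesgue_on \<Omega>) (\<lambda>x. S_op \<Omega> u x - y\<^sub>d x))\<^sup>2
     + \<nu>/2 * (L2_norm (boundary_measure \<Omega>) u)\<^sup>2
     + 1 / (2 * \<gamma>) *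
         (LINT x|lebesgue_on (closure \<omega>). (max 0 (\<mu> x + \<gamma> * (S_op \<Omega> u x - b x)))\<^sup>2)"

definition admissible :: "(real^2) set \<Rightarrow> (real^2 \<Rightarrow> real) \<Rightarrow> (real^2 \<Rightarrow> real) set" where
  "admissible \<Omega> \<beta> = {u \<in> L2 (boundary_measure \<Omega>). AE x in boundary_measure \<Omega>. u x \<le> \<beta> x}"

definition is_minimizer ::
  "(real^2) set \<Rightarrow> (real^2) set \<Rightarrow> (real^2 \<Rightarrow> real) \<Rightarrow> (real^2 \<Rightarrow> real) \<Rightarrow> (real^2 \<Rightarrow> real) \<Rightarrow>
   (real^2 \<Rightarrow> real) \<Rightarrow> real \<Rightarrow> real \<Rightarrow> (real^2 \<Rightarrow> real) \<Rightarrow> bool" where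
  "is_minimizer \<Omega> \<omega> y\<^sub>d \<beta> b \<mu> \<gamma> \<nu> u \<longleftrightarrow> u \<in> admissible \<Omega> \<beta> \<and>
     (\<forall>v\<in>admissible \<Omega> \<beta>. objective \<Omega> \<omega> y\<^sub>d b \<mu> \<gamma> \<nu> u \<le> objective \<Omega> \<omega> y\<^sub>d b \<mu> \<gamma> \<nu> v)"

definition multiplier_term ::
  "(real^2) set \<Rightarrow> (real^2) set \<Rightarrow> (real^2 \<Rightarrow> real) \<Rightarrow> (real^2 \<Rightarrow> real) \<Rightarrow> (real^2 \<Rightarrow> real) \<Rightarrow>
   real \<Rightarrow> (real^2 \<Rightarrow> real) \<Rightarrow> real^2 \<Rightarrow> real" where
  "multiplier_term \<Omega> \<omega> y\<^sub>d b \<mu> \<gamma> u x =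
     - S_adj \<Omega> (S_op \<Omega> u) x + S_adj \<Omega> y\<^sub>d x
     - S_adj \<Omega> (\<lambda>z. indicator (closure \<omega>) z * max 0 (\<mu> z + \<gamma> * (S_op \<Omega> u z - b z))) x"

definition G_map ::
  "(real^2) set \<Rightarrow> (real^2) set \<Rightarrow> (real^2 \<Rightarrow> real) \<Rightarrow> (real^2 \<Rightarrow> real) \<Rightarrow> (real^2 \<Rightarrow> real) \<Rightarrow>
   (real^2 \<Rightarrow> real) \<Rightarrow> real \<Rightarrow> real \<Rightarrow> (real^2 \<Rightarrow> real) \<Rightarrow> real^2 \<Rightarrow> real" where
  "G_map \<Omega> \<omega> y\<^sub>d \<beta> b \<mu> \<gamma> \<nu> u x =
     \<nu> * u x - min (\<nu> * \<beta> x) (multiplier_term \<Omega> \<omega> y\<^sub>d b \<mu> \<gamma> u x)"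

definition state_active_set ::
  "(real^2) set \<Rightarrow> (real^2) set \<Rightarrow> (real^2 \<Rightarrow> real) \<Rightarrow> (real^2 \<Rightarrow> real) \<Rightarrow>
   real \<Rightarrow> (real^2 \<Rightarrow> real) \<Rightarrow> (real^2) set" where
  "state_active_set \<Omega> \<omega> b \<mu> \<gamma> u = {x \<in> closure \<omega>. \<mu> x + \<gamma> * (S_op \<Omega> u x - b x) > 0}"

definition control_active_set ::
  "(real^2) set \<Rightarrow> (real^2) set \<Rightarrow> (real^2 \<Rightarrow> real) \<Rightarrow> (real^2 \<Rightarrow> real) \<Rightarrow> (real^2 \<Rightarrow> real) \<Rightarrow>
   (real^2 \<Rightarrow> real) \<Rightarrow> real \<Rightarrow> real \<Rightarrow> (real^2 \<Rightarrow> real) \<Rightarrow> (real^2) set" where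
  "control_active_set \<Omega> \<omega> y\<^sub>d \<beta> b \<mu> \<gamma> \<nu> u =
     {x \<in> frontier \<Omega>. multiplier_term \<Omega> \<omega> y\<^sub>d b \<mu> \<gamma> u x > \<nu> * \<beta> x}"

definition control_free_set ::
  "(real^2) set \<Rightarrow> (real^2) set \<Rightarrow> (real^2 \<Rightarrow> real) \<Rightarrow> (real^2 \<Rightarrow> real) \<Rightarrow> (real^2 \<Rightarrow> real) \<Rightarrow>
   (real^2 \<Rightarrow> real) \<Rightarrow> real \<Rightarrow> real \<Rightarrow> (real^2 \<Rightarrow> real) \<Rightarrow> (real^2) set" where
  "control_free_set \<Omega> \<omega> y\<^sub>d \<beta> b \<mu> \<gamma> \<nu> u =
     frontier \<Omega> - control_active_set \<Omega> \<omega> y\<^sub>d \<beta> b \<mu> \<gamma> \<nu> u"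

definition M_map ::
  "(real^2) set \<Rightarrow> (real^2) set \<Rightarrow> (real^2 \<Rightarrow> real) \<Rightarrow> (real^2 \<Rightarrow> real) \<Rightarrow> (real^2 \<Rightarrow> real) \<Rightarrow>
   (real^2 \<Rightarrow> real) \<Rightarrow> real \<Rightarrow> real \<Rightarrow> (real^2 \<Rightarrow> real) \<Rightarrow> (real^2 \<Rightarrow> real) \<Rightarrow> real^2 \<Rightarrow> real" where
  "M_map \<Omega> \<omega> y\<^sub>d \<beta> b \<mu> \<gamma> \<nu> u v x =
     \<nu> * v x + indicator (control_free_set \<Omega> \<omega> y\<^sub>d \<beta> b \<mu> \<gamma> \<nu> u) x *
       S_adj \<Omega> (\<lambda>z. (1 + \<gamma> * indicator (state_active_set \<Omega> \<omega> b \<mu> \<gamma> u) z) * S_op \<Omega> v z) x"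


section \<open>Newton's method\<close>

definition newton_sequence ::
  "'a measure \<Rightarrow> (('a \<Rightarrow> real) \<Rightarrow> ('a \<Rightarrow> real)) \<Rightarrow>
   (('a \<Rightarrow> real) \<Rightarrow> ('a \<Rightarrow> real) \<Rightarrow> ('a \<Rightarrow> real)) \<Rightarrow> (nat \<Rightarrow> 'a \<Rightarrow> real) \<Rightarrow> bool" where
  "newton_sequence M F D u \<longleftrightarrow> (\<forall>k. u k \<in> L2 M) \<and>
     (\<forall>k. eq_ae M (D (u k) (\<lambda>x. u (Suc k) x - u k x)) (\<lambda>x. - F (u k) x))"

definition q_superlinear_convergence ::
  "'a measure \<Rightarrow> (nat \<Rightarrow> 'a \<Rightarrow> real) \<Rightarrow> ('a \<Rightarrow> real) \<Rightarrow> bool" where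
  "q_superlinear_convergence M u w \<longleftrightarrow>
     (\<lambda>k. L2_norm M (\<lambda>x. u k x - w x)) \<longlonglongrightarrow> 0 \<and>
     (\<lambda>k. L2_norm M (\<lambda>x. u (Suc k) x - w x)) \<in> o(\<lambda>k. L2_norm M (\<lambda>x. u k x - w x))"

end

theory Submission
  imports Defs "HOL-Computational_Algebra.Polynomial"
begin

text \<open>
  No \<open>H\<^sup>2\<close> regularity and no norm gap is used. Dilating a test function into the domain shows that a
  weak solution \<open>\<phi>\<close> of \<open>-\<Delta>\<phi> = z\<close> carries at most the energy \<open>K \<epsilon> \<parallel>z\<parallel> \<parallel>\<nabla>\<phi>\<parallel>\<close> in the strip of width \<open>\<epsilon>\<close>
  along the boundary. Testing with a cutoff supported in that strip and letting \<open>\<epsilon>\<close> tend to 0 bounds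
  the functional \<open>\<psi> \<mapsto> (\<nabla>\<phi>, \<nabla>\<psi>) - (z, \<psi>)\<close> by the trace norm of \<open>\<psi>\<close>, so that \<open>\<partial>\<^sub>n\<phi>\<close> exists in \<open>L\<^sup>2(\<Gamma>)\<close>
  with \<open>\<parallel>\<partial>\<^sub>n\<phi>\<parallel>\<^sup>2 \<le> C \<parallel>z\<parallel> \<parallel>\<nabla>\<phi>\<parallel>\<close>. Since \<open>\<parallel>\<nabla>\<phi>\<parallel>\<close> is small relative to \<open>\<parallel>z\<parallel>\<close> when \<open>z\<close> is orthogonal to the
  piecewise constant functions on a fine grid, \<open>S\<^sup>*\<close> is a limit of finite rank operators. Therefore the
  squares of \<open>S v\<close> and of \<open>S\<^sup>* z\<close> are uniformly integrable for \<open>v\<close>, \<open>z\<close> in the unit balls. The linearisation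
  errors of \<open>max\<close> and \<open>min\<close> live on sets \<open>{0 < \<bar>w\<bar> \<le> \<bar>S d\<bar>}\<close> and \<open>{0 < \<bar>w\<bar> \<le> \<bar>S\<^sup>* z\<bar>}\<close>, whose measures tend to 0
  with \<open>d\<close> and \<open>z\<close>, so uniform integrability makes these errors \<open>o(\<parallel>d\<parallel>)\<close>. The operator
  \<open>M(u)\<close> is the identity times \<open>\<nu>\<close> off the free set and coercive on it, whence its uniform inverse.
\<close>

subsection \<open>Square integrable functions as a Hilbert space\<close>

text \<open>Weak gradients, weak Laplacians, normal derivatives and states are selected by choice
  from their defining properties. Nothing can be estimated before existence in L^2 and uniqueness up
  to null sets are known; solutions, normal derivatives and states are therefore first produced by
  Riesz arguments and then compared with the chosen ones. Even linearity of S is available only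
  almost everywhere, as a consequence of its having an adjoint. The bound on the normal derivative
  has to contain the product of \<parallel>z\<parallel> and \<parallel>grad \<phi>\<parallel>
  instead of \<parallel>z\<parallel>^2: for rapidly oscillating z only the second factor is small,
  and this is the source of compactness. The strip estimate relies on the plane, where dilations
  leave the Dirichlet integral unchanged, so that the first-order change comes from (z, \<phi>)
  alone. Points where the argument of max or min vanishes do no harm, however many there are: the
  slant differential is evaluated at the perturbed point, and there the linearisation is
  exact.\<close>

locale semi_hilbert =
  fixes V :: "('a \<Rightarrow> 'b::real_vector) set" and ip :: "('a \<Rightarrow> 'b) \<Rightarrow> ('a \<Rightarrow> 'b) \<Rightarrow> real"
  assumes zero_mem: "(\<lambda>x. 0) \<in> V"
    and add_mem: "\<And>f g. f \<in> V \<Longrightarrow> g \<in> V \<Longrightarrow> (\<lambda>x. f x + g x) \<in> V"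
    and scale_mem: "\<And>f c. f \<in> V \<Longrightarrow> (\<lambda>x. c *\<^sub>R f x) \<in> V"
    and ip_add: "\<And>f g h. f \<in> V \<Longrightarrow> g \<in> V \<Longrightarrow> h \<in> V \<Longrightarrow> ip (\<lambda>x. f x + g x) h = ip f h + ip g h"
    and ip_scale: "\<And>f h c. f \<in> V \<Longrightarrow> h \<in> V \<Longrightarrow> ip (\<lambda>x. c *\<^sub>R f x) h = c * ip f h"
    and ip_sym: "\<And>f g. f \<in> V \<Longrightarrow> g \<in> V \<Longrightarrow> ip f g = ip g f"
    and ip_nonneg: "\<And>f. f \<in> V \<Longrightarrow> 0 \<le> ip f f"
    and complete: "\<And>X. (\<And>n::nat. X n \<in> V) \<Longrightarrow>
        (\<And>e. 0 < e \<Longrightarrow> \<exists>N. \<forall>m\<ge>N. \<forall>n\<ge>N. ip (\<lambda>x. X m x - X n x) (\<lambda>x. X m x - X n x) < e) \<Longrightarrow>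
        \<exists>f\<in>V. (\<lambda>n. ip (\<lambda>x. X n x - f x) (\<lambda>x. X n x - f x)) \<longlonglongrightarrow> 0"
begin

abbreviation nrm :: "('a \<Rightarrow> 'b) \<Rightarrow> real" where "nrm f \<equiv> sqrt (ip f f)"

lemma diff_mem: "f \<in> V \<Longrightarrow> g \<in> V \<Longrightarrow> (\<lambda>x. f x - g x) \<in> V"
  using add_mem[of f "\<lambda>x. (-1) *\<^sub>R g x"] scale_mem[of g "-1"] by simp

lemma ip_add2: "f \<in> V \<Longrightarrow> g \<in> V \<Longrightarrow> h \<in> V \<Longrightarrow> ip h (\<lambda>x. f x + g x) = ip h f + ip h g"
  by (simp add: ip_sym[of h] ip_add add_mem)

lemma ip_scale2: "f \<in> V \<Longrightarrow> h \<in> V \<Longrightarrow> ip h (\<lambda>x. c *\<^sub>R f x) = c * ip h f"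
  by (simp add: ip_sym[of h] ip_scale scale_mem)

lemma ip_diff: "f \<in> V \<Longrightarrow> g \<in> V \<Longrightarrow> h \<in> V \<Longrightarrow> ip (\<lambda>x. f x - g x) h = ip f h - ip g h"
  using ip_add[of f "\<lambda>x. (-1) *\<^sub>R g x" h] scale_mem[of g "-1"] ip_scale[of g h "-1"] by simp

lemma ip_diff2: "f \<in> V \<Longrightarrow> g \<in> V \<Longrightarrow> h \<in> V \<Longrightarrow> ip h (\<lambda>x. f x - g x) = ip h f - ip h g"
  by (simp add: ip_sym[of h] ip_diff diff_mem)

lemmas mem = zero_mem add_mem scale_mem diff_mem
lemmas ip_simps = ip_add ip_add2 ip_scale ip_scale2 ip_diff ip_diff2

lemma ip_perturb: "f \<in> V \<Longrightarrow> g \<in> V \<Longrightarrow>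
    ip (\<lambda>x. f x + t *\<^sub>R g x) (\<lambda>x. f x + t *\<^sub>R g x) = ip f f + 2 * t * ip f g + t\<^sup>2 * ip g g"
  by (simp add: mem ip_simps ip_sym[of g f] power2_eq_square algebra_simps)

lemma ip_diff_self: "f \<in> V \<Longrightarrow> g \<in> V \<Longrightarrow>
    ip (\<lambda>x. f x - g x) (\<lambda>x. f x - g x) = ip f f - 2 * ip f g + ip g g"
  by (simp add: mem ip_simps ip_sym[of g f])

text \<open>For small t of sign opposite to a the linear term wins. The test value uses b + 1 in
  place of b so that b = 0 is covered too. This is the first-variation step of the Riesz
  argument.\<close>

lemma quadratic_nonneg:
  fixes a b :: real
  assumes "\<And>t. 0 \<le> 2 * t * a + t\<^sup>2 * b" and "b \<ge> 0"
  shows "a = 0"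
proof (rule ccontr)
  assume "a \<noteq> 0"
  define s where "s = b + 1"
  have s: "s > 0" "b = s - 1" using \<open>b \<ge> 0\<close> by (auto simp: s_def)
  have "0 \<le> 2 * (- a / s) * a + (- a / s)\<^sup>2 * b" by (rule assms)
  also have "\<dots> = - (a\<^sup>2 * (s + 1)) / s\<^sup>2"
    unfolding s(2) using s(1) by (simp add: field_simps power2_eq_square)
  also have "\<dots> < 0" using \<open>a \<noteq> 0\<close> s(1) by (simp add: divide_neg_pos)
  finally show False by simp
qed

lemma cauchy_schwarz:
  assumes "f \<in> V" "g \<in> V" shows "\<bar>ip f g\<bar> \<le> nrm f * nrm g"
proof -
  have *: "(ip f g)\<^sup>2 \<le> ip f f * ip g g"
  proof (cases "ip g g = 0")
    \<comment> \<open>Here g may be a null vector without being the zero function. The expansion is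
      then affine in t, and an affine function bounded below is constant.\<close>
    case True
    have "ip f g = 0"
    proof (rule ccontr)
      assume ne: "ip f g \<noteq> 0"
      have "0 \<le> ip f f + 2 * t * ip f g" for t
        using ip_perturb[OF assms, of t] ip_nonneg[OF add_mem[OF assms(1) scale_mem[OF assms(2)]], of t] True by simp
      from this[of "- (ip f f + 1) / (2 * ip f g)"] show False using ne by (simp add: field_simps)
    qed
    then show ?thesis using True by simp
  next
    case False
    then have pos: "0 < ip g g" using ip_nonneg[OF assms(2)] by simp
    have "0 \<le> ip f f + 2 * t * ip f g + t\<^sup>2 * ip g g" for t
      using ip_perturb[OF assms, of t] ip_nonneg[OF add_mem[OF assms(1) scale_mem[OF assms(2)]], of t] by simp
    from this[of "- ip f g / ip g g"] have "0 \<le> ip f f - (ip f g)\<^sup>2 / ip g g"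
      using pos by (simp add: field_simps power2_eq_square)
    then show ?thesis using pos by (simp add: field_simps)
  qed
  have "\<bar>ip f g\<bar> = sqrt ((ip f g)\<^sup>2)" by simp
  also have "\<dots> \<le> sqrt (ip f f * ip g g)" using * by (rule real_sqrt_le_mono)
  finally show ?thesis by (simp add: real_sqrt_mult)
qed

lemma nrm_nonneg: "f \<in> V \<Longrightarrow> 0 \<le> nrm f" using ip_nonneg by simp

lemma nrm_sq: "f \<in> V \<Longrightarrow> (nrm f)\<^sup>2 = ip f f" using ip_nonneg by simp

lemma nrm_triangle:
  assumes "f \<in> V" "g \<in> V" shows "nrm (\<lambda>x. f x + g x) \<le> nrm f + nrm g"
proof (rule power2_le_imp_le)
  have "(nrm (\<lambda>x. f x + g x))\<^sup>2 = ip f f + 2 * ip f g + ip g g"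
    using ip_perturb[OF assms, of 1] nrm_sq[OF add_mem[OF assms]] by simp
  also have "\<dots> \<le> (nrm f)\<^sup>2 + 2 * (nrm f * nrm g) + (nrm g)\<^sup>2"
    using cauchy_schwarz[OF assms] nrm_sq assms by simp
  finally show "(nrm (\<lambda>x. f x + g x))\<^sup>2 \<le> (nrm f + nrm g)\<^sup>2" by (simp add: power2_sum)
qed (simp add: ip_nonneg assms)

lemma nrm_scale: "f \<in> V \<Longrightarrow> nrm (\<lambda>x. c *\<^sub>R f x) = \<bar>c\<bar> * nrm f"
  by (simp add: mem ip_simps real_sqrt_mult mult.assoc[symmetric] del: mult.assoc)

lemma nrm_diff_sym: "f \<in> V \<Longrightarrow> g \<in> V \<Longrightarrow> nrm (\<lambda>x. f x - g x) = nrm (\<lambda>x. g x - f x)"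
  by (simp add: ip_diff_self ip_sym[of g f])

lemma nrm_triangle_diff:
  assumes "f \<in> V" "g \<in> V" shows "nrm f \<le> nrm g + nrm (\<lambda>x. f x - g x)"
  using nrm_triangle[OF assms(2) diff_mem[OF assms]] by simp

lemma nrm_triangle_sub:
  assumes "f \<in> V" "g \<in> V" shows "nrm (\<lambda>x. f x - g x) \<le> nrm f + nrm g"
  using nrm_triangle[OF assms(1) scale_mem[OF assms(2), of "-1"]] nrm_scale[OF assms(2), of "-1"] by simp

lemma ip_tendsto:
  assumes "\<And>n. X n \<in> V" "f \<in> V" "h \<in> V" "(\<lambda>n. nrm (\<lambda>x. X n x - f x)) \<longlonglongrightarrow> 0"
  shows "(\<lambda>n. ip (X n) h) \<longlonglongrightarrow> ip f h"
proof -
  have lim: "(\<lambda>n. nrm (\<lambda>x. X n x - f x) * nrm h) \<longlonglongrightarrow> 0"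
    using tendsto_mult_right[OF assms(4), of "nrm h"] by simp
  have le: "norm (ip (X n) h - ip f h) \<le> nrm (\<lambda>x. X n x - f x) * nrm h" for n
    using cauchy_schwarz[OF diff_mem[OF assms(1)[of n] assms(2)] assms(3)] by (simp add: ip_diff assms)
  have "(\<lambda>n. ip (X n) h - ip f h) \<longlonglongrightarrow> 0"
    by (rule Lim_null_comparison[OF always_eventually lim]) (rule allI, rule le)
  then show ?thesis by (simp add: LIM_zero_iff)
qed

lemma nrm_tendsto:
  assumes "\<And>n. X n \<in> V" "f \<in> V" "(\<lambda>n. nrm (\<lambda>x. X n x - f x)) \<longlonglongrightarrow> 0"
  shows "(\<lambda>n. nrm (X n)) \<longlonglongrightarrow> nrm f"
proof -
  have "\<bar>nrm (X n) - nrm f\<bar> \<le> nrm (\<lambda>x. X n x - f x)" for n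
    using nrm_triangle_diff[OF assms(1)[of n] assms(2)] nrm_triangle_diff[OF assms(2) assms(1)[of n]]
      nrm_diff_sym[OF assms(1)[of n] assms(2)] by linarith
  then have "\<forall>n. norm (nrm (X n) - nrm f) \<le> nrm (\<lambda>x. X n x - f x)" by simp
  then have "(\<lambda>n. nrm (X n) - nrm f) \<longlonglongrightarrow> 0"
    by (intro Lim_null_comparison[OF always_eventually assms(3)])
  then show ?thesis by (simp add: LIM_zero_iff)
qed

text \<open>Minimising sequences of a uniformly convex functional are Cauchy by the parallelogram identity.\<close>

lemma uniformly_convex_minimizing_sequence:
  assumes K: "K \<subseteq> V" "K \<noteq> {}" and "\<kappa> > 0"
    and mid: "\<And>u v. u \<in> K \<Longrightarrow> v \<in> K \<Longrightarrow>
      \<exists>w\<in>K. 2 * J w + \<kappa> * ip (\<lambda>x. u x - v x) (\<lambda>x. u x - v x) \<le> J u + J v"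
    and bdd: "\<And>u. u \<in> K \<Longrightarrow> L \<le> J u"
  shows "\<exists>X f m. (\<forall>n::nat. X n \<in> K) \<and> f \<in> V \<and> (\<lambda>n. nrm (\<lambda>x. X n x - f x)) \<longlonglongrightarrow> 0 \<and>
    (\<lambda>n. J (X n)) \<longlonglongrightarrow> m \<and> (\<forall>u\<in>K. m \<le> J u)"
proof -
  define m where "m = Inf (J ` K)"
  have bb: "bdd_below (J ` K)" using bdd by (auto intro!: bdd_belowI[of _ L])
  have mle: "m \<le> J u" if "u \<in> K" for u using that bb unfolding m_def by (intro cInf_lower) auto
  have "\<exists>u\<in>K. J u < m + 1 / Suc n" for n
  proof -
    have "\<exists>y\<in>J ` K. y < m + 1 / Suc n"
      using K bb unfolding m_def by (intro cInf_lessD) auto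
    then show ?thesis by auto
  qed
  then obtain X where X: "\<And>n. X n \<in> K" "\<And>n. J (X n) < m + 1 / Suc n" by metis
  have XV: "X n \<in> V" for n using X K by auto
  have est: "ip (\<lambda>x. X a x - X b x) (\<lambda>x. X a x - X b x) \<le> (1 / Suc a + 1 / Suc b) / \<kappa>" for a b
  proof -
    obtain w where w: "w \<in> K" "2 * J w + \<kappa> * ip (\<lambda>x. X a x - X b x) (\<lambda>x. X a x - X b x) \<le> J (X a) + J (X b)"
      using mid[OF X(1) X(1)] by blast
    have "\<kappa> * ip (\<lambda>x. X a x - X b x) (\<lambda>x. X a x - X b x) \<le> 1 / Suc a + 1 / Suc b"
      using w(2) mle[OF w(1)] X(2)[of a] X(2)[of b] by linarith
    then show ?thesis using \<open>\<kappa> > 0\<close> by (simp add: pos_le_divide_eq mult.commute)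
  qed
  have "\<exists>N. \<forall>a\<ge>N. \<forall>b\<ge>N. ip (\<lambda>x. X a x - X b x) (\<lambda>x. X a x - X b x) < e" if "e > 0" for e
  proof -
    obtain N where N: "1 / Suc N < e * \<kappa> / 2"
      using nat_approx_posE[of "e * \<kappa> / 2"] \<open>e > 0\<close> \<open>\<kappa> > 0\<close> by auto
    show ?thesis
    proof (intro exI allI impI)
      fix a b assume ab: "N \<le> a" "N \<le> b"
      have "1 / Suc a \<le> 1 / real (Suc N)" "1 / Suc b \<le> 1 / real (Suc N)"
        using ab by (auto intro!: divide_left_mono)
      then have "(1 / Suc a + 1 / Suc b) < e * \<kappa>" using N by linarith
      then have "(1 / Suc a + 1 / Suc b) / \<kappa> < e" using \<open>\<kappa> > 0\<close> by (simp only: pos_divide_less_eq)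
      then show "ip (\<lambda>x. X a x - X b x) (\<lambda>x. X a x - X b x) < e" using est[of a b] by linarith
    qed
  qed
  from complete[OF XV this] obtain f where f: "f \<in> V"
    "(\<lambda>n. ip (\<lambda>x. X n x - f x) (\<lambda>x. X n x - f x)) \<longlonglongrightarrow> 0" by blast
  have "(\<lambda>n. nrm (\<lambda>x. X n x - f x)) \<longlonglongrightarrow> 0" using tendsto_real_sqrt[OF f(2)] by simp
  moreover have "(\<lambda>n. J (X n)) \<longlonglongrightarrow> m"
  proof (rule real_tendsto_sandwich[where f="\<lambda>n. m" and h="\<lambda>n. m + 1 / Suc n"])
    show "(\<lambda>n. m + 1 / Suc n) \<longlonglongrightarrow> m"
      using tendsto_add[OF tendsto_const LIMSEQ_Suc[OF lim_1_over_n], of m] by simp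
    show "\<forall>\<^sub>F n in sequentially. J (X n) \<le> m + 1 / Suc n"
      by (intro always_eventually allI less_imp_le X(2))
  qed (use mle X(1) in auto)
  ultimately show ?thesis using X(1) f(1) mle by blast
qed

text \<open>The functional (w, w) - 2 l(w) is minimised over W. As W need not be closed, the
  representer lies only in its closure. The minimising sequence X is part of the conclusion because,
  for gradients of test functions, it supplies the approximating sequence that membership in
  \<open>H10\<close> asks for. The bound by C results from pairing g with itself.\<close>

lemma riesz:
  assumes W: "W \<subseteq> V" "(\<lambda>x. 0) \<in> W" "\<And>f g. f \<in> W \<Longrightarrow> g \<in> W \<Longrightarrow> (\<lambda>x. f x + g x) \<in> W"
      "\<And>f c. f \<in> W \<Longrightarrow> (\<lambda>x. c *\<^sub>R f x) \<in> W"
    and l_add: "\<And>f g. f \<in> W \<Longrightarrow> g \<in> W \<Longrightarrow> l (\<lambda>x. f x + g x) = l f + l g"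
    and l_scale: "\<And>f c. f \<in> W \<Longrightarrow> l (\<lambda>x. c *\<^sub>R f x) = c * l f"
    and l_bdd: "\<And>f. f \<in> W \<Longrightarrow> \<bar>l f\<bar> \<le> C * nrm f" and "C \<ge> 0"
  shows "\<exists>X g. (\<forall>n::nat. X n \<in> W) \<and> g \<in> V \<and> (\<lambda>n. nrm (\<lambda>x. X n x - g x)) \<longlonglongrightarrow> 0 \<and>
     (\<forall>w\<in>W. ip g w = l w) \<and> nrm g \<le> C"
proof -
  have WV: "w \<in> V" if "w \<in> W" for w using that W by auto
  define J where "J w = ip w w - 2 * l w" for w
  have low: "- C\<^sup>2 \<le> J w" if "w \<in> W" for w
  proof -
    have "0 \<le> (nrm w - C)\<^sup>2" by simp
    also have "\<dots> = ip w w - 2 * (C * nrm w) + C\<^sup>2"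
      using nrm_sq[OF WV[OF that]] by (simp add: power2_diff)
    also have "\<dots> \<le> J w + C\<^sup>2" using l_bdd[OF that] unfolding J_def by linarith
    finally show ?thesis by linarith
  qed
  \<comment> \<open>By the parallelogram identity this is an equality at the midpoint of u and v,
    which is where the coefficient 1/2 comes from.\<close>
  have mid: "\<exists>w\<in>W. 2 * J w + (1/2) * ip (\<lambda>x. u x - v x) (\<lambda>x. u x - v x) \<le> J u + J v"
    if "u \<in> W" "v \<in> W" for u v
  proof
    let ?w = "\<lambda>x. (1/2) *\<^sub>R u x + (1/2) *\<^sub>R v x"
    show "?w \<in> W" using W that by simp
    have l: "l ?w = (1/2) * l u + (1/2) * l v" using l_add l_scale W that by simp
    show "2 * J ?w + (1/2) * ip (\<lambda>x. u x - v x) (\<lambda>x. u x - v x) \<le> J u + J v"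
      using WV that unfolding J_def l
      by (simp add: mem ip_simps ip_sym[of v u] field_simps)
  qed
  obtain X g m where X: "\<And>n::nat. X n \<in> W" and g: "g \<in> V"
    and lim: "(\<lambda>n. nrm (\<lambda>x. X n x - g x)) \<longlonglongrightarrow> 0"
    and Jm: "(\<lambda>n. J (X n)) \<longlonglongrightarrow> m" and m: "\<And>u. u \<in> W \<Longrightarrow> m \<le> J u"
    using uniformly_convex_minimizing_sequence[of W "1/2" J "- C\<^sup>2", OF W(1) _ _ mid low] W(2) by fastforce
  have XV: "X n \<in> V" for n using X WV by auto
  have ipgw: "ip g w = l w" if w: "w \<in> W" for w
  proof -
    have "ip g w - l w = 0"
    proof (rule quadratic_nonneg[of _ "ip w w"])
      fix t :: real
      \<comment> \<open>The perturbation is applied to the members of the minimising sequence, since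
        l is controlled on W only; the limit in n is taken afterwards.\<close>
      have "m \<le> J (X n) + 2 * t * (ip (X n) w - l w) + t\<^sup>2 * ip w w" for n
      proof -
        have "m \<le> J (\<lambda>x. X n x + t *\<^sub>R w x)" by (rule m[OF W(3)[OF X W(4)[OF w]]])
        also have "\<dots> = J (X n) + 2 * t * (ip (X n) w - l w) + t\<^sup>2 * ip w w"
          unfolding J_def ip_perturb[OF XV WV[OF w]] l_add[OF X W(4)[OF w]] l_scale[OF w] by (simp add: algebra_simps)
        finally show ?thesis .
      qed
      moreover have "(\<lambda>n. J (X n) + 2 * t * (ip (X n) w - l w) + t\<^sup>2 * ip w w)
          \<longlonglongrightarrow> m + 2 * t * (ip g w - l w) + t\<^sup>2 * ip w w"
        by (intro tendsto_intros Jm ip_tendsto XV g WV w lim)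
      ultimately have "m \<le> m + 2 * t * (ip g w - l w) + t\<^sup>2 * ip w w"
        by (intro tendsto_lowerbound[where F=sequentially]) auto
      then show "0 \<le> 2 * t * (ip g w - l w) + t\<^sup>2 * ip w w" by simp
    qed (rule ip_nonneg[OF WV[OF w]])
    then show ?thesis by simp
  qed
  have "ip g g \<le> C * nrm g"
  proof (rule tendsto_le[OF sequentially_bot])
    show "(\<lambda>n. C * nrm (X n)) \<longlonglongrightarrow> C * nrm g" by (intro tendsto_intros nrm_tendsto XV g lim)
    show "(\<lambda>n. ip (X n) g) \<longlonglongrightarrow> ip g g" by (intro ip_tendsto XV g lim)
    have "ip (X n) g = l (X n)" for n using ipgw[OF X] ip_sym[OF XV g] by simp
    then show "\<forall>\<^sub>F n in sequentially. ip (X n) g \<le> C * nrm (X n)"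
      using order_trans[OF abs_ge_self l_bdd[OF X]] by simp
  qed
  then have "nrm g * nrm g \<le> C * nrm g" using ip_nonneg[OF g] by simp
  then have "nrm g \<le> C"
    using \<open>C \<ge> 0\<close> nrm_nonneg[OF g] by (cases "nrm g > 0") (auto simp del: real_sqrt_mult_self real_sqrt_gt_0_iff)
  with X g lim ipgw show ?thesis by (intro exI[of _ X] exI[of _ g]) simp
qed

end

section \<open>Square integrable functions as representatives\<close>

lemma Lp2_iff: "f \<in> L2 M \<longleftrightarrow> f \<in> borel_measurable M \<and> integrable M (\<lambda>x. (norm (f x))\<^sup>2)"
  unfolding Lp_def by (simp add: powr_numeral)

lemma L2_measurable[measurable_dest]: "f \<in> L2 M \<Longrightarrow> f \<in> borel_measurable M"
  by (simp add: Lp2_iff)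

lemma L2_sq_integrable: "f \<in> L2 M \<Longrightarrow> integrable M (\<lambda>x. (norm (f x))\<^sup>2)"
  by (simp add: Lp2_iff)

lemma L2_bound:
  fixes f :: "'a \<Rightarrow> 'b::euclidean_space" and h :: "'a \<Rightarrow> 'c::euclidean_space"
  assumes "f \<in> L2 M" "h \<in> borel_measurable M" "AE x in M. norm (h x) \<le> c * norm (f x)"
  shows "h \<in> L2 M"
proof -
  have "integrable M (\<lambda>x. (norm (h x))\<^sup>2)"
  proof (rule Bochner_Integration.integrable_bound)
    show "integrable M (\<lambda>x. c\<^sup>2 * (norm (f x))\<^sup>2)" using L2_sq_integrable[OF assms(1)] by simp
    show "AE x in M. norm ((norm (h x))\<^sup>2) \<le> norm (c\<^sup>2 * (norm (f x))\<^sup>2)"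
      using assms(3)
    proof eventually_elim
      case (elim x)
      have "(norm (h x))\<^sup>2 \<le> (c * norm (f x))\<^sup>2" by (rule power_mono[OF elim]) simp
      then show ?case by (simp add: power_mult_distrib)
    qed
    show "(\<lambda>x. (norm (h x))\<^sup>2) \<in> borel_measurable M" using assms(2) by measurable
  qed
  then show ?thesis using assms(2) by (simp add: Lp2_iff)
qed

lemma L2_add:
  fixes f g :: "'a \<Rightarrow> 'b::euclidean_space"
  assumes "f \<in> L2 M" "g \<in> L2 M" shows "(\<lambda>x. f x + g x) \<in> L2 M"
proof -
  note [measurable] = L2_measurable[OF assms(1)] L2_measurable[OF assms(2)]
  have "integrable M (\<lambda>x. (norm (f x + g x))\<^sup>2)"
  proof (rule Bochner_Integration.integrable_bound)
    show "integrable M (\<lambda>x. 2 * (norm (f x))\<^sup>2 + 2 * (norm (g x))\<^sup>2)"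
      using assms by (auto simp: Lp2_iff)
    have "(norm (f x + g x))\<^sup>2 \<le> 2 * (norm (f x))\<^sup>2 + 2 * (norm (g x))\<^sup>2" for x
    proof -
      have "(norm (f x + g x))\<^sup>2 \<le> (norm (f x) + norm (g x))\<^sup>2" by (intro power_mono norm_triangle_ineq) simp
      also have "\<dots> \<le> 2 * (norm (f x))\<^sup>2 + 2 * (norm (g x))\<^sup>2"
        using sum_squares_bound[of "norm (f x)" "norm (g x)"] by (simp add: power2_sum)
      finally show ?thesis .
    qed
    then show "AE x in M. norm ((norm (f x + g x))\<^sup>2) \<le> norm (2 * (norm (f x))\<^sup>2 + 2 * (norm (g x))\<^sup>2)"
      by (intro always_eventually allI) (auto intro: order_trans[OF _ abs_ge_self])
  qed measurable
  then show ?thesis by (simp add: Lp2_iff)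
qed

lemma L2_scaleR:
  fixes f :: "'a \<Rightarrow> 'b::euclidean_space"
  assumes "f \<in> L2 M" shows "(\<lambda>x. c *\<^sub>R f x) \<in> L2 M"
  using L2_bound[OF assms, of "\<lambda>x. c *\<^sub>R f x" "\<bar>c\<bar>"] L2_measurable[OF assms] by simp

lemma L2_mult:
  fixes f :: "'a \<Rightarrow> real" shows "f \<in> L2 M \<Longrightarrow> (\<lambda>x. c * f x) \<in> L2 M"
  using L2_scaleR[of f M c] by simp

lemma L2_zero: "(\<lambda>x. 0) \<in> L2 M" by (simp add: Lp2_iff)

lemma L2_minus:
  fixes f :: "'a \<Rightarrow> 'b::euclidean_space" shows "f \<in> L2 M \<Longrightarrow> (\<lambda>x. - f x) \<in> L2 M"
  using L2_scaleR[of f M "-1"] by simp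

lemma L2_diff:
  fixes f g :: "'a \<Rightarrow> 'b::euclidean_space"
  shows "f \<in> L2 M \<Longrightarrow> g \<in> L2 M \<Longrightarrow> (\<lambda>x. f x - g x) \<in> L2 M"
  using L2_add[of f M "\<lambda>x. - g x"] L2_minus[of g M] by simp

lemma L2_inner_integrable:
  fixes f g :: "'a \<Rightarrow> 'b::euclidean_space"
  assumes "f \<in> L2 M" "g \<in> L2 M" shows "integrable M (\<lambda>x. f x \<bullet> g x)"
proof (rule Bochner_Integration.integrable_bound)
  note [measurable] = L2_measurable[OF assms(1)] L2_measurable[OF assms(2)]
  show "integrable M (\<lambda>x. (norm (f x))\<^sup>2 + (norm (g x))\<^sup>2)"
    using assms by (auto simp: Lp2_iff)
  have "\<bar>f x \<bullet> g x\<bar> \<le> (norm (f x))\<^sup>2 + (norm (g x))\<^sup>2" for x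
  proof -
    have "\<bar>f x \<bullet> g x\<bar> \<le> norm (f x) * norm (g x)" by (rule Cauchy_Schwarz_ineq2)
    also have "\<dots> \<le> (norm (f x))\<^sup>2 + (norm (g x))\<^sup>2"
      using sum_squares_bound[of "norm (f x)" "norm (g x)"] zero_le_power2[of "norm (f x)"] zero_le_power2[of "norm (g x)"]
        mult_nonneg_nonneg[OF norm_ge_zero[of "f x"] norm_ge_zero[of "g x"]] by linarith
    finally show ?thesis .
  qed
  then show "AE x in M. norm (f x \<bullet> g x) \<le> norm ((norm (f x))\<^sup>2 + (norm (g x))\<^sup>2)"
    by (intro always_eventually allI) (auto intro: order_trans[OF _ abs_ge_self])
  show "(\<lambda>x. f x \<bullet> g x) \<in> borel_measurable M" by measurable
qed

lemma L2_inner_self: "L2_inner M f f = (LINT x|M. (norm (f x))\<^sup>2)"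
  by (simp add: L2_inner_def power2_norm_eq_inner)

lemma nn_integral_L2:
  "f \<in> L2 M \<Longrightarrow> (\<integral>\<^sup>+x. ennreal ((norm (f x))\<^sup>2) \<partial>M) = ennreal (L2_inner M f f)"
  unfolding L2_inner_self by (rule nn_integral_eq_integral) (auto simp: Lp2_iff)

lemma L2_I_nn:
  fixes f :: "'a \<Rightarrow> 'b::euclidean_space"
  assumes "f \<in> borel_measurable M" "(\<integral>\<^sup>+x. ennreal ((norm (f x))\<^sup>2) \<partial>M) \<le> ennreal c" "0 \<le> c"
  shows "f \<in> L2 M" "L2_inner M f f \<le> c"
proof -
  have [measurable]: "f \<in> borel_measurable M" by fact
  have "integrable M (\<lambda>x. (norm (f x))\<^sup>2)"
  proof (rule integrableI_bounded)
    show "(\<integral>\<^sup>+x. ennreal (norm ((norm (f x))\<^sup>2)) \<partial>M) < \<infinity>"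
      using assms(2) by (auto intro: le_less_trans)
  qed measurable
  then show "f \<in> L2 M" by (simp add: Lp2_iff)
  from nn_integral_L2[OF this] assms(2,3) show "L2_inner M f f \<le> c" by simp
qed

lemma L2_inner_cong_AE:
  fixes f g f' g' :: "'a \<Rightarrow> 'b::euclidean_space"
  assumes "f \<in> borel_measurable M" "g \<in> borel_measurable M" "f' \<in> borel_measurable M" "g' \<in> borel_measurable M"
    and "AE x in M. f x = f' x" "AE x in M. g x = g' x"
  shows "L2_inner M f g = L2_inner M f' g'"
  unfolding L2_inner_def using assms by (intro integral_cong_AE) auto

lemma L2_eq_ae_zero:
  fixes f :: "'a \<Rightarrow> 'b::euclidean_space"
  assumes "f \<in> L2 M" "L2_inner M f f \<le> 0" shows "AE x in M. f x = 0"
proof -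
  have "(LINT x|M. (norm (f x))\<^sup>2) = 0"
    using assms(2) unfolding L2_inner_self by (intro antisym) auto
  then show ?thesis using integral_nonneg_eq_0_iff_AE[OF L2_sq_integrable[OF assms(1)]] by simp
qed

text \<open>The Riesz-Fischer argument. Along a subsequence the squared distances of neighbours are
  below 16^(-k); weighted with 4^k they are still summable, which makes the increments at almost
  every point decay like 2^(-k). Fatou's lemma then turns the Cauchy property into convergence of
  the full sequence in the mean.\<close>

lemma L2_complete:
  fixes X :: "nat \<Rightarrow> 'a \<Rightarrow> 'b::euclidean_space"
  assumes X: "\<And>n. X n \<in> L2 M"
    and cauchy: "\<And>e. 0 < e \<Longrightarrow> \<exists>N. \<forall>m\<ge>N. \<forall>n\<ge>N. L2_inner M (\<lambda>x. X m x - X n x) (\<lambda>x. X m x - X n x) < e"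
  shows "\<exists>f\<in>L2 M. (\<lambda>n. L2_inner M (\<lambda>x. X n x - f x) (\<lambda>x. X n x - f x)) \<longlonglongrightarrow> 0"
proof -
  have XM[measurable]: "X n \<in> borel_measurable M" for n using X L2_measurable by blast
  let ?d = "\<lambda>m n. L2_inner M (\<lambda>x. X m x - X n x) (\<lambda>x. X m x - X n x)"
  have "\<exists>N. \<forall>m\<ge>N. \<forall>n\<ge>N. ?d m n < (1/16)^k" for k by (rule cauchy) simp
  then obtain N where N: "\<And>k m n. m \<ge> N k \<Longrightarrow> n \<ge> N k \<Longrightarrow> ?d m n < (1/16)^k" by metis
  \<comment> \<open>The sum dominates N i for all i up to k and makes r monotone; the summand k
    makes r unbounded, so that the limit inferior may run along the subsequence.\<close>
  define r where "r k = (\<Sum>i\<le>k. N i) + k" for k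
  have rN: "N k \<le> r k" for k unfolding r_def by (simp add: member_le_sum trans_le_add1)
  have r_mono: "r k \<le> r (Suc k)" for k unfolding r_def by simp
  have r_ge: "k \<le> r k" for k unfolding r_def by simp
  define Y where "Y k = X (r k)" for k
  have Ydiff: "(\<integral>\<^sup>+x. ennreal ((norm (X m x - X n x))\<^sup>2) \<partial>M) = ennreal (?d m n)" for m n
    using nn_integral_L2[OF L2_diff[OF X X]] by simp
  have Y2: "(\<integral>\<^sup>+x. ennreal (4^k * (norm (Y (Suc k) x - Y k x))\<^sup>2) \<partial>M) \<le> ennreal ((1/4)^k)" for k
  proof -
    have "(\<integral>\<^sup>+x. ennreal (4^k * (norm (Y (Suc k) x - Y k x))\<^sup>2) \<partial>M)
        = ennreal (4^k) * (\<integral>\<^sup>+x. ennreal ((norm (Y (Suc k) x - Y k x))\<^sup>2) \<partial>M)"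
      unfolding Y_def by (subst nn_integral_cmult[symmetric]) (auto simp: ennreal_mult)
    also have "\<dots> \<le> ennreal (4^k) * ennreal ((1/16)^k)"
      unfolding Y_def Ydiff using N[OF order_trans[OF rN r_mono] rN, of k]
      by (intro mult_left_mono ennreal_leI) auto
    also have "\<dots> = ennreal ((1/4)^k)"
      by (simp add: ennreal_mult[symmetric] power_mult_distrib[symmetric])
    finally show ?thesis .
  qed
  have "(\<integral>\<^sup>+x. (\<Sum>k. ennreal (4^k * (norm (Y (Suc k) x - Y k x))\<^sup>2)) \<partial>M)
      = (\<Sum>k. \<integral>\<^sup>+x. ennreal (4^k * (norm (Y (Suc k) x - Y k x))\<^sup>2) \<partial>M)"
    unfolding Y_def by (rule nn_integral_suminf) measurable
  also have "\<dots> \<le> (\<Sum>k. ennreal ((1/4)^k))" by (intro suminf_le Y2) auto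
  also have "\<dots> < \<infinity>"
    by (subst suminf_ennreal2) (auto intro: summable_geometric)
  finally have fin: "(\<integral>\<^sup>+x. (\<Sum>k. ennreal (4^k * (norm (Y (Suc k) x - Y k x))\<^sup>2)) \<partial>M) < \<infinity>" .
  have AEfin: "AE x in M. (\<Sum>k. ennreal (4^k * (norm (Y (Suc k) x - Y k x))\<^sup>2)) \<noteq> \<infinity>"
    by (rule nn_integral_PInf_AE) (use fin in \<open>auto simp: Y_def\<close>)
  have conv: "AE x in M. convergent (\<lambda>k. Y k x)"
    using AEfin
  proof eventually_elim
    case (elim x)
    let ?t = "\<lambda>k. 4^k * (norm (Y (Suc k) x - Y k x))\<^sup>2"
    have sm: "summable ?t" by (rule summable_suminf_not_top) (use elim in auto)
    then have "Bseq ?t" by (intro convergent_imp_Bseq convergentI[OF summable_LIMSEQ_zero])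
    then obtain K where K: "0 < K" "\<And>k. norm (?t k) \<le> K" by (auto elim: BseqE)
    have le: "norm (Y (Suc k) x - Y k x) \<le> sqrt K * (1/2)^k" for k
    proof (rule power2_le_imp_le)
      have "4^k * (norm (Y (Suc k) x - Y k x))\<^sup>2 \<le> K" using K(2)[of k] by simp
      then have "(norm (Y (Suc k) x - Y k x))\<^sup>2 \<le> K * (1/4)^k" by (simp add: field_simps)
      also have "\<dots> = (sqrt K * (1/2)^k)\<^sup>2"
      proof -
        have "(sqrt K * (1/2)^k)\<^sup>2 = (sqrt K)\<^sup>2 * ((1/2)\<^sup>2)^k"
          by (simp only: power_mult_distrib power_mult[symmetric] mult.commute[of k])
        then show ?thesis using K(1) by (simp add: power2_eq_square)
      qed
      finally show "(norm (Y (Suc k) x - Y k x))\<^sup>2 \<le> (sqrt K * (1/2)^k)\<^sup>2" .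
    qed (use K in simp)
    have "summable (\<lambda>k. sqrt K * (1/2)^k)" by (intro summable_mult summable_geometric) simp
    then have "summable (\<lambda>k. Y (Suc k) x - Y k x)"
      by (rule summable_comparison_test'[where N=0]) (rule le)
    then have "convergent (\<lambda>n. \<Sum>k<n. Y (Suc k) x - Y k x)" by (simp only: summable_iff_convergent)
    then have "convergent (\<lambda>n. Y n x - Y 0 x)" by (simp only: sum_lessThan_telescope[of "\<lambda>k. Y k x"])
    then obtain l where "(\<lambda>n. Y n x - Y 0 x) \<longlonglongrightarrow> l" by (auto simp: convergent_def)
    from tendsto_add[OF this tendsto_const[of "Y 0 x"]] show ?case by (auto simp: convergent_def)
  qed
  define f where "f x = lim (\<lambda>k. Y k x)" for x
  have [measurable]: "f \<in> borel_measurable M"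
    unfolding f_def by (rule borel_measurable_lim_metric) (simp add: Y_def)
  have lim: "AE x in M. (\<lambda>k. Y k x) \<longlonglongrightarrow> f x"
    using conv by eventually_elim (simp add: f_def convergent_LIMSEQ_iff)
  have est: "(\<integral>\<^sup>+x. ennreal ((norm (X n x - f x))\<^sup>2) \<partial>M) \<le> ennreal ((1/16)^k)" if "n \<ge> N k" for n k
  proof -
    have "(\<integral>\<^sup>+x. ennreal ((norm (X n x - f x))\<^sup>2) \<partial>M)
        = (\<integral>\<^sup>+x. liminf (\<lambda>j. ennreal ((norm (X n x - Y j x))\<^sup>2)) \<partial>M)"
    proof (rule nn_integral_cong_AE, use lim in eventually_elim)
      case (elim x)
      have "(\<lambda>j. ennreal ((norm (X n x - Y j x))\<^sup>2)) \<longlonglongrightarrow> ennreal ((norm (X n x - f x))\<^sup>2)"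
        by (intro tendsto_ennrealI tendsto_intros elim)
      then show ?case by (intro lim_imp_Liminf[symmetric]) simp
    qed
    also have "\<dots> \<le> liminf (\<lambda>j. \<integral>\<^sup>+x. ennreal ((norm (X n x - Y j x))\<^sup>2) \<partial>M)"
      unfolding Y_def by (rule nn_integral_liminf) measurable
    also have "\<dots> \<le> ennreal ((1/16)^k)"
    proof (rule Liminf_le)
      have "\<forall>\<^sub>F j in sequentially. N k \<le> r j"
        using eventually_ge_at_top[of "N k"] by eventually_elim (use r_ge in \<open>auto intro: order_trans\<close>)
      then show "\<forall>\<^sub>F j in sequentially. (\<integral>\<^sup>+x. ennreal ((norm (X n x - Y j x))\<^sup>2) \<partial>M) \<le> ennreal ((1/16)^k)"
        unfolding Y_def Ydiff by eventually_elim (use N[OF that] in \<open>auto intro!: ennreal_leI less_imp_le\<close>)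
    qed simp
    finally show ?thesis .
  qed
  have "(\<lambda>x. X (N 0) x - f x) \<in> L2 M" by (rule L2_I_nn(1)[OF _ est[of 0 "N 0"]]) auto
  from L2_diff[OF X[of "N 0"] this] have f: "f \<in> L2 M" by simp
  have "(\<lambda>n. L2_inner M (\<lambda>x. X n x - f x) (\<lambda>x. X n x - f x)) \<longlonglongrightarrow> 0"
  proof (rule LIMSEQ_I)
    fix e :: real assume "e > 0"
    then obtain k where k: "(1/16)^k < e" using real_arch_pow_inv[of e "1/16"] by auto
    have "norm (L2_inner M (\<lambda>x. X n x - f x) (\<lambda>x. X n x - f x) - 0) < e" if "n \<ge> N k" for n
    proof -
      have "L2_inner M (\<lambda>x. X n x - f x) (\<lambda>x. X n x - f x) \<le> (1/16)^k"
        by (rule L2_I_nn(2)[OF _ est[OF that]]) auto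
      moreover have "0 \<le> L2_inner M (\<lambda>x. X n x - f x) (\<lambda>x. X n x - f x)"
        unfolding L2_inner_self by simp
      ultimately show ?thesis using k by simp
    qed
    then show "\<exists>no. \<forall>n\<ge>no. norm (L2_inner M (\<lambda>x. X n x - f x) (\<lambda>x. X n x - f x) - 0) < e" by blast
  qed
  with f show ?thesis by blast
qed

lemma semi_hilbert_L2:
  "semi_hilbert (L2 M :: ('a \<Rightarrow> 'b::euclidean_space) set) (L2_inner M)"
proof
  fix f g h :: "'a \<Rightarrow> 'b" and c :: real
  assume f: "f \<in> L2 M"
  show "L2_inner M (\<lambda>x. c *\<^sub>R f x) h = c * L2_inner M f h" by (simp add: L2_inner_def)
  show "L2_inner M f g = L2_inner M g f" by (simp add: L2_inner_def inner_commute)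
  show "0 \<le> L2_inner M f f" by (simp add: L2_inner_self)
  show "(\<lambda>x. c *\<^sub>R f x) \<in> L2 M" using f by (rule L2_scaleR)
  assume g: "g \<in> L2 M"
  show "(\<lambda>x. f x + g x) \<in> L2 M" using f g by (rule L2_add)
  assume h: "h \<in> L2 M"
  show "L2_inner M (\<lambda>x. f x + g x) h = L2_inner M f h + L2_inner M g h"
    using L2_inner_integrable[OF f h] L2_inner_integrable[OF g h]
    by (simp add: L2_inner_def inner_add_left)
next
  fix X :: "nat \<Rightarrow> 'a \<Rightarrow> 'b"
  assume "\<And>n. X n \<in> L2 M"
    "\<And>e. 0 < e \<Longrightarrow> \<exists>N. \<forall>m\<ge>N. \<forall>n\<ge>N. L2_inner M (\<lambda>x. X m x - X n x) (\<lambda>x. X m x - X n x) < e"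
  then show "\<exists>f\<in>L2 M. (\<lambda>n. L2_inner M (\<lambda>x. X n x - f x) (\<lambda>x. X n x - f x)) \<longlonglongrightarrow> 0"
    by (rule L2_complete)
qed (rule L2_zero)

section \<open>Norm and inner product rules for Lebesgue spaces\<close>

context
  fixes M :: "'a measure"
begin

interpretation semi_hilbert "L2 M :: ('a \<Rightarrow> 'b::euclidean_space) set" "L2_inner M"
  by (rule semi_hilbert_L2)

lemma L2_inner_add:
  fixes f g h :: "'a \<Rightarrow> 'b::euclidean_space"
  assumes "f \<in> L2 M" "g \<in> L2 M" "h \<in> L2 M"
  shows "L2_inner M (\<lambda>x. f x + g x) h = L2_inner M f h + L2_inner M g h"
    and "L2_inner M h (\<lambda>x. f x + g x) = L2_inner M h f + L2_inner M h g"
    and "L2_inner M (\<lambda>x. f x - g x) h = L2_inner M f h - L2_inner M g h"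
    and "L2_inner M h (\<lambda>x. f x - g x) = L2_inner M h f - L2_inner M h g"
  using assms by (rule ip_add ip_add2 ip_diff ip_diff2)+

lemma L2_cauchy_schwarz:
  fixes f g :: "'a \<Rightarrow> 'b::euclidean_space"
  shows "f \<in> L2 M \<Longrightarrow> g \<in> L2 M \<Longrightarrow> \<bar>L2_inner M f g\<bar> \<le> L2_norm M f * L2_norm M g"
  unfolding L2_norm_def by (rule cauchy_schwarz)

lemma L2_norm_triangle:
  fixes f g :: "'a \<Rightarrow> 'b::euclidean_space"
  assumes "f \<in> L2 M" "g \<in> L2 M"
  shows "L2_norm M (\<lambda>x. f x + g x) \<le> L2_norm M f + L2_norm M g"
    and "L2_norm M (\<lambda>x. f x - g x) \<le> L2_norm M f + L2_norm M g"
    and "L2_norm M f \<le> L2_norm M g + L2_norm M (\<lambda>x. f x - g x)"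
  unfolding L2_norm_def using assms by (rule nrm_triangle nrm_triangle_sub nrm_triangle_diff)+

lemma L2_norm_diff_sym:
  fixes f g :: "'a \<Rightarrow> 'b::euclidean_space"
  shows "f \<in> L2 M \<Longrightarrow> g \<in> L2 M \<Longrightarrow> L2_norm M (\<lambda>x. f x - g x) = L2_norm M (\<lambda>x. g x - f x)"
  unfolding L2_norm_def by (rule nrm_diff_sym)

lemma L2_inner_tendsto:
  fixes f h :: "'a \<Rightarrow> 'b::euclidean_space"
  assumes "\<And>n. X n \<in> L2 M" "f \<in> L2 M" "h \<in> L2 M" "(\<lambda>n. L2_norm M (\<lambda>x. X n x - f x)) \<longlonglongrightarrow> 0"
  shows "(\<lambda>n. L2_inner M (X n) h) \<longlonglongrightarrow> L2_inner M f h"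
  using ip_tendsto[of X f h, OF assms(1-3)] assms(4) unfolding L2_norm_def by blast

lemma L2_norm_tendsto:
  fixes f :: "'a \<Rightarrow> 'b::euclidean_space"
  assumes "\<And>n. X n \<in> L2 M" "f \<in> L2 M" "(\<lambda>n. L2_norm M (\<lambda>x. X n x - f x)) \<longlonglongrightarrow> 0"
  shows "(\<lambda>n. L2_norm M (X n)) \<longlonglongrightarrow> L2_norm M f"
  using nrm_tendsto[of X f, OF assms(1,2)] assms(3) unfolding L2_norm_def by blast

lemma L2_norm_scaleR:
  fixes f :: "'a \<Rightarrow> 'b::euclidean_space"
  shows "f \<in> L2 M \<Longrightarrow> L2_norm M (\<lambda>x. c *\<^sub>R f x) = \<bar>c\<bar> * L2_norm M f"
  unfolding L2_norm_def by (rule nrm_scale)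

lemma L2_cauchy_limit:
  fixes X :: "nat \<Rightarrow> 'a \<Rightarrow> 'b::euclidean_space"
  assumes X: "\<And>n. X n \<in> L2 M"
    and cauchy: "\<And>e. 0 < e \<Longrightarrow> \<exists>N. \<forall>m\<ge>N. \<forall>n\<ge>N. L2_norm M (\<lambda>x. X m x - X n x) < e"
  shows "\<exists>f\<in>L2 M. (\<lambda>n. L2_norm M (\<lambda>x. X n x - f x)) \<longlonglongrightarrow> 0"
proof -
  have "\<exists>N. \<forall>m\<ge>N. \<forall>n\<ge>N. L2_inner M (\<lambda>x. X m x - X n x) (\<lambda>x. X m x - X n x) < e" if "e > 0" for e
    using cauchy[of "sqrt e"] that by (simp add: L2_norm_def)
  from L2_complete[OF X this] obtain f where f: "f \<in> L2 M"
    "(\<lambda>n. L2_inner M (\<lambda>x. X n x - f x) (\<lambda>x. X n x - f x)) \<longlonglongrightarrow> 0" by blast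
  then show ?thesis using tendsto_real_sqrt[OF f(2)] by (intro bexI[of _ f]) (simp_all add: L2_norm_def)
qed

end

lemma L2_inner_scale:
  fixes f g :: "'a \<Rightarrow> 'b::euclidean_space"
  shows "L2_inner M (\<lambda>x. c *\<^sub>R f x) g = c * L2_inner M f g" "L2_inner M f (\<lambda>x. c *\<^sub>R g x) = c * L2_inner M f g"
  by (simp_all add: L2_inner_def)

lemma L2_inner_cmult:
  fixes f g :: "'a \<Rightarrow> real"
  shows "L2_inner M (\<lambda>x. c * f x) g = c * L2_inner M f g" "L2_inner M f (\<lambda>x. c * g x) = c * L2_inner M f g"
  using L2_inner_scale[where M=M and c=c and f=f and g=g] by simp_all

lemma L2_norm_cmult:
  fixes f :: "'a \<Rightarrow> real"
  shows "f \<in> L2 M \<Longrightarrow> L2_norm M (\<lambda>x. c * f x) = \<bar>c\<bar> * L2_norm M f"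
  using L2_norm_scaleR[of f M c] by simp

lemma L2_inner_minus:
  fixes f g :: "'a \<Rightarrow> 'b::euclidean_space"
  shows "L2_inner M (\<lambda>x. - f x) g = - L2_inner M f g" "L2_inner M f (\<lambda>x. - g x) = - L2_inner M f g"
  by (simp_all add: L2_inner_def)

lemma L2_norm_minus:
  fixes f :: "'a \<Rightarrow> 'b::euclidean_space"
  shows "L2_norm M (\<lambda>x. - f x) = L2_norm M f"
  by (simp add: L2_norm_def L2_inner_minus)

lemma L2_inner_sym: "L2_inner M f g = L2_inner M g f"
  by (simp add: L2_inner_def inner_commute)

lemma L2_inner_self_nonneg: "0 \<le> L2_inner M f f"
  by (simp add: L2_inner_self)

lemma L2_norm_nonneg: "0 \<le> L2_norm M f"
  by (simp add: L2_norm_def L2_inner_self_nonneg)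

lemma L2_norm_sq: "(L2_norm M f)\<^sup>2 = L2_inner M f f"
  by (simp add: L2_norm_def L2_inner_self_nonneg)

lemma L2_norm_zero: "L2_norm M (\<lambda>x. 0) = 0"
  by (simp add: L2_norm_def L2_inner_def)

lemma L2_norm_cong_AE:
  fixes f g :: "'a \<Rightarrow> 'b::euclidean_space"
  assumes "f \<in> borel_measurable M" "g \<in> borel_measurable M" "AE x in M. f x = g x"
  shows "L2_norm M f = L2_norm M g"
  unfolding L2_norm_def using L2_inner_cong_AE[OF assms(1,1,2,2,3,3)] by simp

lemma L2_norm_eq_zero:
  fixes f :: "'a \<Rightarrow> 'b::euclidean_space"
  shows "f \<in> L2 M \<Longrightarrow> L2_norm M f = 0 \<longleftrightarrow> (AE x in M. f x = 0)"
  using L2_eq_ae_zero[of f M] L2_norm_cong_AE[of f M "\<lambda>x. 0"] L2_measurable[of f M]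
  by (auto simp: L2_norm_zero) (simp add: L2_norm_def)

lemma L2_norm_mono:
  fixes f :: "'a \<Rightarrow> 'b::euclidean_space" and g :: "'a \<Rightarrow> 'c::euclidean_space"
  assumes "f \<in> L2 M" "g \<in> L2 M" "AE x in M. norm (f x) \<le> norm (g x)"
  shows "L2_norm M f \<le> L2_norm M g"
  unfolding L2_norm_def L2_inner_self
proof (intro real_sqrt_le_mono integral_mono_AE L2_sq_integrable assms(1,2))
  show "AE x in M. (norm (f x))\<^sup>2 \<le> (norm (g x))\<^sup>2"
    using assms(3) by eventually_elim (intro power_mono, auto)
qed

lemma L2_bounded:
  fixes f :: "'a \<Rightarrow> 'b::euclidean_space"
  assumes "finite_measure M" "f \<in> borel_measurable M" "AE x in M. norm (f x) \<le> B"
  shows "f \<in> L2 M"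
proof -
  interpret finite_measure M by fact
  have "(\<lambda>x. B) \<in> L2 M" by (simp add: Lp2_iff)
  moreover have "AE x in M. norm (f x) \<le> 1 * norm B"
    using assms(3) by eventually_elim auto
  ultimately show ?thesis by (rule L2_bound[OF _ assms(2)])
qed

lemma L2_integrable:
  fixes f :: "'a \<Rightarrow> real"
  assumes "finite_measure M" "f \<in> L2 M" shows "integrable M f"
proof -
  interpret finite_measure M by fact
  have "(\<lambda>x. 1::real) \<in> L2 M" by (simp add: Lp2_iff)
  from L2_inner_integrable[OF assms(2) this] show ?thesis by simp
qed

subsection \<open>Smooth functions\<close>

text \<open>\<open>foldr\<close> applies the last list element first, so differentiating f itself
  extends the multi-index at its end; hence the case split by \<open>rev_cases\<close>.\<close>

lemma C_infinity_iff:
  "C_infinity f \<longleftrightarrow> (\<forall>x. f differentiable (at x)) \<and> (\<forall>i. C_infinity (partial_deriv i f))"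
proof
  assume f: "C_infinity f"
  have "foldr partial_deriv is (partial_deriv i f) = foldr partial_deriv (is @ [i]) f" for "is" i by simp
  then show "(\<forall>x. f differentiable (at x)) \<and> (\<forall>i. C_infinity (partial_deriv i f))"
    using f unfolding C_infinity_def by (metis foldr_Nil id_apply)
next
  assume *: "(\<forall>x. f differentiable (at x)) \<and> (\<forall>i. C_infinity (partial_deriv i f))"
  have "foldr partial_deriv is f differentiable (at x)" for "is" x
    using * by (cases "is" rule: rev_cases) (auto simp: C_infinity_def)
  then show "C_infinity f" by (simp add: C_infinity_def)
qed

text \<open>Spares formulas for higher derivatives: a smoothness proof only has to exhibit a family
  of differentiable functions that is stable under partial derivatives.\<close>

lemma C_infinity_coinduct:
  assumes "f \<in> A" "\<And>f x. f \<in> A \<Longrightarrow> f differentiable (at x)" "\<And>f i. f \<in> A \<Longrightarrow> partial_deriv i f \<in> A"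
  shows "C_infinity f"
proof -
  have "foldr partial_deriv is f \<in> A" for "is" by (induction "is") (use assms in auto)
  then show ?thesis using assms(2) by (simp add: C_infinity_def)
qed

lemma C_infinity_differentiable: "C_infinity f \<Longrightarrow> f differentiable (at x)"
  using C_infinity_iff by blast

lemma C_infinity_partial: "C_infinity f \<Longrightarrow> C_infinity (partial_deriv i f)"
  using C_infinity_iff by blast

lemma partial_deriv_eq: "(f has_derivative f') (at x) \<Longrightarrow> partial_deriv i f x = f' (axis i 1)"
  unfolding partial_deriv_def using frechet_derivative_at by metis

lemma has_derivative_grad:
  assumes "f differentiable (at x)" shows "(f has_derivative (\<lambda>v. grad f x \<bullet> v)) (at x)"
proof -
  obtain f' where f': "(f has_derivative f') (at x)" using assms by (auto simp: differentiable_def)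
  have l: "linear f'" using f' by (rule has_derivative_linear)
  have "f' v = grad f x \<bullet> v" for v
  proof -
    have "v = (\<Sum>i\<in>UNIV. (v $ i) *\<^sub>R axis i 1)"
      using basis_expansion[of v] by (simp add: scalar_mult_eq_scaleR)
    then have "f' v = f' (\<Sum>i\<in>UNIV. (v $ i) *\<^sub>R axis i 1)" by simp
    also have "\<dots> = (\<Sum>i\<in>UNIV. (v $ i) * f' (axis i 1))"
      by (simp add: linear_sum[OF l] linear_scale[OF l])
    also have "\<dots> = grad f x \<bullet> v"
      by (simp add: grad_def inner_vec_def partial_deriv_eq[OF f'] mult.commute)
    finally show ?thesis .
  qed
  then have "f' = (\<lambda>v. grad f x \<bullet> v)" by auto
  with f' show ?thesis by simp
qed

lemma grad_eqI:
  assumes "(f has_derivative (\<lambda>v. g \<bullet> v)) (at x)" shows "grad f x = g"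
  by (simp add: vec_eq_iff grad_def partial_deriv_eq[OF assms] inner_axis)

lemma differentiable_grad_continuous: "(\<And>x. f differentiable (at x)) \<Longrightarrow> continuous_on S f"
  by (meson differentiable_imp_continuous_within continuous_at_imp_continuous_on)

lemma C_infinity_continuous: "C_infinity f \<Longrightarrow> continuous_on S f"
  using C_infinity_differentiable differentiable_grad_continuous by blast

lemma C_infinity_grad_continuous: "C_infinity f \<Longrightarrow> continuous_on S (grad f)"
  unfolding grad_def by (intro continuous_on_vec_lambda C_infinity_continuous C_infinity_partial)

text \<open>A function F 0 of one real variable bundled with all its derivatives F 1, F 2, ..., so
  that the chain rule amounts to an index shift.\<close>

definition smooth_seq :: "(nat \<Rightarrow> real \<Rightarrow> real) \<Rightarrow> bool" where
  "smooth_seq F \<longleftrightarrow> (\<forall>n x. (F n has_real_derivative F (Suc n) x) (at x))"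

lemma smooth_seqD: "smooth_seq F \<Longrightarrow> (F n has_derivative (\<lambda>v. F (Suc n) x * v)) (at x)"
  unfolding smooth_seq_def has_field_derivative_def by simp

text \<open>Product rule and chain rule do not lead out of this algebra, so one induction yields
  smoothness of sums, products and compositions at once. For sums and products alone, the sequence F
  is taken to be zero.\<close>

inductive_set smooth_algebra :: "(nat \<Rightarrow> real \<Rightarrow> real) \<Rightarrow> (real^2 \<Rightarrow> real) \<Rightarrow> (real^2 \<Rightarrow> real) set"
  for F :: "nat \<Rightarrow> real \<Rightarrow> real" and \<psi> :: "real^2 \<Rightarrow> real" where
  base: "C_infinity f \<Longrightarrow> f \<in> smooth_algebra F \<psi>"
| comp: "(\<lambda>x. F n (\<psi> x)) \<in> smooth_algebra F \<psi>"
| add: "f \<in> smooth_algebra F \<psi> \<Longrightarrow> g \<in> smooth_algebra F \<psi> \<Longrightarrow> (\<lambda>x. f x + g x) \<in> smooth_algebra F \<psi>"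
| mult: "f \<in> smooth_algebra F \<psi> \<Longrightarrow> g \<in> smooth_algebra F \<psi> \<Longrightarrow> (\<lambda>x. f x * g x) \<in> smooth_algebra F \<psi>"

lemma partial_deriv_grad: "partial_deriv i f x = grad f x $ i"
  by (simp add: grad_def)

lemma smooth_algebra_step:
  assumes F: "smooth_seq F" and \<psi>: "C_infinity \<psi>" and "f \<in> smooth_algebra F \<psi>"
  shows "(\<forall>x. f differentiable (at x)) \<and> (\<forall>i. partial_deriv i f \<in> smooth_algebra F \<psi>)"
  using assms(3)
proof induction
  case (base f)
  then show ?case using C_infinity_iff smooth_algebra.base by blast
next
  case (comp n)
  have d: "((\<lambda>x. F n (\<psi> x)) has_derivative (\<lambda>v. F (Suc n) (\<psi> x) * (grad \<psi> x \<bullet> v))) (at x)" for x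
    by (rule has_derivative_compose[OF has_derivative_grad[OF C_infinity_differentiable[OF \<psi>]] smooth_seqD[OF F]])
  have "partial_deriv i (\<lambda>x. F n (\<psi> x)) = (\<lambda>x. F (Suc n) (\<psi> x) * partial_deriv i \<psi> x)" for i
    by (rule ext) (simp add: partial_deriv_eq[OF d] partial_deriv_grad inner_axis)
  then show ?case using d smooth_algebra.intros C_infinity_partial[OF \<psi>] by (auto simp: differentiable_def)
next
  case (add f g)
  then have df: "(f has_derivative (\<lambda>v. grad f x \<bullet> v)) (at x)" and dg: "(g has_derivative (\<lambda>v. grad g x \<bullet> v)) (at x)" for x
    using has_derivative_grad by auto
  have "partial_deriv i (\<lambda>x. f x + g x) = (\<lambda>x. partial_deriv i f x + partial_deriv i g x)" for i
    by (rule ext) (simp add: partial_deriv_eq[OF has_derivative_add[OF df dg]] partial_deriv_grad inner_axis)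
  then show ?case using add by (auto intro: smooth_algebra.intros)
next
  case (mult f g)
  then have df: "(f has_derivative (\<lambda>v. grad f x \<bullet> v)) (at x)" and dg: "(g has_derivative (\<lambda>v. grad g x \<bullet> v)) (at x)" for x
    using has_derivative_grad by auto
  have "partial_deriv i (\<lambda>x. f x * g x) = (\<lambda>x. f x * partial_deriv i g x + partial_deriv i f x * g x)" for i
    by (rule ext) (simp add: partial_deriv_eq[OF has_derivative_mult[OF df dg]] partial_deriv_grad inner_axis)
  then show ?case using mult by (auto intro!: smooth_algebra.add smooth_algebra.mult)
qed

lemma smooth_algebra_C_infinity:
  assumes "smooth_seq F" "C_infinity \<psi>" "f \<in> smooth_algebra F \<psi>" shows "C_infinity f"
  by (rule C_infinity_coinduct[OF assms(3)]) (use smooth_algebra_step[OF assms(1,2)] in auto)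

lemma C_infinity_const: "C_infinity (\<lambda>x. c)"
proof (rule C_infinity_coinduct[where A="range (\<lambda>c x. c)"])
  fix f :: "real^2 \<Rightarrow> real" and i assume "f \<in> range (\<lambda>c x. c)"
  then obtain c where f: "f = (\<lambda>x. c)" by auto
  have "partial_deriv i f = (\<lambda>x. 0)" unfolding f by (rule ext, subst partial_deriv_eq[OF has_derivative_const]) simp
  then show "partial_deriv i f \<in> range (\<lambda>c x. c)" by auto
qed auto

lemma smooth_seq_zero: "smooth_seq (\<lambda>n x. 0)" by (simp add: smooth_seq_def)

lemma C_infinity_add: "C_infinity f \<Longrightarrow> C_infinity g \<Longrightarrow> C_infinity (\<lambda>x. f x + g x)"
  using smooth_algebra_C_infinity[OF smooth_seq_zero C_infinity_const[of 0]] by (blast intro: smooth_algebra.intros)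

lemma C_infinity_mult: "C_infinity f \<Longrightarrow> C_infinity g \<Longrightarrow> C_infinity (\<lambda>x. f x * g x)"
  using smooth_algebra_C_infinity[OF smooth_seq_zero C_infinity_const[of 0]] by (blast intro: smooth_algebra.intros)

lemma C_infinity_compose: "smooth_seq F \<Longrightarrow> C_infinity \<psi> \<Longrightarrow> C_infinity (\<lambda>x. F n (\<psi> x))"
  by (blast intro: smooth_algebra_C_infinity smooth_algebra.intros)

lemma C_infinity_cmult: "C_infinity f \<Longrightarrow> C_infinity (\<lambda>x. c * f x)"
  by (intro C_infinity_mult C_infinity_const)

lemma C_infinity_diff: "C_infinity f \<Longrightarrow> C_infinity g \<Longrightarrow> C_infinity (\<lambda>x. f x - g x)"
  using C_infinity_add[of f "\<lambda>x. (-1) * g x"] C_infinity_cmult[of g "-1"] by simp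

lemma C_infinity_sum: "(\<And>i. i \<in> I \<Longrightarrow> C_infinity (f i)) \<Longrightarrow> C_infinity (\<lambda>x. \<Sum>i\<in>I. f i x)"
proof (induction I rule: infinite_finite_induct)
  case (insert i I)
  then show ?case using C_infinity_add[of "f i" "\<lambda>x. \<Sum>i\<in>I. f i x"] by simp
qed (simp_all add: C_infinity_const)

lemma C_infinity_prod: "(\<And>i. i \<in> I \<Longrightarrow> C_infinity (f i)) \<Longrightarrow> C_infinity (\<lambda>x. \<Prod>i\<in>I. f i x)"
proof (induction I rule: infinite_finite_induct)
  case (insert i I)
  then show ?case using C_infinity_mult[of "f i" "\<lambda>x. \<Prod>i\<in>I. f i x"] by simp
qed (simp_all add: C_infinity_const)

lemma C_infinity_inner: "C_infinity (\<lambda>x. a \<bullet> x)"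
proof -
  have d: "((\<lambda>x. a \<bullet> x) has_derivative (\<lambda>v. a \<bullet> v)) (at x)" for x :: "real^2" by (auto intro!: derivative_eq_intros)
  have "partial_deriv i (\<lambda>x. a \<bullet> x) = (\<lambda>x. a $ i)" for i
    by (rule ext) (simp add: partial_deriv_eq[OF d] inner_axis)
  then show ?thesis by (subst C_infinity_iff) (use d C_infinity_const in \<open>auto simp: differentiable_def\<close>)
qed

lemma has_derivative_dilate:
  fixes f :: "real^2 \<Rightarrow> real"
  assumes "f differentiable (at (c *\<^sub>R x + b))"
  shows "((\<lambda>x. f (c *\<^sub>R x + b)) has_derivative (\<lambda>v. (c *\<^sub>R grad f (c *\<^sub>R x + b)) \<bullet> v)) (at x)"
proof -
  have "((\<lambda>x. c *\<^sub>R x + b) has_derivative (\<lambda>v. c *\<^sub>R v)) (at x)" by (auto intro!: derivative_eq_intros)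
  from has_derivative_compose[OF this has_derivative_grad[OF assms]] show ?thesis by (simp add: inner_commute)
qed

text \<open>Every differentiation pulls out a factor c; the invariant family therefore consists of
  constant multiples of dilated smooth functions.\<close>

lemma C_infinity_dilate:
  assumes "C_infinity f" shows "C_infinity (\<lambda>x. f (c *\<^sub>R x + b))"
proof (rule C_infinity_coinduct[where A="{(\<lambda>x. k * g (c *\<^sub>R x + b)) | k g. C_infinity g}"])
  show "(\<lambda>x. f (c *\<^sub>R x + b)) \<in> {(\<lambda>x. k * g (c *\<^sub>R x + b)) | k g. C_infinity g}"
    using assms by (intro CollectI exI[of _ 1] exI[of _ f]) auto
next
  fix h assume "h \<in> {(\<lambda>x. k * g (c *\<^sub>R x + b)) | k g. C_infinity g}"
  then obtain k g where h: "h = (\<lambda>x. k * g (c *\<^sub>R x + b))" and g: "C_infinity g" by auto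
  have d: "(h has_derivative (\<lambda>v. k * ((c *\<^sub>R grad g (c *\<^sub>R x + b)) \<bullet> v))) (at x)" for x
    unfolding h by (intro has_derivative_mult_right has_derivative_dilate C_infinity_differentiable g)
  then show "h differentiable (at x)" for x by (auto simp: differentiable_def)
  fix i
  have "partial_deriv i h = (\<lambda>x. (k * c) * partial_deriv i g (c *\<^sub>R x + b))"
    by (rule ext, subst partial_deriv_eq[OF d]) (simp add: partial_deriv_grad inner_axis)
  then show "partial_deriv i h \<in> {(\<lambda>x. k * g (c *\<^sub>R x + b)) | k g. C_infinity g}"
    using C_infinity_partial[OF g] by blast
qed

lemma grad_dilate:
  "C_infinity f \<Longrightarrow> grad (\<lambda>x. f (c *\<^sub>R x + b)) x = c *\<^sub>R grad f (c *\<^sub>R x + b)"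
  by (intro grad_eqI has_derivative_dilate C_infinity_differentiable)

lemma grad_add:
  assumes "C_infinity f" "C_infinity g" shows "grad (\<lambda>x. f x + g x) x = grad f x + grad g x"
  by (rule grad_eqI) (use has_derivative_add[OF assms[THEN C_infinity_differentiable, THEN has_derivative_grad]] in \<open>simp add: inner_add_left\<close>)

lemma grad_cmult:
  assumes "C_infinity f" shows "grad (\<lambda>x. c * f x) x = c *\<^sub>R grad f x"
  by (rule grad_eqI) (use has_derivative_mult_right[OF assms[THEN C_infinity_differentiable, THEN has_derivative_grad], of c] in simp)

lemma grad_diff:
  assumes "C_infinity f" "C_infinity g" shows "grad (\<lambda>x. f x - g x) x = grad f x - grad g x"
  by (rule grad_eqI) (use has_derivative_diff[OF assms[THEN C_infinity_differentiable, THEN has_derivative_grad]] in \<open>simp add: inner_diff_left\<close>)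

lemma grad_mult:
  assumes "C_infinity f" "C_infinity g" shows "grad (\<lambda>x. f x * g x) x = f x *\<^sub>R grad g x + g x *\<^sub>R grad f x"
  by (rule grad_eqI) (use has_derivative_mult[OF assms[THEN C_infinity_differentiable, THEN has_derivative_grad]] in \<open>simp add: inner_add_left mult.commute\<close>)

lemma grad_const: "grad (\<lambda>x. c) x = 0"
  by (rule grad_eqI) simp

subsection \<open>A smooth step\<close>

text \<open>The functions p(1/t) exp(-1/t), continued by 0, include exp(-1/t) and are closed under
  differentiation: p turns into X^2 (p - p'). Thus the derivatives of all orders at 0 are handled
  together.\<close>

definition flat :: "real poly \<Rightarrow> real \<Rightarrow> real" where
  "flat p t = (if t > 0 then poly p (1 / t) * exp (- (1 / t)) else 0)"

text \<open>The extra power y^k closes the induction over the coefficients: the factor y in front of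
  the tail of the polynomial is absorbed by raising k.\<close>

lemma power_poly_exp_tendsto_0: "((\<lambda>y::real. y ^ k * poly p y * exp (- y)) \<longlongrightarrow> 0) at_top"
proof (induction p arbitrary: k)
  case 0
  then show ?case by simp
next
  case (pCons a p)
  have "((\<lambda>y::real. y ^ k / exp y) \<longlongrightarrow> 0) at_top" by (rule tendsto_power_div_exp_0)
  from tendsto_add[OF tendsto_mult_right[OF this, of a] pCons.IH[of "Suc k"]]
  show ?case by (simp add: algebra_simps exp_minus field_simps)
qed

lemma flat_DERIV: "(flat p has_real_derivative flat (pCons 0 (pCons 0 (p - pderiv p))) t) (at t)"
proof -
  consider "t > 0" | "t < 0" | "t = 0" by linarith
  then show ?thesis
  proof cases
    case 1
    have "((\<lambda>t. poly p (1 / t) * exp (- (1 / t))) has_real_derivative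
        (poly (pderiv p) (1 / t) * (- 1 / t\<^sup>2)) * exp (- (1 / t)) + poly p (1 / t) * (exp (- (1 / t)) * (1 / t\<^sup>2))) (at t)"
      using 1 by (auto intro!: derivative_eq_intros poly_DERIV[THEN DERIV_chain2] simp: power2_eq_square field_simps)
    also have "(poly (pderiv p) (1 / t) * (- 1 / t\<^sup>2)) * exp (- (1 / t)) + poly p (1 / t) * (exp (- (1 / t)) * (1 / t\<^sup>2))
        = flat (pCons 0 (pCons 0 (p - pderiv p))) t"
      using 1 by (simp add: flat_def power2_eq_square field_simps)
    finally have "((\<lambda>t. poly p (1 / t) * exp (- (1 / t))) has_real_derivative flat (pCons 0 (pCons 0 (p - pderiv p))) t) (at t)" .
    then show ?thesis
      by (rule has_field_derivative_transform_within_open[of _ _ _ "{0<..}"]) (use 1 in \<open>auto simp: flat_def\<close>)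
  next
    case 2
    have "((\<lambda>t. 0) has_real_derivative flat (pCons 0 (pCons 0 (p - pderiv p))) t) (at t)"
      using 2 by (simp add: flat_def)
    then show ?thesis
      by (rule has_field_derivative_transform_within_open[of _ _ _ "{..<0}"]) (use 2 in \<open>auto simp: flat_def\<close>)
  next
    case 3
    \<comment> \<open>The difference quotient from the right is y p(y) exp(-y) with y = 1/h, which
      is the case k = 1 of the preceding limit; from the left the quotient vanishes.\<close>
    have r: "((\<lambda>h. flat p h / h) \<longlongrightarrow> 0) (at_right 0)"
    proof -
      have "((\<lambda>h::real. (1/h) ^ 1 * poly p (1/h) * exp (- (1/h))) \<longlongrightarrow> 0) (at_right 0)"
        by (rule filterlim_compose[OF power_poly_exp_tendsto_0])
          (use filterlim_inverse_at_top_right in \<open>simp add: inverse_eq_divide\<close>)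
      then show ?thesis
        by (rule Lim_transform_eventually)
          (use eventually_at_right_less[of "0::real"] in \<open>auto simp: flat_def field_simps elim!: eventually_mono\<close>)
    qed
    have l: "((\<lambda>h. flat p h / h) \<longlongrightarrow> 0) (at_left 0)"
      by (rule tendsto_eventually) (auto simp: flat_def eventually_at intro!: exI[of _ 1])
    show ?thesis unfolding 3
      using filterlim_split_at[OF l r] by (simp add: DERIV_def flat_def)
  qed
qed

text \<open>A derivative within the class is selected by choice and the selection is
  iterated.\<close>

lemma smooth_seq_exists:
  assumes "f \<in> A" and "\<And>f. f \<in> A \<Longrightarrow> \<exists>f'\<in>A. \<forall>x. (f has_real_derivative f' x) (at x)"
  shows "\<exists>F. F 0 = f \<and> smooth_seq F \<and> (\<forall>n. F n \<in> A)"
proof -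
  obtain D where D: "\<And>f. f \<in> A \<Longrightarrow> D f \<in> A" "\<And>f x. f \<in> A \<Longrightarrow> (f has_real_derivative D f x) (at x)"
    using assms(2) by metis
  have "(D ^^ n) f \<in> A" for n by (induction n) (use assms(1) D in auto)
  then show ?thesis using D(2) by (intro exI[of _ "\<lambda>n. (D ^^ n) f"]) (auto simp: smooth_seq_def)
qed

text \<open>The derivative of such a product is a sum of two of them, hence the closure under
  addition. All members vanish outside (0, 1).\<close>

inductive_set bump_algebra :: "(real \<Rightarrow> real) set" where
  prod: "(\<lambda>t. flat p t * flat q (1 - t)) \<in> bump_algebra"
| add: "f \<in> bump_algebra \<Longrightarrow> g \<in> bump_algebra \<Longrightarrow> (\<lambda>t. f t + g t) \<in> bump_algebra"

lemma flat_uminus: "flat (- p) t = - flat p t" by (simp add: flat_def)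

lemma bump_algebra_deriv:
  "f \<in> bump_algebra \<Longrightarrow> \<exists>f'\<in>bump_algebra. \<forall>x. (f has_real_derivative f' x) (at x)"
proof (induction rule: bump_algebra.induct)
  case (prod p q)
  define p' q' where "p' = pCons 0 (pCons 0 (p - pderiv p))" and "q' = - pCons 0 (pCons 0 (q - pderiv q))"
  have 1: "(flat p has_real_derivative flat p' x) (at x)" for x unfolding p'_def by (rule flat_DERIV)
  have "((\<lambda>t. flat q (1 - t)) has_real_derivative flat (pCons 0 (pCons 0 (q - pderiv q))) (1 - x) * (-1)) (at x)" for x
    by (rule DERIV_chain2[OF flat_DERIV]) (auto intro!: derivative_eq_intros)
  then have 2: "((\<lambda>t. flat q (1 - t)) has_real_derivative flat q' (1 - x)) (at x)" for x
    unfolding q'_def flat_uminus by simp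
  have "((\<lambda>t. flat p t * flat q (1 - t)) has_real_derivative flat p' x * flat q (1 - x) + flat p x * flat q' (1 - x)) (at x)" for x
    using DERIV_mult[OF 1 2, of x] by (simp add: mult.commute)
  then show ?case by (intro bexI[of _ "\<lambda>x. flat p' x * flat q (1 - x) + flat p x * flat q' (1 - x)"])
    (auto intro: bump_algebra.intros)
next
  case (add f g)
  then obtain f' g' where "f' \<in> bump_algebra" "\<And>x. (f has_real_derivative f' x) (at x)"
    "g' \<in> bump_algebra" "\<And>x. (g has_real_derivative g' x) (at x)" by metis
  then show ?case by (intro bexI[of _ "\<lambda>x. f' x + g' x"]) (auto intro: bump_algebra.intros DERIV_add)
qed

text \<open>The step is the normalised primitive of the bump exp(-1/t) exp(-1/(1-t)) on (0, 1). The
  bound and the zeros of the derivative are recorded because gradients of cutoffs are estimated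
  through them.\<close>

lemma smooth_step_exists:
  "\<exists>\<theta> B. smooth_seq \<theta> \<and> (\<forall>t\<le>0. \<theta> 0 t = 0) \<and> (\<forall>t\<ge>1. \<theta> 0 t = 1) \<and> (\<forall>t. 0 \<le> \<theta> 0 t \<and> \<theta> 0 t \<le> 1)
     \<and> (\<forall>t. \<bar>\<theta> 1 t\<bar> \<le> B) \<and> (\<forall>t. t \<le> 0 \<or> 1 \<le> t \<longrightarrow> \<theta> 1 t = 0)"
proof -
  define b where "b t = flat 1 t * flat 1 (1 - t)" for t :: real
  have "b \<in> bump_algebra" unfolding b_def by (rule bump_algebra.prod)
  from smooth_seq_exists[OF this bump_algebra_deriv] obtain F where F: "F 0 = b" "smooth_seq F" by blast
  have cont: "continuous_on S b" for S
    using F unfolding smooth_seq_def by (metis DERIV_isCont continuous_at_imp_continuous_on)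
  have b0: "b t = 0" if "t \<le> 0 \<or> 1 \<le> t" for t using that by (auto simp: b_def flat_def)
  have bpos: "0 \<le> b t" for t by (simp add: b_def flat_def)
  have b1: "b t \<le> 1" for t by (auto simp: b_def flat_def intro!: mult_le_one)
  \<comment> \<open>Integration starts at -1, outside the support, so that every t \<ge> 0 is an
    inner point of an interval on which the fundamental theorem of calculus applies.\<close>
  define c where "c = integral {-1..1} b"
  define I where "I t = integral {-1..t} b" for t
  have io: "b integrable_on {u..v}" for u v by (rule integrable_continuous_real[OF cont])
  have I0: "I t = 0" if "t \<le> 0" for t
  proof -
    have "I t = integral {-1..t} (\<lambda>t. 0)"
      unfolding I_def by (rule Henstock_Kurzweil_Integration.integral_cong) (use that b0 in auto)
    then show ?thesis by simp
  qed
  have dI: "(I has_real_derivative b t) (at t)" for t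
  proof (cases "t < 0")
    case True
    have "((\<lambda>t. 0) has_real_derivative b t) (at t)" using b0[of t] True by simp
    then show ?thesis
      by (rule has_field_derivative_transform_within_open[of _ _ _ "{..<0}"]) (use True I0 in auto)
  next
    case False
    have "(I has_real_derivative b t) (at t within {-1..t+1})"
      unfolding I_def by (rule integral_has_real_derivative[OF cont]) (use False in auto)
    then show ?thesis using False at_within_Icc_at[of "-1" t "t+1"] by simp
  qed
  have I1: "I t = c" if "t \<ge> 1" for t
  proof -
    have "integral {-1..1} b + integral {1..t} b = integral {-1..t} b"
      by (rule Henstock_Kurzweil_Integration.integral_combine) (use that io in auto)
    moreover have "integral {1..t} b = integral {1..t} (\<lambda>t. 0)"
      by (rule Henstock_Kurzweil_Integration.integral_cong) (use b0 in auto)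
    ultimately show ?thesis by (simp add: I_def c_def)
  qed
  have mono: "I s \<le> I t" if "s \<le> t" for s t
    by (rule DERIV_nonneg_imp_nondecreasing[OF that]) (use dI bpos in blast)
  \<comment> \<open>If c were 0, the monotone primitive would be constant on [0, 1], and its
    derivative at 1/2, which is exp(-4), would vanish.\<close>
  have cpos: "c > 0"
  proof (rule ccontr)
    assume "\<not> c > 0"
    then have c0: "c = 0" using mono[of 0 1] I0[of 0] I1[of 1] by simp
    have z: "I s = 0" if "0 \<le> s" "s \<le> 1" for s using mono[of 0 s] mono[of s 1] I0[of 0] I1[of 1] that c0 by simp
    have "((\<lambda>t. 0) has_real_derivative b (1/2)) (at (1/2))"
      by (rule has_field_derivative_transform_within_open[OF dI, where S="{0<..<1}"]) (use z in auto)
    then have "b (1/2) = 0" using DERIV_unique DERIV_const by blast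
    then show False by (simp add: b_def flat_def)
  qed
  define \<theta> where "\<theta> n = (case n of 0 \<Rightarrow> (\<lambda>t. I t / c) | Suc m \<Rightarrow> (\<lambda>t. F m t / c))" for n
  have "smooth_seq \<theta>"
    unfolding smooth_seq_def
  proof (intro allI)
    fix n x
    have "(F m has_real_derivative F (Suc m) x) (at x)" for m using F(2) by (simp add: smooth_seq_def)
    then show "(\<theta> n has_real_derivative \<theta> (Suc n) x) (at x)"
      using DERIV_cdivide[OF dI, of c x] F(1) by (cases n) (auto simp: \<theta>_def intro!: DERIV_cdivide)
  qed
  moreover have "0 \<le> I t \<and> I t \<le> c" for t
    using mono[of 0 t] mono[of t 1] I0[of t] I0[of 0] I1[of 1] I1[of t] cpos by (cases "t \<le> 0"; cases "t \<le> 1") auto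
  moreover have "\<theta> 1 t = b t / c" for t using F(1) by (simp add: \<theta>_def)
  moreover have "\<bar>b t / c\<bar> \<le> 1 / c" for t using bpos[of t] b1[of t] cpos by (simp add: divide_right_mono)
  ultimately show ?thesis using I0 I1 cpos b0
    by (intro exI[of _ \<theta>] exI[of _ "1/c"]) (auto simp: \<theta>_def)
qed

subsection \<open>Convex polygons and arc length\<close>

text \<open>In an irredundant family of half-planes each bounding line carries a facet, and strict
  inequalities describe the relative interior, which is \<Omega> because \<Omega> is open and
  convex. A facet in the plane has dimension 1 and is compact, convex and collinear, hence a
  segment.\<close>

lemma halfplane_representation:
  assumes "convex_polygonal_domain \<Omega>"
  shows "\<exists>H. finite H \<and> closure \<Omega> = {x. \<forall>(a, c)\<in>H. a \<bullet> x \<le> c} \<and> \<Omega> = {x. \<forall>(a, c)\<in>H. a \<bullet> x < c} \<and>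
    (\<forall>(a, c)\<in>H. a \<noteq> 0 \<and> (\<exists>(p, q)\<in>sides \<Omega>. closure \<Omega> \<inter> {x. a \<bullet> x = c} = closed_segment p q))"
proof -
  let ?S = "closure \<Omega>"
  have \<Omega>: "open \<Omega>" "\<Omega> \<noteq> {}" "convex \<Omega>" "polytope ?S"
    using assms by (auto simp: convex_polygonal_domain_def)
  have int: "interior ?S = \<Omega>" using convex_interior_closure[OF \<Omega>(3)] \<Omega>(1) interior_open by blast
  then have aff: "affine hull ?S = UNIV" using \<Omega>(2) affine_hull_nonempty_interior by metis
  have rel: "rel_interior ?S = \<Omega>" using rel_interior_interior[OF aff] int by simp
  have dimS: "aff_dim ?S = 2"
    using aff aff_dim_eq_full[of ?S] by simp
  have "polyhedron ?S" using \<Omega>(4) polytope_imp_polyhedron by blast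
  then obtain F where F: "finite F" "?S = affine hull ?S \<inter> \<Inter>F"
    and half: "\<forall>h\<in>F. \<exists>a b. a \<noteq> 0 \<and> h = {x. a \<bullet> x \<le> b}"
    and min: "\<And>F'. F' \<subset> F \<Longrightarrow> ?S \<subset> affine hull ?S \<inter> \<Inter>F'"
    unfolding polyhedron_Int_affine_minimal by blast
  from half obtain a b where ab: "\<And>h. h \<in> F \<Longrightarrow> a h \<noteq> 0 \<and> h = {x. a h \<bullet> x \<le> b h}"
    by metis
  have S: "?S = {x. \<forall>h\<in>F. a h \<bullet> x \<le> b h}"
  proof (rule set_eqI)
    fix x
    have "?S = \<Inter>F" using F(2) unfolding aff by simp
    then have "x \<in> ?S \<longleftrightarrow> x \<in> \<Inter>F" by (simp only:)
    moreover have "x \<in> h \<longleftrightarrow> a h \<bullet> x \<le> b h" if "h \<in> F" for h using ab[OF that] by blast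
    ultimately show "x \<in> ?S \<longleftrightarrow> x \<in> {x. \<forall>h\<in>F. a h \<bullet> x \<le> b h}" by simp
  qed
  have \<Omega>eq: "\<Omega> = {x. \<forall>h\<in>F. a h \<bullet> x < b h}"
    using rel_interior_polyhedron_explicit[OF F ab min] rel S by (auto intro: less_imp_le)
  have side: "\<exists>(p, q)\<in>sides \<Omega>. ?S \<inter> {x. a h \<bullet> x = b h} = closed_segment p q" if h: "h \<in> F" for h
  proof -
    let ?T = "?S \<inter> {x. a h \<bullet> x = b h}"
    have T: "?T facet_of ?S" using facet_of_polyhedron_explicit[OF F ab min] h by blast
    then have face: "?T face_of ?S" and ne: "?T \<noteq> {}" and dimT: "aff_dim ?T = 1"
      using dimS by (auto simp: facet_of_def)
    have "polytope ?T" using face_of_polytope_polytope[OF \<Omega>(4) face] .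
    moreover have "collinear ?T" using dimT by (simp add: collinear_aff_dim)
    ultimately obtain p q where pq: "?T = closed_segment p q"
      using compact_convex_collinear_segment[OF ne] polytope_imp_compact polytope_imp_convex by metis
    have "p \<noteq> q" using dimT unfolding pq by auto
    define v where "v = q - p"
    have "p \<in> ?T" "q \<in> ?T" unfolding pq by auto
    then have ap: "a h \<bullet> p = b h" and aq: "a h \<bullet> q = b h" by auto
    have av: "a h \<bullet> v = 0" using ap aq by (simp add: v_def inner_diff_right)
    have v0: "v \<noteq> 0" using \<open>p \<noteq> q\<close> by (simp add: v_def)
    have a0: "a h \<noteq> 0" using ab h by blast
    have av': "a h $ 1 * v $ 1 + a h $ 2 * v $ 2 = 0" using av by (simp add: inner_vec_def sum_2)
    \<comment> \<open>The direction v of the side is orthogonal to the normal, so it is \<kappa>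
      times the rotated normal. The orientation form in \<open>sides\<close> then equals \<kappa>
      times the slack of the half-plane, and the sign of \<kappa> decides which order of the
      endpoints is the listed one.\<close>
    obtain \<kappa> where \<kappa>: "v $ 1 = - \<kappa> * (a h $ 2)" "v $ 2 = \<kappa> * (a h $ 1)"
    proof (cases "a h $ 1 = 0")
      case True
      then have "a h $ 2 \<noteq> 0" using a0 by (auto simp: vec_eq_iff forall_2)
      then show ?thesis using that[of "- v $ 1 / a h $ 2"] True av' by simp
    next
      case False
      then show ?thesis using that[of "v $ 2 / a h $ 1"] av' by (simp add: field_simps)
    qed
    have \<kappa>0: "\<kappa> \<noteq> 0" using \<kappa> v0 by (auto simp: vec_eq_iff forall_2)
    have cross: "v $ 1 * (x $ 2 - p $ 2) - v $ 2 * (x $ 1 - p $ 1) = \<kappa> * (b h - a h \<bullet> x)" for x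
      unfolding ap[symmetric] \<kappa> by (simp add: inner_vec_def sum_2 algebra_simps)
    have cross2: "(- v $ 1) * (x $ 2 - q $ 2) - (- v $ 2) * (x $ 1 - q $ 1) = - \<kappa> * (b h - a h \<bullet> x)" for x
      unfolding aq[symmetric] \<kappa> by (simp add: inner_vec_def sum_2 algebra_simps)
    have pos: "0 < b h - a h \<bullet> x" if "x \<in> \<Omega>" for x using that \<Omega>eq h by auto
    show ?thesis
    proof (cases "\<kappa> > 0")
      case True
      have "0 < v $ 1 * (x $ 2 - p $ 2) - v $ 2 * (x $ 1 - p $ 1)" if "x \<in> \<Omega>" for x
        unfolding cross using True pos[OF that] by (rule mult_pos_pos)
      then have "(p, q) \<in> sides \<Omega>"
        using T pq unfolding sides_def v_def by auto
      then show ?thesis using pq by blast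
    next
      case False
      then have "- \<kappa> > 0" using \<kappa>0 by simp
      then have "0 < - v $ 1 * (x $ 2 - q $ 2) - (- v $ 2) * (x $ 1 - q $ 1)" if "x \<in> \<Omega>" for x
        unfolding cross2 using pos[OF that] by (rule mult_pos_pos)
      then have "(q, p) \<in> sides \<Omega>"
        using T pq closed_segment_commute[of p q] unfolding sides_def v_def by auto
      then show ?thesis using pq closed_segment_commute[of p q] by blast
    qed
  qed
  have "finite ((\<lambda>h. (a h, b h)) ` F)" using F(1) by simp
  then show ?thesis
    using S \<Omega>eq side ab by (intro exI[of _ "(\<lambda>h. (a h, b h)) ` F"]) (auto simp del: closure_subset)
qed

text \<open>A segment determines its endpoints up to order, and a polytope has finitely many
  facets.\<close>

lemma finite_sides:
  assumes "convex_polygonal_domain \<Omega>" shows "finite (sides \<Omega>)"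
proof (rule finite_subset)
  let ?E = "\<lambda>T. {(p, q). closed_segment p q = T}"
  show "sides \<Omega> \<subseteq> (\<Union>T\<in>{T. T facet_of closure \<Omega>}. ?E T)" by (auto simp: sides_def)
  have "finite (?E T)" for T :: "(real^2) set"
  proof (cases "?E T = {}")
    case False
    then obtain p q where "T = closed_segment p q" by auto
    then have "?E T \<subseteq> {p, q} \<times> {p, q}" by (auto simp: closed_segment_eq doubleton_eq_iff)
    then show ?thesis by (rule finite_subset) simp
  qed simp
  then show "finite (\<Union>T\<in>{T. T facet_of closure \<Omega>}. ?E T)"
    using finite_polytope_facets assms by (intro finite_UN_I) (auto simp: convex_polygonal_domain_def)
qed

lemma sides_in_frontier:
  assumes "convex_polygonal_domain \<Omega>" "(p, q) \<in> sides \<Omega>" shows "closed_segment p q \<subseteq> frontier \<Omega>"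
proof -
  have \<Omega>: "open \<Omega>" "convex \<Omega>" using assms by (auto simp: convex_polygonal_domain_def)
  have T: "closed_segment p q facet_of closure \<Omega>" using assms(2) by (simp add: sides_def)
  then have "closed_segment p q face_of closure \<Omega>" "closed_segment p q \<noteq> closure \<Omega>"
    using facet_of_irrefl by (auto simp: facet_of_def)
  then have "closed_segment p q \<subseteq> rel_frontier (closure \<Omega>)" using face_of_subset_rel_frontier by blast
  also have "\<dots> \<subseteq> frontier (closure \<Omega>)"
    using interior_subset_rel_interior by (auto simp: rel_frontier_def frontier_def)
  also have "\<dots> = frontier \<Omega>"
    using convex_interior_closure[OF \<Omega>(2)] by (simp add: frontier_def)
  finally show ?thesis .
qed

lemma space_boundary_measure: "space (boundary_measure \<Omega>) = frontier \<Omega>"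
  by (simp add: boundary_measure_def space_restrict_space)

lemma sets_boundary_measure: "sets (boundary_measure \<Omega>) = sets (restrict_space borel (frontier \<Omega>))"
  by (simp add: boundary_measure_def)

lemma nn_integral_boundary_measure:
  assumes \<Omega>: "convex_polygonal_domain \<Omega>" and f[measurable]: "f \<in> borel_measurable (restrict_space borel (frontier \<Omega>))"
  shows "(\<integral>\<^sup>+x. f x \<partial>boundary_measure \<Omega>) = (\<Sum>(p, q)\<in>sides \<Omega>.
      \<integral>\<^sup>+t. ennreal (dist p q) * f ((1 - t) *\<^sub>R p + t *\<^sub>R q) * indicator {0..1} t \<partial>lborel)"
proof -
  let ?N = "restrict_space lborel {0..1::real}"
  let ?P = "count_space (sides \<Omega>) \<Otimes>\<^sub>M ?N"
  let ?m = "\<lambda>((p, q), t). (1 - t) *\<^sub>R p + t *\<^sub>R q :: real^2"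
  let ?w = "\<lambda>((p, q), t). ennreal (dist p q) :: ennreal"
  interpret N: sigma_finite_measure ?N
    by (intro sigma_finite_measure_restrict_space) (auto simp: sigma_finite_lborel)
  have cnt: "countable (sides \<Omega>)" using finite_sides[OF \<Omega>] by (rule countable_finite)
  \<comment> \<open>The first factor is countable and discrete, so joint measurability reduces to
    measurability along each side.\<close>
  have mb: "?m \<in> borel_measurable ?P"
    by (rule measurable_pair_measure_countable1[OF cnt])
      (auto simp: split_beta intro!: measurable_restrict_space1 borel_measurable_continuous_onI continuous_intros)
  have m: "?m \<in> measurable ?P (restrict_space borel (frontier \<Omega>))"
  proof (rule measurable_restrict_space2[OF _ mb])
    show "?m \<in> space ?P \<rightarrow> frontier \<Omega>"
    proof
      fix z assume "z \<in> space ?P"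
      then obtain p q t where z: "z = ((p, q), t)" "(p, q) \<in> sides \<Omega>" "0 \<le> t" "t \<le> 1"
        by (auto simp: space_pair_measure space_restrict_space)
      then have "?m z \<in> closed_segment p q" by (auto simp: in_segment)
      then show "?m z \<in> frontier \<Omega>" using sides_in_frontier[OF \<Omega> z(2)] by blast
    qed
  qed
  have w[measurable]: "?w \<in> borel_measurable ?P"
    by (rule measurable_pair_measure_countable1[OF cnt]) (auto simp: split_beta)
  have fm: "(\<lambda>z. f (?m z)) \<in> borel_measurable ?P" by (rule measurable_compose[OF m f])
  have "(\<integral>\<^sup>+x. f x \<partial>boundary_measure \<Omega>) = (\<integral>\<^sup>+z. f (?m z) \<partial>density ?P ?w)"
    unfolding boundary_measure_def
  proof (rule nn_integral_distr)
    show "?m \<in> measurable (density ?P ?w) (restrict_space borel (frontier \<Omega>))"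
      using m by (simp add: measurable_cong_sets[OF sets_density refl])
  qed (use f in simp)
  also have "\<dots> = (\<integral>\<^sup>+z. ?w z * f (?m z) \<partial>?P)" by (rule nn_integral_density[OF w fm])
  also have "\<dots> = (\<integral>\<^sup>+s. \<integral>\<^sup>+t. ?w (s, t) * f (?m (s, t)) \<partial>?N \<partial>count_space (sides \<Omega>))"
    by (rule N.nn_integral_fst[symmetric, OF borel_measurable_times_ennreal[OF w fm]])
  also have "\<dots> = (\<Sum>s\<in>sides \<Omega>. \<integral>\<^sup>+t. ?w (s, t) * f (?m (s, t)) \<partial>?N)"
    by (rule nn_integral_count_space_finite[OF finite_sides[OF \<Omega>]])
  also have "\<dots> = (\<Sum>(p, q)\<in>sides \<Omega>.
      \<integral>\<^sup>+t. ennreal (dist p q) * f ((1 - t) *\<^sub>R p + t *\<^sub>R q) * indicator {0..1} t \<partial>lborel)"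
    by (intro sum.cong refl) (auto simp: nn_integral_restrict_space split_beta)
  finally show ?thesis .
qed

lemma finite_measure_boundary:
  assumes \<Omega>: "convex_polygonal_domain \<Omega>" shows "finite_measure (boundary_measure \<Omega>)"
proof
  have "emeasure (boundary_measure \<Omega>) (space (boundary_measure \<Omega>)) = (\<integral>\<^sup>+x. 1 \<partial>boundary_measure \<Omega>)"
    by simp
  also have "\<dots> = (\<Sum>(p, q)\<in>sides \<Omega>. \<integral>\<^sup>+t. ennreal (dist p q) * 1 * indicator {0..1} t \<partial>(lborel :: real measure))"
    by (rule nn_integral_boundary_measure[OF \<Omega>, of "\<lambda>x. 1"]) simp
  also have "\<dots> = (\<Sum>(p, q)\<in>sides \<Omega>. ennreal (dist p q))"
    by (intro sum.cong refl) (auto simp: nn_integral_cmult)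
  also have "\<dots> < \<infinity>" by (auto simp: split_beta)
  finally show "emeasure (boundary_measure \<Omega>) (space (boundary_measure \<Omega>)) \<noteq> \<infinity>" by simp
qed

subsection \<open>Linear coordinates in the plane\<close>

lemma borel_measurable_vector2: "(\<lambda>z. vector [fst z, snd z] :: real^2) \<in> borel_measurable borel"
proof -
  have "(\<lambda>z. vector [fst z, snd z] :: real^2) = (\<lambda>z. fst z *\<^sub>R axis 1 1 + snd z *\<^sub>R axis 2 1)"
    by (auto simp: fun_eq_iff vec_eq_iff forall_2 axis_def)
  moreover have "(\<lambda>z. fst z *\<^sub>R axis 1 1 + snd z *\<^sub>R axis 2 1 :: real^2) \<in> borel_measurable borel"
    by (intro borel_measurable_continuous_onI continuous_intros)
  ultimately show ?thesis by simp
qed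

text \<open>Both measures agree on boxes. The identity gives access to Fubini's theorem for vectors
  with two components.\<close>

lemma lborel_real2: "lborel = distr (lborel \<Otimes>\<^sub>M lborel) borel (\<lambda>(a, b). vector [a, b] :: real^2)"
proof (rule lborel_eqI)
  let ?v = "\<lambda>(a, b). vector [a, b] :: real^2"
  have v: "?v \<in> measurable (lborel \<Otimes>\<^sub>M lborel) borel"
    using borel_measurable_vector2 by (simp add: lborel_prod split_beta)
  fix l u :: "real^2" assume "\<And>b. b \<in> Basis \<Longrightarrow> l \<bullet> b \<le> u \<bullet> b"
  then have lu: "l $ i \<le> u $ i" for i
    using \<open>\<And>b. b \<in> Basis \<Longrightarrow> l \<bullet> b \<le> u \<bullet> b\<close>[of "axis i 1"] by (simp add: inner_axis axis_in_Basis_iff)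
  have "emeasure (distr (lborel \<Otimes>\<^sub>M lborel) borel ?v) (box l u)
      = emeasure (lborel \<Otimes>\<^sub>M lborel) ({l$1<..<u$1} \<times> {l$2<..<u$2})"
    by (subst emeasure_distr[OF v]) (auto simp: mem_box_cart forall_2 space_pair_measure intro!: arg_cong[where f="emeasure _"])
  also have "\<dots> = ennreal (u$1 - l$1) * ennreal (u$2 - l$2)"
    using lu by (subst lborel.emeasure_pair_measure_Times) auto
  also have "\<dots> = ennreal (\<Prod>b\<in>Basis. (u - l) \<bullet> b)"
    using lu by (simp add: ennreal_mult[symmetric] Basis_vec_def prod.UNION_disjoint axis_eq_axis UNIV_2 inner_axis)
  finally show "emeasure (distr (lborel \<Otimes>\<^sub>M lborel) borel ?v) (box l u) = ennreal (\<Prod>b\<in>Basis. (u - l) \<bullet> b)" .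
qed simp

lemma nn_integral_real2:
  assumes f[measurable]: "f \<in> borel_measurable borel"
  shows "(\<integral>\<^sup>+x. f x \<partial>(lborel :: (real^2) measure)) = (\<integral>\<^sup>+a. \<integral>\<^sup>+b. f (vector [a, b]) \<partial>lborel \<partial>lborel)"
proof -
  let ?v = "\<lambda>(a, b). vector [a, b] :: real^2"
  have v[measurable]: "?v \<in> measurable (lborel \<Otimes>\<^sub>M lborel) borel"
    using borel_measurable_vector2 by (simp add: lborel_prod split_beta)
  have "(\<integral>\<^sup>+x. f x \<partial>lborel) = (\<integral>\<^sup>+z. f (?v z) \<partial>(lborel \<Otimes>\<^sub>M lborel))"
    by (subst lborel_real2) (simp add: nn_integral_distr)
  also have "\<dots> = (\<integral>\<^sup>+a. \<integral>\<^sup>+b. f (?v (a, b)) \<partial>lborel \<partial>lborel)"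
    by (rule lborel.nn_integral_fst[symmetric]) measurable
  finally show ?thesis by simp
qed

text \<open>The substitution s = a \<bullet> x, t = l \<bullet> x with its Jacobian determinant,
  carried out as affine substitutions in one variable combined with an exchange of the integrals.
  Eliminating a variable divides by \<open>a$1\<close>; if this vanishes, the system is already
  triangular.\<close>

lemma nn_integral_linear_coordinates:
  fixes a l :: "real^2" and F :: "real \<times> real \<Rightarrow> ennreal"
  assumes F: "F \<in> borel_measurable borel" and D: "a$1 * l$2 - a$2 * l$1 \<noteq> 0"
  shows "ennreal \<bar>a$1 * l$2 - a$2 * l$1\<bar> * (\<integral>\<^sup>+x. F (a \<bullet> x, l \<bullet> x) \<partial>lborel) = (\<integral>\<^sup>+s. \<integral>\<^sup>+t. F (s, t) \<partial>lborel \<partial>lborel)"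
proof -
  have Fm[measurable]: "F \<in> borel_measurable (borel \<Otimes>\<^sub>M borel)" using F by (simp add: borel_prod)
  let ?D = "a$1 * l$2 - a$2 * l$1"
  have m: "(\<lambda>x. F (a \<bullet> x, l \<bullet> x)) \<in> borel_measurable borel" by measurable
  have inn: "w \<bullet> (vector [x, y] :: real^2) = w$1 * x + w$2 * y" for w :: "real^2" and x y
    by (simp add: inner_vec_def sum_2)
  have start: "(\<integral>\<^sup>+x. F (a \<bullet> x, l \<bullet> x) \<partial>lborel)
     = (\<integral>\<^sup>+x. \<integral>\<^sup>+y. F (a$1 * x + a$2 * y, l$1 * x + l$2 * y) \<partial>lborel \<partial>lborel)"
    by (subst nn_integral_real2[OF m]) (simp add: inn)
  have swap: "(\<integral>\<^sup>+x. \<integral>\<^sup>+y. F (a$1 * x + a$2 * y, l$1 * x + l$2 * y) \<partial>lborel \<partial>lborel)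
     = (\<integral>\<^sup>+y. \<integral>\<^sup>+x. F (a$1 * x + a$2 * y, l$1 * x + l$2 * y) \<partial>lborel \<partial>lborel)"
    by (rule lborel_pair.Fubini') measurable
  show ?thesis
  proof (cases "a$1 = 0")
    case False
    let ?G = "\<lambda>y s. F (s, (l$1 / a$1) * (s - a$2 * y) + l$2 * y)"
    have 1: "(\<integral>\<^sup>+s. ?G y s \<partial>lborel) = ennreal \<bar>a$1\<bar> * (\<integral>\<^sup>+x. F (a$1 * x + a$2 * y, l$1 * x + l$2 * y) \<partial>lborel)" for y
      using False by (subst nn_integral_real_affine[of _ "a$1" "a$2 * y"]) (auto simp: add.commute)
    let ?H = "\<lambda>s t. F (s, t)"
    have 2: "(\<integral>\<^sup>+t. F (s, t) \<partial>lborel) = ennreal \<bar>?D / a$1\<bar> * (\<integral>\<^sup>+y. ?G y s \<partial>lborel)" for s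
      using False D by (subst nn_integral_real_affine[of _ "?D / a$1" "(l$1 / a$1) * s"]) (auto simp: field_simps)
    have "(\<integral>\<^sup>+s. \<integral>\<^sup>+t. F (s, t) \<partial>lborel \<partial>lborel) = ennreal \<bar>?D / a$1\<bar> * (\<integral>\<^sup>+s. \<integral>\<^sup>+y. ?G y s \<partial>lborel \<partial>lborel)"
      unfolding 2 by (rule nn_integral_cmult) measurable
    also have "(\<integral>\<^sup>+s. \<integral>\<^sup>+y. ?G y s \<partial>lborel \<partial>lborel) = (\<integral>\<^sup>+y. \<integral>\<^sup>+s. ?G y s \<partial>lborel \<partial>lborel)"
      by (rule lborel_pair.Fubini') measurable
    also have "\<dots> = ennreal \<bar>a$1\<bar> * (\<integral>\<^sup>+y. \<integral>\<^sup>+x. F (a$1 * x + a$2 * y, l$1 * x + l$2 * y) \<partial>lborel \<partial>lborel)"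
      unfolding 1 by (rule nn_integral_cmult) measurable
    also have "ennreal \<bar>?D / a$1\<bar> * (ennreal \<bar>a$1\<bar> * X) = ennreal \<bar>?D\<bar> * X" for X
    proof -
      have "\<bar>?D / a$1\<bar> * \<bar>a$1\<bar> = \<bar>?D\<bar>" using False by (simp only: abs_mult[symmetric]) simp
      then show ?thesis by (simp only: mult.assoc[symmetric] ennreal_mult[symmetric] abs_ge_zero)
    qed
    finally show ?thesis unfolding start swap by simp
  next
    case True
    then have nz: "a$2 \<noteq> 0" "l$1 \<noteq> 0" using D by auto
    have 1: "(\<integral>\<^sup>+t. F (s, t) \<partial>lborel) = ennreal \<bar>l$1\<bar> * (\<integral>\<^sup>+x. F (s, l$1 * x + l$2 * y) \<partial>lborel)" for s y
      using nz by (subst nn_integral_real_affine[of _ "l$1" "l$2 * y"]) (auto simp: add.commute)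
    have "(\<integral>\<^sup>+s. \<integral>\<^sup>+t. F (s, t) \<partial>lborel \<partial>lborel) = ennreal \<bar>a$2\<bar> * (\<integral>\<^sup>+y. \<integral>\<^sup>+t. F (a$2 * y, t) \<partial>lborel \<partial>lborel)"
      using nz by (subst nn_integral_real_affine[of _ "a$2" 0]) auto
    also have "(\<integral>\<^sup>+y. \<integral>\<^sup>+t. F (a$2 * y, t) \<partial>lborel \<partial>lborel)
        = (\<integral>\<^sup>+y. ennreal \<bar>l$1\<bar> * (\<integral>\<^sup>+x. F (a$2 * y, l$1 * x + l$2 * y) \<partial>lborel) \<partial>lborel)"
      by (intro nn_integral_cong 1)
    also have "\<dots> = ennreal \<bar>l$1\<bar> * (\<integral>\<^sup>+y. \<integral>\<^sup>+x. F (a$2 * y, l$1 * x + l$2 * y) \<partial>lborel \<partial>lborel)"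
      by (rule nn_integral_cmult) measurable
    finally show ?thesis unfolding start swap using True
      by (simp add: mult.assoc[symmetric] ennreal_mult[symmetric] abs_mult[symmetric])
  qed
qed

subsection \<open>Traces in boundary strips\<close>

text \<open>On the compact set where m is at least \<eta>, the function d has a positive minimum;
  half of it serves as \<epsilon>. The purpose is uniformity: a bound that holds on the zero set of
  d persists, up to \<eta>, in a whole strip.\<close>

lemma compact_sublevel:
  fixes d m :: "'a::t2_space \<Rightarrow> real"
  assumes K: "compact K" "continuous_on K d" "continuous_on K m"
    and d: "\<And>x. x \<in> K \<Longrightarrow> 0 \<le> d x" and m: "\<And>x. x \<in> K \<Longrightarrow> d x = 0 \<Longrightarrow> m x \<le> 0" and "\<eta> > 0"
  shows "\<exists>\<epsilon>>0. \<forall>x\<in>K. d x \<le> \<epsilon> \<longrightarrow> m x < \<eta>"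
proof -
  define A where "A = {x \<in> K. \<eta> \<le> m x}"
  have A: "compact A"
  proof -
    have "closedin (top_of_set K) (K \<inter> m -` {\<eta>..})"
      by (rule continuous_closedin_preimage[OF K(3)]) simp
    moreover have "A = K \<inter> m -` {\<eta>..}" by (auto simp: A_def)
    ultimately show ?thesis using K(1) by (auto intro: closedin_compact)
  qed
  show ?thesis
  proof (cases "A = {}")
    case True
    then show ?thesis by (intro exI[of _ 1]) (auto simp: A_def not_le)
  next
    case False
    have "continuous_on A d" using K(2) by (rule continuous_on_subset) (auto simp: A_def)
    then obtain x0 where x0: "x0 \<in> A" "\<And>x. x \<in> A \<Longrightarrow> d x0 \<le> d x"
      using continuous_attains_inf[OF A False] by blast
    have "d x0 \<noteq> 0" using x0(1) m[of x0] \<open>\<eta> > 0\<close> by (auto simp: A_def)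
    then have pos: "0 < d x0" using x0(1) d[of x0] by (auto simp: A_def)
    show ?thesis
    proof (intro exI[of _ "d x0 / 2"] conjI ballI impI)
      fix x assume "x \<in> K" "d x \<le> d x0 / 2"
      then show "m x < \<eta>" using x0(2)[of x] pos by (auto simp: A_def not_le[symmetric])
    qed (use pos in simp)
  qed
qed

text \<open>In a thin strip f exceeds its value at the foot point on the side by at most \<eta>, so
  the integral is bounded by the width of the strip times an integral along the side. As a is
  orthogonal to q - p, the constant C is 1/|a|, the conversion from the slack c - a \<bullet> x to
  distance. It does not depend on f; only the admissible width does, and \<sigma> absorbs the
  error.\<close>

lemma strip_bound_side:
  fixes f :: "real^2 \<Rightarrow> real"
  assumes \<Omega>: "convex_polygonal_domain \<Omega>" and pq: "(p, q) \<in> sides \<Omega>"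
    and seg: "closure \<Omega> \<inter> {x. a \<bullet> x = c} = closed_segment p q" and half: "\<And>x. x \<in> closure \<Omega> \<Longrightarrow> a \<bullet> x \<le> c"
    and a0: "a \<noteq> 0"
    and f: "continuous_on UNIV f" "\<And>x. 0 \<le> f x" and "\<sigma> > 0"
  defines "C \<equiv> dist p q / \<bar>a$1 * (q - p)$2 - a$2 * (q - p)$1\<bar>"
  shows "\<exists>\<epsilon>0>0. \<forall>\<epsilon>. 0 < \<epsilon> \<and> \<epsilon> \<le> \<epsilon>0 \<longrightarrow>
    (\<integral>\<^sup>+x. ennreal (f x) * indicator {x \<in> \<Omega>. c - a \<bullet> x \<le> \<epsilon>} x \<partial>lborel)
      \<le> ennreal \<epsilon> * (ennreal C * (\<integral>\<^sup>+x. ennreal (f x) \<partial>boundary_measure \<Omega>) + ennreal \<sigma>)"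
proof -
  define L where "L = q - p"
  define n where "n = L \<bullet> L"
  define D where "D = \<bar>a$1 * L$2 - a$2 * L$1\<bar>"
  have cpt: "compact (closure \<Omega>)" and ne: "\<Omega> \<noteq> {}"
    using \<Omega> by (auto simp: convex_polygonal_domain_def compact_closure)
  have L0: "L \<noteq> 0" using pq ne unfolding sides_def L_def by fastforce
  have n0: "n > 0" using L0 by (simp add: n_def)
  have "p \<in> closed_segment p q" "q \<in> closed_segment p q" by auto
  then have ap: "a \<bullet> p = c" and aq: "a \<bullet> q = c" using seg by auto
  have aL: "a$1 * L$1 + a$2 * L$2 = 0" using ap aq by (simp add: L_def inner_vec_def sum_2 algebra_simps)
  have D0: "a$1 * L$2 - a$2 * L$1 \<noteq> 0"
  proof
    assume z: "a$1 * L$2 - a$2 * L$1 = 0"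
    \<comment> \<open>Lagrange's identity: for orthogonal vectors a vanishing cross product forces
      one of them to be 0.\<close>
    have "(a$1 * L$2 - a$2 * L$1)\<^sup>2 + (a$1 * L$1 + a$2 * L$2)\<^sup>2 = (a \<bullet> a) * (L \<bullet> L)"
      by (simp add: inner_vec_def sum_2 power2_eq_square algebra_simps)
    then show False using z aL a0 L0 by simp
  qed
  then have Dpos: "D > 0" by (simp add: D_def)
  \<comment> \<open>\<open>tt\<close> is the coordinate along the side, 0 at p and 1 at q;
    \<open>cl\<close> clamps it to [0, 1] because points of the strip may project beyond the
    endpoints. \<open>m\<close> measures both defects, the overshoot along the side and the excess
    of f over its value at the foot point.\<close>
  define cl where "cl t = max 0 (min 1 t)" for t :: real
  define tt where "tt x = (L \<bullet> x - L \<bullet> p) / n" for x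
  define g0 where "g0 r = f (p + cl r *\<^sub>R L)" for r
  define m where "m x = max (max (- tt x) (tt x - 1)) (f x - g0 (tt x))" for x
  have fc: "continuous_on S (\<lambda>x. f (h x))" if "continuous_on S h" for h :: "'z::topological_space \<Rightarrow> real^2" and S
    using continuous_on_compose2[OF f(1) that] by auto
  have clc: "continuous_on S cl" for S unfolding cl_def by (intro continuous_intros)
  have g0c: "continuous_on UNIV g0" unfolding g0_def by (intro fc continuous_intros clc)
  have [measurable]: "g0 \<in> borel_measurable borel" "f \<in> borel_measurable borel"
    using g0c f(1) by (auto intro: borel_measurable_continuous_onI)
  have ttc: "continuous_on S tt" for S unfolding tt_def using n0 by (intro continuous_intros) auto
  have mc: "continuous_on (closure \<Omega>) m"
    unfolding m_def by (intro continuous_intros ttc fc continuous_on_compose2[OF g0c ttc]) auto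
  \<comment> \<open>Chosen such that the total excess \<eta> (f p + f q + 3), scaled by n / D, stays
    below \<sigma>. The overshoots at the two ends contribute \<eta> f p and \<eta> f q; raising f
    by \<eta> over a length of 1 + 2 \<eta> contributes at most 3 \<eta>, because \<eta> \<le>
    1.\<close>
  define \<eta> where "\<eta> = min 1 (\<sigma> * D / (n * (f p + f q + 3)))"
  have fpos: "0 < f p + f q + 3" using f(2)[of p] f(2)[of q] by linarith
  have \<eta>: "0 < \<eta>" "\<eta> \<le> 1" using \<open>\<sigma> > 0\<close> Dpos n0 fpos by (auto simp: \<eta>_def)
  have \<eta>\<sigma>: "n * (\<eta> * (f p + f q + 3)) / D \<le> \<sigma>"
  proof -
    have "\<eta> \<le> \<sigma> * D / (n * (f p + f q + 3))" by (simp add: \<eta>_def)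
    then have "\<eta> * (n * (f p + f q + 3)) \<le> \<sigma> * D" using n0 fpos by (simp add: pos_le_divide_eq)
    then have "(n * (\<eta> * (f p + f q + 3))) \<le> \<sigma> * D" by (simp add: algebra_simps)
    then show ?thesis using Dpos by (simp add: pos_divide_le_eq)
  qed
  have "\<exists>\<epsilon>>0. \<forall>x\<in>closure \<Omega>. c - a \<bullet> x \<le> \<epsilon> \<longrightarrow> m x < \<eta>"
  proof (rule compact_sublevel[OF cpt _ mc _ _ \<eta>(1)])
    show "continuous_on (closure \<Omega>) (\<lambda>x. c - a \<bullet> x)" by (intro continuous_intros)
    show "0 \<le> c - a \<bullet> x" if "x \<in> closure \<Omega>" for x using half[OF that] by simp
    fix x assume "x \<in> closure \<Omega>" "c - a \<bullet> x = 0"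
    then have "x \<in> closed_segment p q" using seg by auto
    then obtain u where u: "0 \<le> u" "u \<le> 1" "x = p + u *\<^sub>R L"
      by (auto simp: in_segment L_def algebra_simps)
    have "tt x = u" unfolding tt_def u(3) using n0 by (simp add: inner_add_right n_def)
    moreover have "cl u = u" using u by (simp add: cl_def)
    ultimately show "m x \<le> 0" using u by (simp add: m_def g0_def)
  qed
  then obtain \<epsilon>0 where \<epsilon>0: "\<epsilon>0 > 0" "\<And>x. x \<in> closure \<Omega> \<Longrightarrow> c - a \<bullet> x \<le> \<epsilon>0 \<Longrightarrow> m x < \<eta>" by blast
  define g where "g r = (indicator {-\<eta>..1+\<eta>} r * ennreal (g0 r + \<eta>) :: ennreal)" for r
  have [measurable]: "g \<in> borel_measurable borel" unfolding g_def by measurable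
  define I where "I = (\<integral>\<^sup>+r. ennreal (f (p + r *\<^sub>R L)) * indicator {0..1} r \<partial>lborel)"
  have "g r \<le> ennreal (f (p + r *\<^sub>R L)) * indicator {0..1} r + ennreal (f p) * indicator {-\<eta>..0} r
      + ennreal (f q) * indicator {1..1+\<eta>} r + ennreal \<eta> * indicator {-\<eta>..1+\<eta>} r" for r
  proof -
    consider "r < -\<eta>" | "-\<eta> \<le> r" "r < 0" | "0 \<le> r" "r \<le> 1" | "1 < r" "r \<le> 1 + \<eta>" | "1 + \<eta> < r" by linarith
    then show ?thesis
    proof cases
      case 2
      then have "g r = ennreal (f p) + ennreal \<eta>" "r \<le> 1 + \<eta>" using f(2) \<eta> by (auto simp: g_def g0_def cl_def ennreal_plus)
      then show ?thesis using 2 \<eta> by (simp add: indicator_def)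
    next
      case 3
      then have "g r = ennreal (f (p + r *\<^sub>R L)) + ennreal \<eta>" using f(2) \<eta> by (simp add: g_def g0_def cl_def ennreal_plus)
      then show ?thesis using 3 \<eta>(1) by (auto simp: indicator_def intro!: add_mono)
    next
      case 4
      then have "g r = ennreal (f q) + ennreal \<eta>" using f(2) \<eta> by (simp add: g_def g0_def cl_def ennreal_plus L_def)
      then show ?thesis using 4 \<eta>(1) by (simp add: indicator_def)
    qed (use \<eta> in \<open>simp_all add: g_def\<close>)
  qed
  then have "(\<integral>\<^sup>+r. g r \<partial>lborel) \<le> (\<integral>\<^sup>+r. ennreal (f (p + r *\<^sub>R L)) * indicator {0..1} r + ennreal (f p) * indicator {-\<eta>..0} r
      + ennreal (f q) * indicator {1..1+\<eta>} r + ennreal \<eta> * indicator {-\<eta>..1+\<eta>} r \<partial>lborel)"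
    by (intro nn_integral_mono)
  also have "\<dots> = I + ennreal (f p) * ennreal \<eta> + ennreal (f q) * ennreal \<eta> + ennreal \<eta> * ennreal (1 + 2 * \<eta>)"
    unfolding I_def using \<eta> by (simp add: nn_integral_add nn_integral_cmult add.commute[of _ 1])
  also have "\<dots> = I + (ennreal (f p * \<eta>) + ennreal (f q * \<eta>) + ennreal (\<eta> * (1 + 2 * \<eta>)))"
    using \<eta> f(2) by (simp add: ennreal_mult add.assoc)
  also have "\<dots> = I + ennreal (f p * \<eta> + f q * \<eta> + \<eta> * (1 + 2 * \<eta>))"
    using \<eta> f(2) by (simp add: ennreal_plus[symmetric] del: ennreal_plus)
  also have "\<dots> \<le> I + ennreal (\<eta> * (f p + f q + 3))"
    using \<eta> by (intro add_left_mono ennreal_leI) (auto simp: algebra_simps)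
  finally have gI: "(\<integral>\<^sup>+r. g r \<partial>lborel) \<le> I + ennreal (\<eta> * (f p + f q + 3))" .
  have If: "ennreal (dist p q) * I \<le> (\<integral>\<^sup>+x. ennreal (f x) \<partial>boundary_measure \<Omega>)"
  proof -
    let ?T = "\<lambda>(p, q). \<integral>\<^sup>+t. ennreal (dist p q) * ennreal (f ((1 - t) *\<^sub>R p + t *\<^sub>R q)) * indicator {0..1} t \<partial>lborel"
    have fm: "(\<lambda>t. f (p + t *\<^sub>R L)) \<in> borel_measurable borel"
      by (intro borel_measurable_continuous_onI fc continuous_intros)
    have "ennreal (dist p q) * I = (\<integral>\<^sup>+t. ennreal (dist p q) * (ennreal (f (p + t *\<^sub>R L)) * indicator {0..1} t) \<partial>lborel)"
      unfolding I_def using fm by (subst nn_integral_cmult) auto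
    also have "\<dots> = ?T (p, q)"
    proof -
      have "(1 - t) *\<^sub>R p + t *\<^sub>R q = p + t *\<^sub>R L" for t by (simp add: L_def algebra_simps)
      then show ?thesis by (simp add: mult.assoc)
    qed
    also have "\<dots> \<le> (\<Sum>s\<in>sides \<Omega>. ?T s)"
      by (rule member_le_sum[OF pq _ finite_sides[OF \<Omega>]]) simp
    also have "\<dots> = (\<integral>\<^sup>+x. ennreal (f x) \<partial>boundary_measure \<Omega>)"
      by (subst nn_integral_boundary_measure[OF \<Omega>]) (auto intro: measurable_restrict_space1)
    finally show ?thesis .
  qed
  show ?thesis
  proof (intro exI[of _ \<epsilon>0] conjI allI impI \<epsilon>0(1))
    fix \<epsilon> assume \<epsilon>: "0 < \<epsilon> \<and> \<epsilon> \<le> \<epsilon>0"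
    define h where "h t = g ((t - L \<bullet> p) / n)" for t
    have [measurable]: "h \<in> borel_measurable borel" unfolding h_def by measurable
    let ?F = "\<lambda>(s, t). indicator {c-\<epsilon>..c} s * h t :: ennreal"
    have Fm: "?F \<in> borel_measurable borel"
      unfolding borel_prod[symmetric] by measurable
    have le: "ennreal (f x) * indicator {x \<in> \<Omega>. c - a \<bullet> x \<le> \<epsilon>} x \<le> ?F (a \<bullet> x, L \<bullet> x)" for x
    proof (cases "x \<in> \<Omega> \<and> c - a \<bullet> x \<le> \<epsilon>")
      case True
      then have x: "x \<in> closure \<Omega>" using closure_subset by auto
      have "m x < \<eta>" using \<epsilon>0(2)[OF x] True \<epsilon> by simp
      then have *: "- tt x < \<eta>" "tt x - 1 < \<eta>" "f x - g0 (tt x) < \<eta>" by (auto simp: m_def)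
      have "h (L \<bullet> x) = ennreal (g0 (tt x) + \<eta>)" using *(1,2) by (simp add: h_def tt_def[symmetric] g_def)
      moreover have "ennreal (f x) \<le> ennreal (g0 (tt x) + \<eta>)" using *(3) by (intro ennreal_leI) simp
      moreover have "a \<bullet> x \<in> {c-\<epsilon>..c}" using half[OF x] True by simp
      ultimately show ?thesis using True by simp
    qed simp
    have h: "(\<integral>\<^sup>+t. h t \<partial>lborel) = ennreal n * (\<integral>\<^sup>+r. g r \<partial>lborel)"
      using n0 by (subst nn_integral_real_affine[of h n "L \<bullet> p"]) (auto simp: h_def)
    have "ennreal D * (\<integral>\<^sup>+x. ennreal (f x) * indicator {x \<in> \<Omega>. c - a \<bullet> x \<le> \<epsilon>} x \<partial>lborel)
       \<le> ennreal D * (\<integral>\<^sup>+x. ?F (a \<bullet> x, L \<bullet> x) \<partial>lborel)"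
      using le by (intro mult_left_mono nn_integral_mono) auto
    also have "\<dots> = (\<integral>\<^sup>+s. \<integral>\<^sup>+t. ?F (s, t) \<partial>lborel \<partial>lborel)"
      unfolding D_def by (rule nn_integral_linear_coordinates[OF Fm D0])
    also have "\<dots> = (\<integral>\<^sup>+s. indicator {c-\<epsilon>..c} s * (\<integral>\<^sup>+t. h t \<partial>lborel) \<partial>lborel)"
      by (simp add: nn_integral_cmult)
    also have "\<dots> = ennreal \<epsilon> * (\<integral>\<^sup>+t. h t \<partial>lborel)"
      using \<epsilon> by (subst nn_integral_multc) auto
    also have "\<dots> \<le> ennreal \<epsilon> * (ennreal n * (I + ennreal (\<eta> * (f p + f q + 3))))"
      unfolding h by (intro mult_left_mono gI) auto
    also have "\<dots> \<le> ennreal \<epsilon> * (ennreal (dist p q) * (\<integral>\<^sup>+x. ennreal (f x) \<partial>boundary_measure \<Omega>) + ennreal (\<sigma> * D))"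
    proof (intro mult_left_mono)
      have nL: "n = dist p q * dist p q" by (simp add: n_def L_def dist_norm power2_norm_eq_inner[symmetric] power2_eq_square norm_minus_commute)
      have "ennreal n * (I + ennreal (\<eta> * (f p + f q + 3))) = ennreal (dist p q) * (ennreal (dist p q) * I) + ennreal (n * (\<eta> * (f p + f q + 3)))"
      proof -
        have 1: "ennreal n * ennreal (\<eta> * (f p + f q + 3)) = ennreal (n * (\<eta> * (f p + f q + 3)))"
          using n0 \<eta> fpos by (intro ennreal_mult[symmetric]) auto
        have 2: "ennreal n * I = ennreal (dist p q) * (ennreal (dist p q) * I)"
          by (simp add: nL ennreal_mult mult.assoc)
        show ?thesis unfolding distrib_left[of "ennreal n"] 1 2 by (rule refl)
      qed
      also have "\<dots> \<le> ennreal (dist p q) * (\<integral>\<^sup>+x. ennreal (f x) \<partial>boundary_measure \<Omega>) + ennreal (\<sigma> * D)"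
        using \<eta>\<sigma> Dpos by (intro add_mono mult_left_mono If ennreal_leI) (auto simp: pos_divide_le_eq)
      finally show "ennreal n * (I + ennreal (\<eta> * (f p + f q + 3))) \<le> \<dots>" .
    qed auto
    finally have fin: "ennreal D * (\<integral>\<^sup>+x. ennreal (f x) * indicator {x \<in> \<Omega>. c - a \<bullet> x \<le> \<epsilon>} x \<partial>lborel)
      \<le> ennreal \<epsilon> * (ennreal (dist p q) * (\<integral>\<^sup>+x. ennreal (f x) \<partial>boundary_measure \<Omega>) + ennreal (\<sigma> * D))" .
    have inv: "ennreal (1 / D) * (ennreal D * X) = X" for X
      using Dpos by (simp add: mult.assoc[symmetric] ennreal_mult[symmetric])
    have "(\<integral>\<^sup>+x. ennreal (f x) * indicator {x \<in> \<Omega>. c - a \<bullet> x \<le> \<epsilon>} x \<partial>lborel)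
      = ennreal (1 / D) * (ennreal D * (\<integral>\<^sup>+x. ennreal (f x) * indicator {x \<in> \<Omega>. c - a \<bullet> x \<le> \<epsilon>} x \<partial>lborel))"
      by (rule inv[symmetric])
    also have "\<dots> \<le> ennreal (1 / D) * (ennreal \<epsilon> * (ennreal (dist p q) * (\<integral>\<^sup>+x. ennreal (f x) \<partial>boundary_measure \<Omega>) + ennreal (\<sigma> * D)))"
      by (intro mult_left_mono fin) simp
    also have "\<dots> = ennreal \<epsilon> * ((ennreal (1 / D) * ennreal (dist p q)) * (\<integral>\<^sup>+x. ennreal (f x) \<partial>boundary_measure \<Omega>) + ennreal (1 / D) * ennreal (\<sigma> * D))"
      by (simp add: distrib_left mult.assoc mult.left_commute[of "ennreal (1 / D)" "ennreal \<epsilon>"])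
    also have "ennreal (1 / D) * ennreal (dist p q) = ennreal C"
      using Dpos by (simp add: C_def D_def L_def ennreal_mult[symmetric])
    also have "ennreal (1 / D) * ennreal (\<sigma> * D) = ennreal \<sigma>"
      using Dpos \<open>\<sigma> > 0\<close> by (simp add: ennreal_mult[symmetric])
    finally show "(\<integral>\<^sup>+x. ennreal (f x) * indicator {x \<in> \<Omega>. c - a \<bullet> x \<le> \<epsilon>} x \<partial>lborel)
      \<le> ennreal \<epsilon> * (ennreal C * (\<integral>\<^sup>+x. ennreal (f x) \<partial>boundary_measure \<Omega>) + ennreal \<sigma>)" .
  qed
qed

text \<open>Closeness to a side is measured by the slack c - a \<bullet> x without normalising a, so
  \<epsilon> is a width only up to the factors |a|.\<close>

definition collar :: "((real^2) \<times> real) set \<Rightarrow> (real^2) set \<Rightarrow> real \<Rightarrow> (real^2) set" where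
  "collar H \<Omega> \<epsilon> = {x \<in> \<Omega>. \<exists>(a, c)\<in>H. c - a \<bullet> x \<le> \<epsilon>}"

text \<open>The strips of the single sides cover the collar and their bounds add up, with \<sigma>
  halved at every step. What matters is the order of the quantifiers: C is fixed before f and
  \<sigma>, while \<epsilon>0 may depend on both.\<close>

lemma collar_bound:
  assumes \<Omega>: "convex_polygonal_domain \<Omega>" and H: "finite H"
    and sides: "\<And>a c. (a, c) \<in> H \<Longrightarrow> a \<noteq> 0 \<and> (\<forall>x\<in>closure \<Omega>. a \<bullet> x \<le> c) \<and>
      (\<exists>(p, q)\<in>sides \<Omega>. closure \<Omega> \<inter> {x. a \<bullet> x = c} = closed_segment p q)"
  shows "\<exists>C\<ge>0. \<forall>f \<sigma>. continuous_on UNIV f \<and> (\<forall>x. 0 \<le> f x) \<and> 0 < \<sigma> \<longrightarrow> (\<exists>\<epsilon>0>0. \<forall>\<epsilon>. 0 < \<epsilon> \<and> \<epsilon> \<le> \<epsilon>0 \<longrightarrow>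
    (\<integral>\<^sup>+x. ennreal (f x) * indicator (collar H \<Omega> \<epsilon>) x \<partial>lborel)
      \<le> ennreal \<epsilon> * (ennreal C * (\<integral>\<^sup>+x. ennreal (f x) \<partial>boundary_measure \<Omega>) + ennreal \<sigma>))"
  using H sides
proof (induction H rule: finite_induct)
  case empty
  then show ?case by (intro exI[of _ 0]) (auto simp: collar_def intro!: exI[of _ 1])
next
  case (insert h H)
  obtain a c where h: "h = (a, c)" by fastforce
  from insert.IH[OF insert.prems[OF insertI2]] obtain C where C: "C \<ge> 0"
    and CI: "\<And>f \<sigma>. continuous_on UNIV f \<and> (\<forall>x. 0 \<le> f x) \<and> 0 < \<sigma> \<Longrightarrow> \<exists>\<epsilon>0>0. \<forall>\<epsilon>. 0 < \<epsilon> \<and> \<epsilon> \<le> \<epsilon>0 \<longrightarrow>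
    (\<integral>\<^sup>+x. ennreal (f x) * indicator (collar H \<Omega> \<epsilon>) x \<partial>lborel)
      \<le> ennreal \<epsilon> * (ennreal C * (\<integral>\<^sup>+x. ennreal (f x) \<partial>boundary_measure \<Omega>) + ennreal \<sigma>)"
    by auto
  have "a \<noteq> 0" and half: "\<And>x. x \<in> closure \<Omega> \<Longrightarrow> a \<bullet> x \<le> c" using insert.prems h by auto
  obtain p q where pq: "(p, q) \<in> sides \<Omega>" "closure \<Omega> \<inter> {x. a \<bullet> x = c} = closed_segment p q"
    using insert.prems[of a c] h by auto
  define C' where "C' = dist p q / \<bar>a$1 * (q - p)$2 - a$2 * (q - p)$1\<bar>"
  have C': "C' \<ge> 0" by (simp add: C'_def)
  have op: "open \<Omega>" using \<Omega> by (simp add: convex_polygonal_domain_def)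
  show ?case
  proof (rule exI[of _ "C' + C"], intro conjI allI impI)
    show "0 \<le> C' + C" using C C' by simp
    fix f :: "real^2 \<Rightarrow> real" and \<sigma> :: real
    assume f\<sigma>: "continuous_on UNIV f \<and> (\<forall>x. 0 \<le> f x) \<and> 0 < \<sigma>"
    then have [measurable]: "f \<in> borel_measurable borel" by (auto intro: borel_measurable_continuous_onI)
    let ?I = "\<integral>\<^sup>+x. ennreal (f x) \<partial>boundary_measure \<Omega>"
    have s2: "\<sigma> / 2 > 0" using f\<sigma> by simp
    obtain \<epsilon>1 where \<epsilon>1: "\<epsilon>1 > 0" "\<And>\<epsilon>. 0 < \<epsilon> \<Longrightarrow> \<epsilon> \<le> \<epsilon>1 \<Longrightarrow>
      (\<integral>\<^sup>+x. ennreal (f x) * indicator (collar H \<Omega> \<epsilon>) x \<partial>lborel) \<le> ennreal \<epsilon> * (ennreal C * ?I + ennreal (\<sigma> / 2))"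
      using CI[of f "\<sigma>/2"] f\<sigma> s2 by blast
    obtain \<epsilon>2 where \<epsilon>2: "\<epsilon>2 > 0" "\<And>\<epsilon>. 0 < \<epsilon> \<Longrightarrow> \<epsilon> \<le> \<epsilon>2 \<Longrightarrow>
      (\<integral>\<^sup>+x. ennreal (f x) * indicator {x \<in> \<Omega>. c - a \<bullet> x \<le> \<epsilon>} x \<partial>lborel) \<le> ennreal \<epsilon> * (ennreal C' * ?I + ennreal (\<sigma> / 2))"
      using strip_bound_side[OF \<Omega> pq half \<open>a \<noteq> 0\<close>, of f "\<sigma>/2"] f\<sigma> s2 unfolding C'_def by blast
    show "\<exists>\<epsilon>0>0. \<forall>\<epsilon>. 0 < \<epsilon> \<and> \<epsilon> \<le> \<epsilon>0 \<longrightarrow>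
      (\<integral>\<^sup>+x. ennreal (f x) * indicator (collar (insert h H) \<Omega> \<epsilon>) x \<partial>lborel)
        \<le> ennreal \<epsilon> * (ennreal (C' + C) * ?I + ennreal \<sigma>)"
    proof (rule exI[of _ "min \<epsilon>1 \<epsilon>2"], intro conjI allI impI)
      fix \<epsilon> assume "0 < \<epsilon> \<and> \<epsilon> \<le> min \<epsilon>1 \<epsilon>2"
      then have \<epsilon>: "0 < \<epsilon>" "\<epsilon> \<le> \<epsilon>1" "\<epsilon> \<le> \<epsilon>2" by auto
      have halfm: "{x. c - a \<bullet> x \<le> \<epsilon>} \<in> sets borel" for a :: "real^2" and c
        by (intro borel_closed closed_Collect_le continuous_intros)
      have m1[measurable]: "collar H \<Omega> \<epsilon> \<in> sets borel"
      proof -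
        have "collar H \<Omega> \<epsilon> = \<Omega> \<inter> (\<Union>(a, c)\<in>H. {x. c - a \<bullet> x \<le> \<epsilon>})" by (auto simp: collar_def)
        also have "\<dots> \<in> sets borel" using insert.hyps op
          by (intro sets.Int[OF borel_open[OF op]] sets.finite_UN) (auto simp: split_beta halfm)
        finally show ?thesis .
      qed
      have m2[measurable]: "{x \<in> \<Omega>. c - a \<bullet> x \<le> \<epsilon>} \<in> sets borel"
      proof -
        have "{x \<in> \<Omega>. c - a \<bullet> x \<le> \<epsilon>} = \<Omega> \<inter> {x. c - a \<bullet> x \<le> \<epsilon>}" by auto
        also have "\<dots> \<in> sets borel" using op
          by (intro sets.Int borel_open halfm)
        finally show ?thesis .
      qed
      have "(\<integral>\<^sup>+x. ennreal (f x) * indicator (collar (insert h H) \<Omega> \<epsilon>) x \<partial>lborel)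
        \<le> (\<integral>\<^sup>+x. ennreal (f x) * indicator {x \<in> \<Omega>. c - a \<bullet> x \<le> \<epsilon>} x + ennreal (f x) * indicator (collar H \<Omega> \<epsilon>) x \<partial>lborel)"
        by (intro nn_integral_mono) (auto simp: collar_def h indicator_def)
      also have "\<dots> = (\<integral>\<^sup>+x. ennreal (f x) * indicator {x \<in> \<Omega>. c - a \<bullet> x \<le> \<epsilon>} x \<partial>lborel)
          + (\<integral>\<^sup>+x. ennreal (f x) * indicator (collar H \<Omega> \<epsilon>) x \<partial>lborel)"
        by (rule nn_integral_add) measurable
      also have "\<dots> \<le> ennreal \<epsilon> * (ennreal C' * ?I + ennreal (\<sigma> / 2)) + ennreal \<epsilon> * (ennreal C * ?I + ennreal (\<sigma> / 2))"
        by (intro add_mono \<epsilon>1(2) \<epsilon>2(2) \<epsilon>)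
      also have "\<dots> = ennreal \<epsilon> * (ennreal (C' + C) * ?I + (ennreal (\<sigma>/2) + ennreal (\<sigma>/2)))"
        using C C' by (simp add: distrib_left distrib_right add_ac)
      also have "ennreal (\<sigma>/2) + ennreal (\<sigma>/2) = ennreal \<sigma>" using s2 by (subst ennreal_plus[symmetric]) auto
      finally show "(\<integral>\<^sup>+x. ennreal (f x) * indicator (collar (insert h H) \<Omega> \<epsilon>) x \<partial>lborel)
        \<le> ennreal \<epsilon> * (ennreal (C' + C) * ?I + ennreal \<sigma>)" .
    qed (use \<epsilon>1 \<epsilon>2 in simp)
  qed
qed

subsection \<open>Translations and dilations\<close>

lemma nn_integral_translate:
  fixes w :: "real^2"
  assumes [measurable]: "F \<in> borel_measurable borel"
  shows "(\<integral>\<^sup>+x. F (x + w) \<partial>lborel) = (\<integral>\<^sup>+x. F x \<partial>lborel)"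
proof -
  have "(\<integral>\<^sup>+x. F x \<partial>lborel) = (\<integral>\<^sup>+x. F x \<partial>distr lborel borel ((+) w))"
    by (simp add: lborel_distr_plus)
  also have "\<dots> = (\<integral>\<^sup>+x. F (w + x) \<partial>lborel)" by (rule nn_integral_distr) auto
  finally show ?thesis by (simp add: add.commute)
qed

lemma nn_integral_dilate:
  fixes b :: "real^2"
  assumes [measurable]: "F \<in> borel_measurable borel" and "c > 0"
  shows "ennreal (c\<^sup>2) * (\<integral>\<^sup>+x. F (c *\<^sub>R x + b) \<partial>lborel) = (\<integral>\<^sup>+x. F x \<partial>lborel)"
proof -
  have c: "c \<noteq> 0" using assms by simp
  have "(\<integral>\<^sup>+x. F x \<partial>lborel) = (\<integral>\<^sup>+x. F x \<partial>density (distr lborel borel (\<lambda>x. b + c *\<^sub>R x)) (\<lambda>_. ennreal (\<bar>c\<bar> ^ DIM(real^2))))"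
    by (subst lborel_affine[OF c, of b]) simp
  also have "\<dots> = ennreal (c\<^sup>2) * (\<integral>\<^sup>+x. F (b + c *\<^sub>R x) \<partial>lborel)"
    using assms(2) by (simp add: nn_integral_density nn_integral_distr nn_integral_cmult)
  finally show ?thesis by (simp add: add.commute)
qed

lemma nn_integral_dilate_le:
  fixes b :: "real^2"
  assumes F: "F \<in> borel_measurable borel" and "c \<ge> 1"
  shows "(\<integral>\<^sup>+x. F (c *\<^sub>R x + b) \<partial>lborel) \<le> (\<integral>\<^sup>+x. F x \<partial>lborel)"
proof -
  have "1 \<le> c\<^sup>2" using assms(2) by (simp add: one_le_power)
  then have "1 * (\<integral>\<^sup>+x. F (c *\<^sub>R x + b) \<partial>lborel) \<le> ennreal (c\<^sup>2) * (\<integral>\<^sup>+x. F (c *\<^sub>R x + b) \<partial>lborel)"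
    by (intro mult_right_mono) auto
  then show ?thesis using nn_integral_dilate[OF F, of c b] assms(2) by simp
qed

text \<open>The Cauchy-Schwarz inequality against the constant 1, read off from the nonnegative
  variance of g about its mean m.\<close>

lemma integral_square_le:
  fixes g :: "real \<Rightarrow> real"
  assumes "\<tau> \<ge> 0" "continuous_on {0..\<tau>} g"
  shows "(integral {0..\<tau>} g)\<^sup>2 \<le> \<tau> * integral {0..\<tau>} (\<lambda>s. (g s)\<^sup>2)"
proof (cases "\<tau> = 0")
  case False
  then have t: "\<tau> > 0" using assms by simp
  have i1: "g integrable_on {0..\<tau>}" "(\<lambda>s. (g s)\<^sup>2) integrable_on {0..\<tau>}"
    by (intro integrable_continuous_real assms continuous_intros)+
  define m where "m = integral {0..\<tau>} g / \<tau>"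
  have "0 \<le> integral {0..\<tau>} (\<lambda>s. (g s - m)\<^sup>2)"
    by (intro integral_nonneg integrable_continuous_real continuous_intros assms) auto
  also have "integral {0..\<tau>} (\<lambda>s. (g s - m)\<^sup>2) = integral {0..\<tau>} (\<lambda>s. ((g s)\<^sup>2 + (-2 * m) * g s) + m\<^sup>2)"
    by (intro arg_cong[where f="integral {0..\<tau>}"]) (auto simp: power2_eq_square algebra_simps)
  also have "\<dots> = integral {0..\<tau>} (\<lambda>s. (g s)\<^sup>2 + (-2 * m) * g s) + integral {0..\<tau>} (\<lambda>s. m\<^sup>2)"
    by (intro Henstock_Kurzweil_Integration.integral_add integrable_add i1 integrable_on_mult_right integrable_const_ivl)
  also have "\<dots> = integral {0..\<tau>} (\<lambda>s. (g s)\<^sup>2) + (-2 * m) * integral {0..\<tau>} g + m\<^sup>2 * \<tau>"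
    using t by (subst Henstock_Kurzweil_Integration.integral_add[OF i1(2) integrable_on_mult_right[OF i1(1)]]) simp
  also have "\<dots> = integral {0..\<tau>} (\<lambda>s. (g s)\<^sup>2) - (integral {0..\<tau>} g)\<^sup>2 / \<tau>"
    using t by (simp add: m_def power2_eq_square field_simps)
  finally show ?thesis using t by (simp add: field_simps)
qed simp

text \<open>Along the path s \<mapsto> x + s l(x) the difference is an integral of the gradient.
  Cauchy-Schwarz and an exchange of the integrals reduce everything to the hypothesis
  \<open>flow\<close>, that moving along the path does not increase integrals. A constant l gives
  translations; l(x) = x - x0 gives dilations, whose Jacobian (1 + s)^2 is at least 1.\<close>

lemma difference_bound:
  fixes \<psi> :: "real^2 \<Rightarrow> real" and l :: "real^2 \<Rightarrow> real^2"
  assumes \<psi>: "C_infinity \<psi>" and \<tau>: "\<tau> \<ge> 0" and l: "continuous_on UNIV l" and R: "\<And>x. x \<in> A \<Longrightarrow> norm (l x) \<le> R"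
    and A[measurable]: "A \<in> sets borel"
    and flow: "\<And>s F. 0 \<le> s \<Longrightarrow> s \<le> \<tau> \<Longrightarrow> F \<in> borel_measurable borel \<Longrightarrow>
       (\<integral>\<^sup>+x. F (x + s *\<^sub>R l x) \<partial>lborel) \<le> (\<integral>\<^sup>+x. F x \<partial>lborel)"
  shows "(\<integral>\<^sup>+x. ennreal ((\<psi> (x + \<tau> *\<^sub>R l x) - \<psi> x)\<^sup>2) * indicator A x \<partial>lborel)
     \<le> ennreal (\<tau>\<^sup>2 * R\<^sup>2) * (\<integral>\<^sup>+x. ennreal ((norm (grad \<psi> x))\<^sup>2) \<partial>lborel)"
proof -
  let ?G = "\<lambda>x. (norm (grad \<psi> x))\<^sup>2"
  have gc: "continuous_on UNIV (grad \<psi>)" by (rule C_infinity_grad_continuous[OF \<psi>])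
  have [measurable]: "grad \<psi> \<in> borel_measurable borel" "l \<in> borel_measurable borel"
    using gc l by (auto intro: borel_measurable_continuous_onI)
  have Gm: "(\<lambda>x. ennreal (?G x)) \<in> borel_measurable borel" by measurable
  have pt: "ennreal ((\<psi> (x + \<tau> *\<^sub>R l x) - \<psi> x)\<^sup>2) * indicator A x
      \<le> (\<integral>\<^sup>+s. ennreal (\<tau> * R\<^sup>2) * (ennreal (?G (x + s *\<^sub>R l x)) * indicator {0..\<tau>} s) \<partial>lborel)" for x
  proof (cases "x \<in> A")
    case True
    define g where "g s = grad \<psi> (x + s *\<^sub>R l x) \<bullet> l x" for s
    have gcont: "continuous_on {0..\<tau>} g"
      unfolding g_def by (intro continuous_intros continuous_on_compose2[OF gc]) auto
    have "((\<lambda>s. \<psi> (x + s *\<^sub>R l x)) has_vector_derivative g s) (at s within {0..\<tau>})" for s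
    proof -
      have "((\<lambda>s. x + s *\<^sub>R l x) has_derivative (\<lambda>h. h *\<^sub>R l x)) (at s)"
        by (auto intro!: derivative_eq_intros)
      from has_derivative_compose[OF this has_derivative_grad[OF C_infinity_differentiable[OF \<psi>]]]
      have "((\<lambda>s. \<psi> (x + s *\<^sub>R l x)) has_vector_derivative g s) (at s)"
        unfolding has_vector_derivative_def g_def by simp
      then show ?thesis by (rule has_vector_derivative_at_within)
    qed
    from fundamental_theorem_of_calculus[OF \<tau> this]
    have "integral {0..\<tau>} g = \<psi> (x + \<tau> *\<^sub>R l x) - \<psi> x" by (simp add: integral_unique)
    then have "(\<psi> (x + \<tau> *\<^sub>R l x) - \<psi> x)\<^sup>2 \<le> \<tau> * integral {0..\<tau>} (\<lambda>s. (g s)\<^sup>2)"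
      using integral_square_le[OF \<tau> gcont] by simp
    also have "\<dots> \<le> \<tau> * integral {0..\<tau>} (\<lambda>s. R\<^sup>2 * ?G (x + s *\<^sub>R l x))"
    proof (intro mult_left_mono integral_le \<tau>)
      show "(\<lambda>s. (g s)\<^sup>2) integrable_on {0..\<tau>}" by (intro integrable_continuous_real continuous_intros gcont)
      show "(\<lambda>s. R\<^sup>2 * ?G (x + s *\<^sub>R l x)) integrable_on {0..\<tau>}"
        by (intro integrable_continuous_real continuous_intros continuous_on_compose2[OF gc]) auto
      fix s
      have "\<bar>g s\<bar> \<le> norm (grad \<psi> (x + s *\<^sub>R l x)) * norm (l x)" unfolding g_def by (rule Cauchy_Schwarz_ineq2)
      also have "\<dots> \<le> norm (grad \<psi> (x + s *\<^sub>R l x)) * R" by (intro mult_left_mono R True) simp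
      finally have "\<bar>g s\<bar>\<^sup>2 \<le> (norm (grad \<psi> (x + s *\<^sub>R l x)) * R)\<^sup>2" by (intro power_mono) auto
      then show "(g s)\<^sup>2 \<le> R\<^sup>2 * ?G (x + s *\<^sub>R l x)" by (simp add: power_mult_distrib mult.commute)
    qed
    finally have le: "(\<psi> (x + \<tau> *\<^sub>R l x) - \<psi> x)\<^sup>2 \<le> \<tau> * R\<^sup>2 * integral {0..\<tau>} (\<lambda>s. ?G (x + s *\<^sub>R l x))" by simp
    have "(\<lambda>s. ?G (x + s *\<^sub>R l x)) integrable_on {0..\<tau>}"
      by (intro integrable_continuous_real continuous_intros continuous_on_compose2[OF gc]) auto
    then have nn: "(\<integral>\<^sup>+s. ennreal (?G (x + s *\<^sub>R l x)) * indicator {0..\<tau>} s \<partial>lborel) = ennreal (integral {0..\<tau>} (\<lambda>s. ?G (x + s *\<^sub>R l x)))"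
      by (intro nn_integral_has_integral_lebesgue') (auto simp: integrable_integral)
    have "ennreal ((\<psi> (x + \<tau> *\<^sub>R l x) - \<psi> x)\<^sup>2) \<le> ennreal (\<tau> * R\<^sup>2 * integral {0..\<tau>} (\<lambda>s. ?G (x + s *\<^sub>R l x)))"
      by (rule ennreal_leI[OF le])
    also have "\<dots> = ennreal (\<tau> * R\<^sup>2) * (\<integral>\<^sup>+s. ennreal (?G (x + s *\<^sub>R l x)) * indicator {0..\<tau>} s \<partial>lborel)"
      unfolding nn using \<tau> by (intro ennreal_mult Henstock_Kurzweil_Integration.integral_nonneg) (auto intro!: integrable_continuous_real continuous_intros continuous_on_compose2[OF gc])
    also have "\<dots> = (\<integral>\<^sup>+s. ennreal (\<tau> * R\<^sup>2) * (ennreal (?G (x + s *\<^sub>R l x)) * indicator {0..\<tau>} s) \<partial>lborel)"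
      by (rule nn_integral_cmult[symmetric]) measurable
    finally show ?thesis using True by simp
  qed simp
  have "(\<integral>\<^sup>+x. ennreal ((\<psi> (x + \<tau> *\<^sub>R l x) - \<psi> x)\<^sup>2) * indicator A x \<partial>lborel)
     \<le> (\<integral>\<^sup>+x. \<integral>\<^sup>+s. ennreal (\<tau> * R\<^sup>2) * (ennreal (?G (x + s *\<^sub>R l x)) * indicator {0..\<tau>} s) \<partial>lborel \<partial>lborel)"
    by (intro nn_integral_mono pt)
  also have "\<dots> = (\<integral>\<^sup>+s. \<integral>\<^sup>+x. ennreal (\<tau> * R\<^sup>2) * (ennreal (?G (x + s *\<^sub>R l x)) * indicator {0..\<tau>} s) \<partial>lborel \<partial>lborel)"
    by (rule pair_sigma_finite.Fubini') (auto intro!: pair_sigma_finite.intro sigma_finite_lborel)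
  also have "\<dots> = (\<integral>\<^sup>+s. ennreal (\<tau> * R\<^sup>2) * indicator {0..\<tau>} s * (\<integral>\<^sup>+x. ennreal (?G (x + s *\<^sub>R l x)) \<partial>lborel) \<partial>lborel)"
    by (intro nn_integral_cong) (subst nn_integral_cmult[symmetric], auto simp: mult_ac)
  also have "\<dots> \<le> (\<integral>\<^sup>+s. ennreal (\<tau> * R\<^sup>2) * indicator {0..\<tau>} s * (\<integral>\<^sup>+x. ennreal (?G x) \<partial>lborel) \<partial>lborel)"
  proof (intro nn_integral_mono)
    fix s :: real
    show "ennreal (\<tau> * R\<^sup>2) * indicator {0..\<tau>} s * (\<integral>\<^sup>+x. ennreal (?G (x + s *\<^sub>R l x)) \<partial>lborel)
       \<le> ennreal (\<tau> * R\<^sup>2) * indicator {0..\<tau>} s * (\<integral>\<^sup>+x. ennreal (?G x) \<partial>lborel)"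
      using flow[OF _ _ Gm, of s] by (cases "s \<in> {0..\<tau>}") (auto intro: mult_left_mono)
  qed
  also have "\<dots> = ennreal (\<tau> * R\<^sup>2) * ennreal \<tau> * (\<integral>\<^sup>+x. ennreal (?G x) \<partial>lborel)"
    using \<tau> by (simp add: nn_integral_multc nn_integral_cmult)
  also have "ennreal (\<tau> * R\<^sup>2) * ennreal \<tau> = ennreal (\<tau>\<^sup>2 * R\<^sup>2)"
  proof -
    have 1: "0 \<le> \<tau> * R\<^sup>2" using \<tau> by simp
    have 2: "\<tau>\<^sup>2 * R\<^sup>2 = \<tau> * R\<^sup>2 * \<tau>" by (simp add: power2_eq_square)
    show ?thesis unfolding 2 by (rule ennreal_mult[symmetric, OF 1 \<tau>])
  qed
  finally show ?thesis .
qed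

lemma translation_bound:
  assumes "C_infinity \<psi>"
  shows "(\<integral>\<^sup>+x. ennreal ((\<psi> (x + w) - \<psi> x)\<^sup>2) \<partial>lborel) \<le> ennreal ((norm w)\<^sup>2) * (\<integral>\<^sup>+x. ennreal ((norm (grad \<psi> x))\<^sup>2) \<partial>lborel)"
  using difference_bound[OF assms, of 1 "\<lambda>x. w" UNIV "norm w"] nn_integral_translate by simp

lemma dilation_bound:
  fixes x0 :: "real^2"
  assumes "C_infinity \<psi>" "s \<ge> 0" "A \<in> sets borel" "\<And>x. x \<in> A \<Longrightarrow> norm (x - x0) \<le> R"
  shows "(\<integral>\<^sup>+x. ennreal ((\<psi> (x + s *\<^sub>R (x - x0)) - \<psi> x)\<^sup>2) * indicator A x \<partial>lborel)
     \<le> ennreal (s\<^sup>2 * R\<^sup>2) * (\<integral>\<^sup>+x. ennreal ((norm (grad \<psi> x))\<^sup>2) \<partial>lborel)"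
proof (rule difference_bound[OF assms(1,2) _ assms(4,3)])
  show "continuous_on UNIV (\<lambda>x. x - x0)" by (intro continuous_intros)
  fix t :: real and F :: "real^2 \<Rightarrow> ennreal"
  assume t: "0 \<le> t" and F: "F \<in> borel_measurable borel"
  have "x + t *\<^sub>R (x - x0) = (1 + t) *\<^sub>R x + (- t *\<^sub>R x0)" for x by (simp add: algebra_simps)
  then show "(\<integral>\<^sup>+x. F (x + t *\<^sub>R (x - x0)) \<partial>lborel) \<le> (\<integral>\<^sup>+x. F x \<partial>lborel)"
    using nn_integral_dilate_le[OF F, of "1 + t" "- t *\<^sub>R x0"] t by simp
qed

subsection \<open>Functions orthogonal to smooth functions\<close>

text \<open>The positive and the negative part of g are densities of two finite measures. These
  agree on the quadrants \<open>{..a}\<close>, whose indicators are bounded limits of smooth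
  functions, and quadrants are closed under intersection and generate the Borel sets. Requiring only
  that M carries the trace of the Borel sets covers both arc length on the boundary and area on
  \<Omega>.\<close>

lemma AE_zero_if_orthogonal_to_smooth:
  fixes g :: "real^2 \<Rightarrow> real"
  assumes fin: "finite_measure M" and sets: "sets M = sets (restrict_space borel (space M))" and g: "integrable M g"
    and orth: "\<And>\<psi>. C_infinity \<psi> \<Longrightarrow> (\<And>x. 0 \<le> \<psi> x \<and> \<psi> x \<le> 1) \<Longrightarrow> (LINT x|M. g x * \<psi> x) = 0"
  shows "AE x in M. g x = 0"
proof -
  interpret finite_measure M by fact
  obtain \<theta> B where \<theta>: "smooth_seq \<theta>" "\<And>t. t \<le> 0 \<Longrightarrow> \<theta> 0 t = 0" "\<And>t. t \<ge> 1 \<Longrightarrow> \<theta> 0 t = 1" "\<And>t. 0 \<le> \<theta> 0 t \<and> \<theta> 0 t \<le> 1"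
    using smooth_step_exists by metis
  have idm: "(\<lambda>x. x) \<in> measurable M borel"
  proof -
    have "(\<lambda>x. x) \<in> measurable (restrict_space borel (space M)) (borel :: (real^2) measure)"
      by (rule measurable_restrict_space1) simp
    then show ?thesis using measurable_cong_sets[OF sets refl] by blast
  qed
  have cm: "h \<in> borel_measurable M" if "continuous_on UNIV h" for h :: "real^2 \<Rightarrow> real"
    using measurable_compose[OF idm borel_measurable_continuous_onI[OF that]] by simp
  have gm[measurable]: "g \<in> borel_measurable M" using g by simp
  have orth_box: "(LINT x|M. g x * indicator {..a} x) = 0" for a :: "real^2"
  proof -
    \<comment> \<open>A smoothed indicator of the quadrant: each factor is 1 as long as its
      coordinate does not exceed that of a and, for k > 0, vanishes once the excess reaches 1 /
      k.\<close>
    define \<psi> where "\<psi> k x = (\<Prod>i\<in>UNIV. \<theta> 0 (1 + real k * (a $ i - x $ i)))" for k :: nat and x :: "real^2"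
    have C: "C_infinity (\<psi> k)" for k
    proof -
      have "C_infinity (\<lambda>x::real^2. 1 + real k * (a $ i - x $ i))" for i
      proof -
        have "C_infinity (\<lambda>x::real^2. 1 + real k * (a $ i - axis i 1 \<bullet> x))"
          by (intro C_infinity_add C_infinity_const C_infinity_mult C_infinity_diff C_infinity_inner)
        then show ?thesis by (simp add: inner_axis')
      qed
      then show ?thesis unfolding \<psi>_def by (intro C_infinity_prod C_infinity_compose[OF \<theta>(1)])
    qed
    have b: "0 \<le> \<psi> k x \<and> \<psi> k x \<le> 1" for k x
      unfolding \<psi>_def using \<theta>(4) by (auto intro!: prod_nonneg prod_le_1)
    have lim: "(\<lambda>k. \<psi> k x) \<longlonglongrightarrow> indicator {..a} x" for x
    proof (cases "x \<le> a")
      case True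
      then have "\<psi> k x = 1" for k unfolding \<psi>_def by (intro prod.neutral) (auto intro!: \<theta>(3) simp: less_eq_vec_def)
      then show ?thesis using True by simp
    next
      case False
      then obtain i where i: "a $ i < x $ i" by (auto simp: less_eq_vec_def not_le)
      obtain K :: nat where K: "1 \<le> real K * (x $ i - a $ i)"
        using reals_Archimedean3[of "x $ i - a $ i"] i by (metis diff_gt_0_iff_gt less_imp_le)
      have "\<psi> k x = 0" if "k \<ge> K" for k
      proof -
        have "real K * (x $ i - a $ i) \<le> real k * (x $ i - a $ i)" using that i by (intro mult_right_mono) auto
        then have "1 + real k * (a $ i - x $ i) \<le> 0" using K by (simp add: algebra_simps)
        then show ?thesis unfolding \<psi>_def using \<theta>(2) by (intro prod_zero) auto
      qed
      then have "\<forall>\<^sub>F k in sequentially. \<psi> k x = 0" by (auto simp: eventually_sequentially)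
      then show ?thesis using False by (auto intro: tendsto_eventually)
    qed
    have [measurable]: "\<psi> k \<in> borel_measurable M" for k by (rule cm[OF C_infinity_continuous[OF C]])
    have "{..a} \<inter> space M \<in> sets M"
      unfolding sets by (auto simp: sets_restrict_space space_restrict_space)
    then have im: "(\<lambda>x. indicator {..a} x :: real) \<in> borel_measurable M"
      by (simp add: borel_measurable_indicator_iff)
    have "(\<lambda>k. LINT x|M. g x * \<psi> k x) \<longlonglongrightarrow> (LINT x|M. g x * indicator {..a} x)"
    proof (rule integral_dominated_convergence[where w="\<lambda>x. norm (g x)"])
      show "AE x in M. (\<lambda>k. g x * \<psi> k x) \<longlonglongrightarrow> g x * indicator {..a} x"
        by (intro always_eventually allI tendsto_mult tendsto_const lim)
      show "AE x in M. norm (g x * \<psi> k x) \<le> norm (g x)" for k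
        using b by (intro always_eventually allI) (simp add: abs_mult mult_left_le)
      show "(\<lambda>x. g x * indicator {..a} x) \<in> borel_measurable M" by (rule borel_measurable_times[OF gm im])
      show "(\<lambda>x. g x * \<psi> k x) \<in> borel_measurable M" for k by measurable
    qed (use g in simp)
    moreover have "(LINT x|M. g x * \<psi> k x) = 0" for k by (rule orth[OF C b])
    ultimately show ?thesis by (simp add: LIMSEQ_const_iff)
  qed
  let ?p = "\<lambda>x. ennreal (g x)" and ?n = "\<lambda>x. ennreal (- g x)"
  have fp: "(\<integral>\<^sup>+x. ?p x \<partial>M) < \<infinity>" "(\<integral>\<^sup>+x. ?n x \<partial>M) < \<infinity>"
    using g unfolding real_integrable_def by (auto simp: less_top)
  let ?P = "distr (density M ?p) borel (\<lambda>x. x)" and ?N = "distr (density M ?n) borel (\<lambda>x. x)"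
  have em: "emeasure (distr (density M (\<lambda>x. ennreal (h x))) borel (\<lambda>x. x)) X = (\<integral>\<^sup>+x. ennreal (h x) * indicator X x \<partial>M)"
    if [measurable]: "h \<in> borel_measurable M" and X: "X \<in> sets borel" for h X
  proof -
    have "X \<inter> space M \<in> sets M" unfolding sets using X by (auto simp: sets_restrict_space)
    then have "emeasure (distr (density M (\<lambda>x. ennreal (h x))) borel (\<lambda>x. x)) X
        = (\<integral>\<^sup>+x. ennreal (h x) * indicator (X \<inter> space M) x \<partial>M)"
      using X idm by (subst emeasure_distr) (auto simp: emeasure_density)
    also have "\<dots> = (\<integral>\<^sup>+x. ennreal (h x) * indicator X x \<partial>M)"
      by (intro nn_integral_cong) (auto simp: indicator_def)
    finally show ?thesis .
  qed
  have PN: "?P = ?N"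
  proof (rule measure_eqI_generator_eq[where \<Omega>=UNIV and E="range (\<lambda>a. {..a})" and A="\<lambda>i. {..(\<chi> j. real i)}"])
    show "Int_stable (range (\<lambda>a::real^2. {..a}))"
    proof (rule Int_stableI)
      fix A B assume "A \<in> range (\<lambda>a::real^2. {..a})" "B \<in> range (\<lambda>a::real^2. {..a})"
      then obtain a b where "A = {..a}" "B = {..b}" by auto
      then have "A \<inter> B = {..inf a b}" by (auto simp: less_eq_vec_def inf_vec_def)
      then show "A \<inter> B \<in> range (\<lambda>a::real^2. {..a})" by auto
    qed
    show "sets ?P = sigma_sets UNIV (range (\<lambda>a. {..a}))" "sets ?N = sigma_sets UNIV (range (\<lambda>a. {..a}))"
      by (auto simp: borel_eq_atMost)
    show "(\<Union>i. {..(\<chi> j. real i)}) = (UNIV :: (real^2) set)"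
    proof (rule UNIV_eq_I[symmetric])
      fix x :: "real^2"
      obtain k where k: "norm x \<le> real k" using real_arch_simple by blast
      have "x $ j \<le> real k" for j using component_le_norm_cart[of x j] k by linarith
      then show "x \<in> (\<Union>i. {..(\<chi> j. real i)})" by (auto simp: less_eq_vec_def)
    qed
    show "emeasure ?P {..(\<chi> j. real i)} \<noteq> \<infinity>" for i
    proof -
      have "emeasure ?P {..(\<chi> j. real i)} \<le> (\<integral>\<^sup>+x. ?p x \<partial>M)"
        by (subst em) (auto intro!: nn_integral_mono simp: indicator_def)
      then show ?thesis using fp by (auto simp: top_unique)
    qed
    fix X assume "X \<in> range (\<lambda>a::real^2. {..a})"
    then obtain a where X: "X = {..a}" by auto
    have "{..a} \<inter> space M \<in> sets M"
      unfolding sets by (auto simp: sets_restrict_space space_restrict_space)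
    then have im: "(\<lambda>x. indicator {..a} x :: real) \<in> borel_measurable M"
      by (simp add: borel_measurable_indicator_iff)
    have gi: "integrable M (\<lambda>x. g x * indicator {..a} x)"
    proof (rule Bochner_Integration.integrable_bound[OF g])
      show "(\<lambda>x. g x * indicator {..a} x) \<in> borel_measurable M" by (rule borel_measurable_times[OF gm im])
    qed (auto simp: indicator_def)
    have "(\<integral>\<^sup>+x. ennreal (g x * indicator {..a} x) \<partial>M) = (\<integral>\<^sup>+x. ennreal (- (g x * indicator {..a} x)) \<partial>M)"
    proof -
      have f: "(\<integral>\<^sup>+x. ennreal (g x * indicator {..a} x) \<partial>M) < \<infinity>" "(\<integral>\<^sup>+x. ennreal (- (g x * indicator {..a} x)) \<partial>M) < \<infinity>"
        using gi unfolding real_integrable_def by (auto simp: less_top)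
      have "enn2real (\<integral>\<^sup>+x. ennreal (g x * indicator {..a} x) \<partial>M) = enn2real (\<integral>\<^sup>+x. ennreal (- (g x * indicator {..a} x)) \<partial>M)"
        using orth_box[of a] real_lebesgue_integral_def[OF gi] by simp
      then show ?thesis using f by (metis ennreal_enn2real infinity_ennreal_def)
    qed
    moreover have "ennreal (g x * indicator {..a} x) = ?p x * indicator {..a} x"
      "ennreal (- (g x * indicator {..a} x)) = ?n x * indicator {..a} x" for x
      by (auto simp: indicator_def)
    ultimately show "emeasure ?P X = emeasure ?N X" unfolding X by (subst (1 2) em) auto
  qed auto
  have "AE x in M. ?p x = ?n x"
  proof (rule density_unique_finite_measure)
    fix A assume "A \<in> sets M"
    then obtain X where X: "X \<in> sets borel" "A = space M \<inter> X" unfolding sets by (auto simp: sets_restrict_space)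
    have "(\<integral>\<^sup>+x. ?p x * indicator X x \<partial>M) = (\<integral>\<^sup>+x. ?n x * indicator X x \<partial>M)"
      using PN em[OF gm X(1)] em[of "\<lambda>x. - g x", OF _ X(1)] by simp
    moreover have "(\<integral>\<^sup>+x. h x * indicator A x \<partial>M) = (\<integral>\<^sup>+x. h x * indicator X x \<partial>M)" for h :: "real^2 \<Rightarrow> ennreal"
      unfolding X(2) by (intro nn_integral_cong) (auto simp: indicator_def)
    ultimately show "(\<integral>\<^sup>+x. ?p x * indicator A x \<partial>M) = (\<integral>\<^sup>+x. ?n x * indicator A x \<partial>M)" by simp
  qed auto
  then show ?thesis
  proof eventually_elim
    case (elim x)
    then show ?case by (cases "g x" "0::real" rule: linorder_cases) (auto simp: ennreal_neg)
  qed
qed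

subsection \<open>Test functions\<close>

lemma measurable_lebesgue_on_borel:
  assumes "f \<in> borel_measurable borel" "S \<in> sets lebesgue" shows "f \<in> borel_measurable (lebesgue_on S)"
  using assms by (intro measurable_restrict_space1 measurable_completion) simp

lemma nn_integral_lebesgue_on:
  assumes "S \<in> sets lebesgue"
  shows "(\<integral>\<^sup>+x. h x \<partial>lebesgue_on S) = (\<integral>\<^sup>+x. h x * indicator S x \<partial>lborel)"
  using assms by (simp add: nn_integral_restrict_space nn_integral_completion)

text \<open>Lebesgue measurable functions are Borel only up to a null set, whereas the orthogonality
  criterion above is about measures on Borel sets.\<close>

lemma borel_representative:
  fixes g :: "'a::euclidean_space \<Rightarrow> real"
  assumes S: "S \<in> sets borel" and g: "g \<in> borel_measurable (lebesgue_on S)"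
  obtains g' where "g' \<in> borel_measurable borel" "AE x in lebesgue_on S. g x = g' x"
proof -
  have SL: "S \<in> sets lebesgue" using S by auto
  have "(\<lambda>x. indicator S x * g x) \<in> borel_measurable lebesgue"
    using g SL by (simp add: borel_measurable_restrict_space_iff)
  then obtain g' where g': "g' \<in> borel_measurable lborel" "AE x in lborel. indicator S x * g x = g' x"
    using completion_ex_borel_measurable_real by blast
  have "AE x in lebesgue. indicator S x * g x = g' x" using g'(2) by (rule AE_completion)
  then have "AE x in lebesgue. x \<in> S \<longrightarrow> g x = g' x" by eventually_elim (auto simp: indicator_def)
  then have "AE x in lebesgue_on S. g x = g' x"
    using SL by (subst AE_restrict_space_iff) auto
  with g'(1) show ?thesis by (intro that) auto
qed

lemma test_functions_iff:
  "\<psi> \<in> test_functions \<Omega> \<longleftrightarrow> C_infinity \<psi> \<and> (\<exists>K. compact K \<and> K \<subseteq> \<Omega> \<and> (\<forall>x. x \<notin> K \<longrightarrow> \<psi> x = 0))"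
proof
  assume "\<psi> \<in> test_functions \<Omega>"
  moreover have "{x. \<psi> x \<noteq> 0} \<subseteq> closure {x. \<psi> x \<noteq> 0}" by (rule closure_subset)
  ultimately show "C_infinity \<psi> \<and> (\<exists>K. compact K \<and> K \<subseteq> \<Omega> \<and> (\<forall>x. x \<notin> K \<longrightarrow> \<psi> x = 0))"
    by (auto simp: test_functions_def intro!: exI[of _ "closure {x. \<psi> x \<noteq> 0}"])
next
  assume *: "C_infinity \<psi> \<and> (\<exists>K. compact K \<and> K \<subseteq> \<Omega> \<and> (\<forall>x. x \<notin> K \<longrightarrow> \<psi> x = 0))"
  then obtain K where K: "compact K" "K \<subseteq> \<Omega>" "\<And>x. x \<notin> K \<Longrightarrow> \<psi> x = 0" by auto
  have "closure {x. \<psi> x \<noteq> 0} \<subseteq> K"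
    using K by (intro closure_minimal compact_imp_closed) auto
  moreover from this have "compact (closure {x. \<psi> x \<noteq> 0})"
    using K(1) bounded_subset compact_imp_bounded by (auto simp: compact_eq_bounded_closed)
  ultimately show "\<psi> \<in> test_functions \<Omega>"
    using * K(2) by (simp add: test_functions_def)
qed

lemma grad_zero_outside:
  assumes "closed K" "\<And>x. x \<notin> K \<Longrightarrow> \<psi> x = 0" "x \<notin> K" shows "grad \<psi> x = 0"
proof (rule grad_eqI)
  have "((\<lambda>x. 0) has_derivative (\<lambda>v. 0 \<bullet> v)) (at x)" by simp
  then show "(\<psi> has_derivative (\<lambda>v. 0 \<bullet> v)) (at x)"
    by (rule has_derivative_transform_within_open[of _ _ _ _ "- K"]) (use assms in auto)
qed

lemma test_functionsD:
  assumes "\<psi> \<in> test_functions \<Omega>"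
  shows "C_infinity \<psi>" "x \<notin> \<Omega> \<Longrightarrow> \<psi> x = 0" "x \<notin> \<Omega> \<Longrightarrow> grad \<psi> x = 0"
proof -
  obtain K where K: "C_infinity \<psi>" "compact K" "K \<subseteq> \<Omega>" "\<And>x. x \<notin> K \<Longrightarrow> \<psi> x = 0"
    using assms by (auto simp: test_functions_iff)
  show "C_infinity \<psi>" by fact
  show "x \<notin> \<Omega> \<Longrightarrow> \<psi> x = 0" using K by auto
  show "x \<notin> \<Omega> \<Longrightarrow> grad \<psi> x = 0" using K grad_zero_outside[of K \<psi> x] compact_imp_closed[of K] by auto
qed

lemma test_functions_mult:
  assumes "C_infinity f" "\<psi> \<in> test_functions \<Omega>" shows "(\<lambda>x. f x * \<psi> x) \<in> test_functions \<Omega>"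
proof -
  obtain K where K: "compact K" "K \<subseteq> \<Omega>" "\<And>x. x \<notin> K \<Longrightarrow> \<psi> x = 0" and C: "C_infinity \<psi>"
    using assms(2) by (auto simp: test_functions_iff)
  then have "\<forall>x. x \<notin> K \<longrightarrow> f x * \<psi> x = 0" by auto
  then show ?thesis using K C_infinity_mult[OF assms(1) C] unfolding test_functions_iff by blast
qed

lemma test_functions_add:
  assumes "f \<in> test_functions \<Omega>" "g \<in> test_functions \<Omega>" shows "(\<lambda>x. f x + g x) \<in> test_functions \<Omega>"
proof -
  obtain K where K: "compact K" "K \<subseteq> \<Omega>" "\<And>x. x \<notin> K \<Longrightarrow> f x = 0" using assms(1) by (auto simp: test_functions_iff)
  obtain L where L: "compact L" "L \<subseteq> \<Omega>" "\<And>x. x \<notin> L \<Longrightarrow> g x = 0" using assms(2) by (auto simp: test_functions_iff)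
  have "compact (K \<union> L)" "K \<union> L \<subseteq> \<Omega>" "\<And>x. x \<notin> K \<union> L \<Longrightarrow> f x + g x = 0" using K L by (auto simp: compact_Un)
  then show ?thesis using assms unfolding test_functions_iff by (blast intro: C_infinity_add)
qed

lemma test_functions_zero: "(\<lambda>x. 0) \<in> test_functions \<Omega>"
  unfolding test_functions_iff by (intro conjI C_infinity_const exI[of _ "{}"]) auto

lemma test_functions_cmult: "\<psi> \<in> test_functions \<Omega> \<Longrightarrow> (\<lambda>x. c * \<psi> x) \<in> test_functions \<Omega>"
  by (rule test_functions_mult[OF C_infinity_const])

lemma test_functions_diff:
  assumes "f \<in> test_functions \<Omega>" "g \<in> test_functions \<Omega>" shows "(\<lambda>x. f x - g x) \<in> test_functions \<Omega>"
  using test_functions_add[OF assms(1) test_functions_cmult[OF assms(2), of "-1"]] by simp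

lemma test_functions_partial:
  assumes "\<psi> \<in> test_functions \<Omega>" shows "partial_deriv i \<psi> \<in> test_functions \<Omega>"
proof -
  obtain K where K: "C_infinity \<psi>" "compact K" "K \<subseteq> \<Omega>" "\<And>x. x \<notin> K \<Longrightarrow> \<psi> x = 0"
    using assms by (auto simp: test_functions_iff)
  have "partial_deriv i \<psi> x = 0" if "x \<notin> K" for x
    using grad_zero_outside[of K \<psi> x] K that compact_imp_closed[of K] by (auto simp: partial_deriv_grad)
  then show ?thesis using K C_infinity_partial unfolding test_functions_iff by blast
qed

lemma test_functions_bounded:
  assumes "\<psi> \<in> test_functions \<Omega>"
  shows "\<exists>B. \<forall>x. \<bar>\<psi> x\<bar> \<le> B"
proof -
  obtain K where K: "C_infinity \<psi>" "compact K" "\<And>x. x \<notin> K \<Longrightarrow> \<psi> x = 0"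
    using assms by (auto simp: test_functions_iff)
  have "bounded (\<psi> ` K)" using K by (intro compact_imp_bounded compact_continuous_image C_infinity_continuous)
  then obtain B where "\<And>x. x \<in> K \<Longrightarrow> \<bar>\<psi> x\<bar> \<le> B" by (auto simp: bounded_iff)
  then have "\<bar>\<psi> x\<bar> \<le> max B 0" for x using K(3)[of x] by (cases "x \<in> K") (auto intro: max.coboundedI1)
  then show ?thesis by blast
qed

lemma integral_lebesgue_on_test:
  fixes f :: "real^2 \<Rightarrow> real"
  assumes "open \<Omega>" "f \<in> borel_measurable borel" "\<And>x. x \<notin> \<Omega> \<Longrightarrow> f x = 0"
  shows "(LINT x|lebesgue_on \<Omega>. f x) = (LINT x|lborel. f x)"
proof -
  have "(LINT x|lebesgue_on \<Omega>. f x) = (LINT x|lebesgue. indicator \<Omega> x *\<^sub>R f x)"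
    using assms(1) by (subst integral_restrict_space) auto
  also have "(\<lambda>x. indicator \<Omega> x *\<^sub>R f x) = f" by (intro ext) (use assms(3) in \<open>auto simp: indicator_def\<close>)
  also have "(LINT x|lebesgue. f x) = (LINT x|lborel. f x)" using assms(2) by (intro integral_completion) simp
  finally show ?thesis .
qed

text \<open>Difference quotients have integral zero because Lebesgue measure is translation
  invariant; dominated convergence carries this over to the derivative. Integration by parts against
  test functions rests on this.\<close>

lemma integral_partial_deriv_test:
  assumes \<zeta>: "\<zeta> \<in> test_functions \<Omega>" and "open \<Omega>" "bounded \<Omega>"
  shows "(LINT x|lebesgue_on \<Omega>. partial_deriv i \<zeta> x) = 0"
proof -
  note C = test_functionsD(1)[OF \<zeta>]
  have "\<exists>B. \<forall>x. norm (grad \<zeta> x) \<le> B"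
  proof -
    obtain K where K: "compact K" "\<And>x. x \<notin> K \<Longrightarrow> \<zeta> x = 0" using \<zeta> by (auto simp: test_functions_iff)
    have "bounded (grad \<zeta> ` K)" using K C by (intro compact_imp_bounded compact_continuous_image C_infinity_grad_continuous)
    then obtain B where B: "\<And>x. x \<in> K \<Longrightarrow> norm (grad \<zeta> x) \<le> B" by (auto simp: bounded_iff)
    have "norm (grad \<zeta> x) \<le> max B 0" for x
      using B[of x] grad_zero_outside[of K \<zeta> x] K compact_imp_closed[of K] by (cases "x \<in> K") auto
    then show ?thesis by blast
  qed
  then obtain B where B: "\<And>x. norm (grad \<zeta> x) \<le> B" by blast
  have cm: "h \<in> borel_measurable borel" if "continuous_on UNIV h" for h :: "real^2 \<Rightarrow> real"
    using that by (rule borel_measurable_continuous_onI)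
  have chm[measurable]: "\<zeta> \<in> borel_measurable borel" by (intro cm C_infinity_continuous C)
  have pm[measurable]: "partial_deriv i \<zeta> \<in> borel_measurable borel" by (intro cm C_infinity_continuous C_infinity_partial C)
  define e :: "real^2" where "e = axis i 1"
  have ne: "norm e = 1" by (simp add: e_def)
  define h where "h n = 1 / real (Suc n)" for n
  have h: "0 < h n" "h n \<le> 1" for n by (auto simp: h_def)
  have h0: "h \<longlonglongrightarrow> 0" unfolding h_def by (rule LIMSEQ_Suc[OF lim_1_over_n])
  define D where "D n x = (\<zeta> (x + h n *\<^sub>R e) - \<zeta> x) / h n" for n x
  obtain R where R: "\<And>x. x \<in> \<Omega> \<Longrightarrow> norm x \<le> R" using assms(3) by (auto simp: bounded_iff)
  \<comment> \<open>Quotients with step at most 1 are supported in the ball of radius R + 1 and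
    bounded by the Lipschitz constant B, so W dominates them all.\<close>
  define W where "W x = B * indicator (cball 0 (R + 1)) x" for x :: "real^2"
  have Wi: "integrable lborel W"
    unfolding W_def by (intro integrable_mult_right integrable_real_indicator emeasure_lborel_cball_finite) auto
  have D_bound: "\<bar>D n x\<bar> \<le> W x" for n x
  proof (cases "norm x \<le> R + 1")
    case True
    have "norm (\<zeta> (x + h n *\<^sub>R e) - \<zeta> x) \<le> B * norm ((x + h n *\<^sub>R e) - x)"
    proof (rule differentiable_bound[OF convex_UNIV, of _ "\<lambda>x v. grad \<zeta> x \<bullet> v"])
      show "(\<zeta> has_derivative (\<lambda>v. grad \<zeta> x \<bullet> v)) (at x within UNIV)" for x
        using has_derivative_grad[OF C_infinity_differentiable[OF C]] by simp
      show "onorm (\<lambda>v. grad \<zeta> x \<bullet> v) \<le> B" for x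
      proof (rule onorm_le)
        fix v
        have "norm (grad \<zeta> x \<bullet> v) \<le> norm (grad \<zeta> x) * norm v" using Cauchy_Schwarz_ineq2 by simp
        also have "\<dots> \<le> B * norm v" using B by (intro mult_right_mono) auto
        finally show "norm (grad \<zeta> x \<bullet> v) \<le> B * norm v" .
      qed
    qed auto
    then have "\<bar>\<zeta> (x + h n *\<^sub>R e) - \<zeta> x\<bar> \<le> B * h n" using ne h(1)[of n] by simp
    then show ?thesis using h(1)[of n] True by (simp add: D_def W_def abs_divide pos_divide_le_eq)
  next
    case False
    have "x \<notin> \<Omega>" using R[of x] False by auto
    moreover have "x + h n *\<^sub>R e \<notin> \<Omega>"
    proof
      assume "x + h n *\<^sub>R e \<in> \<Omega>"
      then have "norm (x + h n *\<^sub>R e) \<le> R" by (rule R)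
      moreover have "norm x \<le> norm (x + h n *\<^sub>R e) + norm (h n *\<^sub>R e)"
        using norm_triangle_ineq4[of "x + h n *\<^sub>R e" "h n *\<^sub>R e"] by simp
      ultimately show False using False ne h[of n] by simp
    qed
    ultimately show ?thesis using test_functionsD(2)[OF \<zeta>] order_trans[OF norm_ge_zero B]
      by (simp add: D_def W_def)
  qed
  have D_lim: "(\<lambda>n. D n x) \<longlonglongrightarrow> partial_deriv i \<zeta> x" for x
  proof -
    have "((\<lambda>t. x + t *\<^sub>R e) has_derivative (\<lambda>t. t *\<^sub>R e)) (at 0)" by (auto intro!: derivative_eq_intros)
    from has_derivative_compose[OF this, of \<zeta> "\<lambda>v. grad \<zeta> x \<bullet> v"]
    have hd: "((\<lambda>t. \<zeta> (x + t *\<^sub>R e)) has_derivative (\<lambda>t. grad \<zeta> x \<bullet> (t *\<^sub>R e))) (at 0)"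
      using has_derivative_grad[OF C_infinity_differentiable[OF C], of x] by simp
    then have "((\<lambda>t. \<zeta> (x + t *\<^sub>R e)) has_real_derivative partial_deriv i \<zeta> x) (at 0)"
    proof -
      have "(\<lambda>t. grad \<zeta> x \<bullet> (t *\<^sub>R e)) = (*) (partial_deriv i \<zeta> x)"
        by (rule ext) (simp add: partial_deriv_grad e_def inner_axis)
      then show ?thesis using hd unfolding has_field_derivative_def by simp
    qed
    then have "((\<lambda>t. (\<zeta> (x + t *\<^sub>R e) - \<zeta> x) / t) \<longlongrightarrow> partial_deriv i \<zeta> x) (at 0)"
      by (simp add: DERIV_def)
    moreover have "filterlim h (at 0) sequentially" using h0 h(1) by (auto simp: filterlim_at less_imp_neq[symmetric])
    ultimately show ?thesis unfolding D_def by (rule filterlim_compose)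
  qed
  have ci: "integrable lborel \<zeta>"
  proof -
    obtain b where b: "\<And>x. \<bar>\<zeta> x\<bar> \<le> b" using test_functions_bounded[OF \<zeta>] by blast
    show ?thesis
    proof (rule Bochner_Integration.integrable_bound)
      show "integrable lborel (\<lambda>x::real^2. b * indicator (cball 0 R) x)"
        by (intro integrable_mult_right integrable_real_indicator emeasure_lborel_cball_finite) auto
      have "norm (\<zeta> x) \<le> norm (b * indicator (cball 0 R) x :: real)" for x
        using b[of x] R[of x] test_functionsD(2)[OF \<zeta>, of x] by (cases "x \<in> \<Omega>") auto
      then show "AE x in lborel. norm (\<zeta> x) \<le> norm (b * indicator (cball 0 R) x :: real)" by simp
    qed simp
  qed
  have shift: "integrable lborel (\<lambda>x. \<zeta> (x + w)) \<and> (LINT x|lborel. \<zeta> (x + w)) = (LINT x|lborel. \<zeta> x)" for w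
  proof -
    have d: "distr lborel borel ((+) w) = lborel" by (rule lborel_distr_plus)
    have "integrable (distr lborel borel ((+) w)) \<zeta>" using ci d by simp
    then have "integrable lborel (\<lambda>x. \<zeta> (w + x))" by (subst (asm) integrable_distr_eq) auto
    moreover have "(LINT x|distr lborel borel ((+) w). \<zeta> x) = (LINT x|lborel. \<zeta> (w + x))"
      by (rule integral_distr) auto
    ultimately show ?thesis using d by (simp add: add.commute)
  qed
  have D_int: "(LINT x|lborel. D n x) = 0" for n
    unfolding D_def using shift[of "h n *\<^sub>R e"] ci by simp
  have "(\<lambda>n. LINT x|lborel. D n x) \<longlonglongrightarrow> (LINT x|lborel. partial_deriv i \<zeta> x)"
    by (rule integral_dominated_convergence[where w=W]) (use Wi D_bound D_lim in \<open>auto simp: D_def\<close>)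
  then have "(LINT x|lborel. partial_deriv i \<zeta> x) = 0" unfolding D_int by (simp add: LIMSEQ_const_iff)
  then show ?thesis
    using integral_lebesgue_on_test[OF assms(2) pm] test_functionsD(3)[OF \<zeta>] by (simp add: partial_deriv_grad)
qed

section \<open>Test functions on a bounded open set\<close>

locale bounded_domain =
  fixes \<Omega> :: "(real^2) set"
  assumes open_dom: "open \<Omega>" and bounded_dom: "bounded \<Omega>"
begin

abbreviation M\<Omega> :: "(real^2) measure" where "M\<Omega> \<equiv> lebesgue_on \<Omega>"

lemma dom_sets: "\<Omega> \<in> sets borel" "\<Omega> \<in> sets lebesgue" using open_dom by auto

lemma finite_M\<Omega>: "finite_measure M\<Omega>"
proof
  have "\<Omega> \<in> lmeasurable" using open_dom bounded_dom by (rule lmeasurable_open[rotated])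
  then show "emeasure M\<Omega> (space M\<Omega>) \<noteq> \<infinity>"
    using dom_sets by (auto simp: emeasure_restrict_space fmeasurable_def)
qed

lemma continuous_L2:
  fixes f :: "real^2 \<Rightarrow> 'b::euclidean_space"
  assumes "continuous_on UNIV f" shows "f \<in> L2 M\<Omega>"
proof -
  have "compact (closure \<Omega>)" using bounded_dom by (simp add: compact_closure)
  then have "bounded (f ` closure \<Omega>)"
    using assms by (intro compact_imp_bounded compact_continuous_image) (auto intro: continuous_on_subset)
  then obtain B where B: "\<And>x. x \<in> closure \<Omega> \<Longrightarrow> norm (f x) \<le> B" by (auto simp: bounded_iff)
  show ?thesis
  proof (rule L2_bounded[OF finite_M\<Omega>])
    show "f \<in> borel_measurable M\<Omega>"
      by (intro measurable_lebesgue_on_borel borel_measurable_continuous_onI assms dom_sets)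
    show "AE x in M\<Omega>. norm (f x) \<le> B" using B closure_subset[of \<Omega>] by (intro AE_I2) auto
  qed
qed

lemma C_infinity_L2: "C_infinity f \<Longrightarrow> f \<in> L2 M\<Omega>" "C_infinity f \<Longrightarrow> grad f \<in> L2 M\<Omega>"
  by (rule continuous_L2, erule C_infinity_continuous) (rule continuous_L2, erule C_infinity_grad_continuous)

lemma test_L2:
  assumes "\<psi> \<in> test_functions \<Omega>" shows "\<psi> \<in> L2 M\<Omega>" "grad \<psi> \<in> L2 M\<Omega>"
  using C_infinity_L2 test_functionsD(1)[OF assms] by blast+

lemma test_continuous: "\<psi> \<in> test_functions \<Omega> \<Longrightarrow> continuous_on S \<psi>"
  using C_infinity_continuous test_functionsD by blast

lemma ennreal_L2_inner_continuous:
  fixes f :: "real^2 \<Rightarrow> 'b::euclidean_space"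
  assumes "continuous_on UNIV f"
  shows "ennreal (L2_inner M\<Omega> f f) = (\<integral>\<^sup>+x. ennreal ((norm (f x))\<^sup>2) * indicator \<Omega> x \<partial>lborel)"
  using nn_integral_L2[OF continuous_L2[OF assms]] nn_integral_lebesgue_on[OF dom_sets(2)] by simp

lemma nn_integral_grad_test:
  assumes "\<psi> \<in> test_functions \<Omega>"
  shows "(\<integral>\<^sup>+x. ennreal ((norm (grad \<psi> x))\<^sup>2) \<partial>lborel) = ennreal (L2_inner M\<Omega> (grad \<psi>) (grad \<psi>))"
  unfolding ennreal_L2_inner_continuous[OF C_infinity_grad_continuous[OF test_functionsD(1)[OF assms]]]
  using test_functionsD(3)[OF assms] by (intro nn_integral_cong) (auto simp: indicator_def)

text \<open>A translation by a vector w longer than the diameter carries \<Omega> off itself, so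
  that on \<Omega> the value \<psi> x is the difference \<psi> x - \<psi> (x + w). The translation
  bound then gives the inequality with constant |w|.\<close>

lemma poincare_test:
  "\<exists>P\<ge>0. \<forall>\<psi>\<in>test_functions \<Omega>. L2_norm M\<Omega> \<psi> \<le> P * L2_norm M\<Omega> (grad \<psi>)"
proof -
  obtain R where R: "\<And>x. x \<in> \<Omega> \<Longrightarrow> norm x \<le> R" using bounded_dom by (auto simp: bounded_iff)
  define w :: "real^2" where "w = (2 * \<bar>R\<bar> + 1) *\<^sub>R axis 1 1"
  have nw: "norm w = 2 * \<bar>R\<bar> + 1" by (simp add: w_def)
  have "L2_norm M\<Omega> \<psi> \<le> norm w * L2_norm M\<Omega> (grad \<psi>)" if \<psi>: "\<psi> \<in> test_functions \<Omega>" for \<psi>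
  proof -
    have "ennreal (L2_inner M\<Omega> \<psi> \<psi>) = (\<integral>\<^sup>+x. ennreal ((\<psi> x)\<^sup>2) * indicator \<Omega> x \<partial>lborel)"
      using ennreal_L2_inner_continuous[OF test_continuous[OF \<psi>]] by simp
    also have "\<dots> \<le> (\<integral>\<^sup>+x. ennreal ((\<psi> (x + w) - \<psi> x)\<^sup>2) \<partial>lborel)"
    proof (intro nn_integral_mono)
      fix x
      have "\<psi> (x + w) = 0" if "x \<in> \<Omega>"
      proof (rule test_functionsD(2)[OF \<psi>])
        have "norm w \<le> norm (x + w) + norm x" using norm_triangle_ineq4[of "x + w" x] by simp
        then show "x + w \<notin> \<Omega>" using R[OF that] R[of "x + w"] nw by auto
      qed
      then show "ennreal ((\<psi> x)\<^sup>2) * indicator \<Omega> x \<le> ennreal ((\<psi> (x + w) - \<psi> x)\<^sup>2)"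
        by (cases "x \<in> \<Omega>") auto
    qed
    also have "\<dots> \<le> ennreal ((norm w)\<^sup>2) * ennreal (L2_inner M\<Omega> (grad \<psi>) (grad \<psi>))"
      using translation_bound[OF test_functionsD(1)[OF \<psi>]] nn_integral_grad_test[OF \<psi>] by simp
    also have "\<dots> = ennreal ((norm w)\<^sup>2 * L2_inner M\<Omega> (grad \<psi>) (grad \<psi>))" by (simp add: ennreal_mult L2_inner_self_nonneg)
    finally have "L2_inner M\<Omega> \<psi> \<psi> \<le> (norm w)\<^sup>2 * L2_inner M\<Omega> (grad \<psi>) (grad \<psi>)"
      by (simp add: L2_inner_self_nonneg)
    then have "(L2_norm M\<Omega> \<psi>)\<^sup>2 \<le> (norm w * L2_norm M\<Omega> (grad \<psi>))\<^sup>2"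
      by (simp add: L2_norm_sq power_mult_distrib)
    then show ?thesis by (rule power2_le_imp_le) (simp add: L2_norm_nonneg)
  qed
  then show ?thesis by (intro exI[of _ "norm w"]) auto
qed

text \<open>The product is a test function although g alone has no compact support, and its partial
  derivatives have integral zero.\<close>

lemma integration_by_parts:
  assumes "f \<in> test_functions \<Omega>" "C_infinity g"
  shows "L2_inner M\<Omega> f (partial_deriv i g) = - L2_inner M\<Omega> (partial_deriv i f) g"
proof -
  note C = test_functionsD(1)[OF assms(1)] assms(2)
  have t: "(\<lambda>x. g x * f x) \<in> test_functions \<Omega>" by (rule test_functions_mult[OF assms(2,1)])
  have "partial_deriv i (\<lambda>x. g x * f x) x = f x * partial_deriv i g x + partial_deriv i f x * g x" for x
    using grad_mult[OF C(2,1)] by (simp add: partial_deriv_grad)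
  then have "0 = (LINT x|M\<Omega>. f x * partial_deriv i g x + partial_deriv i f x * g x)"
    using integral_partial_deriv_test[OF t open_dom bounded_dom, of i] by simp
  also have "\<dots> = L2_inner M\<Omega> f (partial_deriv i g) + L2_inner M\<Omega> (partial_deriv i f) g"
    using L2_inner_integrable[OF C_infinity_L2(1)[OF C(1)] C_infinity_L2(1)[OF C_infinity_partial[OF C(2), of i]]]
      L2_inner_integrable[OF C_infinity_L2(1)[OF C_infinity_partial[OF C(1), of i]] C_infinity_L2(1)[OF C(2)]]
    by (simp add: L2_inner_def)
  finally show ?thesis by simp
qed

end

subsection \<open>The Poisson problem on a polygon\<close>

lemma L2_component:
  fixes g :: "'a \<Rightarrow> real^'n"
  assumes "g \<in> L2 M" shows "(\<lambda>x. g x $ i) \<in> L2 M"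
proof (rule L2_bound[OF assms, of _ 1])
  have "(\<lambda>x. g x \<bullet> axis i 1) \<in> borel_measurable M" using L2_measurable[OF assms] by measurable
  then show "(\<lambda>x. g x $ i) \<in> borel_measurable M" by (simp add: inner_axis)
  show "AE x in M. norm (g x $ i) \<le> 1 * norm (g x)" by (intro AE_I2) (simp add: component_le_norm_cart)
qed

lemma L2_inner_components:
  fixes g h :: "'a \<Rightarrow> real^'n"
  assumes "g \<in> L2 M" "h \<in> L2 M"
  shows "L2_inner M g h = (\<Sum>i\<in>UNIV. L2_inner M (\<lambda>x. g x $ i) (\<lambda>x. h x $ i))"
proof -
  have "integrable M (\<lambda>x. g x $ i * h x $ i)" for i
    using L2_inner_integrable[OF L2_component[OF assms(1)] L2_component[OF assms(2)], of i i] by simp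
  then show ?thesis by (simp add: L2_inner_def inner_vec_def)
qed

lemma L2_indicator:
  fixes f :: "'a \<Rightarrow> 'b::euclidean_space"
  assumes f: "f \<in> L2 M" and A: "A \<inter> space M \<in> sets M"
  shows "(\<lambda>x. indicator A x *\<^sub>R f x) \<in> L2 M"
proof (rule L2_bound[OF f, of _ 1])
  have "(indicator A :: _ \<Rightarrow> real) \<in> borel_measurable M" using A by (simp add: borel_measurable_indicator_iff)
  then show "(\<lambda>x. indicator A x *\<^sub>R f x) \<in> borel_measurable M"
    by (rule borel_measurable_scaleR[OF _ L2_measurable[OF f]])
qed (auto simp: indicator_def)

locale polygon = bounded_domain +
  fixes H :: "((real^2) \<times> real) set"
  assumes polygonal: "convex_polygonal_domain \<Omega>" and finite_H: "finite H"
    and closure_eq: "closure \<Omega> = {x. \<forall>(a, c)\<in>H. a \<bullet> x \<le> c}" and dom_eq: "\<Omega> = {x. \<forall>(a, c)\<in>H. a \<bullet> x < c}"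
    and facets: "\<And>a c. (a, c) \<in> H \<Longrightarrow>
      a \<noteq> 0 \<and> (\<exists>(p, q)\<in>sides \<Omega>. closure \<Omega> \<inter> {x. a \<bullet> x = c} = closed_segment p q)"
begin

text \<open>Each summand of \<sigma> is 1 where the slack of its half-plane is at most \<epsilon>/2
  and 0 where it is at least \<epsilon>. The outer step sends all sums \<ge> 1 to the value 0 of
  \<zeta>, so several half-planes acting near a corner do no harm. In the constant 2 B^2 N one
  factor B and the 2/\<epsilon> stem from the inner steps, the other B from the outer one, and N
  adds up the lengths of the normals.\<close>

lemma cutoff_exists:
  "\<exists>K\<ge>0. \<forall>\<epsilon>>0. \<exists>\<zeta>. C_infinity \<zeta> \<and> (\<forall>x. 0 \<le> \<zeta> x \<and> \<zeta> x \<le> 1) \<and>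
     (\<forall>x. (\<exists>(a, c)\<in>H. c - a \<bullet> x \<le> \<epsilon> / 2) \<longrightarrow> \<zeta> x = 0) \<and> (\<forall>x. norm (grad \<zeta> x) \<le> K / \<epsilon>) \<and>
     (\<forall>x\<in>\<Omega> - collar H \<Omega> \<epsilon>. \<zeta> x = 1 \<and> grad \<zeta> x = 0)"
proof -
  obtain \<theta> B where \<theta>: "smooth_seq \<theta>" "\<And>t. t \<le> 0 \<Longrightarrow> \<theta> 0 t = 0" "\<And>t. t \<ge> 1 \<Longrightarrow> \<theta> 0 t = 1"
      "\<And>t. 0 \<le> \<theta> 0 t \<and> \<theta> 0 t \<le> 1" "\<And>t. \<bar>\<theta> 1 t\<bar> \<le> B" "\<And>t. t \<le> 0 \<or> 1 \<le> t \<Longrightarrow> \<theta> 1 t = 0"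
    using smooth_step_exists by metis
  have B0: "0 \<le> B" using \<theta>(5)[of 0] by linarith
  define N where "N = (\<Sum>h\<in>H. norm (fst h))"
  have N0: "0 \<le> N" unfolding N_def by (intro sum_nonneg) auto
  show ?thesis
  proof (rule exI[of _ "2 * B\<^sup>2 * N"], rule conjI, goal_cases)
    case 1
    show ?case using N0 by simp
  next
    case 2
    show ?case
    proof (intro allI impI)
    fix \<epsilon> :: real assume \<epsilon>: "0 < \<epsilon>"
    define arg where "arg h x = 2 * (snd h - fst h \<bullet> x) / \<epsilon> - 1" for h :: "(real^2) \<times> real" and x
    define \<sigma> where "\<sigma> x = (\<Sum>h\<in>H. 1 - \<theta> 0 (arg h x))" for x
    define \<zeta> where "\<zeta> x = 1 - \<theta> 0 (\<sigma> x)" for x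
    have argC: "C_infinity (arg h)" for h
    proof -
      have "C_infinity (\<lambda>x. (2 / \<epsilon>) * (snd h - fst h \<bullet> x) - 1)"
        by (intro C_infinity_diff C_infinity_cmult C_infinity_const C_infinity_inner)
      then show ?thesis by (simp add: arg_def[abs_def])
    qed
    have \<sigma>C: "C_infinity \<sigma>" unfolding \<sigma>_def[abs_def]
      by (intro C_infinity_sum C_infinity_diff C_infinity_const C_infinity_compose[OF \<theta>(1)] argC)
    have \<zeta>C: "C_infinity \<zeta>" unfolding \<zeta>_def[abs_def]
      by (intro C_infinity_diff C_infinity_const C_infinity_compose[OF \<theta>(1)] \<sigma>C)
    have \<theta>D: "(\<theta> 0 has_derivative (\<lambda>v. \<theta> 1 t * v)) (at t)" for t
      using smooth_seqD[OF \<theta>(1), of 0 t] by simp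
    have gD: "(arg h has_derivative (\<lambda>v. - (2 / \<epsilon>) * (fst h \<bullet> v))) (at x)" for h x
      unfolding arg_def[abs_def] using \<epsilon> by (auto intro!: derivative_eq_intros simp: field_simps)
    define s where "s x = (\<Sum>h\<in>H. (\<theta> 1 (arg h x) * (2 / \<epsilon>)) *\<^sub>R fst h)" for x
    have \<sigma>D: "(\<sigma> has_derivative (\<lambda>v. s x \<bullet> v)) (at x)" for x
    proof -
      have "((\<lambda>x. 1 - \<theta> 0 (arg h x)) has_derivative (\<lambda>v. 0 - \<theta> 1 (arg h x) * (- (2 / \<epsilon>) * (fst h \<bullet> v)))) (at x)" for h
        by (rule has_derivative_diff[OF has_derivative_const has_derivative_compose[OF gD \<theta>D]])
      then have "(\<sigma> has_derivative (\<lambda>v. \<Sum>h\<in>H. 0 - \<theta> 1 (arg h x) * (- (2 / \<epsilon>) * (fst h \<bullet> v)))) (at x)"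
        unfolding \<sigma>_def[abs_def] by (intro has_derivative_sum)
      then show ?thesis by (simp add: s_def inner_sum_left mult.assoc)
    qed
    have grad\<zeta>: "grad \<zeta> x = - \<theta> 1 (\<sigma> x) *\<^sub>R s x" for x
    proof (rule grad_eqI)
      have "(\<zeta> has_derivative (\<lambda>v. 0 - \<theta> 1 (\<sigma> x) * (s x \<bullet> v))) (at x)"
        unfolding \<zeta>_def[abs_def] by (rule has_derivative_diff[OF has_derivative_const has_derivative_compose[OF \<sigma>D \<theta>D]])
      then show "(\<zeta> has_derivative (\<lambda>v. (- \<theta> 1 (\<sigma> x) *\<^sub>R s x) \<bullet> v)) (at x)" by simp
    qed
    have term0: "0 \<le> 1 - \<theta> 0 (arg h x)" for h x using \<theta>(4) by simp
    show "\<exists>\<zeta>. C_infinity \<zeta> \<and> (\<forall>x. 0 \<le> \<zeta> x \<and> \<zeta> x \<le> 1) \<and>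
     (\<forall>x. (\<exists>(a, c)\<in>H. c - a \<bullet> x \<le> \<epsilon> / 2) \<longrightarrow> \<zeta> x = 0) \<and> (\<forall>x. norm (grad \<zeta> x) \<le> 2 * B\<^sup>2 * N / \<epsilon>) \<and>
     (\<forall>x\<in>\<Omega> - collar H \<Omega> \<epsilon>. \<zeta> x = 1 \<and> grad \<zeta> x = 0)"
    proof (rule exI[of _ \<zeta>], intro conjI allI impI ballI)
      show "C_infinity \<zeta>" by fact
      show "0 \<le> \<zeta> x" "\<zeta> x \<le> 1" for x using \<theta>(4) by (auto simp: \<zeta>_def)
    next
      fix x assume "\<exists>(a, c)\<in>H. c - a \<bullet> x \<le> \<epsilon> / 2"
      then obtain h where h: "h \<in> H" "snd h - fst h \<bullet> x \<le> \<epsilon> / 2" by (auto simp: split_beta)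
      then have "arg h x \<le> 0" using \<epsilon> by (simp add: arg_def field_simps)
      then have "1 \<le> 1 - \<theta> 0 (arg h x)" using \<theta>(2) by simp
      also have "\<dots> \<le> \<sigma> x" unfolding \<sigma>_def using member_le_sum[OF h(1), of "\<lambda>h. 1 - \<theta> 0 (arg h x)"] term0 finite_H by simp
      finally show "\<zeta> x = 0" using \<theta>(3) by (simp add: \<zeta>_def)
    next
      fix x
      have "norm (s x) \<le> (\<Sum>h\<in>H. norm ((\<theta> 1 (arg h x) * (2 / \<epsilon>)) *\<^sub>R fst h))" unfolding s_def by (rule norm_sum)
      also have "\<dots> \<le> (\<Sum>h\<in>H. B * (2 / \<epsilon>) * norm (fst h))"
      proof (rule sum_mono)
        fix h
        have "\<bar>\<theta> 1 (arg h x)\<bar> * (2 / \<epsilon>) * norm (fst h) \<le> B * (2 / \<epsilon>) * norm (fst h)"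
          using \<theta>(5)[of "arg h x"] \<epsilon> by (intro mult_right_mono) auto
        then show "norm ((\<theta> 1 (arg h x) * (2 / \<epsilon>)) *\<^sub>R fst h) \<le> B * (2 / \<epsilon>) * norm (fst h)"
          using \<epsilon> by (simp add: abs_mult)
      qed
      also have "\<dots> = B * (2 / \<epsilon>) * N" by (simp add: N_def sum_distrib_left)
      finally have "norm (s x) \<le> B * (2 / \<epsilon>) * N" .
      then have "\<bar>\<theta> 1 (\<sigma> x)\<bar> * norm (s x) \<le> B * (B * (2 / \<epsilon>) * N)"
        using \<theta>(5)[of "\<sigma> x"] B0 by (intro mult_mono) auto
      then show "norm (grad \<zeta> x) \<le> 2 * B\<^sup>2 * N / \<epsilon>" unfolding grad\<zeta> by (simp add: power2_eq_square mult_ac)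
    next
      fix x assume x: "x \<in> \<Omega> - collar H \<Omega> \<epsilon>"
      have "\<theta> 0 (arg h x) = 1" if "h \<in> H" for h
      proof -
        have "\<not> (snd h - fst h \<bullet> x \<le> \<epsilon>)" using x that by (auto simp: collar_def split_beta)
        then have "1 \<le> arg h x" using \<epsilon> by (simp add: arg_def field_simps)
        then show ?thesis using \<theta>(3) by simp
      qed
      then have "\<sigma> x = 0" by (simp add: \<sigma>_def)
      then show "\<zeta> x = 1" "grad \<zeta> x = 0" using \<theta>(2)[of 0] \<theta>(6)[of 0] by (auto simp: \<zeta>_def grad\<zeta>)
    qed
    qed
  qed
qed

lemma cutoff_test:
  assumes "C_infinity \<zeta>" "\<And>x. \<exists>(a, c)\<in>H. c - a \<bullet> x \<le> \<epsilon> / 2 \<Longrightarrow> \<zeta> x = 0" "\<epsilon> > 0" "C_infinity \<psi>"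
  shows "(\<lambda>x. \<zeta> x * \<psi> x) \<in> test_functions \<Omega>"
  unfolding test_functions_iff
proof (intro conjI exI[of _ "{x. \<forall>(a, c)\<in>H. \<epsilon> / 2 \<le> c - a \<bullet> x}"] allI impI)
  let ?K = "{x. \<forall>(a, c)\<in>H. \<epsilon> / 2 \<le> c - a \<bullet> x}"
  show "C_infinity (\<lambda>x. \<zeta> x * \<psi> x)" using assms by (intro C_infinity_mult)
  show sub: "?K \<subseteq> \<Omega>" unfolding dom_eq using assms(3) by (fastforce split: prod.splits)
  have "?K = (\<Inter>h\<in>H. {x. \<epsilon> / 2 \<le> snd h - fst h \<bullet> x})" by (auto simp: split_beta)
  moreover have "closed \<dots>" by (intro closed_INT ballI closed_Collect_le continuous_intros)
  ultimately have "closed ?K" by simp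
  moreover have "bounded ?K" by (rule bounded_subset[OF bounded_dom sub])
  ultimately show "compact ?K" by (simp only: compact_eq_bounded_closed)
  fix x assume "x \<notin> ?K"
  then obtain a c where "(a, c) \<in> H" "\<not> \<epsilon> / 2 \<le> c - a \<bullet> x" by auto
  then have "\<exists>(a, c)\<in>H. c - a \<bullet> x \<le> \<epsilon> / 2" by (intro bexI[of _ "(a, c)"]) auto
  then show "\<zeta> x * \<psi> x = 0" using assms(2) by simp
qed

text \<open>Cutoffs turn smooth functions into test functions, so g times a cutoff is orthogonal to
  all smooth functions and vanishes. At a fixed point of \<Omega> the cutoffs are eventually 1,
  since its slacks with respect to the finitely many half-planes have a positive minimum.\<close>

lemma AE_zero_if_orthogonal_to_test:
  fixes g :: "real^2 \<Rightarrow> real"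
  assumes g: "g \<in> L2 M\<Omega>" and orth: "\<And>\<psi>. \<psi> \<in> test_functions \<Omega> \<Longrightarrow> L2_inner M\<Omega> g \<psi> = 0"
  shows "AE x in M\<Omega>. g x = 0"
proof -
  obtain g' where g'm[measurable]: "g' \<in> borel_measurable borel" and g': "AE x in M\<Omega>. g x = g' x"
    using borel_representative[OF dom_sets(1) L2_measurable[OF g]] by blast
  have g'L: "g' \<in> L2 M\<Omega>"
    using g' by (intro L2_bound[OF g, of _ 1] measurable_lebesgue_on_borel g'm dom_sets) (auto elim!: eventually_mono)
  let ?N = "restrict_space lborel \<Omega> :: (real^2) measure"
  have to_N: "(LINT x|M\<Omega>. f x) = (LINT x|?N. f x)" "integrable M\<Omega> f \<longleftrightarrow> integrable ?N f"
    if [measurable]: "f \<in> borel_measurable borel" for f :: "real^2 \<Rightarrow> real"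
  proof -
    have m: "(\<lambda>x. indicator \<Omega> x *\<^sub>R f x) \<in> borel_measurable lborel" using dom_sets by measurable
    show "(LINT x|M\<Omega>. f x) = (LINT x|?N. f x)"
      using dom_sets integral_completion[OF m] by (simp add: integral_restrict_space)
    show "integrable M\<Omega> f \<longleftrightarrow> integrable ?N f"
      using dom_sets integrable_completion[OF m] by (simp add: integrable_restrict_space)
  qed
  have finN: "finite_measure ?N"
  proof
    have "emeasure ?N (space ?N) = emeasure M\<Omega> (space M\<Omega>)"
      using dom_sets by (simp add: emeasure_restrict_space)
    then show "emeasure ?N (space ?N) \<noteq> \<infinity>" using finite_measure.emeasure_finite[OF finite_M\<Omega>] by simp
  qed
  have spN: "space ?N = \<Omega>" by (simp add: space_restrict_space)
  have setsN: "sets ?N = sets (restrict_space borel (space ?N))"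
    unfolding spN by (intro sets_restrict_space_cong) simp
  obtain K where K: "\<And>\<epsilon>. 0 < \<epsilon> \<Longrightarrow> \<exists>\<zeta>. C_infinity \<zeta> \<and> (\<forall>x. 0 \<le> \<zeta> x \<and> \<zeta> x \<le> 1) \<and>
     (\<forall>x. (\<exists>(a, c)\<in>H. c - a \<bullet> x \<le> \<epsilon> / 2) \<longrightarrow> \<zeta> x = 0) \<and> (\<forall>x. norm (grad \<zeta> x) \<le> K / \<epsilon>) \<and>
     (\<forall>x\<in>\<Omega> - collar H \<Omega> \<epsilon>. \<zeta> x = 1 \<and> grad \<zeta> x = 0)"
    using cutoff_exists by auto
  have "\<exists>\<zeta>. C_infinity \<zeta> \<and> (\<forall>x. 0 \<le> \<zeta> x \<and> \<zeta> x \<le> 1) \<and>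
     (\<forall>x. (\<exists>(a, c)\<in>H. c - a \<bullet> x \<le> (1 / real (Suc n)) / 2) \<longrightarrow> \<zeta> x = 0) \<and>
     (\<forall>x\<in>\<Omega> - collar H \<Omega> (1 / real (Suc n)). \<zeta> x = 1)" for n
  proof -
    have pos: "0 < 1 / real (Suc n)" by simp
    obtain \<zeta> where "C_infinity \<zeta>" "\<forall>x. 0 \<le> \<zeta> x \<and> \<zeta> x \<le> 1"
      "\<forall>x. (\<exists>(a, c)\<in>H. c - a \<bullet> x \<le> (1 / real (Suc n)) / 2) \<longrightarrow> \<zeta> x = 0"
      "\<forall>x\<in>\<Omega> - collar H \<Omega> (1 / real (Suc n)). \<zeta> x = 1 \<and> grad \<zeta> x = 0"
      using K[OF pos] by (elim exE conjE) (rule that)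
    then show ?thesis by (intro exI[of _ \<zeta>] conjI) auto
  qed
  then have "\<forall>n. \<exists>\<zeta>. C_infinity \<zeta> \<and> (\<forall>x. 0 \<le> \<zeta> x \<and> \<zeta> x \<le> 1) \<and>
     (\<forall>x. (\<exists>(a, c)\<in>H. c - a \<bullet> x \<le> (1 / real (Suc n)) / 2) \<longrightarrow> \<zeta> x = 0) \<and>
     (\<forall>x\<in>\<Omega> - collar H \<Omega> (1 / real (Suc n)). \<zeta> x = 1)" by (rule allI)
  from choice[OF this] obtain \<zeta> where \<zeta>': "\<forall>n. C_infinity (\<zeta> n) \<and> (\<forall>x. 0 \<le> \<zeta> n x \<and> \<zeta> n x \<le> 1) \<and>
     (\<forall>x. (\<exists>(a, c)\<in>H. c - a \<bullet> x \<le> (1 / real (Suc n)) / 2) \<longrightarrow> \<zeta> n x = 0) \<and>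
     (\<forall>x\<in>\<Omega> - collar H \<Omega> (1 / real (Suc n)). \<zeta> n x = 1)" by (rule exE)
  have \<zeta>: "C_infinity (\<zeta> n)" "0 \<le> \<zeta> n x \<and> \<zeta> n x \<le> 1"
     "\<exists>(a, c)\<in>H. c - a \<bullet> x \<le> (1 / real (Suc n)) / 2 \<Longrightarrow> \<zeta> n x = 0"
     "x \<in> \<Omega> - collar H \<Omega> (1 / real (Suc n)) \<Longrightarrow> \<zeta> n x = 1" for n x
    using spec[OF \<zeta>', of n] by blast+
  have \<zeta>m[measurable]: "\<zeta> n \<in> borel_measurable borel" for n
    by (intro borel_measurable_continuous_onI C_infinity_continuous \<zeta>)
  have "AE x in ?N. g' x * \<zeta> n x = 0" for n
  proof (rule AE_zero_if_orthogonal_to_smooth[OF finN setsN])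
    have "integrable M\<Omega> (\<lambda>x. g' x * \<zeta> n x)"
      using L2_inner_integrable[OF g'L C_infinity_L2(1)[OF \<zeta>(1)], of n] by simp
    then show "integrable ?N (\<lambda>x. g' x * \<zeta> n x)" by (subst (asm) to_N(2)) auto
    fix \<psi> :: "real^2 \<Rightarrow> real" assume \<psi>: "C_infinity \<psi>"
    have [measurable]: "\<psi> \<in> borel_measurable borel"
      by (intro borel_measurable_continuous_onI C_infinity_continuous \<psi>)
    have t: "(\<lambda>x. \<zeta> n x * \<psi> x) \<in> test_functions \<Omega>"
      by (rule cutoff_test[where \<epsilon>="1 / real (Suc n)", OF \<zeta>(1) \<zeta>(3) _ \<psi>]) auto
    have "(LINT x|?N. g' x * \<zeta> n x * \<psi> x) = (LINT x|M\<Omega>. g' x * \<zeta> n x * \<psi> x)" by (rule to_N(1)[symmetric]) measurable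
    also have "\<dots> = L2_inner M\<Omega> g' (\<lambda>x. \<zeta> n x * \<psi> x)" by (simp add: L2_inner_def mult.assoc)
    also have "\<dots> = L2_inner M\<Omega> g (\<lambda>x. \<zeta> n x * \<psi> x)"
      using g' L2_measurable[OF g] L2_measurable[OF g'L] L2_measurable[OF test_L2(1)[OF t]]
      by (intro L2_inner_cong_AE) (auto elim!: eventually_mono)
    finally show "(LINT x|?N. g' x * \<zeta> n x * \<psi> x) = 0" using orth[OF t] by simp
  qed
  then have "AE x in ?N. \<forall>n. g' x * \<zeta> n x = 0" by (subst AE_all_countable) (rule allI)
  moreover have "AE x in ?N. x \<in> \<Omega>" using spN by (intro AE_I2) auto
  ultimately have "AE x in ?N. g' x = 0"
  proof eventually_elim
    case (elim x)
    have pos: "0 < c - a \<bullet> x" if "(a, c) \<in> H" for a c using elim that by (auto simp: dom_eq)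
    have "\<exists>n. x \<notin> collar H \<Omega> (1 / real (Suc n))"
    proof -
      define m where "m = Min (insert 1 ((\<lambda>(a, c). c - a \<bullet> x) ` H))"
      have "m > 0" unfolding m_def using finite_H pos by (subst Min_gr_iff) auto
      then obtain n where n: "1 / real (Suc n) < m" using nat_approx_posE by blast
      have lt: "1 / real (Suc n) < c - a \<bullet> x" if "(a, c) \<in> H" for a c
      proof -
        have "m \<le> c - a \<bullet> x" unfolding m_def using finite_H that by (intro Min_le) auto
        then show ?thesis using n by simp
      qed
      show ?thesis by (intro exI[of _ n]) (auto simp: collar_def not_le simp del: of_nat_Suc dest: lt leD)
    qed
    then show ?case using elim \<zeta>(4) by (metis DiffI mult_cancel_right1 mult_eq_0_iff)
  qed
  then have "AE x in lborel. x \<in> \<Omega> \<longrightarrow> g' x = 0" using dom_sets by (simp add: AE_restrict_space_iff)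
  then have "AE x in M\<Omega>. g' x = 0" using dom_sets AE_completion by (subst AE_restrict_space_iff) auto
  then show ?thesis using g' by eventually_elim simp
qed

section \<open>Weak derivatives and functions with zero boundary values\<close>

lemma weak_gradient_unique:
  assumes "has_weak_gradient \<Omega> u g" "has_weak_gradient \<Omega> u g'" shows "AE x in M\<Omega>. g x = g' x"
proof -
  have g: "g \<in> L2 M\<Omega>" "g' \<in> L2 M\<Omega>" using assms by (auto simp: has_weak_gradient_def)
  have "AE x in M\<Omega>. g x $ i - g' x $ i = 0" for i
  proof (rule AE_zero_if_orthogonal_to_test)
    show "(\<lambda>x. g x $ i - g' x $ i) \<in> L2 M\<Omega>" by (intro L2_diff L2_component g)
    fix \<psi> assume \<psi>: "\<psi> \<in> test_functions \<Omega>"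
    then show "L2_inner M\<Omega> (\<lambda>x. g x $ i - g' x $ i) \<psi> = 0"
      using assms by (simp add: L2_inner_add L2_component g test_L2 has_weak_gradient_def)
  qed
  then have "AE x in M\<Omega>. \<forall>i. g x $ i - g' x $ i = 0" by (simp add: AE_all_countable)
  then show ?thesis by eventually_elim (simp add: vec_eq_iff)
qed

lemma weak_laplacian_unique:
  assumes "has_weak_laplacian \<Omega> u f" "has_weak_laplacian \<Omega> u f'" shows "AE x in M\<Omega>. f x = f' x"
proof -
  have f: "f \<in> L2 M\<Omega>" "f' \<in> L2 M\<Omega>" using assms by (auto simp: has_weak_laplacian_def)
  have "AE x in M\<Omega>. f x - f' x = 0"
    using assms f by (intro AE_zero_if_orthogonal_to_test L2_diff)
      (auto simp: L2_inner_add test_L2 has_weak_laplacian_def)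
  then show ?thesis by eventually_elim simp
qed

text \<open>Integration by parts passes to the limit along the test functions. Since
  \<open>weak_grad\<close> is an arbitrarily selected weak gradient, it can be identified with g
  only almost everywhere.\<close>

lemma H10_approx:
  assumes \<psi>: "\<And>k. \<psi> k \<in> test_functions \<Omega>" and u: "u \<in> L2 M\<Omega>" and g: "g \<in> L2 M\<Omega>"
    and lim: "(\<lambda>k. L2_norm M\<Omega> (\<lambda>x. \<psi> k x - u x)) \<longlonglongrightarrow> 0" "(\<lambda>k. L2_norm M\<Omega> (\<lambda>x. grad (\<psi> k) x - g x)) \<longlonglongrightarrow> 0"
  shows "has_weak_gradient \<Omega> u g" "has_weak_gradient \<Omega> u (weak_grad \<Omega> u)" "AE x in M\<Omega>. weak_grad \<Omega> u x = g x" "u \<in> H10 \<Omega>"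
proof -
  have lim_i: "(\<lambda>k. L2_norm M\<Omega> (\<lambda>x. partial_deriv i (\<psi> k) x - g x $ i)) \<longlonglongrightarrow> 0" for i
  proof (rule Lim_null_comparison[OF always_eventually lim(2)], rule allI)
    fix k
    have "L2_norm M\<Omega> (\<lambda>x. (grad (\<psi> k) x - g x) $ i) \<le> L2_norm M\<Omega> (\<lambda>x. grad (\<psi> k) x - g x)"
    proof (rule L2_norm_mono)
      show d: "(\<lambda>x. grad (\<psi> k) x - g x) \<in> L2 M\<Omega>" by (rule L2_diff[OF test_L2(2)[OF \<psi>] g])
      show "(\<lambda>x. (grad (\<psi> k) x - g x) $ i) \<in> L2 M\<Omega>" by (rule L2_component[OF d])
    qed (intro AE_I2, simp add: component_le_norm_cart del: vector_minus_component)
    then show "norm (L2_norm M\<Omega> (\<lambda>x. partial_deriv i (\<psi> k) x - g x $ i)) \<le> L2_norm M\<Omega> (\<lambda>x. grad (\<psi> k) x - g x)"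
      by (simp add: partial_deriv_grad L2_norm_nonneg)
  qed
  show 1: "has_weak_gradient \<Omega> u g"
    unfolding has_weak_gradient_def
  proof (intro conjI ballI allI g)
    fix \<phi> i assume \<phi>: "\<phi> \<in> test_functions \<Omega>"
    have "(\<lambda>k. L2_inner M\<Omega> (\<psi> k) (partial_deriv i \<phi>)) \<longlonglongrightarrow> L2_inner M\<Omega> u (partial_deriv i \<phi>)"
      by (rule L2_inner_tendsto[OF test_L2(1)[OF \<psi>] u test_L2(1)[OF test_functions_partial[OF \<phi>]] lim(1)])
    moreover have "(\<lambda>k. - L2_inner M\<Omega> (partial_deriv i (\<psi> k)) \<phi>) \<longlonglongrightarrow> - L2_inner M\<Omega> (\<lambda>x. g x $ i) \<phi>"
      by (intro tendsto_minus L2_inner_tendsto[OF test_L2(1)[OF test_functions_partial[OF \<psi>]] L2_component[OF g] test_L2(1)[OF \<phi>] lim_i])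
    moreover have "L2_inner M\<Omega> (\<psi> k) (partial_deriv i \<phi>) = - L2_inner M\<Omega> (partial_deriv i (\<psi> k)) \<phi>" for k
      by (rule integration_by_parts[OF \<psi> test_functionsD(1)[OF \<phi>]])
    ultimately show "L2_inner M\<Omega> u (partial_deriv i \<phi>) = - L2_inner M\<Omega> (\<lambda>x. g x $ i) \<phi>"
      using LIMSEQ_unique by simp
  qed
  then show 2: "has_weak_gradient \<Omega> u (weak_grad \<Omega> u)" unfolding weak_grad_def by (rule someI[of "has_weak_gradient \<Omega> u"])
  then have wg: "weak_grad \<Omega> u \<in> L2 M\<Omega>" by (simp add: has_weak_gradient_def)
  show 3: "AE x in M\<Omega>. weak_grad \<Omega> u x = g x" by (rule weak_gradient_unique[OF 2 1])
  have "L2_norm M\<Omega> (\<lambda>x. grad (\<psi> k) x - weak_grad \<Omega> u x) = L2_norm M\<Omega> (\<lambda>x. grad (\<psi> k) x - g x)" for k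
    by (rule L2_norm_cong_AE) (use 3 L2_measurable[OF L2_diff[OF test_L2(2)[OF \<psi>] wg]] L2_measurable[OF L2_diff[OF test_L2(2)[OF \<psi>] g]]
      in \<open>auto elim!: eventually_mono\<close>)
  then show "u \<in> H10 \<Omega>" unfolding H10_def H1_def using u 1 \<psi> lim by (auto intro!: exI[of _ \<psi>])
qed

lemma H10_D:
  assumes "u \<in> H10 \<Omega>"
  shows "u \<in> L2 M\<Omega>" "weak_grad \<Omega> u \<in> L2 M\<Omega>" "has_weak_gradient \<Omega> u (weak_grad \<Omega> u)"
proof -
  show "u \<in> L2 M\<Omega>" using assms by (simp add: H10_def H1_def)
  obtain g where "has_weak_gradient \<Omega> u g" using assms by (auto simp: H10_def H1_def)
  then show *: "has_weak_gradient \<Omega> u (weak_grad \<Omega> u)" unfolding weak_grad_def by (rule someI[of "has_weak_gradient \<Omega> u"])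
  then show "weak_grad \<Omega> u \<in> L2 M\<Omega>" by (simp add: has_weak_gradient_def)
qed

lemma H10_sequence:
  assumes "u \<in> H10 \<Omega>"
  obtains \<psi> :: "nat \<Rightarrow> real^2 \<Rightarrow> real" where "\<And>k. \<psi> k \<in> test_functions \<Omega>"
    "(\<lambda>k. L2_norm M\<Omega> (\<lambda>x. \<psi> k x - u x)) \<longlonglongrightarrow> 0" "(\<lambda>k. L2_norm M\<Omega> (\<lambda>x. grad (\<psi> k) x - weak_grad \<Omega> u x)) \<longlonglongrightarrow> 0"
  using assms by (auto simp: H10_def)

lemma test_H10:
  assumes "\<psi> \<in> test_functions \<Omega>"
  shows "\<psi> \<in> H10 \<Omega>" "AE x in M\<Omega>. weak_grad \<Omega> \<psi> x = grad \<psi> x"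
  using H10_approx[of "\<lambda>_. \<psi>" \<psi> "grad \<psi>"] assms test_L2[OF assms] by (auto simp: L2_norm_zero)

text \<open>\<open>H10\<close> is the closure of the test functions, and both sides of the equation
  are continuous in v with respect to the norms of function and gradient. Test functions can be
  dilated and cut off, which the boundary estimates require.\<close>

lemma weak_poisson_solution_iff:
  assumes z: "z \<in> L2 M\<Omega>"
  shows "weak_poisson_solution \<Omega> z \<phi> \<longleftrightarrow> \<phi> \<in> H10 \<Omega> \<and>
    (\<forall>\<psi>\<in>test_functions \<Omega>. L2_inner M\<Omega> (weak_grad \<Omega> \<phi>) (grad \<psi>) = L2_inner M\<Omega> z \<psi>)"
proof (intro iffI conjI ballI)
  assume *: "weak_poisson_solution \<Omega> z \<phi>"
  then show \<phi>: "\<phi> \<in> H10 \<Omega>" by (simp add: weak_poisson_solution_def)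
  fix \<psi> assume \<psi>: "\<psi> \<in> test_functions \<Omega>"
  have "L2_inner M\<Omega> (weak_grad \<Omega> \<phi>) (grad \<psi>) = L2_inner M\<Omega> (weak_grad \<Omega> \<phi>) (weak_grad \<Omega> \<psi>)"
    using test_H10[OF \<psi>] H10_D[OF \<phi>] H10_D[OF test_H10(1)[OF \<psi>]] test_L2[OF \<psi>]
    by (intro L2_inner_cong_AE) (auto simp: L2_measurable elim!: eventually_mono)
  then show "L2_inner M\<Omega> (weak_grad \<Omega> \<phi>) (grad \<psi>) = L2_inner M\<Omega> z \<psi>"
    using * test_H10(1)[OF \<psi>] by (simp add: weak_poisson_solution_def)
next
  assume *: "\<phi> \<in> H10 \<Omega> \<and> (\<forall>\<psi>\<in>test_functions \<Omega>. L2_inner M\<Omega> (weak_grad \<Omega> \<phi>) (grad \<psi>) = L2_inner M\<Omega> z \<psi>)"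
  note \<phi> = H10_D[OF conjunct1[OF *]]
  have "L2_inner M\<Omega> (weak_grad \<Omega> \<phi>) (weak_grad \<Omega> v) = L2_inner M\<Omega> z v" if v: "v \<in> H10 \<Omega>" for v
  proof -
    obtain \<psi> :: "nat \<Rightarrow> real^2 \<Rightarrow> real" where \<psi>: "\<And>k. \<psi> k \<in> test_functions \<Omega>"
      "(\<lambda>k. L2_norm M\<Omega> (\<lambda>x. \<psi> k x - v x)) \<longlonglongrightarrow> 0" "(\<lambda>k. L2_norm M\<Omega> (\<lambda>x. grad (\<psi> k) x - weak_grad \<Omega> v x)) \<longlonglongrightarrow> 0"
      using H10_sequence[OF v] by blast
    have "(\<lambda>k. L2_inner M\<Omega> (grad (\<psi> k)) (weak_grad \<Omega> \<phi>)) \<longlonglongrightarrow> L2_inner M\<Omega> (weak_grad \<Omega> v) (weak_grad \<Omega> \<phi>)"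
      by (rule L2_inner_tendsto[OF test_L2(2)[OF \<psi>(1)] H10_D(2)[OF v] \<phi>(2) \<psi>(3)])
    moreover have "(\<lambda>k. L2_inner M\<Omega> (\<psi> k) z) \<longlonglongrightarrow> L2_inner M\<Omega> v z"
      by (rule L2_inner_tendsto[OF test_L2(1)[OF \<psi>(1)] H10_D(1)[OF v] z \<psi>(2)])
    moreover have "L2_inner M\<Omega> (grad (\<psi> k)) (weak_grad \<Omega> \<phi>) = L2_inner M\<Omega> (\<psi> k) z" for k
      using * \<psi>(1) L2_inner_sym by metis
    ultimately have "L2_inner M\<Omega> (weak_grad \<Omega> v) (weak_grad \<Omega> \<phi>) = L2_inner M\<Omega> v z" using LIMSEQ_unique by simp
    then show ?thesis using L2_inner_sym by metis
  qed
  then show "weak_poisson_solution \<Omega> z \<phi>" using * by (simp add: weak_poisson_solution_def)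
qed

lemma weak_poisson_energy:
  assumes z: "z \<in> L2 M\<Omega>" and \<phi>: "weak_poisson_solution \<Omega> z \<phi>"
  shows "L2_inner M\<Omega> (weak_grad \<Omega> \<phi>) (weak_grad \<Omega> \<phi>) = L2_inner M\<Omega> z \<phi>"
  using \<phi> by (simp add: weak_poisson_solution_def)

text \<open>The Riesz argument is run on the gradients of test functions inside L^2, where the
  energy is the ordinary inner product. The Poincare inequality enters twice: it makes the
  functional well defined and bounded on gradients, and it makes the potentials of a convergent
  sequence of gradients converge as well.\<close>

lemma weak_poisson_exists:
  assumes z: "z \<in> L2 M\<Omega>" shows "\<exists>\<phi>. weak_poisson_solution \<Omega> z \<phi>"
proof -
  obtain P where P: "P \<ge> 0" "\<And>\<psi>. \<psi> \<in> test_functions \<Omega> \<Longrightarrow> L2_norm M\<Omega> \<psi> \<le> P * L2_norm M\<Omega> (grad \<psi>)"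
    using poincare_test by blast
  interpret V: semi_hilbert "L2 M\<Omega> :: (real^2 \<Rightarrow> real^2) set" "L2_inner M\<Omega>" by (rule semi_hilbert_L2)
  let ?T = "test_functions \<Omega>"
  define W where "W = grad ` ?T"
  \<comment> \<open>A potential is recovered from its gradient by choice. Two potentials with the
    same gradient differ by a null function, by the Poincare inequality, so the choice does not
    affect the pairing with z.\<close>
  define l where "l w = L2_inner M\<Omega> z (inv_into ?T grad w)" for w
  have l_grad: "l (grad \<psi>) = L2_inner M\<Omega> z \<psi>" if \<psi>: "\<psi> \<in> ?T" for \<psi>
  proof -
    let ?\<psi>' = "inv_into ?T grad (grad \<psi>)"
    have \<psi>': "?\<psi>' \<in> ?T" "grad ?\<psi>' = grad \<psi>"
      using inv_into_into[OF imageI[OF \<psi>]] f_inv_into_f[OF imageI[OF \<psi>]] by auto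
    have d: "(\<lambda>x. ?\<psi>' x - \<psi> x) \<in> ?T" by (intro test_functions_diff \<psi>' \<psi>)
    have "grad (\<lambda>x. ?\<psi>' x - \<psi> x) = (\<lambda>x. 0)"
      using grad_diff[OF test_functionsD(1)[OF \<psi>'(1)] test_functionsD(1)[OF \<psi>]] \<psi>'(2) by auto
    then have "L2_norm M\<Omega> (\<lambda>x. ?\<psi>' x - \<psi> x) = 0"
      using P(2)[OF d] L2_norm_nonneg[of M\<Omega> "\<lambda>x. ?\<psi>' x - \<psi> x"] by (simp add: L2_norm_zero)
    then have "\<bar>L2_inner M\<Omega> z (\<lambda>x. ?\<psi>' x - \<psi> x)\<bar> \<le> 0"
      using L2_cauchy_schwarz[OF z test_L2(1)[OF d]] by simp
    then show ?thesis unfolding l_def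
      using L2_inner_add(4)[OF test_L2(1)[OF \<psi>'(1)] test_L2(1)[OF \<psi>] z] by simp
  qed
  have W_add: "(\<lambda>x. f x + g x) \<in> W \<and> l (\<lambda>x. f x + g x) = l f + l g" if fg: "f \<in> W" "g \<in> W" for f g
  proof -
    obtain \<psi>1 \<psi>2 where \<psi>: "\<psi>1 \<in> ?T" "\<psi>2 \<in> ?T" "f = grad \<psi>1" "g = grad \<psi>2"
      using fg unfolding W_def by blast
    have eq: "(\<lambda>x. f x + g x) = grad (\<lambda>x. \<psi>1 x + \<psi>2 x)"
      using grad_add[OF test_functionsD(1)[OF \<psi>(1)] test_functionsD(1)[OF \<psi>(2)]] \<psi> by auto
    show ?thesis unfolding eq using l_grad[OF test_functions_add[OF \<psi>(1,2)]] test_functions_add[OF \<psi>(1,2)]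
      by (simp add: \<psi>(3,4) l_grad \<psi>(1,2) W_def L2_inner_add z test_L2)
  qed
  have W_scale: "(\<lambda>x. c *\<^sub>R f x) \<in> W \<and> l (\<lambda>x. c *\<^sub>R f x) = c * l f" if f: "f \<in> W" for f c
  proof -
    obtain \<psi> where \<psi>: "\<psi> \<in> ?T" "f = grad \<psi>" using f by (auto simp: W_def)
    have eq: "(\<lambda>x. c *\<^sub>R f x) = grad (\<lambda>x. c * \<psi> x)"
      using grad_cmult[OF test_functionsD(1)[OF \<psi>(1)]] \<psi> by auto
    show ?thesis unfolding eq using l_grad[OF test_functions_cmult[OF \<psi>(1)]] test_functions_cmult[OF \<psi>(1)]
      by (simp add: \<psi>(2) l_grad \<psi>(1) W_def L2_inner_cmult)
  qed
  have "\<exists>X g. (\<forall>n::nat. X n \<in> W) \<and> g \<in> L2 M\<Omega> \<and> (\<lambda>n. sqrt (L2_inner M\<Omega> (\<lambda>x. X n x - g x) (\<lambda>x. X n x - g x))) \<longlonglongrightarrow> 0 \<and>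
     (\<forall>w\<in>W. L2_inner M\<Omega> g w = l w) \<and> sqrt (L2_inner M\<Omega> g g) \<le> L2_norm M\<Omega> z * P"
  proof (rule V.riesz)
    show "W \<subseteq> L2 M\<Omega>" using test_L2 by (auto simp: W_def)
    have "grad (\<lambda>x. 0) = (\<lambda>x. 0)" by (auto simp: grad_const)
    then show "(\<lambda>x. 0) \<in> W" unfolding W_def using test_functions_zero[of \<Omega>] by (metis imageI)
    show "0 \<le> L2_norm M\<Omega> z * P" using P(1) by (simp add: L2_norm_nonneg)
    fix f assume "f \<in> W"
    then obtain \<psi> where \<psi>: "\<psi> \<in> ?T" "f = grad \<psi>" by (auto simp: W_def)
    have "\<bar>l f\<bar> \<le> L2_norm M\<Omega> z * L2_norm M\<Omega> \<psi>" unfolding \<psi>(2) l_grad[OF \<psi>(1)] by (rule L2_cauchy_schwarz[OF z test_L2(1)[OF \<psi>(1)]])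
    also have "\<dots> \<le> L2_norm M\<Omega> z * (P * L2_norm M\<Omega> f)" unfolding \<psi>(2) by (intro mult_left_mono P \<psi> L2_norm_nonneg)
    finally show "\<bar>l f\<bar> \<le> L2_norm M\<Omega> z * P * sqrt (L2_inner M\<Omega> f f)" by (simp add: L2_norm_def)
  qed (use W_add W_scale in auto)
  then obtain X g where X: "\<And>n::nat. X n \<in> W" and g: "g \<in> L2 M\<Omega>"
    and lim: "(\<lambda>n. L2_norm M\<Omega> (\<lambda>x. X n x - g x)) \<longlonglongrightarrow> 0" and rep: "\<And>w. w \<in> W \<Longrightarrow> L2_inner M\<Omega> g w = l w"
    unfolding L2_norm_def by blast
  have "\<forall>n. \<exists>\<psi>. \<psi> \<in> ?T \<and> X n = grad \<psi>" using X by (auto simp: W_def)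
  then obtain \<psi> where \<psi>: "\<And>n. \<psi> n \<in> ?T" "\<And>n. X n = grad (\<psi> n)" by metis
  have lim': "(\<lambda>n. L2_norm M\<Omega> (\<lambda>x. grad (\<psi> n) x - g x)) \<longlonglongrightarrow> 0" using lim by (simp add: \<psi>(2))
  have diff: "L2_norm M\<Omega> (\<lambda>x. \<psi> m x - \<psi> n x)
      \<le> P * (L2_norm M\<Omega> (\<lambda>x. grad (\<psi> m) x - g x) + L2_norm M\<Omega> (\<lambda>x. grad (\<psi> n) x - g x))" for m n
  proof -
    have "L2_norm M\<Omega> (\<lambda>x. \<psi> m x - \<psi> n x) \<le> P * L2_norm M\<Omega> (grad (\<lambda>x. \<psi> m x - \<psi> n x))"
      by (intro P test_functions_diff \<psi>)
    also have "grad (\<lambda>x. \<psi> m x - \<psi> n x) = (\<lambda>x. (grad (\<psi> m) x - g x) - (grad (\<psi> n) x - g x))"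
      by (rule ext) (simp add: grad_diff test_functionsD(1)[OF \<psi>(1)])
    also have "L2_norm M\<Omega> \<dots> \<le> L2_norm M\<Omega> (\<lambda>x. grad (\<psi> m) x - g x) + L2_norm M\<Omega> (\<lambda>x. grad (\<psi> n) x - g x)"
      by (intro L2_norm_triangle(2) L2_diff test_L2 \<psi> g)
    finally show ?thesis using P(1) by (simp add: mult_left_mono)
  qed
  have "\<exists>\<phi>\<in>L2 M\<Omega>. (\<lambda>n. L2_norm M\<Omega> (\<lambda>x. \<psi> n x - \<phi> x)) \<longlonglongrightarrow> 0"
  proof (rule L2_cauchy_limit[OF test_L2(1)[OF \<psi>(1)]])
    fix e :: real assume e: "e > 0"
    have "(\<lambda>n. P * L2_norm M\<Omega> (\<lambda>x. grad (\<psi> n) x - g x)) \<longlonglongrightarrow> P * 0" by (intro tendsto_intros lim')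
    from LIMSEQ_D[OF this half_gt_zero[OF e]] obtain N where N: "\<And>n. n \<ge> N \<Longrightarrow> \<bar>P * L2_norm M\<Omega> (\<lambda>x. grad (\<psi> n) x - g x)\<bar> < e / 2"
      by auto
    show "\<exists>N. \<forall>m\<ge>N. \<forall>n\<ge>N. L2_norm M\<Omega> (\<lambda>x. \<psi> m x - \<psi> n x) < e"
    proof (intro exI[of _ N] allI impI)
      fix m n assume "N \<le> m" "N \<le> n"
      then show "L2_norm M\<Omega> (\<lambda>x. \<psi> m x - \<psi> n x) < e"
        using N[of m] N[of n] diff[of m n] by (simp add: distrib_left)
    qed
  qed
  then obtain \<phi> where \<phi>: "\<phi> \<in> L2 M\<Omega>" "(\<lambda>n. L2_norm M\<Omega> (\<lambda>x. \<psi> n x - \<phi> x)) \<longlonglongrightarrow> 0" by blast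
  note app = H10_approx[OF \<psi>(1) \<phi>(1) g \<phi>(2) lim']
  have "L2_inner M\<Omega> (weak_grad \<Omega> \<phi>) (grad \<eta>) = L2_inner M\<Omega> z \<eta>" if t: "\<eta> \<in> ?T" for \<eta>
  proof -
    have "L2_inner M\<Omega> (weak_grad \<Omega> \<phi>) (grad \<eta>) = L2_inner M\<Omega> g (grad \<eta>)"
      using app(3) H10_D(2)[OF app(4)] g test_L2(2)[OF t] by (intro L2_inner_cong_AE) (auto simp: L2_measurable)
    also have "\<dots> = l (grad \<eta>)" by (rule rep) (use t in \<open>simp add: W_def\<close>)
    finally show ?thesis by (simp add: l_grad[OF t])
  qed
  then show ?thesis using weak_poisson_solution_iff[OF z, of \<phi>] app(4) by blast
qed

lemma weak_laplacian_of_gradient: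
  assumes g: "has_weak_gradient \<Omega> u g" and \<psi>: "\<psi> \<in> test_functions \<Omega>" and u: "u \<in> L2 M\<Omega>"
  shows "L2_inner M\<Omega> u (\<lambda>x. \<Sum>i\<in>UNIV. partial_deriv i (partial_deriv i \<psi>) x) = - L2_inner M\<Omega> g (grad \<psi>)"
proof -
  have pt: "partial_deriv i (partial_deriv i \<psi>) \<in> test_functions \<Omega>" for i by (intro test_functions_partial \<psi>)
  have gL: "g \<in> L2 M\<Omega>" using g by (simp add: has_weak_gradient_def)
  have "L2_inner M\<Omega> u (\<lambda>x. \<Sum>i\<in>UNIV. partial_deriv i (partial_deriv i \<psi>) x)
      = (\<Sum>i\<in>UNIV. L2_inner M\<Omega> u (partial_deriv i (partial_deriv i \<psi>)))"
    using L2_inner_integrable[OF u test_L2(1)[OF pt]] by (simp add: L2_inner_def sum_distrib_left)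
  also have "\<dots> = (\<Sum>i\<in>UNIV. - L2_inner M\<Omega> (\<lambda>x. g x $ i) (partial_deriv i \<psi>))"
    using g test_functions_partial[OF \<psi>] by (simp add: has_weak_gradient_def)
  also have "\<dots> = - L2_inner M\<Omega> g (grad \<psi>)"
  proof -
    have "partial_deriv i \<psi> = (\<lambda>x. grad \<psi> x $ i)" for i by (rule ext) (rule partial_deriv_grad)
    then show ?thesis using L2_inner_components[OF gL test_L2(2)[OF \<psi>]] by (simp add: sum_negf)
  qed
  finally show ?thesis .
qed

text \<open>Together with \<open>poisson_Phi\<close> this identifies \<open>Phi\<close> with the
  weak solutions for right-hand sides in L^2, which allows transposition solutions to be tested by z
  instead of \<phi>.\<close>

lemma Phi_poisson:
  assumes "\<phi> \<in> Phi \<Omega>"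
  shows "weak_laplacian \<Omega> \<phi> \<in> L2 M\<Omega>" "weak_poisson_solution \<Omega> (\<lambda>x. - weak_laplacian \<Omega> \<phi> x) \<phi>"
proof -
  have \<phi>: "\<phi> \<in> H10 \<Omega>" using assms by (simp add: Phi_def)
  obtain f where "has_weak_laplacian \<Omega> \<phi> f" using assms by (auto simp: Phi_def)
  then have wl: "has_weak_laplacian \<Omega> \<phi> (weak_laplacian \<Omega> \<phi>)" unfolding weak_laplacian_def by (rule someI[of "has_weak_laplacian \<Omega> \<phi>"])
  then show L: "weak_laplacian \<Omega> \<phi> \<in> L2 M\<Omega>" by (simp add: has_weak_laplacian_def)
  show "weak_poisson_solution \<Omega> (\<lambda>x. - weak_laplacian \<Omega> \<phi> x) \<phi>"
    unfolding weak_poisson_solution_iff[OF L2_minus[OF L]]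
    using \<phi> wl weak_laplacian_of_gradient[OF H10_D(3)[OF \<phi>] _ H10_D(1)[OF \<phi>]]
    by (auto simp: has_weak_laplacian_def L2_inner_minus)
qed

lemma poisson_Phi:
  assumes z: "z \<in> L2 M\<Omega>" and \<phi>: "weak_poisson_solution \<Omega> z \<phi>"
  shows "\<phi> \<in> Phi \<Omega>" "AE x in M\<Omega>. weak_laplacian \<Omega> \<phi> x = - z x" "weak_laplacian \<Omega> \<phi> \<in> L2 M\<Omega>"
proof -
  have H: "\<phi> \<in> H10 \<Omega>" and eq: "\<And>\<psi>. \<psi> \<in> test_functions \<Omega> \<Longrightarrow> L2_inner M\<Omega> (weak_grad \<Omega> \<phi>) (grad \<psi>) = L2_inner M\<Omega> z \<psi>"
    using \<phi> weak_poisson_solution_iff[OF z] by auto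
  have wl: "has_weak_laplacian \<Omega> \<phi> (\<lambda>x. - z x)"
    unfolding has_weak_laplacian_def using L2_minus[OF z] weak_laplacian_of_gradient[OF H10_D(3)[OF H] _ H10_D(1)[OF H]] eq
    by (auto simp: L2_inner_minus)
  then show P: "\<phi> \<in> Phi \<Omega>" using H by (auto simp: Phi_def)
  have "has_weak_laplacian \<Omega> \<phi> (weak_laplacian \<Omega> \<phi>)" unfolding weak_laplacian_def by (rule someI[of "has_weak_laplacian \<Omega> \<phi>", OF wl])
  then show "AE x in M\<Omega>. weak_laplacian \<Omega> \<phi> x = - z x" by (rule weak_laplacian_unique[OF _ wl])
  show "weak_laplacian \<Omega> \<phi> \<in> L2 M\<Omega>" by (rule Phi_poisson(1)[OF P])
qed

end

subsection \<open>Hidden regularity at the boundary\<close>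

context polygon
begin

abbreviation \<Gamma> :: "(real^2) measure" where "\<Gamma> \<equiv> boundary_measure \<Omega>"

abbreviation U :: "real \<Rightarrow> (real^2) set" where "U \<equiv> collar H \<Omega>"

lemma dom_nonempty: "\<Omega> \<noteq> {}" and convex_dom: "convex \<Omega>"
  using polygonal by (auto simp: convex_polygonal_domain_def)

lemma collar_sets: "U \<epsilon> \<in> sets borel"
proof -
  have "U \<epsilon> = \<Omega> \<inter> (\<Union>h\<in>H. {x. snd h - fst h \<bullet> x \<le> \<epsilon>})" by (auto simp: collar_def split_beta)
  moreover have "{x. snd h - fst h \<bullet> x \<le> \<epsilon>} \<in> sets borel" for h :: "(real^2) \<times> real"
    by (intro borel_closed closed_Collect_le continuous_intros)
  ultimately show ?thesis using dom_sets finite_H by auto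
qed

lemma L2_collar:
  fixes f :: "real^2 \<Rightarrow> 'b::euclidean_space"
  assumes "f \<in> L2 M\<Omega>" shows "(\<lambda>x. indicator (U \<epsilon>) x *\<^sub>R f x) \<in> L2 M\<Omega>"
proof (rule L2_indicator[OF assms])
  have "U \<epsilon> \<inter> \<Omega> \<in> sets lebesgue" using collar_sets dom_sets by auto
  then show "U \<epsilon> \<inter> space M\<Omega> \<in> sets M\<Omega>" using dom_sets by (auto simp: sets_restrict_space)
qed

text \<open>The energy is invariant under dilations of the plane. Comparing a weak solution with its
  dilation \<open>\<psi>((1 + s) x - s x0)\<close>, which vanishes on the collar of width proportional to \<open>s\<close>, bounds
  the energy in the collar by the first power of its width.\<close>

lemma hidden_regularity:
  "\<exists>K\<ge>0. \<exists>\<epsilon>1>0. \<forall>z \<phi> \<epsilon>. z \<in> L2 M\<Omega> \<longrightarrow> weak_poisson_solution \<Omega> z \<phi> \<longrightarrow> 0 < \<epsilon> \<longrightarrow> \<epsilon> \<le> \<epsilon>1 \<longrightarrow>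
    L2_inner M\<Omega> (\<lambda>x. indicator (U \<epsilon>) x *\<^sub>R weak_grad \<Omega> \<phi> x) (\<lambda>x. indicator (U \<epsilon>) x *\<^sub>R weak_grad \<Omega> \<phi> x)
      \<le> K * \<epsilon> * (L2_norm M\<Omega> z * L2_norm M\<Omega> (weak_grad \<Omega> \<phi>))"
proof -
  obtain x0 where x0: "x0 \<in> \<Omega>" using dom_nonempty by blast
  \<comment> \<open>The least slack of the centre x0: a dilation about x0 by the factor 1 + s sends
    a slack d to at most (1 + s) d - s m. The inserted 1 keeps the minimum over a nonempty
    set.\<close>
  define m where "m = Min (insert 1 ((\<lambda>(a, c). c - a \<bullet> x0) ` H))"
  have m0: "m > 0" unfolding m_def using finite_H x0 dom_eq by (subst Min_gr_iff) auto
  have m: "m \<le> c - a \<bullet> x0" if "(a, c) \<in> H" for a c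
    unfolding m_def using finite_H that by (intro Min_le) auto
  obtain B where B: "\<And>x. x \<in> \<Omega> \<Longrightarrow> norm x \<le> B" using bounded_dom by (auto simp: bounded_iff)
  define R where "R = B + norm x0"
  have R: "norm (x - x0) \<le> R" if "x \<in> \<Omega>" for x using B[OF that] norm_triangle_ineq4[of x x0] by (simp add: R_def)
  have R0: "R \<ge> 0" using R[OF x0] by simp
  show ?thesis
  proof (rule exI[of _ "4 * R / m"], rule conjI, goal_cases)
    case 1 show ?case using R0 m0 by simp
  next
    case 2
    show ?case
    proof (rule exI[of _ "m / 2"], intro conjI allI impI)
      show "m / 2 > 0" using m0 by simp
      fix z \<phi> \<epsilon> assume z: "z \<in> L2 M\<Omega>" and sol: "weak_poisson_solution \<Omega> z \<phi>" and \<epsilon>: "0 < \<epsilon>" "\<epsilon> \<le> m / 2"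
      have H: "\<phi> \<in> H10 \<Omega>" and eq: "\<And>\<psi>. \<psi> \<in> test_functions \<Omega> \<Longrightarrow> L2_inner M\<Omega> (weak_grad \<Omega> \<phi>) (grad \<psi>) = L2_inner M\<Omega> z \<psi>"
        using sol weak_poisson_solution_iff[OF z] by auto
      define g where "g = weak_grad \<Omega> \<phi>"
      have g: "g \<in> L2 M\<Omega>" using H10_D(2)[OF H] by (simp add: g_def)
      obtain \<psi> :: "nat \<Rightarrow> real^2 \<Rightarrow> real" where \<psi>: "\<And>k. \<psi> k \<in> test_functions \<Omega>"
        "(\<lambda>k. L2_norm M\<Omega> (\<lambda>x. \<psi> k x - \<phi> x)) \<longlonglongrightarrow> 0" "(\<lambda>k. L2_norm M\<Omega> (\<lambda>x. grad (\<psi> k) x - g x)) \<longlonglongrightarrow> 0"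
        using H10_sequence[OF H] unfolding g_def by blast
      \<comment> \<open>With s m = 2 \<epsilon>, a point of slack at most \<epsilon> is sent to
        slack at most (1 + s) \<epsilon> - 2 \<epsilon> \<le> 0, that is, out of \<Omega>. This uses
        s \<le> 1, hence the restriction \<epsilon> \<le> m / 2.\<close>
      define s where "s = 2 * \<epsilon> / m"
      have s: "0 < s" "s \<le> 1" "s * m = 2 * \<epsilon>" using \<epsilon> m0 by (auto simp: s_def field_simps)
      define D where "D k x = \<psi> k ((1 + s) *\<^sub>R x + (- s *\<^sub>R x0))" for k x
      have Deq: "D k x = \<psi> k (x + s *\<^sub>R (x - x0))" for k x
        by (simp add: D_def algebra_simps)
      have DC: "C_infinity (D k)" for k unfolding D_def by (intro C_infinity_dilate test_functionsD(1)[OF \<psi>(1)])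
      have gD: "grad (D k) x = (1 + s) *\<^sub>R grad (\<psi> k) ((1 + s) *\<^sub>R x + (- s *\<^sub>R x0))" for k x
        unfolding D_def by (rule grad_dilate[OF test_functionsD(1)[OF \<psi>(1)]])
      have Dt: "D k \<in> test_functions \<Omega>" for k
      proof -
        obtain K where K: "compact K" "K \<subseteq> \<Omega>" "\<And>x. x \<notin> K \<Longrightarrow> \<psi> k x = 0" using \<psi>(1)[of k] by (auto simp: test_functions_iff)
        let ?f = "\<lambda>y. (1 / (1 + s)) *\<^sub>R y + (s / (1 + s)) *\<^sub>R x0"
        have "compact (?f ` K)" by (intro compact_continuous_image continuous_intros K)
        moreover have "?f ` K \<subseteq> \<Omega>"
        proof
          fix x assume "x \<in> ?f ` K"
          then obtain y where y: "y \<in> \<Omega>" "x = ?f y" using K by auto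
          then show "x \<in> \<Omega>" using s convexD[OF convex_dom y(1) x0, of "1 / (1 + s)" "s / (1 + s)"]
            by (simp add: field_simps)
        qed
        moreover have "D k x = 0" if "x \<notin> ?f ` K" for x
        proof -
          have "?f ((1 + s) *\<^sub>R x + (- s *\<^sub>R x0)) = x" using s by (simp add: scaleR_right_diff_distrib)
          then have "(1 + s) *\<^sub>R x + (- s *\<^sub>R x0) \<notin> K" using that by (metis imageI)
          then show ?thesis using K(3) by (simp add: D_def)
        qed
        ultimately show ?thesis using DC unfolding test_functions_iff by blast
      qed
      have Dcollar: "grad (D k) x = 0" if "x \<in> U \<epsilon>" for k x
      proof -
        obtain a c where ac: "(a, c) \<in> H" "c - a \<bullet> x \<le> \<epsilon>" using \<open>x \<in> U \<epsilon>\<close> by (auto simp: collar_def)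
        have "c - a \<bullet> ((1 + s) *\<^sub>R x + (- s *\<^sub>R x0)) = (1 + s) * (c - a \<bullet> x) - s * (c - a \<bullet> x0)"
          by (simp add: algebra_simps inner_diff_right inner_add_right)
        also have "\<dots> \<le> 2 * \<epsilon> - s * m"
        proof -
          have "(1 + s) * (c - a \<bullet> x) \<le> (1 + s) * \<epsilon>" using ac(2) s by (intro mult_left_mono) auto
          also have "\<dots> \<le> 2 * \<epsilon>" using s \<epsilon> by (intro mult_right_mono) auto
          finally show ?thesis using mult_left_mono[OF m[OF ac(1)], of s] s by simp
        qed
        finally have le: "c - a \<bullet> ((1 + s) *\<^sub>R x + (- s *\<^sub>R x0)) \<le> 2 * \<epsilon> - s * m" .
        have lt: "a \<bullet> y < c" if "y \<in> \<Omega>" for y using that ac(1) by (auto simp: dom_eq)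
        have "(1 + s) *\<^sub>R x + (- s *\<^sub>R x0) \<notin> \<Omega>" using le s lt[of "(1 + s) *\<^sub>R x + (- s *\<^sub>R x0)"] by fastforce
        then show ?thesis using test_functionsD(3)[OF \<psi>(1)] by (simp add: gD)
      qed
      have DE: "L2_inner M\<Omega> (grad (D k)) (grad (D k)) = L2_inner M\<Omega> (grad (\<psi> k)) (grad (\<psi> k))" for k
      proof -
        have [measurable]: "grad (\<psi> k) \<in> borel_measurable borel"
          by (intro borel_measurable_continuous_onI C_infinity_grad_continuous test_functionsD(1)[OF \<psi>(1)])
        have "ennreal (L2_inner M\<Omega> (grad (D k)) (grad (D k)))
            = (\<integral>\<^sup>+x. ennreal ((1 + s)\<^sup>2) * ennreal ((norm (grad (\<psi> k) ((1 + s) *\<^sub>R x + (- s *\<^sub>R x0))))\<^sup>2) \<partial>lborel)"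
          unfolding nn_integral_grad_test[OF Dt, symmetric] gD
          by (intro nn_integral_cong) (simp add: power_mult_distrib ennreal_mult)
        also have "\<dots> = ennreal ((1 + s)\<^sup>2) * (\<integral>\<^sup>+x. ennreal ((norm (grad (\<psi> k) ((1 + s) *\<^sub>R x + (- s *\<^sub>R x0))))\<^sup>2) \<partial>lborel)"
          by (rule nn_integral_cmult) measurable
        also have "\<dots> = ennreal (L2_inner M\<Omega> (grad (\<psi> k)) (grad (\<psi> k)))"
          unfolding nn_integral_grad_test[OF \<psi>(1), symmetric] using s
          by (intro nn_integral_dilate) auto
        finally show ?thesis by (simp add: L2_inner_self_nonneg)
      qed
      have Ddiff: "L2_norm M\<Omega> (\<lambda>x. D k x - \<psi> k x) \<le> s * R * L2_norm M\<Omega> (grad (\<psi> k))" for k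
      proof -
        have "ennreal (L2_inner M\<Omega> (\<lambda>x. D k x - \<psi> k x) (\<lambda>x. D k x - \<psi> k x))
            = (\<integral>\<^sup>+x. ennreal ((\<psi> k (x + s *\<^sub>R (x - x0)) - \<psi> k x)\<^sup>2) * indicator \<Omega> x \<partial>lborel)"
          using ennreal_L2_inner_continuous[OF C_infinity_continuous[OF C_infinity_diff[OF DC test_functionsD(1)[OF \<psi>(1)]]], of k k]
          by (simp add: Deq)
        also have "\<dots> \<le> ennreal (s\<^sup>2 * R\<^sup>2) * ennreal (L2_inner M\<Omega> (grad (\<psi> k)) (grad (\<psi> k)))"
          unfolding nn_integral_grad_test[OF \<psi>(1), symmetric]
          using s by (intro dilation_bound test_functionsD(1)[OF \<psi>(1)] dom_sets R) auto
        also have "\<dots> = ennreal (s\<^sup>2 * R\<^sup>2 * L2_inner M\<Omega> (grad (\<psi> k)) (grad (\<psi> k)))"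
          by (simp add: ennreal_mult L2_inner_self_nonneg)
        finally have "(L2_norm M\<Omega> (\<lambda>x. D k x - \<psi> k x))\<^sup>2 \<le> (s * R * L2_norm M\<Omega> (grad (\<psi> k)))\<^sup>2"
          by (simp add: L2_inner_self_nonneg L2_norm_sq power_mult_distrib)
        then show ?thesis by (rule power2_le_imp_le) (use s R0 in \<open>simp add: L2_norm_nonneg\<close>)
      qed
      let ?E = "L2_inner M\<Omega> (\<lambda>x. indicator (U \<epsilon>) x *\<^sub>R g x) (\<lambda>x. indicator (U \<epsilon>) x *\<^sub>R g x)"
      have bound: "?E \<le> L2_inner M\<Omega> g g - 2 * L2_inner M\<Omega> (\<psi> k) z + (L2_norm M\<Omega> (grad (\<psi> k)))\<^sup>2
          + 2 * (L2_norm M\<Omega> z * (s * R * L2_norm M\<Omega> (grad (\<psi> k))))" for k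
      proof -
        have d: "(\<lambda>x. g x - grad (D k) x) \<in> L2 M\<Omega>" by (intro L2_diff g test_L2 Dt)
        have "L2_norm M\<Omega> (\<lambda>x. indicator (U \<epsilon>) x *\<^sub>R g x) \<le> L2_norm M\<Omega> (\<lambda>x. g x - grad (D k) x)"
          by (rule L2_norm_mono[OF L2_collar[OF g] d]) (intro AE_I2, auto simp: indicator_def Dcollar)
        then have "?E \<le> L2_inner M\<Omega> (\<lambda>x. g x - grad (D k) x) (\<lambda>x. g x - grad (D k) x)"
          by (simp add: L2_norm_def)
        also have "\<dots> = L2_inner M\<Omega> g g - 2 * L2_inner M\<Omega> g (grad (D k)) + L2_inner M\<Omega> (grad (D k)) (grad (D k))"
          using L2_inner_sym[of M\<Omega> "grad (D k)" g] by (simp add: L2_inner_add g test_L2 Dt L2_diff)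
        also have "L2_inner M\<Omega> g (grad (D k)) = L2_inner M\<Omega> z (D k)" unfolding g_def by (rule eq[OF Dt])
        also have "L2_inner M\<Omega> z (D k) = L2_inner M\<Omega> z (\<psi> k) + L2_inner M\<Omega> z (\<lambda>x. D k x - \<psi> k x)"
          using L2_inner_add(4)[OF test_L2(1)[OF Dt] test_L2(1)[OF \<psi>(1)] z, of k k] by simp
        also have "L2_inner M\<Omega> (grad (D k)) (grad (D k)) = (L2_norm M\<Omega> (grad (\<psi> k)))\<^sup>2" by (simp add: DE L2_norm_sq)
        finally have 1: "?E \<le> L2_inner M\<Omega> g g - 2 * (L2_inner M\<Omega> z (\<psi> k) + L2_inner M\<Omega> z (\<lambda>x. D k x - \<psi> k x)) + (L2_norm M\<Omega> (grad (\<psi> k)))\<^sup>2" .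
        have "\<bar>L2_inner M\<Omega> z (\<lambda>x. D k x - \<psi> k x)\<bar> \<le> L2_norm M\<Omega> z * L2_norm M\<Omega> (\<lambda>x. D k x - \<psi> k x)"
          by (intro L2_cauchy_schwarz z L2_diff test_L2 Dt \<psi>(1))
        also have "\<dots> \<le> L2_norm M\<Omega> z * (s * R * L2_norm M\<Omega> (grad (\<psi> k)))"
          by (intro mult_left_mono Ddiff L2_norm_nonneg)
        finally have 2: "\<bar>L2_inner M\<Omega> z (\<lambda>x. D k x - \<psi> k x)\<bar> \<le> L2_norm M\<Omega> z * (s * R * L2_norm M\<Omega> (grad (\<psi> k)))" .
        have "E \<le> A - 2 * p' + C + 2 * X" if "E \<le> A - 2 * (p + q) + C" "\<bar>q\<bar> \<le> X" "p = p'" for E A p q C X p' :: real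
          using that(1,3) abs_le_D2[OF that(2)] by (simp add: algebra_simps)
        from this[OF 1 2 L2_inner_sym] show ?thesis .
      qed
      \<comment> \<open>In the limit \<psi> k becomes \<phi>, and the energy identity makes the
        first three terms cancel. Only the displacement term of order s remains, and s = 2
        \<epsilon> / m produces the constant 4 R / m.\<close>
      have "?E \<le> L2_inner M\<Omega> g g - 2 * L2_inner M\<Omega> \<phi> z + (L2_norm M\<Omega> g)\<^sup>2 + 2 * (L2_norm M\<Omega> z * (s * R * L2_norm M\<Omega> g))"
      proof (rule tendsto_lowerbound)
        show "(\<lambda>k. L2_inner M\<Omega> g g - 2 * L2_inner M\<Omega> (\<psi> k) z + (L2_norm M\<Omega> (grad (\<psi> k)))\<^sup>2
          + 2 * (L2_norm M\<Omega> z * (s * R * L2_norm M\<Omega> (grad (\<psi> k))))) \<longlonglongrightarrow>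
          L2_inner M\<Omega> g g - 2 * L2_inner M\<Omega> \<phi> z + (L2_norm M\<Omega> g)\<^sup>2 + 2 * (L2_norm M\<Omega> z * (s * R * L2_norm M\<Omega> g))"
          by (intro tendsto_intros L2_inner_tendsto[OF test_L2(1)[OF \<psi>(1)] H10_D(1)[OF H] z \<psi>(2)]
            L2_norm_tendsto[OF test_L2(2)[OF \<psi>(1)] g \<psi>(3)])
      qed (use bound in auto)
      also have "L2_inner M\<Omega> \<phi> z = L2_inner M\<Omega> g g"
        unfolding g_def using weak_poisson_energy[OF z sol] L2_inner_sym[of M\<Omega> z \<phi>] by simp
      also have "L2_inner M\<Omega> g g - 2 * L2_inner M\<Omega> g g + (L2_norm M\<Omega> g)\<^sup>2 + 2 * (L2_norm M\<Omega> z * (s * R * L2_norm M\<Omega> g))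
          = 4 * R / m * \<epsilon> * (L2_norm M\<Omega> z * L2_norm M\<Omega> g)"
        by (simp add: L2_norm_sq s_def)
      finally show "L2_inner M\<Omega> (\<lambda>x. indicator (U \<epsilon>) x *\<^sub>R weak_grad \<Omega> \<phi> x) (\<lambda>x. indicator (U \<epsilon>) x *\<^sub>R weak_grad \<Omega> \<phi> x)
        \<le> 4 * R / m * \<epsilon> * (L2_norm M\<Omega> z * L2_norm M\<Omega> (weak_grad \<Omega> \<phi>))" by (simp add: g_def)
    qed
  qed
qed

section \<open>Traces and the flux through the boundary\<close>

lemma finite_\<Gamma>: "finite_measure \<Gamma>" by (rule finite_measure_boundary[OF polygonal])

lemma continuous_L2_\<Gamma>:
  fixes f :: "real^2 \<Rightarrow> real"
  assumes "continuous_on (frontier \<Omega>) f" shows "f \<in> L2 \<Gamma>"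
proof -
  have "compact (frontier \<Omega>)" using bounded_dom by (intro compact_frontier_bounded)
  then have "bounded (f ` frontier \<Omega>)" using assms by (intro compact_imp_bounded compact_continuous_image)
  then obtain B where B: "\<And>x. x \<in> frontier \<Omega> \<Longrightarrow> norm (f x) \<le> B" by (auto simp: bounded_iff)
  show ?thesis
  proof (rule L2_bounded[OF finite_\<Gamma>])
    have "f \<in> borel_measurable (restrict_space borel (frontier \<Omega>))"
      by (rule borel_measurable_continuous_on_restrict[OF assms])
    then show "f \<in> borel_measurable \<Gamma>" using measurable_cong_sets[OF sets_boundary_measure refl] by blast
    show "AE x in \<Gamma>. norm (f x) \<le> B" using B by (intro AE_I2) (auto simp: space_boundary_measure)
  qed
qed

lemma C_infinity_L2_\<Gamma>: "C_infinity f \<Longrightarrow> f \<in> L2 \<Gamma>"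
  by (intro continuous_L2_\<Gamma> C_infinity_continuous)

lemma collar_L2_bound:
  "\<exists>C\<ge>0. \<forall>\<psi> \<sigma>. C_infinity \<psi> \<longrightarrow> 0 < \<sigma> \<longrightarrow> (\<exists>\<epsilon>0>0. \<forall>\<epsilon>. 0 < \<epsilon> \<and> \<epsilon> \<le> \<epsilon>0 \<longrightarrow>
    L2_inner M\<Omega> (\<lambda>x. indicator (U \<epsilon>) x *\<^sub>R \<psi> x) (\<lambda>x. indicator (U \<epsilon>) x *\<^sub>R \<psi> x) \<le> \<epsilon> * (C * (L2_norm \<Gamma> \<psi>)\<^sup>2 + \<sigma>))"
proof -
  have half: "a \<noteq> 0 \<and> (\<forall>x\<in>closure \<Omega>. a \<bullet> x \<le> c) \<and>
      (\<exists>(p, q)\<in>sides \<Omega>. closure \<Omega> \<inter> {x. a \<bullet> x = c} = closed_segment p q)" if "(a, c) \<in> H" for a c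
    using facets[OF that] that closure_eq by auto
  from collar_bound[OF polygonal finite_H half] obtain C where C: "C \<ge> 0" and CB: "\<forall>f \<sigma>. continuous_on UNIV f \<and> (\<forall>x. 0 \<le> f x) \<and> 0 < \<sigma> \<longrightarrow> (\<exists>\<epsilon>0>0. \<forall>\<epsilon>. 0 < \<epsilon> \<and> \<epsilon> \<le> \<epsilon>0 \<longrightarrow>
    (\<integral>\<^sup>+x. ennreal (f x) * indicator (U \<epsilon>) x \<partial>lborel)
      \<le> ennreal \<epsilon> * (ennreal C * (\<integral>\<^sup>+x. ennreal (f x) \<partial>\<Gamma>) + ennreal \<sigma>))" by auto
  show ?thesis
  proof (rule exI[of _ C], intro conjI allI impI C)
    fix \<psi> :: "real^2 \<Rightarrow> real" and \<sigma> :: real assume \<psi>: "C_infinity \<psi>" and \<sigma>: "0 < \<sigma>"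
    have "continuous_on UNIV (\<lambda>x. (\<psi> x)\<^sup>2) \<and> (\<forall>x. 0 \<le> (\<psi> x)\<^sup>2) \<and> 0 < \<sigma>"
      using \<sigma> by (intro conjI continuous_intros C_infinity_continuous \<psi>) auto
    from CB[THEN spec, THEN spec, THEN mp, OF this] obtain \<epsilon>0 where \<epsilon>0: "\<epsilon>0 > 0" "\<And>\<epsilon>. 0 < \<epsilon> \<and> \<epsilon> \<le> \<epsilon>0 \<Longrightarrow>
      (\<integral>\<^sup>+x. ennreal ((\<psi> x)\<^sup>2) * indicator (U \<epsilon>) x \<partial>lborel) \<le> ennreal \<epsilon> * (ennreal C * (\<integral>\<^sup>+x. ennreal ((\<psi> x)\<^sup>2) \<partial>\<Gamma>) + ennreal \<sigma>)"
      by (elim exE conjE) (rule that, simp, blast)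
    show "\<exists>\<epsilon>0>0. \<forall>\<epsilon>. 0 < \<epsilon> \<and> \<epsilon> \<le> \<epsilon>0 \<longrightarrow>
      L2_inner M\<Omega> (\<lambda>x. indicator (U \<epsilon>) x *\<^sub>R \<psi> x) (\<lambda>x. indicator (U \<epsilon>) x *\<^sub>R \<psi> x) \<le> \<epsilon> * (C * (L2_norm \<Gamma> \<psi>)\<^sup>2 + \<sigma>)"
    proof (rule exI[of _ \<epsilon>0], intro conjI allI impI \<epsilon>0(1))
      fix \<epsilon> assume \<epsilon>: "0 < \<epsilon> \<and> \<epsilon> \<le> \<epsilon>0"
      have "ennreal (L2_inner M\<Omega> (\<lambda>x. indicator (U \<epsilon>) x *\<^sub>R \<psi> x) (\<lambda>x. indicator (U \<epsilon>) x *\<^sub>R \<psi> x))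
          = (\<integral>\<^sup>+x. ennreal ((norm (indicator (U \<epsilon>) x *\<^sub>R \<psi> x))\<^sup>2) * indicator \<Omega> x \<partial>lborel)"
        unfolding nn_integral_L2[OF L2_collar[OF C_infinity_L2(1)[OF \<psi>]], symmetric] by (rule nn_integral_lebesgue_on[OF dom_sets(2)])
      also have "\<dots> = (\<integral>\<^sup>+x. ennreal ((\<psi> x)\<^sup>2) * indicator (U \<epsilon>) x \<partial>lborel)"
        by (intro nn_integral_cong) (auto simp: indicator_def collar_def)
      also have "\<dots> \<le> ennreal \<epsilon> * (ennreal C * (\<integral>\<^sup>+x. ennreal ((\<psi> x)\<^sup>2) \<partial>\<Gamma>) + ennreal \<sigma>)" by (rule \<epsilon>0(2)[OF \<epsilon>])
      also have "(\<integral>\<^sup>+x. ennreal ((\<psi> x)\<^sup>2) \<partial>\<Gamma>) = ennreal ((L2_norm \<Gamma> \<psi>)\<^sup>2)"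
        using nn_integral_L2[OF C_infinity_L2_\<Gamma>[OF \<psi>]] by (simp add: L2_norm_sq)
      also have "ennreal \<epsilon> * (ennreal C * ennreal ((L2_norm \<Gamma> \<psi>)\<^sup>2) + ennreal \<sigma>) = ennreal (\<epsilon> * (C * (L2_norm \<Gamma> \<psi>)\<^sup>2 + \<sigma>))"
        using C \<sigma> \<epsilon> by (simp add: ennreal_mult ennreal_plus)
      finally show "L2_inner M\<Omega> (\<lambda>x. indicator (U \<epsilon>) x *\<^sub>R \<psi> x) (\<lambda>x. indicator (U \<epsilon>) x *\<^sub>R \<psi> x) \<le> \<epsilon> * (C * (L2_norm \<Gamma> \<psi>)\<^sup>2 + \<sigma>)"
        using C \<sigma> \<epsilon> by simp
    qed
  qed
qed

text \<open>The functional vanishes on test functions, so \<psi> may be replaced by (1 - \<zeta>)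
  \<psi>, which lives in the collar. The dangerous term \<psi> grad \<zeta> has size 1/\<epsilon>,
  but it is paired with grad \<phi>, and the collar norms of grad \<phi> and of \<psi> are each of
  order sqrt \<epsilon>. A bound remains that sees \<psi> only through its trace; all other terms
  disappear with \<epsilon>.\<close>

lemma flux_bound:
  "\<exists>C\<ge>0. \<forall>z \<phi> \<psi>. z \<in> L2 M\<Omega> \<longrightarrow> weak_poisson_solution \<Omega> z \<phi> \<longrightarrow> C_infinity \<psi> \<longrightarrow>
     \<bar>L2_inner M\<Omega> (weak_grad \<Omega> \<phi>) (grad \<psi>) - L2_inner M\<Omega> z \<psi>\<bar>
       \<le> C * sqrt (L2_norm M\<Omega> z * L2_norm M\<Omega> (weak_grad \<Omega> \<phi>)) * L2_norm \<Gamma> \<psi>"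
proof -
  obtain K \<epsilon>1 where K: "K \<ge> 0" "\<epsilon>1 > 0" and hidden: "\<And>z \<phi> \<epsilon>. z \<in> L2 M\<Omega> \<Longrightarrow> weak_poisson_solution \<Omega> z \<phi> \<Longrightarrow> 0 < \<epsilon> \<Longrightarrow> \<epsilon> \<le> \<epsilon>1 \<Longrightarrow>
    L2_inner M\<Omega> (\<lambda>x. indicator (U \<epsilon>) x *\<^sub>R weak_grad \<Omega> \<phi> x) (\<lambda>x. indicator (U \<epsilon>) x *\<^sub>R weak_grad \<Omega> \<phi> x)
      \<le> K * \<epsilon> * (L2_norm M\<Omega> z * L2_norm M\<Omega> (weak_grad \<Omega> \<phi>))" using hidden_regularity by auto
  obtain C where C: "C \<ge> 0" and CB: "\<And>\<psi> \<sigma>. C_infinity \<psi> \<Longrightarrow> 0 < \<sigma> \<Longrightarrow> (\<exists>\<epsilon>0>0. \<forall>\<epsilon>. 0 < \<epsilon> \<and> \<epsilon> \<le> \<epsilon>0 \<longrightarrow>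
    L2_inner M\<Omega> (\<lambda>x. indicator (U \<epsilon>) x *\<^sub>R \<psi> x) (\<lambda>x. indicator (U \<epsilon>) x *\<^sub>R \<psi> x) \<le> \<epsilon> * (C * (L2_norm \<Gamma> \<psi>)\<^sup>2 + \<sigma>))"
    using collar_L2_bound by auto
  obtain J where J: "J \<ge> 0" and cut: "\<And>\<epsilon>. 0 < \<epsilon> \<Longrightarrow> \<exists>\<zeta>. C_infinity \<zeta> \<and> (\<forall>x. 0 \<le> \<zeta> x \<and> \<zeta> x \<le> 1) \<and>
     (\<forall>x. (\<exists>(a, c)\<in>H. c - a \<bullet> x \<le> \<epsilon> / 2) \<longrightarrow> \<zeta> x = 0) \<and> (\<forall>x. norm (grad \<zeta> x) \<le> J / \<epsilon>) \<and>
     (\<forall>x\<in>\<Omega> - U \<epsilon>. \<zeta> x = 1 \<and> grad \<zeta> x = 0)" using cutoff_exists by auto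
  show ?thesis
  proof (rule exI[of _ "J * sqrt K * sqrt C"], intro conjI allI impI)
    show "0 \<le> J * sqrt K * sqrt C" using J K C by simp
    fix z \<phi> \<psi> assume z: "z \<in> L2 M\<Omega>" and sol: "weak_poisson_solution \<Omega> z \<phi>" and \<psi>: "C_infinity \<psi>"
    have H: "\<phi> \<in> H10 \<Omega>" and eq: "\<And>\<psi>. \<psi> \<in> test_functions \<Omega> \<Longrightarrow> L2_inner M\<Omega> (weak_grad \<Omega> \<phi>) (grad \<psi>) = L2_inner M\<Omega> z \<psi>"
      using sol weak_poisson_solution_iff[OF z] by auto
    define g where "g = weak_grad \<Omega> \<phi>"
    have g: "g \<in> L2 M\<Omega>" using H10_D(2)[OF H] by (simp add: g_def)
    define m where "m = L2_norm M\<Omega> z * L2_norm M\<Omega> g"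
    have m0: "m \<ge> 0" by (simp add: m_def L2_norm_nonneg)
    let ?L = "\<bar>L2_inner M\<Omega> g (grad \<psi>) - L2_inner M\<Omega> z \<psi>\<bar>"
    have \<psi>L: "\<psi> \<in> L2 M\<Omega>" "grad \<psi> \<in> L2 M\<Omega>" using C_infinity_L2 \<psi> by auto
    have step: "?L \<le> J * sqrt (K * m) * sqrt (C * (L2_norm \<Gamma> \<psi>)\<^sup>2 + \<sigma>)" if \<sigma>: "\<sigma> > 0" for \<sigma>
    proof -
      define T where "T = C * (L2_norm \<Gamma> \<psi>)\<^sup>2 + \<sigma>"
      have T0: "T \<ge> 0" using C \<sigma> by (simp add: T_def)
      obtain \<epsilon>0 where \<epsilon>0: "\<epsilon>0 > 0" "\<And>\<epsilon>. 0 < \<epsilon> \<Longrightarrow> \<epsilon> \<le> \<epsilon>0 \<Longrightarrow>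
        L2_inner M\<Omega> (\<lambda>x. indicator (U \<epsilon>) x *\<^sub>R \<psi> x) (\<lambda>x. indicator (U \<epsilon>) x *\<^sub>R \<psi> x) \<le> \<epsilon> * T"
        using CB[OF \<psi> \<sigma>] unfolding T_def by blast
      have main: "?L \<le> J * sqrt (K * m) * sqrt T + sqrt \<epsilon> * (sqrt (K * m) * L2_norm M\<Omega> (grad \<psi>) + L2_norm M\<Omega> z * sqrt T)"
        if \<epsilon>: "0 < \<epsilon>" "\<epsilon> < min \<epsilon>0 \<epsilon>1" for \<epsilon>
      proof -
        let ?g = "\<lambda>x. indicator (U \<epsilon>) x *\<^sub>R g x" and ?p = "\<lambda>x. indicator (U \<epsilon>) x *\<^sub>R \<psi> x"
        have gn: "L2_norm M\<Omega> ?g \<le> sqrt \<epsilon> * sqrt (K * m)"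
        proof -
          have "L2_inner M\<Omega> ?g ?g \<le> \<epsilon> * (K * m)"
            using hidden[OF z sol \<epsilon>(1)] \<epsilon>(2) by (simp add: g_def m_def mult_ac)
          then show ?thesis unfolding L2_norm_def real_sqrt_mult[symmetric] by (rule real_sqrt_le_mono)
        qed
        have pn: "L2_norm M\<Omega> ?p \<le> sqrt \<epsilon> * sqrt T"
          using \<epsilon>0(2)[OF \<epsilon>(1)] \<epsilon>(2) unfolding L2_norm_def real_sqrt_mult[symmetric] by (intro real_sqrt_le_mono) simp
        obtain \<zeta> where \<zeta>: "C_infinity \<zeta>" "\<forall>x. 0 \<le> \<zeta> x \<and> \<zeta> x \<le> 1"
          "\<forall>x. (\<exists>(a, c)\<in>H. c - a \<bullet> x \<le> \<epsilon> / 2) \<longrightarrow> \<zeta> x = 0" "\<forall>x. norm (grad \<zeta> x) \<le> J / \<epsilon>"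
          "\<forall>x\<in>\<Omega> - U \<epsilon>. \<zeta> x = 1 \<and> grad \<zeta> x = 0" using cut[OF \<epsilon>(1)] by (elim exE conjE) (rule that)
        define h where "h x = \<zeta> x * \<psi> x" for x
        have ht: "h \<in> test_functions \<Omega>" unfolding h_def[abs_def]
          by (rule cutoff_test[OF \<zeta>(1) _ \<epsilon>(1) \<psi>]) (use \<zeta>(3) in blast)
        have gh: "grad h x = \<zeta> x *\<^sub>R grad \<psi> x + \<psi> x *\<^sub>R grad \<zeta> x" for x
          unfolding h_def[abs_def] by (rule grad_mult[OF \<zeta>(1) \<psi>])
        have hL: "h \<in> L2 M\<Omega>" "grad h \<in> L2 M\<Omega>" using test_L2[OF ht] by auto
        let ?d = "\<lambda>x. grad \<psi> x - grad h x" and ?e = "\<lambda>x. \<psi> x - h x"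
        have dL: "?d \<in> L2 M\<Omega>" and eL: "?e \<in> L2 M\<Omega>" by (intro L2_diff \<psi>L hL)+
        have "L2_inner M\<Omega> g (grad \<psi>) - L2_inner M\<Omega> z \<psi> = L2_inner M\<Omega> g ?d - L2_inner M\<Omega> z ?e"
          using eq[OF ht] by (simp add: L2_inner_add g z \<psi>L hL g_def[symmetric])
        \<comment> \<open>Off the collar \<zeta> is 1 with zero gradient, so the gradients of \<psi>
          and of \<zeta> \<psi> coincide there and g may be cut off to the collar.\<close>
        moreover have "L2_inner M\<Omega> g ?d = L2_inner M\<Omega> ?g ?d"
          unfolding L2_inner_def using \<zeta>(5) by (intro Bochner_Integration.integral_cong refl) (auto simp: indicator_def gh)
        moreover have "\<bar>L2_inner M\<Omega> ?g ?d\<bar> \<le> L2_norm M\<Omega> ?g * L2_norm M\<Omega> ?d"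
          by (rule L2_cauchy_schwarz[OF L2_collar[OF g] dL])
        moreover have "\<bar>L2_inner M\<Omega> z ?e\<bar> \<le> L2_norm M\<Omega> z * L2_norm M\<Omega> ?e" by (rule L2_cauchy_schwarz[OF z eL])
        moreover have "L2_norm M\<Omega> ?e \<le> sqrt \<epsilon> * sqrt T"
        proof -
          have "L2_norm M\<Omega> ?e \<le> L2_norm M\<Omega> ?p"
          proof (rule L2_norm_mono[OF eL L2_collar[OF \<psi>L(1)]], intro AE_I2)
            fix x assume "x \<in> space M\<Omega>"
            then have x: "x \<in> \<Omega>" by simp
            have "?e x = (1 - \<zeta> x) * \<psi> x" by (simp add: h_def algebra_simps)
            then show "norm (?e x) \<le> norm (?p x)"
              using \<zeta>(2,5) x by (cases "x \<in> U \<epsilon>") (auto simp: abs_mult mult_left_le_one_le)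
          qed
          then show ?thesis using pn by simp
        qed
        moreover have "L2_norm M\<Omega> ?d \<le> L2_norm M\<Omega> (grad \<psi>) + J / \<epsilon> * (sqrt \<epsilon> * sqrt T)"
        proof -
          let ?d1 = "\<lambda>x. (1 - \<zeta> x) *\<^sub>R grad \<psi> x" and ?d2 = "\<lambda>x. \<psi> x *\<^sub>R grad \<zeta> x"
          have d2: "?d2 \<in> L2 M\<Omega>"
            by (intro continuous_L2 continuous_intros C_infinity_continuous C_infinity_grad_continuous \<psi> \<zeta>(1))
          have d1: "?d1 \<in> L2 M\<Omega>"
            by (intro continuous_L2 continuous_intros C_infinity_continuous C_infinity_grad_continuous \<psi> \<zeta>(1))
          have "?d = (\<lambda>x. ?d1 x - ?d2 x)" by (simp add: gh algebra_simps fun_eq_iff)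
          then have "L2_norm M\<Omega> ?d \<le> L2_norm M\<Omega> ?d1 + L2_norm M\<Omega> ?d2" using L2_norm_triangle(2)[OF d1 d2] by simp
          moreover have "L2_norm M\<Omega> ?d1 \<le> L2_norm M\<Omega> (grad \<psi>)"
            using \<zeta>(2) by (intro L2_norm_mono[OF d1 \<psi>L(2)] AE_I2) (auto simp: mult_left_le_one_le)
          moreover have "L2_norm M\<Omega> ?d2 \<le> J / \<epsilon> * L2_norm M\<Omega> ?p"
          proof -
            have "L2_norm M\<Omega> ?d2 \<le> L2_norm M\<Omega> (\<lambda>x. (J / \<epsilon>) *\<^sub>R ?p x)"
            proof (rule L2_norm_mono[OF d2 L2_scaleR[OF L2_collar[OF \<psi>L(1)]]], intro AE_I2)
              fix x assume "x \<in> space M\<Omega>"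
              then have x: "x \<in> \<Omega>" by simp
              show "norm (?d2 x) \<le> norm ((J / \<epsilon>) *\<^sub>R ?p x)"
              proof (cases "x \<in> U \<epsilon>")
                case True
                have "\<bar>\<psi> x\<bar> * norm (grad \<zeta> x) \<le> \<bar>\<psi> x\<bar> * (J / \<epsilon>)" using \<zeta>(4) by (intro mult_left_mono) auto
                then show ?thesis using True J \<epsilon>(1) by (simp add: abs_mult mult.commute)
              qed (use \<zeta>(5) x in auto)
            qed
            then show ?thesis using L2_norm_scaleR[OF L2_collar[OF \<psi>L(1)], of "J / \<epsilon>" \<epsilon>] J \<epsilon>(1) by simp
          qed
          moreover have "J / \<epsilon> * L2_norm M\<Omega> ?p \<le> J / \<epsilon> * (sqrt \<epsilon> * sqrt T)"
            using J \<epsilon>(1) by (intro mult_left_mono pn) auto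
          ultimately show ?thesis by linarith
        qed
        ultimately have "?L \<le> sqrt \<epsilon> * sqrt (K * m) * (L2_norm M\<Omega> (grad \<psi>) + J / \<epsilon> * (sqrt \<epsilon> * sqrt T)) + L2_norm M\<Omega> z * (sqrt \<epsilon> * sqrt T)"
        proof -
          assume 1: "L2_inner M\<Omega> g (grad \<psi>) - L2_inner M\<Omega> z \<psi> = L2_inner M\<Omega> g ?d - L2_inner M\<Omega> z ?e"
            "L2_inner M\<Omega> g ?d = L2_inner M\<Omega> ?g ?d" "\<bar>L2_inner M\<Omega> ?g ?d\<bar> \<le> L2_norm M\<Omega> ?g * L2_norm M\<Omega> ?d"
            "\<bar>L2_inner M\<Omega> z ?e\<bar> \<le> L2_norm M\<Omega> z * L2_norm M\<Omega> ?e" "L2_norm M\<Omega> ?e \<le> sqrt \<epsilon> * sqrt T"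
            "L2_norm M\<Omega> ?d \<le> L2_norm M\<Omega> (grad \<psi>) + J / \<epsilon> * (sqrt \<epsilon> * sqrt T)"
          have "L2_norm M\<Omega> ?g * L2_norm M\<Omega> ?d \<le> sqrt \<epsilon> * sqrt (K * m) * (L2_norm M\<Omega> (grad \<psi>) + J / \<epsilon> * (sqrt \<epsilon> * sqrt T))"
            using gn 1(6) \<epsilon>(1) K m0 by (intro mult_mono) (auto simp: L2_norm_nonneg)
          moreover have "L2_norm M\<Omega> z * L2_norm M\<Omega> ?e \<le> L2_norm M\<Omega> z * (sqrt \<epsilon> * sqrt T)"
            by (intro mult_left_mono 1 L2_norm_nonneg)
          ultimately show ?thesis using 1 by linarith
        qed
        \<comment> \<open>The powers cancel exactly: sqrt \<epsilon> from the energy, sqrt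
          \<epsilon> from \<psi> and J / \<epsilon> from the cutoff leave J.\<close>
        also have "\<dots> = J * sqrt (K * m) * sqrt T + sqrt \<epsilon> * (sqrt (K * m) * L2_norm M\<Omega> (grad \<psi>) + L2_norm M\<Omega> z * sqrt T)"
        proof -
          have "sqrt \<epsilon> * (J / \<epsilon> * sqrt \<epsilon>) = J" using \<epsilon>(1) by (simp add: field_simps)
          then have "sqrt \<epsilon> * sqrt (K * m) * (J / \<epsilon> * (sqrt \<epsilon> * sqrt T)) = J * sqrt (K * m) * sqrt T"
            by (metis (no_types, opaque_lifting) mult.assoc mult.commute)
          then show ?thesis by (simp add: distrib_left mult_ac)
        qed
        finally show ?thesis .
      qed
      have "?L \<le> J * sqrt (K * m) * sqrt T + sqrt 0 * (sqrt (K * m) * L2_norm M\<Omega> (grad \<psi>) + L2_norm M\<Omega> z * sqrt T)"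
      proof (rule tendsto_lowerbound)
        show "((\<lambda>\<epsilon>. J * sqrt (K * m) * sqrt T + sqrt \<epsilon> * (sqrt (K * m) * L2_norm M\<Omega> (grad \<psi>) + L2_norm M\<Omega> z * sqrt T)) \<longlongrightarrow>
          J * sqrt (K * m) * sqrt T + sqrt 0 * (sqrt (K * m) * L2_norm M\<Omega> (grad \<psi>) + L2_norm M\<Omega> z * sqrt T)) (at_right 0)"
          by (intro tendsto_intros)
        have "0 < min \<epsilon>0 \<epsilon>1" using \<epsilon>0 K by simp
        then show "\<forall>\<^sub>F \<epsilon> in at_right 0. ?L \<le> J * sqrt (K * m) * sqrt T + sqrt \<epsilon> * (sqrt (K * m) * L2_norm M\<Omega> (grad \<psi>) + L2_norm M\<Omega> z * sqrt T)"
          using main unfolding eventually_at_right_field by blast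
      qed simp
      then show ?thesis by (simp add: T_def)
    qed
    \<comment> \<open>Now the error \<sigma> of the strip estimate is sent to 0. It had to stay
      fixed while \<epsilon> tended to 0, because the admissible widths depend on it.\<close>
    have "?L \<le> J * sqrt (K * m) * sqrt (C * (L2_norm \<Gamma> \<psi>)\<^sup>2 + 0)"
    proof (rule tendsto_lowerbound)
      show "((\<lambda>\<sigma>. J * sqrt (K * m) * sqrt (C * (L2_norm \<Gamma> \<psi>)\<^sup>2 + \<sigma>)) \<longlongrightarrow> J * sqrt (K * m) * sqrt (C * (L2_norm \<Gamma> \<psi>)\<^sup>2 + 0)) (at_right 0)"
        by (intro tendsto_intros)
      show "\<forall>\<^sub>F \<sigma> in at_right 0. ?L \<le> J * sqrt (K * m) * sqrt (C * (L2_norm \<Gamma> \<psi>)\<^sup>2 + \<sigma>)"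
        using step unfolding eventually_at_right_field by (intro exI[of _ 1]) auto
    qed simp
    then show "\<bar>L2_inner M\<Omega> (weak_grad \<Omega> \<phi>) (grad \<psi>) - L2_inner M\<Omega> z \<psi>\<bar>
       \<le> J * sqrt K * sqrt C * sqrt (L2_norm M\<Omega> z * L2_norm M\<Omega> (weak_grad \<Omega> \<phi>)) * L2_norm \<Gamma> \<psi>"
      by (simp add: g_def m_def real_sqrt_mult L2_norm_nonneg mult_ac)
  qed
qed

end

subsection \<open>Normal derivatives and transposition solutions\<close>

lemma L2_norm_cong_diff:
  fixes f g h :: "'a \<Rightarrow> 'b::euclidean_space"
  assumes "f \<in> L2 M" "g \<in> L2 M" "h \<in> L2 M" "AE x in M. f x = g x"
  shows "L2_inner M f h = L2_inner M g h" "L2_inner M h f = L2_inner M h g" "L2_norm M f = L2_norm M g"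
  using assms by (auto intro!: L2_inner_cong_AE L2_norm_cong_AE L2_measurable)

context polygon
begin

lemma AE_eq_if_smooth_inner_eq:
  assumes g: "g \<in> L2 \<Gamma>" "g' \<in> L2 \<Gamma>" and eq: "\<And>\<psi>. C_infinity \<psi> \<Longrightarrow> L2_inner \<Gamma> g \<psi> = L2_inner \<Gamma> g' \<psi>"
  shows "AE x in \<Gamma>. g x = g' x"
proof -
  have d: "(\<lambda>x. g x - g' x) \<in> L2 \<Gamma>" by (intro L2_diff g)
  have "AE x in \<Gamma>. g x - g' x = 0"
  proof (rule AE_zero_if_orthogonal_to_smooth[OF finite_\<Gamma>])
    show "sets \<Gamma> = sets (restrict_space borel (space \<Gamma>))" by (simp add: sets_boundary_measure space_boundary_measure)
    show "integrable \<Gamma> (\<lambda>x. g x - g' x)" by (rule L2_integrable[OF finite_\<Gamma> d])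
    fix \<psi> :: "real^2 \<Rightarrow> real" assume \<psi>: "C_infinity \<psi>"
    show "(LINT x|\<Gamma>. (g x - g' x) * \<psi> x) = 0"
      using L2_inner_add(3)[OF g C_infinity_L2_\<Gamma>[OF \<psi>]] eq[OF \<psi>] by (simp add: L2_inner_def)
  qed
  then show ?thesis by eventually_elim simp
qed

text \<open>Linear combinations of weak gradients are treated as vector fields in this closure,
  without forming the corresponding combinations of functions in \<open>H10\<close>.\<close>

definition grad_closure :: "(real^2 \<Rightarrow> real^2) set" where
  "grad_closure = {g \<in> L2 M\<Omega>. \<exists>\<psi>. (\<forall>k::nat. \<psi> k \<in> test_functions \<Omega>) \<and> (\<lambda>k. L2_norm M\<Omega> (\<lambda>x. grad (\<psi> k) x - g x)) \<longlonglongrightarrow> 0}"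

lemma weak_grad_closure: "\<phi> \<in> H10 \<Omega> \<Longrightarrow> weak_grad \<Omega> \<phi> \<in> grad_closure"
  unfolding grad_closure_def using H10_D(2) by (auto elim!: H10_sequence)

lemma grad_closure_lincomb:
  assumes "f \<in> grad_closure" "g \<in> grad_closure" shows "(\<lambda>x. f x + c *\<^sub>R g x) \<in> grad_closure"
proof -
  obtain \<psi> \<eta> where \<psi>: "\<And>k::nat. \<psi> k \<in> test_functions \<Omega>" "(\<lambda>k. L2_norm M\<Omega> (\<lambda>x. grad (\<psi> k) x - f x)) \<longlonglongrightarrow> 0" "f \<in> L2 M\<Omega>"
    and \<eta>: "\<And>k::nat. \<eta> k \<in> test_functions \<Omega>" "(\<lambda>k. L2_norm M\<Omega> (\<lambda>x. grad (\<eta> k) x - g x)) \<longlonglongrightarrow> 0" "g \<in> L2 M\<Omega>"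
    using assms by (auto simp: grad_closure_def)
  have t: "(\<lambda>x. \<psi> k x + c * \<eta> k x) \<in> test_functions \<Omega>" for k by (intro test_functions_add test_functions_cmult \<psi> \<eta>)
  have le: "L2_norm M\<Omega> (\<lambda>x. grad (\<lambda>x. \<psi> k x + c * \<eta> k x) x - (f x + c *\<^sub>R g x))
      \<le> L2_norm M\<Omega> (\<lambda>x. grad (\<psi> k) x - f x) + \<bar>c\<bar> * L2_norm M\<Omega> (\<lambda>x. grad (\<eta> k) x - g x)" for k
  proof -
    note d = L2_diff[OF test_L2(2)[OF \<psi>(1)] \<psi>(3), of k] L2_diff[OF test_L2(2)[OF \<eta>(1)] \<eta>(3), of k]
    have eq: "grad (\<lambda>x. \<psi> k x + c * \<eta> k x) x - (f x + c *\<^sub>R g x) = (grad (\<psi> k) x - f x) + c *\<^sub>R (grad (\<eta> k) x - g x)" for x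
      using test_functionsD(1)[OF \<psi>(1)[of k]] test_functionsD(1)[OF \<eta>(1)[of k]]
      by (simp add: grad_add grad_cmult C_infinity_cmult algebra_simps)
    show ?thesis unfolding eq using L2_norm_triangle(1)[OF d(1) L2_scaleR[OF d(2), of c]] L2_norm_scaleR[OF d(2), of c] by simp
  qed
  have lim: "(\<lambda>k. L2_norm M\<Omega> (\<lambda>x. grad (\<psi> k) x - f x) + \<bar>c\<bar> * L2_norm M\<Omega> (\<lambda>x. grad (\<eta> k) x - g x)) \<longlonglongrightarrow> 0 + \<bar>c\<bar> * 0"
    by (intro tendsto_intros \<psi> \<eta>)
  have "(\<lambda>k. L2_norm M\<Omega> (\<lambda>x. grad (\<lambda>x. \<psi> k x + c * \<eta> k x) x - (f x + c *\<^sub>R g x))) \<longlonglongrightarrow> 0"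
    using le lim by (intro Lim_null_comparison[OF always_eventually, OF allI lim[simplified]]) (simp add: L2_norm_nonneg)
  then show ?thesis unfolding grad_closure_def using t \<psi>(3) \<eta>(3)
    by (auto intro!: L2_add L2_scaleR exI[of _ "\<lambda>k x. \<psi> k x + c * \<eta> k x"])
qed

text \<open>As a limit of gradients of test functions, g is orthogonal to itself.\<close>

lemma grad_closure_orthogonal:
  assumes g: "g \<in> grad_closure" and orth: "\<And>\<psi>. \<psi> \<in> test_functions \<Omega> \<Longrightarrow> L2_inner M\<Omega> g (grad \<psi>) = 0"
  shows "AE x in M\<Omega>. g x = 0"
proof -
  obtain \<psi> where \<psi>: "\<And>k::nat. \<psi> k \<in> test_functions \<Omega>" "(\<lambda>k. L2_norm M\<Omega> (\<lambda>x. grad (\<psi> k) x - g x)) \<longlonglongrightarrow> 0" "g \<in> L2 M\<Omega>"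
    using g by (auto simp: grad_closure_def)
  have "(\<lambda>k. L2_inner M\<Omega> (grad (\<psi> k)) g) \<longlonglongrightarrow> L2_inner M\<Omega> g g"
    by (rule L2_inner_tendsto[OF test_L2(2)[OF \<psi>(1)] \<psi>(3,3,2)])
  moreover have "L2_inner M\<Omega> (grad (\<psi> k)) g = 0" for k using orth[OF \<psi>(1)] L2_inner_sym[of M\<Omega> g] by simp
  ultimately show ?thesis using L2_eq_ae_zero[OF \<psi>(3)] by (simp add: LIMSEQ_const_iff)
qed

lemma weak_grad_lincomb:
  assumes z: "z1 \<in> L2 M\<Omega>" "z2 \<in> L2 M\<Omega>"
    and sol: "weak_poisson_solution \<Omega> z1 \<phi>1" "weak_poisson_solution \<Omega> z2 \<phi>2"
      "weak_poisson_solution \<Omega> (\<lambda>x. z1 x + c * z2 x) \<phi>"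
  shows "AE x in M\<Omega>. weak_grad \<Omega> \<phi> x = weak_grad \<Omega> \<phi>1 x + c *\<^sub>R weak_grad \<Omega> \<phi>2 x"
proof -
  have cz: "(\<lambda>x. c * z2 x) \<in> L2 M\<Omega>" and zc: "(\<lambda>x. z1 x + c * z2 x) \<in> L2 M\<Omega>" using z L2_mult L2_add by blast+
  have H: "\<phi>1 \<in> H10 \<Omega>" "\<phi>2 \<in> H10 \<Omega>" "\<phi> \<in> H10 \<Omega>" using sol by (auto simp: weak_poisson_solution_def)
  note g = H(1)[THEN H10_D(2)] H(2)[THEN H10_D(2)] H(3)[THEN H10_D(2)]
  let ?h = "\<lambda>x. weak_grad \<Omega> \<phi>1 x + c *\<^sub>R weak_grad \<Omega> \<phi>2 x"
  have h: "?h \<in> L2 M\<Omega>" by (intro L2_add L2_scaleR g)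
  have "AE x in M\<Omega>. ?h x + (-1) *\<^sub>R weak_grad \<Omega> \<phi> x = 0"
  proof (rule grad_closure_orthogonal[OF grad_closure_lincomb[OF grad_closure_lincomb]])
    fix \<psi> assume \<psi>: "\<psi> \<in> test_functions \<Omega>"
    have "L2_inner M\<Omega> (weak_grad \<Omega> \<phi>1) (grad \<psi>) = L2_inner M\<Omega> z1 \<psi>" "L2_inner M\<Omega> (weak_grad \<Omega> \<phi>2) (grad \<psi>) = L2_inner M\<Omega> z2 \<psi>"
      "L2_inner M\<Omega> (weak_grad \<Omega> \<phi>) (grad \<psi>) = L2_inner M\<Omega> (\<lambda>x. z1 x + c * z2 x) \<psi>"
      using sol weak_poisson_solution_iff z zc \<psi> by blast+
    then show "L2_inner M\<Omega> (\<lambda>x. ?h x + (-1) *\<^sub>R weak_grad \<Omega> \<phi> x) (grad \<psi>) = 0"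
      using L2_inner_add(1)[OF h L2_scaleR[OF g(3), of "-1"] test_L2(2)[OF \<psi>]]
        L2_inner_add(1)[OF g(1) L2_scaleR[OF g(2), of c] test_L2(2)[OF \<psi>]] L2_inner_add(1)[OF z(1) cz test_L2(1)[OF \<psi>]]
      by (simp add: L2_inner_scale L2_inner_cmult L2_inner_minus)
  qed (intro weak_grad_closure H)+
  then show ?thesis by eventually_elim simp
qed

lemma weak_grad_unique:
  assumes z: "z \<in> L2 M\<Omega>" and "weak_poisson_solution \<Omega> z \<phi>" "weak_poisson_solution \<Omega> z \<phi>'"
  shows "AE x in M\<Omega>. weak_grad \<Omega> \<phi> x = weak_grad \<Omega> \<phi>' x"
  using weak_grad_lincomb[OF z z assms(3,3), of 0 \<phi>] assms(2) by simp

text \<open>By \<open>flux_bound\<close> the right-hand side of Green's formula is a bounded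
  functional of the trace of \<psi>, so the Riesz argument in L^2(\<Gamma>) provides a normal
  derivative. The chosen one satisfies the same identities and equals it almost everywhere, which
  transfers the bound.\<close>

lemma normal_derivative_bound:
  "\<exists>C\<ge>0. \<forall>z \<phi>. z \<in> L2 M\<Omega> \<longrightarrow> weak_poisson_solution \<Omega> z \<phi> \<longrightarrow> normal_derivative \<Omega> \<phi> \<in> L2 \<Gamma> \<and>
    (\<forall>\<psi>. C_infinity \<psi> \<longrightarrow> L2_inner \<Gamma> (normal_derivative \<Omega> \<phi>) \<psi> = L2_inner M\<Omega> (weak_grad \<Omega> \<phi>) (grad \<psi>) - L2_inner M\<Omega> z \<psi>) \<and>
    L2_norm \<Gamma> (normal_derivative \<Omega> \<phi>) \<le> C * sqrt (L2_norm M\<Omega> z * L2_norm M\<Omega> (weak_grad \<Omega> \<phi>))"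
proof -
  obtain C where C: "C \<ge> 0" and flux: "\<And>z \<phi> \<psi>. z \<in> L2 M\<Omega> \<Longrightarrow> weak_poisson_solution \<Omega> z \<phi> \<Longrightarrow> C_infinity \<psi> \<Longrightarrow>
     \<bar>L2_inner M\<Omega> (weak_grad \<Omega> \<phi>) (grad \<psi>) - L2_inner M\<Omega> z \<psi>\<bar>
       \<le> C * sqrt (L2_norm M\<Omega> z * L2_norm M\<Omega> (weak_grad \<Omega> \<phi>)) * L2_norm \<Gamma> \<psi>" using flux_bound by auto
  interpret V: semi_hilbert "L2 \<Gamma> :: (real^2 \<Rightarrow> real) set" "L2_inner \<Gamma>" by (rule semi_hilbert_L2)
  show ?thesis
  proof (rule exI[of _ C], rule conjI[OF C], intro allI impI)
    fix z \<phi> assume z: "z \<in> L2 M\<Omega>" and sol: "weak_poisson_solution \<Omega> z \<phi>"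
    let ?g = "weak_grad \<Omega> \<phi>"
    have g: "?g \<in> L2 M\<Omega>" using sol H10_D(2) by (auto simp: weak_poisson_solution_def)
    define l where "l \<psi> = L2_inner M\<Omega> ?g (grad \<psi>) - L2_inner M\<Omega> z \<psi>" for \<psi>
    let ?C = "C * sqrt (L2_norm M\<Omega> z * L2_norm M\<Omega> ?g)"
    have "\<exists>X h. (\<forall>n::nat. X n \<in> Collect C_infinity) \<and> h \<in> L2 \<Gamma> \<and> (\<lambda>n. sqrt (L2_inner \<Gamma> (\<lambda>x. X n x - h x) (\<lambda>x. X n x - h x))) \<longlonglongrightarrow> 0 \<and>
      (\<forall>w\<in>Collect C_infinity. L2_inner \<Gamma> h w = l w) \<and> sqrt (L2_inner \<Gamma> h h) \<le> ?C"
    proof (rule V.riesz)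
      show "Collect C_infinity \<subseteq> L2 \<Gamma>" using C_infinity_L2_\<Gamma> by auto
      show "(\<lambda>x. 0) \<in> Collect C_infinity" using C_infinity_const by simp
      show "0 \<le> ?C" using C by (simp add: L2_norm_nonneg)
      fix f assume "f \<in> Collect C_infinity"
      then have f: "C_infinity f" by simp
      show "\<bar>l f\<bar> \<le> ?C * sqrt (L2_inner \<Gamma> f f)" using flux[OF z sol f] by (simp add: l_def L2_norm_def)
      show "(\<lambda>x. c *\<^sub>R f x) \<in> Collect C_infinity" for c using C_infinity_cmult[OF f] by simp
      show "l (\<lambda>x. c *\<^sub>R f x) = c * l f" for c
        unfolding l_def using ext[of "grad (\<lambda>x. c * f x)", OF grad_cmult[OF f, of c]] by (simp add: L2_inner_scale L2_inner_cmult right_diff_distrib)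
      fix f' assume "f' \<in> Collect C_infinity"
      then have f': "C_infinity f'" by simp
      show "(\<lambda>x. f x + f' x) \<in> Collect C_infinity" using C_infinity_add[OF f f'] by simp
      show "l (\<lambda>x. f x + f' x) = l f + l f'"
        unfolding l_def using ext[of "grad (\<lambda>x. f x + f' x)", OF grad_add[OF f f']]
        by (simp add: L2_inner_add(2)[OF C_infinity_L2(2)[OF f] C_infinity_L2(2)[OF f'] g] L2_inner_add(2)[OF C_infinity_L2(1)[OF f] C_infinity_L2(1)[OF f'] z])
    qed
    then obtain h where h: "h \<in> L2 \<Gamma>" "\<And>\<psi>. C_infinity \<psi> \<Longrightarrow> L2_inner \<Gamma> h \<psi> = l \<psi>" "L2_norm \<Gamma> h \<le> ?C"
      by (auto simp: L2_norm_def)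
    \<comment> \<open>The definition of the normal derivative refers to the chosen weak Laplacian;
      this equals - z almost everywhere, which turns Green's formula into l.\<close>
    have wl: "L2_inner M\<Omega> (weak_laplacian \<Omega> \<phi>) \<psi> = - L2_inner M\<Omega> z \<psi>" if "C_infinity \<psi>" for \<psi>
      using L2_norm_cong_diff(1)[OF poisson_Phi(3)[OF z sol] L2_minus[OF z] C_infinity_L2(1)[OF that] poisson_Phi(2)[OF z sol]]
      by (simp add: L2_inner_minus)
    have nd_iff: "has_normal_derivative \<Omega> \<phi> f \<longleftrightarrow> f \<in> L2 \<Gamma> \<and> (\<forall>\<psi>. C_infinity \<psi> \<longrightarrow> L2_inner \<Gamma> f \<psi> = l \<psi>)" for f
      unfolding has_normal_derivative_def l_def using wl by auto
    let ?n = "normal_derivative \<Omega> \<phi>"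
    have "has_normal_derivative \<Omega> \<phi> ?n"
      unfolding normal_derivative_def by (rule someI[of "has_normal_derivative \<Omega> \<phi>" h]) (use h in \<open>simp add: nd_iff\<close>)
    then have n: "?n \<in> L2 \<Gamma>" "\<And>\<psi>. C_infinity \<psi> \<Longrightarrow> L2_inner \<Gamma> ?n \<psi> = l \<psi>" by (auto simp: nd_iff)
    have "AE x in \<Gamma>. ?n x = h x" by (rule AE_eq_if_smooth_inner_eq[OF n(1) h(1)]) (simp add: n h)
    then have "L2_norm \<Gamma> ?n = L2_norm \<Gamma> h" by (rule L2_norm_cong_diff(3)[OF n(1) h(1,1)])
    then show "?n \<in> L2 \<Gamma> \<and> (\<forall>\<psi>. C_infinity \<psi> \<longrightarrow> L2_inner \<Gamma> ?n \<psi> = L2_inner M\<Omega> ?g (grad \<psi>) - L2_inner M\<Omega> z \<psi>) \<and>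
      L2_norm \<Gamma> ?n \<le> ?C" using n h(3) by (simp add: l_def)
  qed
qed

text \<open>\<open>S_adj\<close> is built from one chosen solution. Solutions for the same z have
  the same gradient almost everywhere, so its properties may be stated for any solution
  \<phi>.\<close>

lemma S_adj_bound:
  "\<exists>C\<ge>0. \<forall>z\<in>L2 M\<Omega>. S_adj \<Omega> z \<in> L2 \<Gamma> \<and> (\<forall>\<phi>. weak_poisson_solution \<Omega> z \<phi> \<longrightarrow>
    (\<forall>\<psi>. C_infinity \<psi> \<longrightarrow> L2_inner \<Gamma> (S_adj \<Omega> z) \<psi> = L2_inner M\<Omega> z \<psi> - L2_inner M\<Omega> (weak_grad \<Omega> \<phi>) (grad \<psi>)) \<and>
    (AE x in \<Gamma>. S_adj \<Omega> z x = - normal_derivative \<Omega> \<phi> x) \<and>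
    L2_norm \<Gamma> (S_adj \<Omega> z) \<le> C * sqrt (L2_norm M\<Omega> z * L2_norm M\<Omega> (weak_grad \<Omega> \<phi>)))"
proof -
  obtain C where C: "C \<ge> 0" and nd: "\<And>z \<phi>. z \<in> L2 M\<Omega> \<Longrightarrow> weak_poisson_solution \<Omega> z \<phi> \<Longrightarrow> normal_derivative \<Omega> \<phi> \<in> L2 \<Gamma>"
    "\<And>z \<phi> \<psi>. z \<in> L2 M\<Omega> \<Longrightarrow> weak_poisson_solution \<Omega> z \<phi> \<Longrightarrow> C_infinity \<psi> \<Longrightarrow> L2_inner \<Gamma> (normal_derivative \<Omega> \<phi>) \<psi> = L2_inner M\<Omega> (weak_grad \<Omega> \<phi>) (grad \<psi>) - L2_inner M\<Omega> z \<psi>"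
    "\<And>z \<phi>. z \<in> L2 M\<Omega> \<Longrightarrow> weak_poisson_solution \<Omega> z \<phi> \<Longrightarrow> L2_norm \<Gamma> (normal_derivative \<Omega> \<phi>) \<le> C * sqrt (L2_norm M\<Omega> z * L2_norm M\<Omega> (weak_grad \<Omega> \<phi>))"
    using normal_derivative_bound by auto
  show ?thesis
  proof (rule exI[of _ C], rule conjI[OF C], intro ballI conjI allI impI)
    fix z :: "real^2 \<Rightarrow> real" assume z: "z \<in> L2 M\<Omega>"
    define \<phi>0 where "\<phi>0 = (SOME \<phi>. weak_poisson_solution \<Omega> z \<phi>)"
    have s0: "weak_poisson_solution \<Omega> z \<phi>0" unfolding \<phi>0_def using weak_poisson_exists[OF z] by (rule someI_ex)
    have S: "S_adj \<Omega> z = (\<lambda>x. - normal_derivative \<Omega> \<phi>0 x)" by (simp add: S_adj_def \<phi>0_def)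
    show SL: "S_adj \<Omega> z \<in> L2 \<Gamma>" unfolding S by (rule L2_minus[OF nd(1)[OF z s0]])
    fix \<phi> assume sol: "weak_poisson_solution \<Omega> z \<phi>"
    have H: "\<phi> \<in> H10 \<Omega>" "\<phi>0 \<in> H10 \<Omega>" using sol s0 by (auto simp: weak_poisson_solution_def)
    have eq: "L2_inner M\<Omega> (weak_grad \<Omega> \<phi>0) (grad \<psi>) = L2_inner M\<Omega> (weak_grad \<Omega> \<phi>) (grad \<psi>)" if "C_infinity \<psi>" for \<psi>
      by (rule L2_norm_cong_diff(1)[OF H10_D(2)[OF H(2)] H10_D(2)[OF H(1)] C_infinity_L2(2)[OF that] weak_grad_unique[OF z s0 sol]])
    show 1: "L2_inner \<Gamma> (S_adj \<Omega> z) \<psi> = L2_inner M\<Omega> z \<psi> - L2_inner M\<Omega> (weak_grad \<Omega> \<phi>) (grad \<psi>)" if "C_infinity \<psi>" for \<psi>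
      unfolding S using nd(2)[OF z s0 that] eq[OF that] by (simp add: L2_inner_minus)
    show 2: "AE x in \<Gamma>. S_adj \<Omega> z x = - normal_derivative \<Omega> \<phi> x"
      by (rule AE_eq_if_smooth_inner_eq[OF SL L2_minus[OF nd(1)[OF z sol]]]) (simp add: 1 nd(2)[OF z sol] L2_inner_minus)
    show "L2_norm \<Gamma> (S_adj \<Omega> z) \<le> C * sqrt (L2_norm M\<Omega> z * L2_norm M\<Omega> (weak_grad \<Omega> \<phi>))"
      using L2_norm_cong_diff(3)[OF SL L2_minus[OF nd(1)[OF z sol]] SL 2] nd(3)[OF z sol] by (simp add: L2_norm_minus)
  qed
qed

section \<open>Boundedness and duality of the two solution operators\<close>

lemma S_adj_L2: "z \<in> L2 M\<Omega> \<Longrightarrow> S_adj \<Omega> z \<in> L2 \<Gamma>"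
  using S_adj_bound by blast

lemma S_adj_lincomb:
  assumes z: "z1 \<in> L2 M\<Omega>" "z2 \<in> L2 M\<Omega>"
  shows "AE x in \<Gamma>. S_adj \<Omega> (\<lambda>x. z1 x + c * z2 x) x = S_adj \<Omega> z1 x + c * S_adj \<Omega> z2 x"
proof -
  have cz: "(\<lambda>x. c * z2 x) \<in> L2 M\<Omega>" and zc: "(\<lambda>x. z1 x + c * z2 x) \<in> L2 M\<Omega>" using z L2_mult L2_add by blast+
  obtain \<phi>1 \<phi>2 \<phi> where sol: "weak_poisson_solution \<Omega> z1 \<phi>1" "weak_poisson_solution \<Omega> z2 \<phi>2" "weak_poisson_solution \<Omega> (\<lambda>x. z1 x + c * z2 x) \<phi>"
    using weak_poisson_exists z zc by metis
  have H: "\<phi>1 \<in> H10 \<Omega>" "\<phi>2 \<in> H10 \<Omega>" "\<phi> \<in> H10 \<Omega>" using sol by (auto simp: weak_poisson_solution_def)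
  note g = H(1)[THEN H10_D(2)] H(2)[THEN H10_D(2)] H(3)[THEN H10_D(2)]
  note S = S_adj_L2[OF z(1)] S_adj_L2[OF z(2)] S_adj_L2[OF zc]
  have ip: "L2_inner \<Gamma> (S_adj \<Omega> z) \<psi> = L2_inner M\<Omega> z \<psi> - L2_inner M\<Omega> (weak_grad \<Omega> \<phi>) (grad \<psi>)"
    if "z \<in> L2 M\<Omega>" "weak_poisson_solution \<Omega> z \<phi>" "C_infinity \<psi>" for z \<phi> \<psi> using S_adj_bound that by blast
  show ?thesis
  proof (rule AE_eq_if_smooth_inner_eq[OF S(3) L2_add[OF S(1) L2_mult[OF S(2)]]])
    fix \<psi> :: "real^2 \<Rightarrow> real" assume \<psi>: "C_infinity \<psi>"
    note \<psi>L = C_infinity_L2[OF \<psi>] C_infinity_L2_\<Gamma>[OF \<psi>]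
    have "L2_inner M\<Omega> (weak_grad \<Omega> \<phi>) (grad \<psi>) = L2_inner M\<Omega> (\<lambda>x. weak_grad \<Omega> \<phi>1 x + c *\<^sub>R weak_grad \<Omega> \<phi>2 x) (grad \<psi>)"
      by (rule L2_norm_cong_diff(1)[OF g(3) L2_add[OF g(1) L2_scaleR[OF g(2)]] \<psi>L(2) weak_grad_lincomb[OF z sol]])
    then show "L2_inner \<Gamma> (S_adj \<Omega> (\<lambda>x. z1 x + c * z2 x)) \<psi> = L2_inner \<Gamma> (\<lambda>x. S_adj \<Omega> z1 x + c * S_adj \<Omega> z2 x) \<psi>"
      using L2_inner_add(1)[OF S(1) L2_mult[OF S(2)] \<psi>L(3), of c] L2_inner_add(1)[OF z(1) cz \<psi>L(1)]
        L2_inner_add(1)[OF g(1) L2_scaleR[OF g(2)] \<psi>L(2), of c] ip[OF z(1) sol(1) \<psi>] ip[OF z(2) sol(2) \<psi>] ip[OF zc sol(3) \<psi>]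
      by (simp add: L2_inner_cmult L2_inner_scale algebra_simps)
  qed
qed

lemma poincare_H10:
  "\<exists>P\<ge>0. \<forall>\<phi>\<in>H10 \<Omega>. L2_norm M\<Omega> \<phi> \<le> P * L2_norm M\<Omega> (weak_grad \<Omega> \<phi>)"
proof -
  obtain P where P: "P \<ge> 0" "\<And>\<psi>. \<psi> \<in> test_functions \<Omega> \<Longrightarrow> L2_norm M\<Omega> \<psi> \<le> P * L2_norm M\<Omega> (grad \<psi>)"
    using poincare_test by blast
  have "L2_norm M\<Omega> \<phi> \<le> P * L2_norm M\<Omega> (weak_grad \<Omega> \<phi>)" if H: "\<phi> \<in> H10 \<Omega>" for \<phi>
  proof -
    obtain \<psi> :: "nat \<Rightarrow> real^2 \<Rightarrow> real" where \<psi>: "\<And>k. \<psi> k \<in> test_functions \<Omega>"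
      "(\<lambda>k. L2_norm M\<Omega> (\<lambda>x. \<psi> k x - \<phi> x)) \<longlonglongrightarrow> 0" "(\<lambda>k. L2_norm M\<Omega> (\<lambda>x. grad (\<psi> k) x - weak_grad \<Omega> \<phi> x)) \<longlonglongrightarrow> 0"
      using H10_sequence[OF H] by blast
    show ?thesis
    proof (rule LIMSEQ_le)
      show "(\<lambda>k. L2_norm M\<Omega> (\<psi> k)) \<longlonglongrightarrow> L2_norm M\<Omega> \<phi>" by (rule L2_norm_tendsto[OF test_L2(1)[OF \<psi>(1)] H10_D(1)[OF H] \<psi>(2)])
      show "(\<lambda>k. P * L2_norm M\<Omega> (grad (\<psi> k))) \<longlonglongrightarrow> P * L2_norm M\<Omega> (weak_grad \<Omega> \<phi>)"
        by (intro tendsto_intros L2_norm_tendsto[OF test_L2(2)[OF \<psi>(1)] H10_D(2)[OF H] \<psi>(3)])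
    qed (use P(2)[OF \<psi>(1)] in blast)
  qed
  with P(1) show ?thesis by blast
qed

text \<open>The energy identity and the Poincare inequality bound the energy norm by P
  \<parallel>z\<parallel>, so the geometric mean in \<open>S_adj_bound\<close> becomes a multiple of
  \<parallel>z\<parallel>.\<close>

lemma S_adj_bounded: "\<exists>C\<ge>0. \<forall>z\<in>L2 M\<Omega>. L2_norm \<Gamma> (S_adj \<Omega> z) \<le> C * L2_norm M\<Omega> z"
proof -
  obtain C where C: "C \<ge> 0" and S: "\<And>z \<phi>. z \<in> L2 M\<Omega> \<Longrightarrow> weak_poisson_solution \<Omega> z \<phi> \<Longrightarrow>
    L2_norm \<Gamma> (S_adj \<Omega> z) \<le> C * sqrt (L2_norm M\<Omega> z * L2_norm M\<Omega> (weak_grad \<Omega> \<phi>))" using S_adj_bound by auto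
  obtain P where P: "P \<ge> 0" "\<And>\<phi>. \<phi> \<in> H10 \<Omega> \<Longrightarrow> L2_norm M\<Omega> \<phi> \<le> P * L2_norm M\<Omega> (weak_grad \<Omega> \<phi>)" using poincare_H10 by blast
  have "L2_norm \<Gamma> (S_adj \<Omega> z) \<le> (C * sqrt P) * L2_norm M\<Omega> z" if z: "z \<in> L2 M\<Omega>" for z
  proof -
    obtain \<phi> where sol: "weak_poisson_solution \<Omega> z \<phi>" using weak_poisson_exists[OF z] by blast
    then have H: "\<phi> \<in> H10 \<Omega>" by (simp add: weak_poisson_solution_def)
    let ?e = "L2_norm M\<Omega> (weak_grad \<Omega> \<phi>)"
    have "?e * ?e = L2_inner M\<Omega> z \<phi>" using weak_poisson_energy[OF z sol] L2_norm_sq[of M\<Omega> "weak_grad \<Omega> \<phi>"] by (simp add: power2_eq_square)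
    also have "\<dots> \<le> L2_norm M\<Omega> z * L2_norm M\<Omega> \<phi>" using L2_cauchy_schwarz[OF z H10_D(1)[OF H]] by simp
    also have "\<dots> \<le> L2_norm M\<Omega> z * (P * ?e)" by (intro mult_left_mono P H L2_norm_nonneg)
    finally have "?e * ?e \<le> (P * L2_norm M\<Omega> z) * ?e" by (simp add: mult_ac)
    then have "?e \<le> P * L2_norm M\<Omega> z" using P(1) L2_norm_nonneg[of M\<Omega> "weak_grad \<Omega> \<phi>"] L2_norm_nonneg[of M\<Omega> z]
      by (cases "?e > 0") (auto intro: order_trans)
    then have "sqrt (L2_norm M\<Omega> z * ?e) \<le> sqrt (L2_norm M\<Omega> z * (P * L2_norm M\<Omega> z))"
      by (intro real_sqrt_le_mono mult_left_mono L2_norm_nonneg)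
    also have "\<dots> = sqrt P * L2_norm M\<Omega> z" by (simp add: real_sqrt_mult L2_norm_nonneg)
    finally have "C * sqrt (L2_norm M\<Omega> z * ?e) \<le> C * (sqrt P * L2_norm M\<Omega> z)" by (intro mult_left_mono C)
    then show ?thesis using S[OF z sol] by simp
  qed
  then show ?thesis using C P by (intro exI[of _ "C * sqrt P"]) auto
qed

text \<open>The functional z \<mapsto> (u, S_adj z) is bounded, and its representer is a
  transposition solution, so the choice in \<open>S_op\<close> selects a genuine one. Conversely,
  every z is up to sign the weak Laplacian of an element of \<open>Phi\<close>, whence the selected
  state satisfies the adjoint identity for all z.\<close>

lemma S_op_adjoint:
  assumes u: "u \<in> L2 \<Gamma>"
  shows "S_op \<Omega> u \<in> L2 M\<Omega>" "\<And>z. z \<in> L2 M\<Omega> \<Longrightarrow> L2_inner M\<Omega> (S_op \<Omega> u) z = L2_inner \<Gamma> u (S_adj \<Omega> z)"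
proof -
  interpret V: semi_hilbert "L2 M\<Omega> :: (real^2 \<Rightarrow> real) set" "L2_inner M\<Omega>" by (rule semi_hilbert_L2)
  obtain C where C: "C \<ge> 0" "\<And>z. z \<in> L2 M\<Omega> \<Longrightarrow> L2_norm \<Gamma> (S_adj \<Omega> z) \<le> C * L2_norm M\<Omega> z" using S_adj_bounded by blast
  have Snd: "AE x in \<Gamma>. S_adj \<Omega> z x = - normal_derivative \<Omega> \<phi> x"
    if "z \<in> L2 M\<Omega>" "weak_poisson_solution \<Omega> z \<phi>" for z \<phi> using S_adj_bound that by blast
  have ndL: "normal_derivative \<Omega> \<phi> \<in> L2 \<Gamma>" if "z \<in> L2 M\<Omega>" "weak_poisson_solution \<Omega> z \<phi>" for z \<phi>
    using normal_derivative_bound that by blast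
  define l where "l z = L2_inner \<Gamma> u (S_adj \<Omega> z)" for z
  have lin: "l (\<lambda>x. z1 x + c * z2 x) = l z1 + c * l z2" if z: "z1 \<in> L2 M\<Omega>" "z2 \<in> L2 M\<Omega>" for z1 z2 c
  proof -
    note S = S_adj_L2[OF z(1)] S_adj_L2[OF z(2)] S_adj_L2[OF L2_add[OF z(1) L2_mult[OF z(2)]]]
    have "l (\<lambda>x. z1 x + c * z2 x) = L2_inner \<Gamma> u (\<lambda>x. S_adj \<Omega> z1 x + c * S_adj \<Omega> z2 x)"
      unfolding l_def by (rule L2_norm_cong_diff(2)[OF S(3) L2_add[OF S(1) L2_mult[OF S(2)]] u S_adj_lincomb[OF z]])
    then show ?thesis using L2_inner_add(2)[OF S(1) L2_mult[OF S(2)] u, of c] by (simp add: l_def L2_inner_cmult)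
  qed
  have "\<exists>X y. (\<forall>n::nat. X n \<in> L2 M\<Omega>) \<and> y \<in> L2 M\<Omega> \<and> (\<lambda>n. sqrt (L2_inner M\<Omega> (\<lambda>x. X n x - y x) (\<lambda>x. X n x - y x))) \<longlonglongrightarrow> 0 \<and>
      (\<forall>w\<in>L2 M\<Omega>. L2_inner M\<Omega> y w = l w) \<and> sqrt (L2_inner M\<Omega> y y) \<le> L2_norm \<Gamma> u * C"
  proof (rule V.riesz)
    show "0 \<le> L2_norm \<Gamma> u * C" using C by (simp add: L2_norm_nonneg)
    have z0: "(\<lambda>x. 0) \<in> L2 M\<Omega>" by (rule L2_zero)
    have l0: "l (\<lambda>x. 0) = 0" using lin[OF z0 z0, of 1] by simp
    fix f :: "real^2 \<Rightarrow> real" assume f: "f \<in> L2 M\<Omega>"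
    show "l (\<lambda>x. c *\<^sub>R f x) = c * l f" for c using lin[OF z0 f, of c] l0 by simp
    have "\<bar>l f\<bar> \<le> L2_norm \<Gamma> u * L2_norm \<Gamma> (S_adj \<Omega> f)" unfolding l_def by (rule L2_cauchy_schwarz[OF u S_adj_L2[OF f]])
    also have "\<dots> \<le> L2_norm \<Gamma> u * (C * L2_norm M\<Omega> f)" by (intro mult_left_mono C f L2_norm_nonneg)
    finally show "\<bar>l f\<bar> \<le> L2_norm \<Gamma> u * C * sqrt (L2_inner M\<Omega> f f)" by (simp add: L2_norm_def)
    fix g :: "real^2 \<Rightarrow> real" assume g: "g \<in> L2 M\<Omega>"
    show "l (\<lambda>x. f x + g x) = l f + l g" using lin[OF f g, of 1] by simp
  qed (auto intro: L2_zero L2_add L2_mult)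
  then obtain y where y: "y \<in> L2 M\<Omega>" "\<And>w. w \<in> L2 M\<Omega> \<Longrightarrow> L2_inner M\<Omega> y w = l w" by auto
  have "transposition_solution \<Omega> u y"
    unfolding transposition_solution_def
  proof (intro conjI ballI y(1))
    fix \<phi> assume \<phi>: "\<phi> \<in> Phi \<Omega>"
    note P = Phi_poisson[OF \<phi>]
    let ?z = "\<lambda>x. - weak_laplacian \<Omega> \<phi> x"
    have z: "?z \<in> L2 M\<Omega>" by (rule L2_minus[OF P(1)])
    have "L2_inner M\<Omega> y ?z = L2_inner \<Gamma> u (\<lambda>x. - normal_derivative \<Omega> \<phi> x)"
      unfolding y(2)[OF z] l_def
      by (rule L2_norm_cong_diff(2)[OF S_adj_L2[OF z] L2_minus[OF ndL[OF z P(2)]] u Snd[OF z P(2)]])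
    then show "L2_inner M\<Omega> y ?z = - L2_inner \<Gamma> u (normal_derivative \<Omega> \<phi>)" by (simp add: L2_inner_minus)
  qed
  then have S: "transposition_solution \<Omega> u (S_op \<Omega> u)" unfolding S_op_def by (rule someI[of "transposition_solution \<Omega> u"])
  then show SL: "S_op \<Omega> u \<in> L2 M\<Omega>" by (simp add: transposition_solution_def)
  fix z :: "real^2 \<Rightarrow> real" assume z: "z \<in> L2 M\<Omega>"
  obtain \<phi> where sol: "weak_poisson_solution \<Omega> z \<phi>" using weak_poisson_exists[OF z] by blast
  note P = poisson_Phi[OF z sol]
  have "L2_inner M\<Omega> (S_op \<Omega> u) z = L2_inner M\<Omega> (S_op \<Omega> u) (\<lambda>x. - weak_laplacian \<Omega> \<phi> x)"
    by (rule L2_norm_cong_diff(2)[OF z L2_minus[OF P(3)] SL]) (use P(2) in \<open>auto elim!: eventually_mono\<close>)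
  also have "\<dots> = - L2_inner \<Gamma> u (normal_derivative \<Omega> \<phi>)" using S P(1) by (simp add: transposition_solution_def)
  also have "\<dots> = L2_inner \<Gamma> u (\<lambda>x. - normal_derivative \<Omega> \<phi> x)" by (simp add: L2_inner_minus)
  also have "\<dots> = L2_inner \<Gamma> u (S_adj \<Omega> z)"
    by (rule L2_norm_cong_diff(2)[OF L2_minus[OF ndL[OF z sol]] S_adj_L2[OF z] u]) (use Snd[OF z sol] in \<open>auto elim!: eventually_mono\<close>)
  finally show "L2_inner M\<Omega> (S_op \<Omega> u) z = L2_inner \<Gamma> u (S_adj \<Omega> z)" .
qed

end

subsection \<open>Averages over a grid\<close>

lemma L2_sum:
  fixes f :: "'i \<Rightarrow> 'a \<Rightarrow> 'b::euclidean_space"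
  assumes "\<And>i. i \<in> I \<Longrightarrow> f i \<in> L2 M" shows "(\<lambda>x. \<Sum>i\<in>I. f i x) \<in> L2 M"
  using assms
proof (induction I rule: infinite_finite_induct)
  case (insert i I)
  then show ?case using L2_add[of "f i" M "\<lambda>x. \<Sum>i\<in>I. f i x"] by simp
qed (simp_all add: L2_zero)

lemma L2_inner_sum:
  fixes f :: "'i \<Rightarrow> 'a \<Rightarrow> 'b::euclidean_space"
  assumes "\<And>i. i \<in> I \<Longrightarrow> f i \<in> L2 M" "g \<in> L2 M"
  shows "L2_inner M (\<lambda>x. \<Sum>i\<in>I. f i x) g = (\<Sum>i\<in>I. L2_inner M (f i) g)"
  unfolding L2_inner_def inner_sum_left
  by (rule Bochner_Integration.integral_sum) (rule L2_inner_integrable[OF assms(1,2)])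

lemma L2_norm_sum:
  fixes f :: "'i \<Rightarrow> 'a \<Rightarrow> 'b::euclidean_space"
  assumes "\<And>i. i \<in> I \<Longrightarrow> f i \<in> L2 M"
  shows "L2_norm M (\<lambda>x. \<Sum>i\<in>I. f i x) \<le> (\<Sum>i\<in>I. L2_norm M (f i))"
  using assms
proof (induction I rule: infinite_finite_induct)
  case (insert i I)
  then show ?case using L2_norm_triangle(1)[of "f i" M "\<lambda>x. \<Sum>i\<in>I. f i x"] L2_sum[of I f M] by simp
qed (simp_all add: L2_norm_zero)

text \<open>Averaging over a family of disjoint sets, as a finite rank operator.\<close>

definition average :: "'a measure \<Rightarrow> 'i set \<Rightarrow> real \<Rightarrow> ('i \<Rightarrow> 'a \<Rightarrow> real) \<Rightarrow> ('a \<Rightarrow> real) \<Rightarrow> 'a \<Rightarrow> real" where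
  "average M J k e f x = (\<Sum>j\<in>J. k * L2_inner M f (e j) * e j x)"

lemma average_L2:
  assumes "\<And>j. j \<in> J \<Longrightarrow> e j \<in> L2 M" shows "average M J k e f \<in> L2 M"
  unfolding average_def[abs_def] using assms by (intro L2_sum L2_mult)

lemma average_inner:
  assumes "\<And>j. j \<in> J \<Longrightarrow> e j \<in> L2 M" "g \<in> L2 M"
  shows "L2_inner M (average M J k e f) g = (\<Sum>j\<in>J. k * L2_inner M f (e j) * L2_inner M g (e j))"
  unfolding average_def[abs_def] using assms
  by (subst L2_inner_sum) (auto intro: L2_mult simp: L2_inner_cmult L2_inner_sym[of M g])

lemma average_sym:
  assumes "\<And>j. j \<in> J \<Longrightarrow> e j \<in> L2 M" "f \<in> L2 M" "g \<in> L2 M"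
  shows "L2_inner M (average M J k e f) g = L2_inner M f (average M J k e g)"
  using average_inner[of J e M g k f] average_inner[of J e M f k g] L2_inner_sym[of M f "average M J k e g"] assms
  by (simp add: mult_ac)

lemma average_diff:
  assumes "\<And>j. j \<in> J \<Longrightarrow> e j \<in> L2 M" "f \<in> L2 M" "g \<in> L2 M"
  shows "average M J k e (\<lambda>x. f x - g x) x = average M J k e f x - average M J k e g x"
  unfolding average_def sum_subtractf[symmetric] using assms
  by (intro sum.cong refl) (simp add: L2_inner_add algebra_simps)

text \<open>Bessel's inequality, from (P f, P f) \<le> (P f, f). For normalised functions this would
  be an equality; the weaker bound k (e j, e j) \<le> 1 admits cells that are cut by the boundary of
  the domain.\<close>

lemma average_norm:
  assumes e: "\<And>j. j \<in> J \<Longrightarrow> e j \<in> L2 M" and f: "f \<in> L2 M" and k: "k > 0" and J: "finite J"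
    and bnd: "\<And>j. j \<in> J \<Longrightarrow> k * L2_inner M (e j) (e j) \<le> 1"
    and disj: "\<And>i j. i \<in> J \<Longrightarrow> j \<in> J \<Longrightarrow> i \<noteq> j \<Longrightarrow> L2_inner M (e i) (e j) = 0"
  shows "L2_norm M (average M J k e f) \<le> L2_norm M f"
proof -
  let ?P = "average M J k e f"
  have P: "?P \<in> L2 M" by (rule average_L2[OF e])
  have c: "L2_inner M ?P (e i) = k * L2_inner M f (e i) * L2_inner M (e i) (e i)" if "i \<in> J" for i
  proof -
    have "L2_inner M ?P (e i) = (\<Sum>j\<in>J. k * L2_inner M f (e j) * L2_inner M (e i) (e j))"
      using average_inner[of J e M "e i" k f] e that by simp
    also have "\<dots> = (\<Sum>j\<in>J. if j = i then k * L2_inner M f (e i) * L2_inner M (e i) (e i) else 0)"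
      using disj that by (intro sum.cong) auto
    finally show ?thesis using J that by simp
  qed
  have "L2_inner M ?P ?P = (\<Sum>j\<in>J. k * L2_inner M f (e j) * L2_inner M ?P (e j))"
    by (rule average_inner[OF e P])
  also have "\<dots> \<le> (\<Sum>j\<in>J. k * L2_inner M f (e j) * L2_inner M f (e j))"
  proof (rule sum_mono)
    fix j assume j: "j \<in> J"
    have "(k * (L2_inner M f (e j))\<^sup>2) * (k * L2_inner M (e j) (e j)) \<le> (k * (L2_inner M f (e j))\<^sup>2) * 1"
      using k by (intro mult_left_mono bnd j) auto
    then show "k * L2_inner M f (e j) * L2_inner M ?P (e j) \<le> k * L2_inner M f (e j) * L2_inner M f (e j)"
      unfolding c[OF j] by (simp add: power2_eq_square mult_ac)
  qed
  also have "\<dots> = L2_inner M ?P f" by (rule average_inner[OF e f, symmetric])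
  also have "\<dots> \<le> L2_norm M ?P * L2_norm M f" using L2_cauchy_schwarz[OF P f] by simp
  finally have "L2_norm M ?P * L2_norm M ?P \<le> L2_norm M ?P * L2_norm M f"
    using L2_norm_sq[of M ?P] by (simp add: power2_eq_square)
  then show ?thesis using L2_norm_nonneg[of M ?P] L2_norm_nonneg[of M f] by (cases "L2_norm M ?P > 0") auto
qed

section \<open>Square grids and uniform integrability\<close>

definition cell :: "real \<Rightarrow> real^2 \<Rightarrow> int \<times> int" where
  "cell h x = (\<lfloor>x $ 1 / h\<rfloor>, \<lfloor>x $ 2 / h\<rfloor>)"

text \<open>The indicator of the whole cell, also where the cell leaves the domain. For functions
  extended by zero, the weight 1 / h^2 makes \<open>average\<close> the mean over the full
  cell.\<close>

definition cell_ind :: "real \<Rightarrow> int \<times> int \<Rightarrow> real^2 \<Rightarrow> real" where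
  "cell_ind h j = indicator {x. cell h x = j}"

lemma cell_iff:
  assumes "h > 0"
  shows "cell h x = (m, n) \<longleftrightarrow> m * h \<le> x $ 1 \<and> x $ 1 < (m + 1) * h \<and> n * h \<le> x $ 2 \<and> x $ 2 < (n + 1) * h"
  using assms by (simp add: cell_def floor_eq_iff pos_le_divide_eq pos_divide_less_eq)

lemma cell_sets: assumes "h > 0" shows "{x. cell h x = j} \<in> sets borel"
proof -
  obtain m n where j: "j = (m, n)" by fastforce
  have [measurable]: "(\<lambda>x::real^2. x $ i) \<in> borel_measurable borel" for i
    by (intro borel_measurable_continuous_onI continuous_intros)
  have "{x \<in> space borel. m * h \<le> x $ 1 \<and> x $ 1 < (m + 1) * h \<and> n * h \<le> x $ 2 \<and> x $ 2 < (n + 1) * h} \<in> sets (borel :: (real^2) measure)"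
    by measurable
  then show ?thesis unfolding j cell_iff[OF assms] by simp
qed

lemma cell_ind_measurable: "h > 0 \<Longrightarrow> cell_ind h j \<in> borel_measurable borel"
  using cell_sets by (simp add: cell_ind_def)

lemma emeasure_cbox_real2:
  fixes l u :: "real^2"
  assumes "\<And>i. l $ i \<le> u $ i"
  shows "emeasure lborel (cbox l u) = ennreal ((u $ 1 - l $ 1) * (u $ 2 - l $ 2))"
    "emeasure lborel (box l u) = ennreal ((u $ 1 - l $ 1) * (u $ 2 - l $ 2))"
proof -
  have b: "\<And>b. b \<in> Basis \<Longrightarrow> l \<bullet> b \<le> u \<bullet> b" using assms by (auto simp: Basis_vec_def inner_axis)
  have p: "(\<Prod>b\<in>Basis. (u - l) \<bullet> b) = (u $ 1 - l $ 1) * (u $ 2 - l $ 2)"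
    by (simp add: Basis_vec_def prod.UNION_disjoint axis_eq_axis UNIV_2 inner_axis)
  show "emeasure lborel (cbox l u) = ennreal ((u $ 1 - l $ 1) * (u $ 2 - l $ 2))"
    using emeasure_lborel_cbox[of l u, OF b] p by simp
  show "emeasure lborel (box l u) = ennreal ((u $ 1 - l $ 1) * (u $ 2 - l $ 2))"
    using emeasure_lborel_box[of l u, OF b] p by simp
qed

text \<open>The half-open square lies between the open and the closed one, which have equal
  area.\<close>

lemma emeasure_cell:
  assumes "h > 0" shows "emeasure lborel {x. cell h x = j} = ennreal (h\<^sup>2)"
proof -
  obtain m n where j: "j = (m, n)" by fastforce
  define l u :: "real^2" where "l = vector [m * h, n * h]" and "u = vector [(m + 1) * h, (n + 1) * h]"
  have lu: "l $ i \<le> u $ i" for i using assms exhaust_2[of i] by (auto simp: l_def u_def algebra_simps)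
  have a: "(u $ 1 - l $ 1) * (u $ 2 - l $ 2) = h\<^sup>2" by (simp add: l_def u_def algebra_simps power2_eq_square)
  have "emeasure lborel (box l u) \<le> emeasure lborel {x. cell h x = j}"
    using cell_sets[OF assms] by (intro emeasure_mono) (auto simp: j cell_iff[OF assms] mem_box_cart forall_2 l_def u_def)
  moreover have "emeasure lborel {x. cell h x = j} \<le> emeasure lborel (cbox l u)"
    by (intro emeasure_mono) (auto simp: j cell_iff[OF assms] mem_box_cart forall_2 l_def u_def)
  ultimately show ?thesis unfolding emeasure_cbox_real2[OF lu] a by (rule antisym[rotated])
qed

lemma finite_cells: assumes "bounded S" "h > 0" shows "finite (cell h ` S)"
proof -
  obtain R where R: "\<And>x. x \<in> S \<Longrightarrow> norm x \<le> R" using assms by (auto simp: bounded_iff)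
  have "\<lfloor>x $ i / h\<rfloor> \<in> {\<lfloor>- R / h\<rfloor>..\<lfloor>R / h\<rfloor>}" if "x \<in> S" for x i
  proof -
    have "\<bar>x $ i\<bar> \<le> R" using component_le_norm_cart[of x i] R[OF that] by linarith
    then have "- R / h \<le> x $ i / h" "x $ i / h \<le> R / h" using assms(2) by (intro divide_right_mono; simp)+
    then show ?thesis by (simp only: atLeastAtMost_iff floor_mono)
  qed
  then have "cell h ` S \<subseteq> {\<lfloor>- R / h\<rfloor>..\<lfloor>R / h\<rfloor>} \<times> {\<lfloor>- R / h\<rfloor>..\<lfloor>R / h\<rfloor>}" unfolding cell_def by blast
  then show ?thesis by (rule finite_subset) simp
qed

text \<open>Uniform integrability of the squares of T v over the unit ball, scaled to arbitrary v.
  This is the form in which compactness of the solution operators is handed to the Newton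
  analysis.\<close>

definition equi_L2 :: "'a measure \<Rightarrow> 'b measure \<Rightarrow> (('a \<Rightarrow> real) \<Rightarrow> ('b \<Rightarrow> real)) \<Rightarrow> bool" where
  "equi_L2 M N T \<longleftrightarrow> (\<forall>\<epsilon>>0. \<exists>\<delta>>0. \<forall>A\<in>sets N. \<forall>v\<in>L2 M. measure N A < \<delta> \<longrightarrow>
     L2_norm N (\<lambda>x. indicator A x * T v x) \<le> \<epsilon> * L2_norm M v)"

lemma L2_indicator_real:
  fixes f :: "'a \<Rightarrow> real"
  assumes "f \<in> L2 M" "A \<in> sets M" shows "(\<lambda>x. indicator A x * f x) \<in> L2 M"
  using L2_indicator[OF assms(1), of A] assms(2) by simp

text \<open>Truncation: the part of g^2 above a level n has a small integral, and below that level
  the integral over A is at most n times the measure of A.\<close>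

lemma L2_absolutely_continuous:
  fixes g :: "'a \<Rightarrow> real"
  assumes "finite_measure M" and g: "g \<in> L2 M" and "\<epsilon> > 0"
  shows "\<exists>\<delta>>0. \<forall>A\<in>sets M. measure M A < \<delta> \<longrightarrow> L2_norm M (\<lambda>x. indicator A x * g x) \<le> \<epsilon>"
proof -
  interpret finite_measure M by fact
  have gm[measurable]: "g \<in> borel_measurable M" by (rule L2_measurable[OF g])
  have gi: "integrable M (\<lambda>x. (g x)\<^sup>2)" using L2_sq_integrable[OF g] by simp
  define t where "t n x = (if real n < (g x)\<^sup>2 then (g x)\<^sup>2 else 0)" for n :: nat and x
  have tm[measurable]: "t n \<in> borel_measurable M" for n unfolding t_def by measurable
  have "(\<lambda>n. LINT x|M. t n x) \<longlonglongrightarrow> (LINT x|M. 0)"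
  proof (rule integral_dominated_convergence[where w="\<lambda>x. (g x)\<^sup>2"])
    show "AE x in M. (\<lambda>n. t n x) \<longlonglongrightarrow> 0"
    proof (intro AE_I2 tendsto_eventually)
      fix x
      obtain N :: nat where "(g x)\<^sup>2 \<le> real N" using real_arch_simple by blast
      then show "\<forall>\<^sub>F n in sequentially. t n x = 0"
        unfolding eventually_sequentially t_def by (intro exI[of _ N]) auto
    qed
  qed (use gi in \<open>auto simp: t_def\<close>)
  then have lim: "(\<lambda>n. LINT x|M. t n x) \<longlonglongrightarrow> 0" by simp
  have "0 < \<epsilon>\<^sup>2 / 2" using \<open>\<epsilon> > 0\<close> by simp
  from LIMSEQ_D[OF lim this] obtain n where "norm ((LINT x|M. t n x) - 0) < \<epsilon>\<^sup>2 / 2" by blast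
  then have n: "(LINT x|M. t n x) < \<epsilon>\<^sup>2 / 2" by simp
  have ti: "integrable M (t n)" by (rule Bochner_Integration.integrable_bound[OF gi]) (auto simp: t_def)
  show ?thesis
  \<comment> \<open>Half of the squared tolerance is spent on the truncated part and half on n times
    the measure; n + 1 keeps the quotient meaningful for n = 0.\<close>
  proof (intro exI[of _ "\<epsilon>\<^sup>2 / (2 * (real n + 1))"] conjI ballI impI)
    show "0 < \<epsilon>\<^sup>2 / (2 * (real n + 1))" using \<open>\<epsilon> > 0\<close> by (intro divide_pos_pos) auto
    fix A assume A[measurable]: "A \<in> sets M" and mA: "measure M A < \<epsilon>\<^sup>2 / (2 * (real n + 1))"
    have Ai: "integrable M (\<lambda>x. real n * indicator A x :: real)"
      by (intro integrable_mult_right integrable_real_indicator) (auto simp: less_top[symmetric])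
    have "L2_inner M (\<lambda>x. indicator A x * g x) (\<lambda>x. indicator A x * g x) = (LINT x|M. indicator A x * (g x)\<^sup>2)"
      unfolding L2_inner_def by (intro Bochner_Integration.integral_cong refl) (auto simp: indicator_def power2_eq_square)
    also have "\<dots> \<le> (LINT x|M. t n x + real n * indicator A x)"
      by (intro integral_mono Bochner_Integration.integrable_add ti Ai
          Bochner_Integration.integrable_bound[OF gi, of "\<lambda>x. indicator A x * (g x)\<^sup>2"]) (auto simp: t_def indicator_def)
    also have "\<dots> = (LINT x|M. t n x) + real n * measure M A" using ti Ai by (simp add: Bochner_Integration.integral_add)
    also have "\<dots> \<le> \<epsilon>\<^sup>2 / 2 + \<epsilon>\<^sup>2 / 2"
    proof -
      have "real n * measure M A \<le> (real n + 1) * (\<epsilon>\<^sup>2 / (2 * (real n + 1)))" using mA by (intro mult_mono) auto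
      also have "\<dots> = \<epsilon>\<^sup>2 / 2" by (simp add: field_simps)
      finally show ?thesis using n by linarith
    qed
    finally have "L2_norm M (\<lambda>x. indicator A x * g x) \<le> sqrt (\<epsilon>\<^sup>2)" unfolding L2_norm_def by (intro real_sqrt_le_mono) simp
    then show "L2_norm M (\<lambda>x. indicator A x * g x) \<le> \<epsilon>" using \<open>\<epsilon> > 0\<close> by simp
  qed
qed

context polygon
begin

text \<open>The deviation at x is the mean of \<psi> x - \<psi> y over the cell of x, and y - x lies
  in the square of half-width h whatever x is. The double integral over x and y is thus bounded by
  one over x and the offset w, to which the translation bound applies. The square has area 4 h^2 and
  |w|^2 \<le> 4 h^2 on it, so with the weight 1 / h^2 the squared norms are compared with the factor
  (4 h)^2.\<close>

lemma cell_average_test: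
  assumes h: "h > 0" and \<psi>: "\<psi> \<in> test_functions \<Omega>"
  shows "L2_norm M\<Omega> (\<lambda>x. \<psi> x - average M\<Omega> (cell h ` \<Omega>) (1 / h\<^sup>2) (cell_ind h) \<psi> x) \<le> 4 * h * L2_norm M\<Omega> (grad \<psi>)"
proof -
  let ?P = "average M\<Omega> (cell h ` \<Omega>) (1 / h\<^sup>2) (cell_ind h) \<psi>"
  have \<psi>m[measurable]: "\<psi> \<in> borel_measurable borel"
    by (intro borel_measurable_continuous_onI test_continuous \<psi>)
  have em[measurable]: "cell_ind h j \<in> borel_measurable borel" for j by (rule cell_ind_measurable[OF h])
  obtain B where B: "\<And>x. \<bar>\<psi> x\<bar> \<le> B" using test_functions_bounded[OF \<psi>] by blast
  have fin: "finite (cell h ` \<Omega>)" by (rule finite_cells[OF bounded_dom h])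
  have eL: "cell_ind h j \<in> L2 lborel" and eN: "L2_inner lborel (cell_ind h j) (cell_ind h j) = h\<^sup>2"
    and eI: "integrable lborel (cell_ind h j)" "(LINT y|lborel. cell_ind h j y) = h\<^sup>2" for j
  proof -
    have sq: "(norm (cell_ind h j x))\<^sup>2 = cell_ind h j x" for x by (simp add: cell_ind_def indicator_def)
    have nn: "(\<integral>\<^sup>+x. ennreal (cell_ind h j x) \<partial>lborel) = ennreal (h\<^sup>2)"
      unfolding cell_ind_def using cell_sets[OF h, of j] emeasure_cell[OF h, of j] by (simp add: ennreal_indicator)
    show i: "integrable lborel (cell_ind h j)"
    proof (rule integrableI_nonneg)
      show "cell_ind h j \<in> borel_measurable lborel" using em by simp
      show "AE x in lborel. 0 \<le> cell_ind h j x" by (simp add: cell_ind_def)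
    qed (use nn in simp)
    show "cell_ind h j \<in> L2 lborel" using i sq by (simp add: Lp2_iff)
    show l: "(LINT y|lborel. cell_ind h j y) = h\<^sup>2"
    proof (subst integral_eq_nn_integral)
      show "cell_ind h j \<in> borel_measurable lborel" using em by simp
      show "AE x in lborel. 0 \<le> cell_ind h j x" by (simp add: cell_ind_def)
    qed (use nn in simp)
    show "L2_inner lborel (cell_ind h j) (cell_ind h j) = h\<^sup>2" using l unfolding L2_inner_self sq .
  qed
  let ?W = "{w::real^2. \<bar>w $ 1\<bar> \<le> h \<and> \<bar>w $ 2\<bar> \<le> h}"
  have W: "?W = cbox (vector [- h, - h]) (vector [h, h])" by (auto simp: mem_box_cart forall_2)
  have Wm[measurable]: "?W \<in> sets borel" unfolding W by simp
  have lu: "(vector [- h, - h] :: real^2) $ i \<le> (vector [h, h] :: real^2) $ i" for i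
    using h exhaust_2[of i] by auto
  have "emeasure lborel ?W = ennreal ((2 * h) * (2 * h))"
    unfolding W using emeasure_cbox_real2(1)[OF lu] by simp
  then have We: "emeasure lborel ?W = ennreal (4 * h\<^sup>2)" by (simp add: power2_eq_square)
  have pt: "ennreal ((\<psi> x - ?P x)\<^sup>2) * indicator \<Omega> x
      \<le> ennreal (1 / h\<^sup>2) * (\<integral>\<^sup>+w. ennreal ((\<psi> (x + w) - \<psi> x)\<^sup>2) * indicator ?W w \<partial>lborel)" for x
  proof (cases "x \<in> \<Omega>")
    case True
    let ?e = "cell_ind h (cell h x)"
    have "?P x = (\<Sum>j\<in>cell h ` \<Omega>. if j = cell h x then 1 / h\<^sup>2 * L2_inner M\<Omega> \<psi> ?e else 0)"
      unfolding average_def by (intro sum.cong refl) (auto simp: cell_ind_def)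
    also have "\<dots> = 1 / h\<^sup>2 * L2_inner M\<Omega> \<psi> ?e" using True fin by simp
    \<comment> \<open>As \<psi> vanishes outside \<Omega>, the integral may be taken over the whole
      cell even if the cell crosses the boundary; the factor 1 / h^2 is made for full cells.\<close>
    also have "L2_inner M\<Omega> \<psi> ?e = (LINT y|lborel. \<psi> y * ?e y)"
      unfolding L2_inner_def using test_functionsD(2)[OF \<psi>] by (simp add: integral_lebesgue_on_test[OF open_dom])
    finally have P: "?P x = 1 / h\<^sup>2 * (LINT y|lborel. \<psi> y * ?e y)" .
    let ?f = "\<lambda>y. (\<psi> x - \<psi> y) * ?e y"
    have fL: "?f \<in> L2 lborel"
    proof (rule L2_bound[OF eL])
      show "AE y in lborel. norm (?f y) \<le> (2 * B) * norm (?e y)"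
      proof (intro AE_I2)
        fix y
        have "\<bar>\<psi> x - \<psi> y\<bar> \<le> 2 * B" using B[of x] B[of y] by linarith
        then show "norm (?f y) \<le> (2 * B) * norm (?e y)" by (simp add: abs_mult mult_right_mono)
      qed
    qed measurable
    have \<psi>e: "integrable lborel (\<lambda>y. \<psi> y * ?e y)"
    proof (rule Bochner_Integration.integrable_bound)
      show "integrable lborel (\<lambda>y. B * ?e y)" using eI by simp
      show "AE y in lborel. norm (\<psi> y * ?e y) \<le> norm (B * ?e y)"
        using B by (intro AE_I2) (auto simp: abs_mult intro!: mult_right_mono order_trans[OF B abs_ge_self])
    qed measurable
    have "\<psi> x - ?P x = 1 / h\<^sup>2 * ((LINT y|lborel. \<psi> x * ?e y) - (LINT y|lborel. \<psi> y * ?e y))"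
      unfolding P using h eI by (simp add: field_simps)
    also have "(LINT y|lborel. \<psi> x * ?e y) - (LINT y|lborel. \<psi> y * ?e y) = L2_inner lborel ?f ?e"
    proof -
      have "?f y * ?e y = \<psi> x * ?e y - \<psi> y * ?e y" for y by (simp add: cell_ind_def indicator_def)
      then show ?thesis using eI \<psi>e by (simp add: L2_inner_def)
    qed
    finally have d: "\<psi> x - ?P x = 1 / h\<^sup>2 * L2_inner lborel ?f ?e" .
    have "(L2_inner lborel ?f ?e)\<^sup>2 \<le> (L2_norm lborel ?f * L2_norm lborel ?e)\<^sup>2"
      using L2_cauchy_schwarz[OF fL eL] by (intro power2_le_iff_abs_le[THEN iffD2]) (auto simp: L2_norm_nonneg)
    also have "\<dots> = L2_inner lborel ?f ?f * h\<^sup>2" by (simp add: power_mult_distrib L2_norm_sq eN)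
    finally have sq: "(L2_inner lborel ?f ?e)\<^sup>2 \<le> L2_inner lborel ?f ?f * h\<^sup>2" .
    have "(\<psi> x - ?P x)\<^sup>2 = (1 / h\<^sup>2)\<^sup>2 * (L2_inner lborel ?f ?e)\<^sup>2" unfolding d by (rule power_mult_distrib)
    also have "\<dots> \<le> (1 / h\<^sup>2)\<^sup>2 * (L2_inner lborel ?f ?f * h\<^sup>2)" by (intro mult_left_mono sq) simp
    also have "\<dots> = 1 / h\<^sup>2 * L2_inner lborel ?f ?f" using h by (simp add: power2_eq_square)
    finally have le: "(\<psi> x - ?P x)\<^sup>2 \<le> 1 / h\<^sup>2 * L2_inner lborel ?f ?f" .
    have "(\<integral>\<^sup>+y. ennreal ((norm (?f y))\<^sup>2) \<partial>lborel) = (\<integral>\<^sup>+w. ennreal ((norm (?f (w + x)))\<^sup>2) \<partial>lborel)"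
      by (rule nn_integral_translate[symmetric]) measurable
    also have "\<dots> \<le> (\<integral>\<^sup>+w. ennreal ((\<psi> (x + w) - \<psi> x)\<^sup>2) * indicator ?W w \<partial>lborel)"
    proof (intro nn_integral_mono)
      fix w
      show "ennreal ((norm (?f (w + x)))\<^sup>2) \<le> ennreal ((\<psi> (x + w) - \<psi> x)\<^sup>2) * indicator ?W w"
      proof (cases "cell h (w + x) = cell h x")
        case True
        obtain m n where mn: "cell h x = (m, n)" by fastforce
        then have "\<bar>w $ 1\<bar> \<le> h" "\<bar>w $ 2\<bar> \<le> h"
          using True cell_iff[OF h, of x m n] cell_iff[OF h, of "w + x" m n] by (auto simp: algebra_simps)
        then show ?thesis by (simp add: cell_ind_def True power2_commute[of "\<psi> x"] add.commute)
      qed (simp add: cell_ind_def)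
    qed
    finally have nn: "ennreal (L2_inner lborel ?f ?f) \<le> (\<integral>\<^sup>+w. ennreal ((\<psi> (x + w) - \<psi> x)\<^sup>2) * indicator ?W w \<partial>lborel)"
      using nn_integral_L2[OF fL] by simp
    have "ennreal ((\<psi> x - ?P x)\<^sup>2) \<le> ennreal (1 / h\<^sup>2 * L2_inner lborel ?f ?f)" by (rule ennreal_leI[OF le])
    also have "\<dots> = ennreal (1 / h\<^sup>2) * ennreal (L2_inner lborel ?f ?f)"
      by (rule ennreal_mult) (auto simp: L2_inner_self_nonneg)
    also have "\<dots> \<le> ennreal (1 / h\<^sup>2) * (\<integral>\<^sup>+w. ennreal ((\<psi> (x + w) - \<psi> x)\<^sup>2) * indicator ?W w \<partial>lborel)"
      by (intro mult_left_mono nn) simp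
    finally show ?thesis using True by simp
  qed simp
  let ?G = "L2_inner M\<Omega> (grad \<psi>) (grad \<psi>)"
  have Pm: "?P \<in> borel_measurable borel" unfolding average_def[abs_def] by measurable
  have PL: "?P \<in> L2 M\<Omega>"
    by (intro average_L2 L2_bounded[OF finite_M\<Omega>, of _ 1] measurable_lebesgue_on_borel cell_ind_measurable h dom_sets)
      (auto simp: cell_ind_def indicator_def)
  have dL: "(\<lambda>x. \<psi> x - ?P x) \<in> L2 M\<Omega>" by (intro L2_diff test_L2 \<psi> PL)
  have "ennreal (L2_inner M\<Omega> (\<lambda>x. \<psi> x - ?P x) (\<lambda>x. \<psi> x - ?P x)) = (\<integral>\<^sup>+x. ennreal ((\<psi> x - ?P x)\<^sup>2) * indicator \<Omega> x \<partial>lborel)"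
    using nn_integral_L2[OF dL] nn_integral_lebesgue_on[OF dom_sets(2)] by simp
  also have "\<dots> \<le> (\<integral>\<^sup>+x. ennreal (1 / h\<^sup>2) * (\<integral>\<^sup>+w. ennreal ((\<psi> (x + w) - \<psi> x)\<^sup>2) * indicator ?W w \<partial>lborel) \<partial>lborel)"
    by (intro nn_integral_mono pt)
  also have "\<dots> = ennreal (1 / h\<^sup>2) * (\<integral>\<^sup>+x. \<integral>\<^sup>+w. ennreal ((\<psi> (x + w) - \<psi> x)\<^sup>2) * indicator ?W w \<partial>lborel \<partial>lborel)"
    by (rule nn_integral_cmult) measurable
  also have "(\<integral>\<^sup>+x. \<integral>\<^sup>+w. ennreal ((\<psi> (x + w) - \<psi> x)\<^sup>2) * indicator ?W w \<partial>lborel \<partial>lborel)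
      = (\<integral>\<^sup>+w. \<integral>\<^sup>+x. ennreal ((\<psi> (x + w) - \<psi> x)\<^sup>2) * indicator ?W w \<partial>lborel \<partial>lborel)"
    by (rule pair_sigma_finite.Fubini') (auto intro!: pair_sigma_finite.intro sigma_finite_lborel)
  also have "\<dots> \<le> (\<integral>\<^sup>+w. ennreal (4 * h\<^sup>2 * ?G) * indicator ?W w \<partial>lborel)"
  proof (intro nn_integral_mono)
    fix w :: "real^2"
    show "(\<integral>\<^sup>+x. ennreal ((\<psi> (x + w) - \<psi> x)\<^sup>2) * indicator ?W w \<partial>lborel) \<le> ennreal (4 * h\<^sup>2 * ?G) * indicator ?W w"
    proof (cases "w \<in> ?W")
      case True
      have "norm w \<le> \<bar>w $ 1\<bar> + \<bar>w $ 2\<bar>" using norm_le_l1_cart[of w] by (simp add: sum_2)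
      then have "norm w \<le> 2 * h" using True by simp
      then have "(norm w)\<^sup>2 \<le> (2 * h)\<^sup>2" by (intro power_mono) auto
      then have w: "(norm w)\<^sup>2 * ?G \<le> 4 * h\<^sup>2 * ?G" by (intro mult_right_mono) (auto simp: L2_inner_self_nonneg power_mult_distrib)
      have "(\<integral>\<^sup>+x. ennreal ((\<psi> (x + w) - \<psi> x)\<^sup>2) \<partial>lborel) \<le> ennreal ((norm w)\<^sup>2) * ennreal ?G"
        using translation_bound[OF test_functionsD(1)[OF \<psi>], of w] nn_integral_grad_test[OF \<psi>] by simp
      also have "\<dots> = ennreal ((norm w)\<^sup>2 * ?G)" by (simp add: ennreal_mult L2_inner_self_nonneg)
      also have "\<dots> \<le> ennreal (4 * h\<^sup>2 * ?G)" by (rule ennreal_leI[OF w])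
      finally show ?thesis using True by simp
    qed simp
  qed
  also have "\<dots> = ennreal (4 * h\<^sup>2 * ?G) * ennreal (4 * h\<^sup>2)" using We by (simp add: nn_integral_cmult)
  finally have "ennreal (L2_inner M\<Omega> (\<lambda>x. \<psi> x - ?P x) (\<lambda>x. \<psi> x - ?P x)) \<le> ennreal (1 / h\<^sup>2) * (ennreal (4 * h\<^sup>2 * ?G) * ennreal (4 * h\<^sup>2))"
    by (simp add: mult_left_mono)
  also have "\<dots> = ennreal (1 / h\<^sup>2 * (4 * h\<^sup>2 * ?G * (4 * h\<^sup>2)))"
    using h by (simp add: ennreal_mult[symmetric] L2_inner_self_nonneg)
  also have "1 / h\<^sup>2 * (4 * h\<^sup>2 * ?G * (4 * h\<^sup>2)) = (4 * h * L2_norm M\<Omega> (grad \<psi>))\<^sup>2"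
    using h by (simp add: power_mult_distrib L2_norm_sq)
  finally have "(L2_norm M\<Omega> (\<lambda>x. \<psi> x - ?P x))\<^sup>2 \<le> (4 * h * L2_norm M\<Omega> (grad \<psi>))\<^sup>2"
    by (simp add: L2_norm_sq)
  then show ?thesis by (rule power2_le_imp_le) (use h in \<open>simp add: L2_norm_nonneg\<close>)
qed

end

section \<open>Finite rank approximation of the solution operators\<close>

lemma finite_common_delta:
  fixes P :: "'i \<Rightarrow> real \<Rightarrow> bool"
  assumes "finite J" "\<And>j. j \<in> J \<Longrightarrow> \<exists>\<delta>>0. \<forall>t<\<delta>. P j t"
  shows "\<exists>\<delta>>0. \<forall>j\<in>J. \<forall>t<\<delta>. P j t"
  using assms
proof (induction J rule: finite_induct)
  case (insert i J)
  obtain \<delta>1 where "\<delta>1 > 0" "\<forall>j\<in>J. \<forall>t<\<delta>1. P j t" using insert by auto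
  moreover obtain \<delta>2 where "\<delta>2 > 0" "\<forall>t<\<delta>2. P i t" using insert.prems[of i] by auto
  ultimately show ?case by (intro exI[of _ "min \<delta>1 \<delta>2"]) auto
qed (auto intro: exI[of _ 1])

lemma L2_norm_indicator_le:
  fixes f :: "'a \<Rightarrow> real"
  assumes "f \<in> L2 M" "A \<in> sets M" shows "L2_norm M (\<lambda>x. indicator A x * f x) \<le> L2_norm M f"
  by (rule L2_norm_mono[OF L2_indicator_real[OF assms] assms(1)]) (intro AE_I2, auto simp: indicator_def)

lemma mult_half_divide: "0 < D \<Longrightarrow> D * (\<epsilon> / (2 * D)) = \<epsilon> / 2" for D :: real
  by simp

context polygon
begin

abbreviation avg :: "real \<Rightarrow> (real^2 \<Rightarrow> real) \<Rightarrow> real^2 \<Rightarrow> real" where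
  "avg h \<equiv> average M\<Omega> (cell h ` \<Omega>) (1 / h\<^sup>2) (cell_ind h)"

lemma cell_ind_L2: "h > 0 \<Longrightarrow> cell_ind h j \<in> L2 M\<Omega>"
  by (intro L2_bounded[OF finite_M\<Omega>, of _ 1] measurable_lebesgue_on_borel cell_ind_measurable dom_sets)
    (auto simp: cell_ind_def indicator_def)

lemma cell_ind_norm: assumes "h > 0" shows "L2_inner M\<Omega> (cell_ind h j) (cell_ind h j) \<le> h\<^sup>2"
proof -
  have "ennreal (L2_inner M\<Omega> (cell_ind h j) (cell_ind h j)) = (\<integral>\<^sup>+x. ennreal ((norm (cell_ind h j x))\<^sup>2) * indicator \<Omega> x \<partial>lborel)"
    using nn_integral_L2[OF cell_ind_L2[OF assms]] nn_integral_lebesgue_on[OF dom_sets(2)] by simp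
  also have "\<dots> \<le> (\<integral>\<^sup>+x. indicator {x. cell h x = j} x \<partial>lborel)"
    by (intro nn_integral_mono) (auto simp: cell_ind_def indicator_def)
  also have "\<dots> = ennreal (h\<^sup>2)" using cell_sets[OF assms, of j] emeasure_cell[OF assms, of j] by simp
  finally show ?thesis by simp
qed

lemma avg_L2: "h > 0 \<Longrightarrow> avg h f \<in> L2 M\<Omega>"
  by (intro average_L2 cell_ind_L2)

lemma avg_norm: assumes "h > 0" "f \<in> L2 M\<Omega>" shows "L2_norm M\<Omega> (avg h f) \<le> L2_norm M\<Omega> f"
proof (rule average_norm[OF cell_ind_L2[OF assms(1)] assms(2)])
  show "finite (cell h ` \<Omega>)" by (rule finite_cells[OF bounded_dom assms(1)])
  show "1 / h\<^sup>2 * L2_inner M\<Omega> (cell_ind h j) (cell_ind h j) \<le> 1" for j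
    using cell_ind_norm[OF assms(1), of j] assms(1) by (simp add: pos_divide_le_eq)
  have z: "cell_ind h i x * cell_ind h j x = 0" if "i \<noteq> j" for i j x using that by (auto simp: cell_ind_def indicator_def)
  show "L2_inner M\<Omega> (cell_ind h i) (cell_ind h j) = 0" if "i \<noteq> j" for i j
    unfolding L2_inner_def by (simp add: z[OF that] del: mult_eq_0_iff)
qed (use assms in simp)

text \<open>The estimate holds for test functions, and since \<open>avg\<close> is nonexpansive it
  survives the passage to the limit.\<close>

lemma avg_H10:
  assumes h: "h > 0" and H: "\<phi> \<in> H10 \<Omega>"
  shows "L2_norm M\<Omega> (\<lambda>x. \<phi> x - avg h \<phi> x) \<le> 4 * h * L2_norm M\<Omega> (weak_grad \<Omega> \<phi>)"
proof -
  obtain \<psi> :: "nat \<Rightarrow> real^2 \<Rightarrow> real" where \<psi>: "\<And>k. \<psi> k \<in> test_functions \<Omega>"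
    "(\<lambda>k. L2_norm M\<Omega> (\<lambda>x. \<psi> k x - \<phi> x)) \<longlonglongrightarrow> 0" "(\<lambda>k. L2_norm M\<Omega> (\<lambda>x. grad (\<psi> k) x - weak_grad \<Omega> \<phi> x)) \<longlonglongrightarrow> 0"
    using H10_sequence[OF H] by blast
  note \<phi>L = H10_D(1)[OF H]
  have le: "L2_norm M\<Omega> (\<lambda>x. \<phi> x - avg h \<phi> x) \<le> 4 * h * L2_norm M\<Omega> (grad (\<psi> k)) + 2 * L2_norm M\<Omega> (\<lambda>x. \<psi> k x - \<phi> x)" for k
  proof -
    note \<psi>L = test_L2(1)[OF \<psi>(1)[of k]]
    have d: "(\<lambda>x. \<phi> x - \<psi> k x) \<in> L2 M\<Omega>" by (intro L2_diff \<phi>L \<psi>L)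
    have e: "(\<lambda>x. \<psi> k x - avg h (\<psi> k) x) \<in> L2 M\<Omega>" by (intro L2_diff avg_L2 h \<psi>L)
    have f: "(\<lambda>x. (\<phi> x - \<psi> k x) - avg h (\<lambda>x. \<phi> x - \<psi> k x) x) \<in> L2 M\<Omega>" by (intro L2_diff[OF d] avg_L2 h)
    have "(\<lambda>x. \<phi> x - avg h \<phi> x) = (\<lambda>x. (\<psi> k x - avg h (\<psi> k) x) + ((\<phi> x - \<psi> k x) - avg h (\<lambda>x. \<phi> x - \<psi> k x) x))"
      by (rule ext) (simp add: average_diff cell_ind_L2 h \<phi>L \<psi>L)
    then have "L2_norm M\<Omega> (\<lambda>x. \<phi> x - avg h \<phi> x) \<le> L2_norm M\<Omega> (\<lambda>x. \<psi> k x - avg h (\<psi> k) x)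
        + L2_norm M\<Omega> (\<lambda>x. (\<phi> x - \<psi> k x) - avg h (\<lambda>x. \<phi> x - \<psi> k x) x)"
      using L2_norm_triangle(1)[OF e f] by simp
    also have "\<dots> \<le> 4 * h * L2_norm M\<Omega> (grad (\<psi> k)) + (L2_norm M\<Omega> (\<lambda>x. \<phi> x - \<psi> k x) + L2_norm M\<Omega> (\<lambda>x. \<phi> x - \<psi> k x))"
      using cell_average_test[OF h \<psi>(1)[of k]] L2_norm_triangle(2)[OF d avg_L2[OF h], of "\<lambda>x. \<phi> x - \<psi> k x"] avg_norm[OF h d] by (intro add_mono) auto
    finally show ?thesis using L2_norm_diff_sym[OF \<phi>L \<psi>L] by simp
  qed
  have "(\<lambda>k. 4 * h * L2_norm M\<Omega> (grad (\<psi> k)) + 2 * L2_norm M\<Omega> (\<lambda>x. \<psi> k x - \<phi> x)) \<longlonglongrightarrow> 4 * h * L2_norm M\<Omega> (weak_grad \<Omega> \<phi>) + 2 * 0"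
    by (intro tendsto_intros \<psi>(2) L2_norm_tendsto[OF test_L2(2)[OF \<psi>(1)] H10_D(2)[OF H] \<psi>(3)])
  then have "L2_norm M\<Omega> (\<lambda>x. \<phi> x - avg h \<phi> x) \<le> 4 * h * L2_norm M\<Omega> (weak_grad \<Omega> \<phi>) + 2 * 0"
    by (rule tendsto_lowerbound) (use le in auto)
  then show ?thesis by simp
qed

text \<open>Moving the symmetric operator \<open>avg\<close> to the other side gives (z - avg z,
  \<phi>) = (z, \<phi> - avg \<phi>), so the energy identity yields \<parallel>grad
  \<phi>\<parallel> \<le> 4 h \<parallel>z\<parallel>. The geometric mean in
  \<open>S_adj_bound\<close> turns this into the rate sqrt (8 h).\<close>

lemma S_adj_finite_rank:
  assumes "\<eta> > 0"
  shows "\<exists>h>0. \<forall>z\<in>L2 M\<Omega>. L2_norm \<Gamma> (S_adj \<Omega> (\<lambda>x. z x - avg h z x)) \<le> \<eta> * L2_norm M\<Omega> z"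
proof -
  obtain C where C: "C \<ge> 0" and S: "\<And>z \<phi>. z \<in> L2 M\<Omega> \<Longrightarrow> weak_poisson_solution \<Omega> z \<phi> \<Longrightarrow>
    L2_norm \<Gamma> (S_adj \<Omega> z) \<le> C * sqrt (L2_norm M\<Omega> z * L2_norm M\<Omega> (weak_grad \<Omega> \<phi>))" using S_adj_bound by auto
  \<comment> \<open>Makes sqrt (8 h) equal to \<eta> / (C + 1). The 8 collects the 2 from
    \<parallel>z - avg z\<parallel> \<le> 2 \<parallel>z\<parallel> and the 4 of the energy
    bound.\<close>
  define h where "h = (\<eta> / (C + 1))\<^sup>2 / 8"
  have h: "h > 0" using assms C by (simp add: h_def)
  have s8: "sqrt (8 * h) = \<eta> / (C + 1)" using assms C by (simp add: h_def)
  have "L2_norm \<Gamma> (S_adj \<Omega> (\<lambda>x. z x - avg h z x)) \<le> \<eta> * L2_norm M\<Omega> z" if z: "z \<in> L2 M\<Omega>" for z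
  proof -
    let ?d = "\<lambda>x. z x - avg h z x" and ?nz = "L2_norm M\<Omega> z"
    have d: "?d \<in> L2 M\<Omega>" by (intro L2_diff z avg_L2 h)
    have dn: "L2_norm M\<Omega> ?d \<le> 2 * ?nz" using L2_norm_triangle(2)[OF z avg_L2[OF h], of z] avg_norm[OF h z] by simp
    obtain \<phi> where sol: "weak_poisson_solution \<Omega> ?d \<phi>" using weak_poisson_exists[OF d] by blast
    then have H: "\<phi> \<in> H10 \<Omega>" by (simp add: weak_poisson_solution_def)
    note \<phi>L = H10_D(1)[OF H]
    let ?e = "L2_norm M\<Omega> (weak_grad \<Omega> \<phi>)"
    have "?e * ?e = L2_inner M\<Omega> ?d \<phi>" using weak_poisson_energy[OF d sol] L2_norm_sq[of M\<Omega> "weak_grad \<Omega> \<phi>"] by (simp add: power2_eq_square)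
    also have "\<dots> = L2_inner M\<Omega> z (\<lambda>x. \<phi> x - avg h \<phi> x)"
      using average_sym[of "cell h ` \<Omega>" "cell_ind h" M\<Omega> z \<phi> "1 / h\<^sup>2"] h
      by (simp add: L2_inner_add z \<phi>L avg_L2 cell_ind_L2)
    also have "\<dots> \<le> ?nz * L2_norm M\<Omega> (\<lambda>x. \<phi> x - avg h \<phi> x)"
      using L2_cauchy_schwarz[OF z L2_diff[OF \<phi>L avg_L2[OF h]], of \<phi>] by simp
    also have "\<dots> \<le> ?nz * (4 * h * ?e)" by (intro mult_left_mono avg_H10 h H L2_norm_nonneg)
    finally have "?e * ?e \<le> (4 * h * ?nz) * ?e" by (simp add: mult_ac)
    then have e: "?e \<le> 4 * h * ?nz" using h L2_norm_nonneg[of M\<Omega> "weak_grad \<Omega> \<phi>"] L2_norm_nonneg[of M\<Omega> z]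
      by (cases "?e > 0") (auto intro: order_trans)
    have "L2_norm M\<Omega> ?d * ?e \<le> (2 * ?nz) * (4 * h * ?nz)" using dn e by (intro mult_mono) (auto simp: L2_norm_nonneg)
    also have "\<dots> = (8 * h) * ?nz\<^sup>2" by (simp add: power2_eq_square)
    finally have "sqrt (L2_norm M\<Omega> ?d * ?e) \<le> sqrt ((8 * h) * ?nz\<^sup>2)" by (rule real_sqrt_le_mono)
    also have "\<dots> = \<eta> / (C + 1) * ?nz" unfolding real_sqrt_mult[of "8 * h"] s8 by (simp add: L2_norm_nonneg)
    finally have "C * sqrt (L2_norm M\<Omega> ?d * ?e) \<le> C * (\<eta> / (C + 1) * ?nz)" by (intro mult_left_mono C)
    also have "\<dots> = (C / (C + 1)) * (\<eta> * ?nz)" by simp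
    also have "\<dots> \<le> 1 * (\<eta> * ?nz)" using C assms by (intro mult_right_mono) (auto simp: L2_norm_nonneg)
    finally show ?thesis using S[OF d sol] by simp
  qed
  with h show ?thesis by blast
qed

lemma S_adj_sum:
  assumes "finite J" "\<And>j. j \<in> J \<Longrightarrow> e j \<in> L2 M\<Omega>"
  shows "AE x in \<Gamma>. S_adj \<Omega> (\<lambda>x. \<Sum>j\<in>J. c j * e j x) x = (\<Sum>j\<in>J. c j * S_adj \<Omega> (e j) x)"
  using assms
proof (induction J rule: finite_induct)
  case empty
  obtain C where C: "\<And>z. z \<in> L2 M\<Omega> \<Longrightarrow> L2_norm \<Gamma> (S_adj \<Omega> z) \<le> C * L2_norm M\<Omega> z" using S_adj_bounded by blast
  have z: "(\<lambda>x. 0) \<in> L2 M\<Omega>" by (rule L2_zero)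
  have "L2_norm \<Gamma> (S_adj \<Omega> (\<lambda>x. 0)) = 0" using C[OF z] L2_norm_nonneg[of \<Gamma> "S_adj \<Omega> (\<lambda>x. 0)"] by (simp add: L2_norm_zero)
  then show ?case using L2_norm_eq_zero[OF S_adj_L2[OF z]] by simp
next
  case (insert i J)
  have "AE x in \<Gamma>. S_adj \<Omega> (\<lambda>x. (\<Sum>j\<in>J. c j * e j x) + c i * e i x) x = S_adj \<Omega> (\<lambda>x. \<Sum>j\<in>J. c j * e j x) x + c i * S_adj \<Omega> (e i) x"
    by (rule S_adj_lincomb) (use insert.prems in \<open>auto intro!: L2_sum L2_mult\<close>)
  then show ?case using insert.IH[OF insert.prems[OF insertI2]] insert.hyps
    by (auto simp: add.commute elim!: eventually_elim2)
qed

text \<open>Up to a remainder of norm at most (\<epsilon> / 2) \<parallel>z\<parallel>, the image of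
  z is a combination of the finitely many images of cell indicators, with coefficients bounded by
  \<parallel>z\<parallel> / h. For finitely many fixed functions, absolute continuity of the
  integral gives a common \<delta>.\<close>

lemma equi_L2_S_adj: "equi_L2 M\<Omega> \<Gamma> (S_adj \<Omega>)"
  unfolding equi_L2_def
proof (intro allI impI)
  fix \<epsilon> :: real assume \<epsilon>: "\<epsilon> > 0"
  obtain h where h: "h > 0" and fr: "\<And>z. z \<in> L2 M\<Omega> \<Longrightarrow> L2_norm \<Gamma> (S_adj \<Omega> (\<lambda>x. z x - avg h z x)) \<le> \<epsilon> / 2 * L2_norm M\<Omega> z"
    using S_adj_finite_rank[of "\<epsilon>/2"] \<epsilon> by auto
  let ?J = "cell h ` \<Omega>" and ?e = "cell_ind h"
  have fin: "finite ?J" by (rule finite_cells[OF bounded_dom h])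
  \<comment> \<open>The sum has as many terms as there are cells, each of size at most \<kappa>
    \<parallel>z\<parallel> / h; the added 1 keeps the denominator positive.\<close>
  define \<kappa> where "\<kappa> = \<epsilon> / (2 * (1 / h * real (card ?J) + 1))"
  have den: "0 < 1 / h * real (card ?J) + 1" using h by (intro add_nonneg_pos) auto
  then have \<kappa>: "\<kappa> > 0" using \<epsilon> by (simp add: \<kappa>_def)
  have "\<exists>\<delta>>0. \<forall>j\<in>?J. \<forall>t<\<delta>. \<forall>A\<in>sets \<Gamma>. measure \<Gamma> A = t \<longrightarrow> L2_norm \<Gamma> (\<lambda>x. indicator A x * S_adj \<Omega> (?e j) x) \<le> \<kappa>"
    by (rule finite_common_delta[OF fin])
      (use L2_absolutely_continuous[OF finite_\<Gamma> S_adj_L2[OF cell_ind_L2[OF h]] \<kappa>] in blast)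
  then obtain \<delta> where \<delta>: "\<delta> > 0" "\<And>j A. j \<in> ?J \<Longrightarrow> A \<in> sets \<Gamma> \<Longrightarrow> measure \<Gamma> A < \<delta> \<Longrightarrow> L2_norm \<Gamma> (\<lambda>x. indicator A x * S_adj \<Omega> (?e j) x) \<le> \<kappa>"
    by blast
  show "\<exists>\<delta>>0. \<forall>A\<in>sets \<Gamma>. \<forall>z\<in>L2 M\<Omega>. measure \<Gamma> A < \<delta> \<longrightarrow> L2_norm \<Gamma> (\<lambda>x. indicator A x * S_adj \<Omega> z x) \<le> \<epsilon> * L2_norm M\<Omega> z"
  proof (rule exI[of _ \<delta>], intro conjI ballI impI \<delta>(1))
    fix A and z :: "real^2 \<Rightarrow> real" assume A: "A \<in> sets \<Gamma>" and z: "z \<in> L2 M\<Omega>" and mA: "measure \<Gamma> A < \<delta>"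
    let ?nz = "L2_norm M\<Omega> z"
    define c where "c j = 1 / h\<^sup>2 * L2_inner M\<Omega> z (?e j)" for j
    have c: "\<bar>c j\<bar> \<le> 1 / h * ?nz" for j
    proof -
      have "L2_norm M\<Omega> (?e j) \<le> h" unfolding L2_norm_def using cell_ind_norm[OF h, of j] h by (intro real_le_lsqrt) (auto simp: L2_inner_self_nonneg)
      then have "\<bar>L2_inner M\<Omega> z (?e j)\<bar> \<le> ?nz * h"
        using L2_cauchy_schwarz[OF z cell_ind_L2[OF h, of j]] mult_left_mono[OF _ L2_norm_nonneg[of M\<Omega> z]] by (meson order_trans)
      then have "1 / h\<^sup>2 * \<bar>L2_inner M\<Omega> z (?e j)\<bar> \<le> 1 / h\<^sup>2 * (?nz * h)" by (intro mult_left_mono) auto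
      also have "\<dots> = 1 / h * ?nz" using h by (simp add: power2_eq_square)
      finally show ?thesis using h by (simp add: c_def abs_mult)
    qed
    let ?d = "\<lambda>x. z x - avg h z x"
    have dL: "?d \<in> L2 M\<Omega>" by (intro L2_diff z avg_L2 h)
    have a: "avg h z = (\<lambda>x. \<Sum>j\<in>?J. c j * ?e j x)" by (simp add: average_def c_def fun_eq_iff)
    have "AE x in \<Gamma>. S_adj \<Omega> (\<lambda>x. ?d x + 1 * avg h z x) x = S_adj \<Omega> ?d x + 1 * S_adj \<Omega> (avg h z) x"
      by (rule S_adj_lincomb[OF dL avg_L2[OF h]])
    moreover have "AE x in \<Gamma>. S_adj \<Omega> (avg h z) x = (\<Sum>j\<in>?J. c j * S_adj \<Omega> (?e j) x)"
      unfolding a by (rule S_adj_sum[OF fin cell_ind_L2[OF h]])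
    ultimately have ae: "AE x in \<Gamma>. indicator A x * S_adj \<Omega> z x = indicator A x * S_adj \<Omega> ?d x + (\<Sum>j\<in>?J. c j * (indicator A x * S_adj \<Omega> (?e j) x))"
      by eventually_elim (simp add: distrib_left sum_distrib_left mult_ac)
    have s1: "(\<lambda>x. indicator A x * S_adj \<Omega> ?d x) \<in> L2 \<Gamma>" by (rule L2_indicator_real[OF S_adj_L2[OF dL] A])
    have s2': "(\<lambda>x. c j * (indicator A x * S_adj \<Omega> (?e j) x)) \<in> L2 \<Gamma>" for j
      by (intro L2_mult L2_indicator_real S_adj_L2 cell_ind_L2 h A)
    have s2: "(\<lambda>x. \<Sum>j\<in>?J. c j * (indicator A x * S_adj \<Omega> (?e j) x)) \<in> L2 \<Gamma>" by (intro L2_sum s2')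
    have "L2_norm \<Gamma> (\<lambda>x. indicator A x * S_adj \<Omega> z x)
        = L2_norm \<Gamma> (\<lambda>x. indicator A x * S_adj \<Omega> ?d x + (\<Sum>j\<in>?J. c j * (indicator A x * S_adj \<Omega> (?e j) x)))"
      by (rule L2_norm_cong_diff(3)[OF L2_indicator_real[OF S_adj_L2[OF z] A] L2_add[OF s1 s2] s1 ae])
    also have "\<dots> \<le> L2_norm \<Gamma> (\<lambda>x. indicator A x * S_adj \<Omega> ?d x) + (\<Sum>j\<in>?J. L2_norm \<Gamma> (\<lambda>x. c j * (indicator A x * S_adj \<Omega> (?e j) x)))"
      using L2_norm_triangle(1)[OF s1 s2] L2_norm_sum[OF s2', of "\<lambda>j. j" ?J] L2_norm_sum[of ?J "\<lambda>j x. c j * (indicator A x * S_adj \<Omega> (?e j) x)" \<Gamma>] s2' by fastforce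
    also have "\<dots> \<le> \<epsilon> / 2 * ?nz + (\<Sum>j\<in>?J. 1 / h * ?nz * \<kappa>)"
    proof (intro add_mono sum_mono)
      show "L2_norm \<Gamma> (\<lambda>x. indicator A x * S_adj \<Omega> ?d x) \<le> \<epsilon> / 2 * ?nz"
        using L2_norm_indicator_le[OF S_adj_L2[OF dL] A] fr[OF z] by linarith
      fix j assume j: "j \<in> ?J"
      have "L2_norm \<Gamma> (\<lambda>x. c j * (indicator A x * S_adj \<Omega> (?e j) x)) = \<bar>c j\<bar> * L2_norm \<Gamma> (\<lambda>x. indicator A x * S_adj \<Omega> (?e j) x)"
        by (intro L2_norm_cmult L2_indicator_real S_adj_L2 cell_ind_L2 h A)
      also have "\<dots> \<le> (1 / h * ?nz) * \<kappa>"
        using h by (intro mult_mono c \<delta>(2) j A mA) (auto simp: L2_norm_nonneg)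
      finally show "L2_norm \<Gamma> (\<lambda>x. c j * (indicator A x * S_adj \<Omega> (?e j) x)) \<le> 1 / h * ?nz * \<kappa>" .
    qed
    also have "(\<Sum>j\<in>?J. 1 / h * ?nz * \<kappa>) = (1 / h * real (card ?J)) * \<kappa> * ?nz" by simp
    also have "\<dots> \<le> \<epsilon> / 2 * ?nz"
    proof (intro mult_right_mono L2_norm_nonneg)
      have "(1 / h * real (card ?J)) * \<kappa> \<le> (1 / h * real (card ?J) + 1) * \<kappa>" using \<kappa> by (intro mult_right_mono) auto
      also have "\<dots> = \<epsilon> / 2" unfolding \<kappa>_def by (rule mult_half_divide[OF den])
      finally show "(1 / h * real (card ?J)) * \<kappa> \<le> \<epsilon> / 2" .
    qed
    finally show "L2_norm \<Gamma> (\<lambda>x. indicator A x * S_adj \<Omega> z x) \<le> \<epsilon> * ?nz" by simp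
  qed
qed

lemma S_op_bounded: "\<exists>C\<ge>0. \<forall>u\<in>L2 \<Gamma>. L2_norm M\<Omega> (S_op \<Omega> u) \<le> C * L2_norm \<Gamma> u"
proof -
  obtain C where C: "C \<ge> 0" "\<And>z. z \<in> L2 M\<Omega> \<Longrightarrow> L2_norm \<Gamma> (S_adj \<Omega> z) \<le> C * L2_norm M\<Omega> z" using S_adj_bounded by blast
  have "L2_norm M\<Omega> (S_op \<Omega> u) \<le> C * L2_norm \<Gamma> u" if u: "u \<in> L2 \<Gamma>" for u
  proof -
    let ?y = "S_op \<Omega> u"
    note y = S_op_adjoint[OF u]
    have "L2_norm M\<Omega> ?y * L2_norm M\<Omega> ?y = L2_inner \<Gamma> u (S_adj \<Omega> ?y)"
      using y(2)[OF y(1)] L2_norm_sq[of M\<Omega> ?y] by (simp add: power2_eq_square)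
    also have "\<dots> \<le> L2_norm \<Gamma> u * L2_norm \<Gamma> (S_adj \<Omega> ?y)" using L2_cauchy_schwarz[OF u S_adj_L2[OF y(1)]] by simp
    also have "\<dots> \<le> L2_norm \<Gamma> u * (C * L2_norm M\<Omega> ?y)" by (intro mult_left_mono C y L2_norm_nonneg)
    finally have "L2_norm M\<Omega> ?y * L2_norm M\<Omega> ?y \<le> (C * L2_norm \<Gamma> u) * L2_norm M\<Omega> ?y" by (simp add: mult_ac)
    then show ?thesis using C(1) L2_norm_nonneg[of \<Gamma> u] L2_norm_nonneg[of M\<Omega> ?y]
      by (cases "L2_norm M\<Omega> ?y > 0") (auto intro: order_trans)
  qed
  with C(1) show ?thesis by blast
qed

text \<open>The approximation carries over by duality. With d = y - avg y the remainder of y = S u,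
  symmetry of \<open>avg\<close> gives (d, d) = (y, d - avg d) = (u, S_adj (d - avg d)), so
  \<parallel>d\<parallel> is small as well. The other part of y is a combination of cell indicators,
  with coefficients bounded by a multiple of \<parallel>u\<parallel>.\<close>

lemma equi_L2_S_op: "equi_L2 \<Gamma> M\<Omega> (S_op \<Omega>)"
  unfolding equi_L2_def
proof (intro allI impI)
  fix \<epsilon> :: real assume \<epsilon>: "\<epsilon> > 0"
  obtain h where h: "h > 0" and fr: "\<And>z. z \<in> L2 M\<Omega> \<Longrightarrow> L2_norm \<Gamma> (S_adj \<Omega> (\<lambda>x. z x - avg h z x)) \<le> \<epsilon> / 2 * L2_norm M\<Omega> z"
    using S_adj_finite_rank[of "\<epsilon>/2"] \<epsilon> by auto
  obtain C where C: "C \<ge> 0" "\<And>u. u \<in> L2 \<Gamma> \<Longrightarrow> L2_norm M\<Omega> (S_op \<Omega> u) \<le> C * L2_norm \<Gamma> u" using S_op_bounded by blast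
  let ?J = "cell h ` \<Omega>" and ?e = "cell_ind h"
  have fin: "finite ?J" by (rule finite_cells[OF bounded_dom h])
  define \<kappa> where "\<kappa> = \<epsilon> / (2 * (1 / h\<^sup>2 * h * C * real (card ?J) + 1))"
  have den: "0 < 1 / h\<^sup>2 * h * C * real (card ?J) + 1" using h C(1) by (intro add_nonneg_pos) auto
  then have \<kappa>: "\<kappa> > 0" using \<epsilon> by (simp add: \<kappa>_def)
  have "\<exists>\<delta>>0. \<forall>j\<in>?J. \<forall>t<\<delta>. \<forall>A\<in>sets M\<Omega>. measure M\<Omega> A = t \<longrightarrow> L2_norm M\<Omega> (\<lambda>x. indicator A x * ?e j x) \<le> \<kappa>"
    by (rule finite_common_delta[OF fin])
      (use L2_absolutely_continuous[OF finite_M\<Omega> cell_ind_L2[OF h] \<kappa>] in blast)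
  then obtain \<delta> where \<delta>: "\<delta> > 0" "\<And>j A. j \<in> ?J \<Longrightarrow> A \<in> sets M\<Omega> \<Longrightarrow> measure M\<Omega> A < \<delta> \<Longrightarrow> L2_norm M\<Omega> (\<lambda>x. indicator A x * ?e j x) \<le> \<kappa>"
    by blast
  show "\<exists>\<delta>>0. \<forall>A\<in>sets M\<Omega>. \<forall>u\<in>L2 \<Gamma>. measure M\<Omega> A < \<delta> \<longrightarrow> L2_norm M\<Omega> (\<lambda>x. indicator A x * S_op \<Omega> u x) \<le> \<epsilon> * L2_norm \<Gamma> u"
  proof (rule exI[of _ \<delta>], intro conjI ballI impI \<delta>(1))
    fix A and u :: "real^2 \<Rightarrow> real" assume A: "A \<in> sets M\<Omega>" and u: "u \<in> L2 \<Gamma>" and mA: "measure M\<Omega> A < \<delta>"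
    let ?y = "S_op \<Omega> u" and ?nu = "L2_norm \<Gamma> u"
    note y = S_op_adjoint[OF u]
    let ?d = "\<lambda>x. ?y x - avg h ?y x"
    have dL: "?d \<in> L2 M\<Omega>" by (intro L2_diff y avg_L2 h)
    have aL: "avg h ?d \<in> L2 M\<Omega>" by (rule avg_L2[OF h])
    have "L2_norm M\<Omega> ?d * L2_norm M\<Omega> ?d = L2_inner M\<Omega> ?d ?d" using L2_norm_sq[of M\<Omega> ?d] by (simp add: power2_eq_square)
    also have "\<dots> = L2_inner M\<Omega> ?y (\<lambda>x. ?d x - avg h ?d x)"
      using L2_inner_add(3)[OF y(1) avg_L2[OF h] dL] L2_inner_add(4)[OF dL aL y(1)]
        average_sym[of ?J ?e M\<Omega> ?y ?d "1 / h\<^sup>2", OF cell_ind_L2[OF h] y(1) dL] by simp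
    also have "\<dots> = L2_inner \<Gamma> u (S_adj \<Omega> (\<lambda>x. ?d x - avg h ?d x))" by (rule y(2)[OF L2_diff[OF dL aL]])
    also have "\<dots> \<le> ?nu * L2_norm \<Gamma> (S_adj \<Omega> (\<lambda>x. ?d x - avg h ?d x))"
      using L2_cauchy_schwarz[OF u S_adj_L2[OF L2_diff[OF dL aL]]] by simp
    also have "\<dots> \<le> ?nu * (\<epsilon> / 2 * L2_norm M\<Omega> ?d)" by (intro mult_left_mono fr dL L2_norm_nonneg)
    finally have "L2_norm M\<Omega> ?d * L2_norm M\<Omega> ?d \<le> (\<epsilon> / 2 * ?nu) * L2_norm M\<Omega> ?d" by (simp add: mult_ac)
    then have dn: "L2_norm M\<Omega> ?d \<le> \<epsilon> / 2 * ?nu" using \<epsilon> L2_norm_nonneg[of \<Gamma> u] L2_norm_nonneg[of M\<Omega> ?d]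
      by (cases "L2_norm M\<Omega> ?d > 0") (auto intro: order_trans)
    define c where "c j = 1 / h\<^sup>2 * L2_inner M\<Omega> ?y (?e j)" for j
    have c: "\<bar>c j\<bar> \<le> 1 / h\<^sup>2 * h * C * ?nu" for j
    proof -
      have "L2_norm M\<Omega> (?e j) \<le> h" unfolding L2_norm_def using cell_ind_norm[OF h, of j] h by (intro real_le_lsqrt) (auto simp: L2_inner_self_nonneg)
      then have "L2_norm M\<Omega> ?y * L2_norm M\<Omega> (?e j) \<le> (C * ?nu) * h"
        using C(1) by (intro mult_mono C(2) u) (auto simp: L2_norm_nonneg)
      then have "\<bar>L2_inner M\<Omega> ?y (?e j)\<bar> \<le> (C * ?nu) * h" using L2_cauchy_schwarz[OF y(1) cell_ind_L2[OF h, of j]] by simp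
      then have "1 / h\<^sup>2 * \<bar>L2_inner M\<Omega> ?y (?e j)\<bar> \<le> 1 / h\<^sup>2 * ((C * ?nu) * h)" by (intro mult_left_mono) auto
      then show ?thesis by (simp add: c_def abs_mult mult_ac)
    qed
    have s1: "(\<lambda>x. indicator A x * ?d x) \<in> L2 M\<Omega>" by (rule L2_indicator_real[OF dL A])
    have s2': "(\<lambda>x. c j * (indicator A x * ?e j x)) \<in> L2 M\<Omega>" for j by (intro L2_mult L2_indicator_real cell_ind_L2 h A)
    have s2: "(\<lambda>x. \<Sum>j\<in>?J. c j * (indicator A x * ?e j x)) \<in> L2 M\<Omega>" by (intro L2_sum s2')
    have eq: "(\<lambda>x. indicator A x * ?y x) = (\<lambda>x. indicator A x * ?d x + (\<Sum>j\<in>?J. c j * (indicator A x * ?e j x)))"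
      by (auto simp: fun_eq_iff average_def c_def indicator_def)
    have "L2_norm M\<Omega> (\<lambda>x. indicator A x * ?y x)
        \<le> L2_norm M\<Omega> (\<lambda>x. indicator A x * ?d x) + (\<Sum>j\<in>?J. L2_norm M\<Omega> (\<lambda>x. c j * (indicator A x * ?e j x)))"
      unfolding eq using L2_norm_triangle(1)[OF s1 s2] L2_norm_sum[of ?J "\<lambda>j x. c j * (indicator A x * ?e j x)" M\<Omega>] s2' by fastforce
    also have "\<dots> \<le> \<epsilon> / 2 * ?nu + (\<Sum>j\<in>?J. 1 / h\<^sup>2 * h * C * ?nu * \<kappa>)"
    proof (intro add_mono sum_mono)
      show "L2_norm M\<Omega> (\<lambda>x. indicator A x * ?d x) \<le> \<epsilon> / 2 * ?nu" using L2_norm_indicator_le[OF dL A] dn by linarith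
      fix j assume j: "j \<in> ?J"
      have "L2_norm M\<Omega> (\<lambda>x. c j * (indicator A x * ?e j x)) = \<bar>c j\<bar> * L2_norm M\<Omega> (\<lambda>x. indicator A x * ?e j x)"
        by (intro L2_norm_cmult L2_indicator_real cell_ind_L2 h A)
      also have "\<dots> \<le> (1 / h\<^sup>2 * h * C * ?nu) * \<kappa>"
        using h C(1) by (intro mult_mono c \<delta>(2) j A mA) (auto simp: L2_norm_nonneg)
      finally show "L2_norm M\<Omega> (\<lambda>x. c j * (indicator A x * ?e j x)) \<le> 1 / h\<^sup>2 * h * C * ?nu * \<kappa>" .
    qed
    also have "(\<Sum>j\<in>?J. 1 / h\<^sup>2 * h * C * ?nu * \<kappa>) = (1 / h\<^sup>2 * h * C * real (card ?J)) * \<kappa> * ?nu" by simp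
    also have "\<dots> \<le> \<epsilon> / 2 * ?nu"
    proof (intro mult_right_mono L2_norm_nonneg)
      have "(1 / h\<^sup>2 * h * C * real (card ?J)) * \<kappa> \<le> (1 / h\<^sup>2 * h * C * real (card ?J) + 1) * \<kappa>" using \<kappa> by (intro mult_right_mono) auto
      also have "\<dots> = \<epsilon> / 2" unfolding \<kappa>_def by (rule mult_half_divide[OF den])
      finally show "(1 / h\<^sup>2 * h * C * real (card ?J)) * \<kappa> \<le> \<epsilon> / 2" .
    qed
    finally show "L2_norm M\<Omega> (\<lambda>x. indicator A x * ?y x) \<le> \<epsilon> * ?nu" by simp
  qed
qed

end

subsection \<open>Semismooth Newton methods\<close>

text \<open>The defect of linearity is tested against itself; the adjoint moves the question to the
  argument, where it is trivial. For a state selected by choice this is how linearity is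
  obtained.\<close>

lemma adjoint_lincomb:
  fixes S :: "('a \<Rightarrow> real) \<Rightarrow> ('b \<Rightarrow> real)" and T :: "('b \<Rightarrow> real) \<Rightarrow> ('a \<Rightarrow> real)"
  assumes S: "\<And>u. u \<in> L2 M \<Longrightarrow> S u \<in> L2 N" and T: "\<And>z. z \<in> L2 N \<Longrightarrow> T z \<in> L2 M"
    and adj: "\<And>u z. u \<in> L2 M \<Longrightarrow> z \<in> L2 N \<Longrightarrow> L2_inner N (S u) z = L2_inner M u (T z)"
    and uv: "u \<in> L2 M" "v \<in> L2 M"
  shows "AE x in N. S (\<lambda>x. u x + c * v x) x = S u x + c * S v x"
proof -
  have cv: "(\<lambda>x. c * v x) \<in> L2 M" and ucv: "(\<lambda>x. u x + c * v x) \<in> L2 M" using uv L2_mult L2_add by blast+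
  let ?r = "\<lambda>x. S u x + c * S v x"
  have r: "?r \<in> L2 N" by (intro L2_add L2_mult S uv)
  let ?d = "\<lambda>x. S (\<lambda>x. u x + c * v x) x - ?r x"
  have d: "?d \<in> L2 N" by (rule L2_diff[OF S[OF ucv] r])
  have "L2_inner N ?d ?d = L2_inner M (\<lambda>x. u x + c * v x) (T ?d) - (L2_inner M u (T ?d) + c * L2_inner M v (T ?d))"
    using L2_inner_add(3)[OF S[OF ucv] r d] L2_inner_add(1)[OF S[OF uv(1)] L2_mult[OF S[OF uv(2)]] d, of c]
      adj[OF ucv d] adj[OF uv(1) d] adj[OF uv(2) d] by (simp add: L2_inner_cmult)
  then have "L2_inner N ?d ?d = 0" using L2_inner_add(1)[OF uv(1) cv T[OF d]] by (simp add: L2_inner_cmult)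
  then have "AE x in N. ?d x = 0" using L2_eq_ae_zero[OF d] by simp
  then show ?thesis by eventually_elim simp
qed

text \<open>By linearity and boundedness the image of the difference, a null function, is again a
  null function.\<close>

lemma lincomb_cong:
  fixes F :: "('a \<Rightarrow> real) \<Rightarrow> ('b \<Rightarrow> real)"
  assumes F: "\<And>u. u \<in> L2 M \<Longrightarrow> F u \<in> L2 N"
    and lin: "\<And>u v c. u \<in> L2 M \<Longrightarrow> v \<in> L2 M \<Longrightarrow> AE x in N. F (\<lambda>x. u x + c * v x) x = F u x + c * F v x"
    and bdd: "\<And>u. u \<in> L2 M \<Longrightarrow> L2_norm N (F u) \<le> C * L2_norm M u"
    and uv: "u \<in> L2 M" "v \<in> L2 M" "AE x in M. u x = v x"
  shows "AE x in N. F u x = F v x"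
proof -
  have w: "(\<lambda>x. u x + (-1) * v x) \<in> L2 M" by (intro L2_add L2_mult uv)
  have "AE x in M. u x + (-1) * v x = 0" using uv(3) by eventually_elim simp
  then have "L2_norm M (\<lambda>x. u x + (-1) * v x) = 0" using L2_norm_eq_zero[OF w] by simp
  then have "L2_norm N (F (\<lambda>x. u x + (-1) * v x)) = 0" using bdd[OF w] L2_norm_nonneg[of N "F (\<lambda>x. u x + (-1) * v x)"] by simp
  then have "AE x in N. F (\<lambda>x. u x + (-1) * v x) x = 0" using L2_norm_eq_zero[OF F[OF w]] by blast
  with lin[OF uv(1,2), of "-1"] show ?thesis by eventually_elim simp
qed

lemma L2_bounded_linearI:
  fixes F :: "('a \<Rightarrow> real) \<Rightarrow> ('b \<Rightarrow> real)"
  assumes F: "\<And>u. u \<in> L2 M \<Longrightarrow> F u \<in> L2 N"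
    and lin: "\<And>u v c. u \<in> L2 M \<Longrightarrow> v \<in> L2 M \<Longrightarrow> AE x in N. F (\<lambda>x. u x + c * v x) x = F u x + c * F v x"
    and bdd: "\<And>u. u \<in> L2 M \<Longrightarrow> L2_norm N (F u) \<le> C * L2_norm M u"
  shows "L2_bounded_linear M N F"
  unfolding L2_bounded_linear_def L2_map_def eq_ae_def
proof (intro conjI ballI allI impI)
  show "F u \<in> L2 N" if "u \<in> L2 M" for u by (rule F[OF that])
  show "AE x in N. F u x = F v x" if "u \<in> L2 M" "v \<in> L2 M" "AE x in M. u x = v x" for u v
    by (rule lincomb_cong[OF F lin bdd that])
  show "AE x in N. F (\<lambda>x. u x + v x) x = F u x + F v x" if "u \<in> L2 M" "v \<in> L2 M" for u v
    using lin[OF that, of 1] by simp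
  have z: "(\<lambda>x. 0) \<in> L2 M" by (rule L2_zero)
  have "L2_norm N (F (\<lambda>x. 0)) = 0" using bdd[OF z] L2_norm_nonneg[of N "F (\<lambda>x. 0)"] by (simp add: L2_norm_zero)
  then have F0: "AE x in N. F (\<lambda>x. 0) x = 0" using L2_norm_eq_zero[OF F[OF z]] by blast
  show "AE x in N. F (\<lambda>x. c * u x) x = c * F u x" if "u \<in> L2 M" for c u
    using lin[OF z that, of c] F0 by (auto elim: eventually_elim2)
  show "\<exists>C. \<forall>u\<in>L2 M. L2_norm N (F u) \<le> C * L2_norm M u" using bdd by blast
qed

text \<open>Uniform integrability of the images replaces the norm gap usually required of \<open>T\<close>.\<close>

lemma level_set_error:
  fixes T :: "('a \<Rightarrow> real) \<Rightarrow> ('b \<Rightarrow> real)" and w :: "'b \<Rightarrow> real"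
  assumes fin: "finite_measure N" and T: "\<And>v. v \<in> L2 M \<Longrightarrow> T v \<in> L2 N" and equi: "equi_L2 M N T"
    and bdd: "\<And>v. v \<in> L2 M \<Longrightarrow> L2_norm N (T v) \<le> C * L2_norm M v" and C: "C \<ge> 0"
    and w[measurable]: "w \<in> borel_measurable N" and \<epsilon>: "\<epsilon> > 0"
  shows "\<exists>\<delta>>0. \<forall>v\<in>L2 M. L2_norm M v < \<delta> \<longrightarrow>
    L2_norm N (\<lambda>x. indicator {x \<in> space N. 0 < \<bar>w x\<bar> \<and> \<bar>w x\<bar> \<le> \<bar>T v x\<bar>} x * T v x) \<le> \<epsilon> * L2_norm M v"
proof -
  interpret finite_measure N by fact
  obtain \<delta>0 where \<delta>0: "\<delta>0 > 0" "\<And>A v. A \<in> sets N \<Longrightarrow> v \<in> L2 M \<Longrightarrow> measure N A < \<delta>0 \<Longrightarrow>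
     L2_norm N (\<lambda>x. indicator A x * T v x) \<le> \<epsilon> * L2_norm M v"
    using equi \<epsilon> unfolding equi_L2_def by blast
  \<comment> \<open>Excluding the value 0 makes these sets shrink to the empty set, so their
    measures tend to 0 for a w that is merely measurable.\<close>
  define B where "B n = {x \<in> space N. 0 < \<bar>w x\<bar> \<and> \<bar>w x\<bar> < 1 / real (Suc n)}" for n
  have Bm: "B n \<in> sets N" for n unfolding B_def by measurable
  have "decseq B"
  proof (intro decseq_SucI subsetI)
    fix n x assume "x \<in> B (Suc n)"
    moreover have "1 / real (Suc (Suc n)) \<le> 1 / real (Suc n)" by (intro divide_left_mono) auto
    ultimately show "x \<in> B n" by (auto simp: B_def)
  qed
  then have "(\<lambda>n. measure N (B n)) \<longlonglongrightarrow> measure N (\<Inter>n. B n)"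
    using Bm by (intro finite_Lim_measure_decseq) auto
  moreover have "(\<Inter>n. B n) = {}"
  proof (rule ccontr)
    assume "(\<Inter>n. B n) \<noteq> {}"
    then obtain x where x: "\<And>n. x \<in> B n" by auto
    then have "0 < \<bar>w x\<bar>" by (auto simp: B_def)
    then obtain n where "1 / real (Suc n) < \<bar>w x\<bar>" using nat_approx_posE by blast
    with x[of n] show False by (auto simp: B_def)
  qed
  ultimately have "(\<lambda>n. measure N (B n)) \<longlonglongrightarrow> 0" by simp
  from LIMSEQ_D[OF this half_gt_zero[OF \<delta>0(1)]] obtain n where n: "measure N (B n) < \<delta>0 / 2" by auto
  define s where "s = 1 / real (Suc n)"
  have s: "s > 0" by (simp add: s_def)
  \<comment> \<open>Chosen for Chebyshev's inequality: if \<parallel>v\<parallel> < \<delta>, the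
    set where |T v| \<ge> s has measure below \<delta>0 / 2. Off that set, the level set under
    consideration lies in B n.\<close>
  define \<delta> where "\<delta> = s * sqrt (\<delta>0 / 2) / (C + 1)"
  have \<delta>: "\<delta> > 0" using s C \<delta>0 by (simp add: \<delta>_def)
  have "L2_norm N (\<lambda>x. indicator {x \<in> space N. 0 < \<bar>w x\<bar> \<and> \<bar>w x\<bar> \<le> \<bar>T v x\<bar>} x * T v x) \<le> \<epsilon> * L2_norm M v"
    if v: "v \<in> L2 M" and small: "L2_norm M v < \<delta>" for v
  proof (rule \<delta>0(2)[OF _ v])
    note [measurable] = L2_measurable[OF T[OF v]]
    let ?D = "{x \<in> space N. s \<le> \<bar>T v x\<bar>}"
    have D: "?D \<in> sets N" by measurable
    show "{x \<in> space N. 0 < \<bar>w x\<bar> \<and> \<bar>w x\<bar> \<le> \<bar>T v x\<bar>} \<in> sets N" by measurable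
    have Di: "integrable N (\<lambda>x. s\<^sup>2 * indicator ?D x :: real)"
      using D by (intro integrable_mult_right integrable_real_indicator) (auto simp: less_top[symmetric])
    have "s\<^sup>2 * measure N ?D = (LINT x|N. s\<^sup>2 * indicator ?D x)" using D by simp
    also have "\<dots> \<le> (LINT x|N. (norm (T v x))\<^sup>2)"
    proof (intro integral_mono Di L2_sq_integrable T v)
      fix x show "s\<^sup>2 * indicator ?D x \<le> (norm (T v x))\<^sup>2"
        using s power_mono[of s "\<bar>T v x\<bar>" 2] by (auto simp: indicator_def)
    qed
    also have "\<dots> = (L2_norm N (T v))\<^sup>2" by (simp add: L2_norm_sq L2_inner_self)
    also have "\<dots> \<le> (C * L2_norm M v)\<^sup>2" by (intro power_mono bdd v L2_norm_nonneg)
    also have "\<dots> \<le> (C * \<delta>)\<^sup>2" using small C by (intro power_mono mult_left_mono) (auto simp: L2_norm_nonneg)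
    also have "C * \<delta> < (C + 1) * \<delta>" using \<delta> by simp
    then have "(C * \<delta>)\<^sup>2 < ((C + 1) * \<delta>)\<^sup>2" using C \<delta> by (intro power_strict_mono) auto
    also have "((C + 1) * \<delta>)\<^sup>2 = s\<^sup>2 * (\<delta>0 / 2)" using C \<delta>0 by (simp add: \<delta>_def power_mult_distrib)
    finally have "measure N ?D < \<delta>0 / 2" using s by simp
    have Bs: "B n = {x \<in> space N. 0 < \<bar>w x\<bar> \<and> \<bar>w x\<bar> < s}" by (simp add: B_def s_def)
    have "measure N {x \<in> space N. 0 < \<bar>w x\<bar> \<and> \<bar>w x\<bar> \<le> \<bar>T v x\<bar>} \<le> measure N (B n \<union> ?D)"
      using Bm D by (intro finite_measure_mono) (auto simp: Bs)
    also have "\<dots> \<le> measure N (B n) + measure N ?D" using Bm D by (intro measure_Un_le)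
    finally show "measure N {x \<in> space N. 0 < \<bar>w x\<bar> \<and> \<bar>w x\<bar> \<le> \<bar>T v x\<bar>} < \<delta>0"
      using n \<open>measure N ?D < \<delta>0 / 2\<close> by linarith
  qed
  with \<delta> show ?thesis by blast
qed

text \<open>The derivative is taken at the new point a + t, as for slant differentials. If a = 0,
  the linearisation is then exact for either sign of t; an error can occur only if a is nonzero and
  t takes it to 0 or across, whence the condition 0 < |a| \<le> |t|.\<close>

lemma max_slant_error:
  fixes a t :: real
  shows "\<bar>max 0 (a + t) - max 0 a - (if a + t > 0 then t else 0)\<bar> \<le> (if 0 < \<bar>a\<bar> \<and> \<bar>a\<bar> \<le> \<bar>t\<bar> then \<bar>t\<bar> else 0)"
  by (auto simp: max_def)

text \<open>The same with q' as the point of linearisation: for q = c there is no error, on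
  whichever side of c the value q' lies.\<close>

lemma min_slant_error:
  fixes c q q' :: real
  shows "\<bar>min c q' - min c q - (if q' > c then 0 else q' - q)\<bar> \<le> (if 0 < \<bar>q - c\<bar> \<and> \<bar>q - c\<bar> \<le> \<bar>q' - q\<bar> then \<bar>q' - q\<bar> else 0)"
  by (auto simp: min_def)

text \<open>Since G w = 0, the new iterate u' satisfies D(u) (u' - w) = - (G u - G w - D(u) (u -
  w)). The right-hand side is up to sign the slant remainder at w in direction u - w, hence
  o(\<parallel>u - w\<parallel>), and the inverses of D(u) are bounded uniformly.\<close>

lemma newton_superlinear:
  fixes G :: "('a \<Rightarrow> real) \<Rightarrow> ('a \<Rightarrow> real)"
  assumes slant: "slant_differential M M G D"
    and inv: "\<And>u. u \<in> L2 M \<Longrightarrow> \<exists>N. L2_bounded_linear M M N \<and> (\<forall>v\<in>L2 M. eq_ae M (N (D u v)) v \<and> eq_ae M (D u (N v)) v \<and> L2_norm M (N v) \<le> C * L2_norm M v)"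
    and w: "w \<in> L2 M" "eq_ae M (G w) (\<lambda>x. 0)"
  shows "\<exists>\<delta>>0. \<forall>u0\<in>L2 M. L2_norm M (\<lambda>x. u0 x - w x) < \<delta> \<longrightarrow>
    (\<exists>u. newton_sequence M G D u \<and> u 0 = u0) \<and>
    (\<forall>u. newton_sequence M G D u \<and> u 0 = u0 \<longrightarrow> q_superlinear_convergence M u w)"
proof -
  have GL: "\<And>u. u \<in> L2 M \<Longrightarrow> G u \<in> L2 M" using slant by (auto simp: slant_differential_def L2_map_def)
  have lin: "\<And>u. u \<in> L2 M \<Longrightarrow> L2_bounded_linear M M (D u)" using slant by (auto simp: slant_differential_def)
  have DL: "\<And>u v. u \<in> L2 M \<Longrightarrow> v \<in> L2 M \<Longrightarrow> D u v \<in> L2 M" using lin by (auto simp: L2_bounded_linear_def L2_map_def)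
  define err where "err u = L2_norm M (\<lambda>x. u x - w x)" for u
  have step: "err u' \<le> \<bar>C\<bar> * L2_norm M (\<lambda>x. G u x - G w x - D u (\<lambda>x. u x - w x) x)"
    if u: "u \<in> L2 M" and u': "u' \<in> L2 M" and nt: "eq_ae M (D u (\<lambda>x. u' x - u x)) (\<lambda>x. - G u x)" for u u'
  proof -
    obtain N where N: "L2_bounded_linear M M N" "\<And>v. v \<in> L2 M \<Longrightarrow> eq_ae M (N (D u v)) v" "\<And>v. v \<in> L2 M \<Longrightarrow> L2_norm M (N v) \<le> C * L2_norm M v"
      using inv[OF u] by blast
    have NL: "\<And>v. v \<in> L2 M \<Longrightarrow> N v \<in> L2 M" using N(1) by (auto simp: L2_bounded_linear_def L2_map_def)
    let ?e = "\<lambda>x. u x - w x" and ?d = "\<lambda>x. u' x - u x" and ?e' = "\<lambda>x. u' x - w x"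
    have L: "?e \<in> L2 M" "?d \<in> L2 M" "?e' \<in> L2 M" by (intro L2_diff u u' w)+
    let ?r = "\<lambda>x. G u x - G w x - D u ?e x"
    have rL: "?r \<in> L2 M" by (intro L2_diff GL DL u w L)
    have "\<forall>f\<in>L2 M. \<forall>g\<in>L2 M. eq_ae M (D u (\<lambda>x. f x + g x)) (\<lambda>x. D u f x + D u g x)"
      using lin[OF u] unfolding L2_bounded_linear_def by simp
    from bspec[OF bspec[OF this L(2)] L(1)]
    have "AE x in M. D u (\<lambda>x. ?d x + ?e x) x = D u ?d x + D u ?e x" unfolding eq_ae_def .
    with nt w(2) have "AE x in M. D u ?e' x = - ?r x" unfolding eq_ae_def by eventually_elim simp
    then have n: "L2_norm M (D u ?e') = L2_norm M ?r"
      by (rule trans[OF L2_norm_cong_diff(3)[OF DL[OF u L(3)] L2_minus[OF rL] rL] L2_norm_minus])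
    have "err u' = L2_norm M (N (D u ?e'))"
      unfolding err_def using N(2)[OF L(3)] L2_norm_cong_diff(3)[OF NL[OF DL[OF u L(3)]] L(3) L(3)] by (simp add: eq_ae_def)
    also have "\<dots> \<le> C * L2_norm M (D u ?e')" by (rule N(3)[OF DL[OF u L(3)]])
    also have "\<dots> \<le> \<bar>C\<bar> * L2_norm M (D u ?e')" by (intro mult_right_mono L2_norm_nonneg) simp
    finally show ?thesis by (simp add: n)
  qed
  have small: "\<exists>\<delta>>0. \<forall>u\<in>L2 M. err u < \<delta> \<longrightarrow> (\<forall>u'\<in>L2 M. eq_ae M (D u (\<lambda>x. u' x - u x)) (\<lambda>x. - G u x) \<longrightarrow> err u' \<le> \<epsilon> * err u)"
    if \<epsilon>: "\<epsilon> > 0" for \<epsilon>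
  proof -
    have "0 < \<epsilon> / (\<bar>C\<bar> + 1)" using \<epsilon> by simp
    then obtain \<delta> where \<delta>: "\<delta> > 0" "\<And>d. d \<in> L2 M \<Longrightarrow> L2_norm M d < \<delta> \<Longrightarrow>
        L2_norm M (\<lambda>x. G (\<lambda>z. w z + d z) x - G w x - D (\<lambda>z. w z + d z) d x) \<le> \<epsilon> / (\<bar>C\<bar> + 1) * L2_norm M d"
      using slant w(1) unfolding slant_differential_def by blast
    show ?thesis
    proof (intro exI[of _ \<delta>] conjI ballI impI \<delta>(1))
      fix u u' assume u: "u \<in> L2 M" "err u < \<delta>" and u': "u' \<in> L2 M" "eq_ae M (D u (\<lambda>x. u' x - u x)) (\<lambda>x. - G u x)"
      have "L2_norm M (\<lambda>x. G u x - G w x - D u (\<lambda>x. u x - w x) x) \<le> \<epsilon> / (\<bar>C\<bar> + 1) * err u"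
        using \<delta>(2)[OF L2_diff[OF u(1) w(1)]] u(2) by (simp add: err_def)
      then have "err u' \<le> \<bar>C\<bar> * (\<epsilon> / (\<bar>C\<bar> + 1) * err u)"
        using step[OF u(1) u'] by (meson abs_ge_zero mult_left_mono order_trans)
      also have "\<dots> = (\<bar>C\<bar> / (\<bar>C\<bar> + 1)) * (\<epsilon> * err u)" by simp
      also have "\<dots> \<le> 1 * (\<epsilon> * err u)" using \<epsilon> by (intro mult_right_mono) (auto simp: err_def L2_norm_nonneg)
      finally show "err u' \<le> \<epsilon> * err u" by simp
    qed
  qed
  \<comment> \<open>The factor 1/2 makes the ball of radius \<delta> invariant and forces
    convergence; arbitrarily small factors are used afterwards for the superlinear rate.\<close>
  obtain \<delta> where \<delta>: "\<delta> > 0" and half: "\<And>u u'. u \<in> L2 M \<Longrightarrow> err u < \<delta> \<Longrightarrow> u' \<in> L2 M \<Longrightarrow> eq_ae M (D u (\<lambda>x. u' x - u x)) (\<lambda>x. - G u x) \<Longrightarrow> err u' \<le> 1/2 * err u"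
    using small[of "1/2"] by auto
  have next_ex: "\<exists>u'. u' \<in> L2 M \<and> eq_ae M (D u (\<lambda>x. u' x - u x)) (\<lambda>x. - G u x)" if u: "u \<in> L2 M" for u
  proof -
    obtain N where N: "L2_bounded_linear M M N" "\<And>v. v \<in> L2 M \<Longrightarrow> eq_ae M (D u (N v)) v" using inv[OF u] by blast
    have mG: "(\<lambda>x. - G u x) \<in> L2 M" by (rule L2_minus[OF GL[OF u]])
    then have NG: "N (\<lambda>x. - G u x) \<in> L2 M" using N(1) by (auto simp: L2_bounded_linear_def L2_map_def)
    show ?thesis using N(2)[OF mG] L2_add[OF u NG] by (intro exI[of _ "\<lambda>x. u x + N (\<lambda>x. - G u x) x"]) simp
  qed
  have exists_seq: "\<exists>u. newton_sequence M G D u \<and> u 0 = u0" if u0: "u0 \<in> L2 M" for u0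
  proof -
    define nxt where "nxt u = (SOME u'. u' \<in> L2 M \<and> eq_ae M (D u (\<lambda>x. u' x - u x)) (\<lambda>x. - G u x))" for u
    have nxt: "nxt u \<in> L2 M \<and> eq_ae M (D u (\<lambda>x. nxt u x - u x)) (\<lambda>x. - G u x)" if "u \<in> L2 M" for u
      unfolding nxt_def by (rule someI_ex[OF next_ex[OF that]])
    have L: "(nxt ^^ k) u0 \<in> L2 M" for k by (induction k) (use u0 nxt in auto)
    have "newton_sequence M G D (\<lambda>k. (nxt ^^ k) u0)"
      unfolding newton_sequence_def using L nxt[OF L] by simp
    then show ?thesis by (intro exI[of _ "\<lambda>k. (nxt ^^ k) u0"]) simp
  qed
  have conv: "q_superlinear_convergence M u w" if nseq: "newton_sequence M G D u" and u0: "err (u 0) < \<delta>" for u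
  proof -
    have uL: "\<And>k. u k \<in> L2 M" and nt: "\<And>k. eq_ae M (D (u k) (\<lambda>x. u (Suc k) x - u k x)) (\<lambda>x. - G (u k) x)"
      using nseq by (auto simp: newton_sequence_def)
    have e0: "0 \<le> err v" for v by (simp add: err_def L2_norm_nonneg)
    have dec: "err (u k) \<le> (1/2)^k * err (u 0) \<and> err (u k) < \<delta>" for k
    proof (induction k)
      case (Suc k)
      then have "err (u (Suc k)) \<le> 1/2 * err (u k)" using half[OF uL _ uL nt] by blast
      then show ?case using Suc e0[of "u k"] by auto
    qed (use u0 in simp)
    have "(\<lambda>k. (1/2)^k * err (u 0)) \<longlonglongrightarrow> 0 * err (u 0)" by (intro tendsto_intros LIMSEQ_power_zero) simp
    then have "(\<lambda>k. (1/2)^k * err (u 0)) \<longlonglongrightarrow> 0" by simp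
    then have lim: "(\<lambda>k. err (u k)) \<longlonglongrightarrow> 0"
      by (rule Lim_null_comparison[OF always_eventually, rotated]) (use dec e0 in simp)
    have "(\<lambda>k. err (u (Suc k))) \<in> o(\<lambda>k. err (u k))"
    proof (rule landau_o.smallI)
      fix \<epsilon> :: real assume "\<epsilon> > 0"
      from small[OF this] obtain \<delta>' where \<delta>': "\<delta>' > 0" "\<And>u u'. u \<in> L2 M \<Longrightarrow> err u < \<delta>' \<Longrightarrow> u' \<in> L2 M \<Longrightarrow>
          eq_ae M (D u (\<lambda>x. u' x - u x)) (\<lambda>x. - G u x) \<Longrightarrow> err u' \<le> \<epsilon> * err u" by blast
      have "\<forall>\<^sub>F k in sequentially. err (u k) < \<delta>'" using order_tendstoD(2)[OF lim \<delta>'(1)] .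
      then show "\<forall>\<^sub>F k in sequentially. norm (err (u (Suc k))) \<le> \<epsilon> * norm (err (u k))"
        by eventually_elim (use \<delta>'(2)[OF uL _ uL nt] e0 in simp)
    qed
    with lim show ?thesis by (simp add: q_superlinear_convergence_def err_def)
  qed
  show ?thesis
    by (rule exI[of _ \<delta>]) (use \<delta> exists_seq conv in \<open>simp add: err_def\<close>)
qed

lemma L2_norm_le_add:
  fixes f g h :: "'a \<Rightarrow> real"
  assumes L: "f \<in> L2 M" "g \<in> L2 M" "h \<in> L2 M" and le: "AE x in M. \<bar>f x\<bar> \<le> \<bar>g x\<bar> + \<bar>h x\<bar>"
  shows "L2_norm M f \<le> L2_norm M g + L2_norm M h"
proof -
  have a: "(\<lambda>x. \<bar>k x\<bar>) \<in> L2 M" "L2_norm M (\<lambda>x. \<bar>k x\<bar>) = L2_norm M k" if "k \<in> L2 M" for k :: "'a \<Rightarrow> real"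
  proof -
    have "(\<lambda>x. \<bar>k x\<bar>) \<in> borel_measurable M" using L2_measurable[OF that] by measurable
    then show "(\<lambda>x. \<bar>k x\<bar>) \<in> L2 M" by (rule L2_bound[OF that, of _ 1]) simp
    show "L2_norm M (\<lambda>x. \<bar>k x\<bar>) = L2_norm M k" by (simp add: L2_norm_def L2_inner_self)
  qed
  have "L2_norm M f \<le> L2_norm M (\<lambda>x. \<bar>g x\<bar> + \<bar>h x\<bar>)"
    by (rule L2_norm_mono[OF L(1) L2_add[OF a(1)[OF L(2)] a(1)[OF L(3)]]]) (use le in simp)
  also have "\<dots> \<le> L2_norm M g + L2_norm M h"
    using L2_norm_triangle(1)[OF a(1)[OF L(2)] a(1)[OF L(3)]] a(2)[OF L(2)] a(2)[OF L(3)] by simp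
  finally show ?thesis .
qed

text \<open>On \<open>F\<close> the equation is solved by the Riesz representation for the symmetric coercive form
  \<open>\<nu>(v, w) + (A(1\<^sub>F v), 1\<^sub>F w)\<close>; off \<open>F\<close> it is explicit.\<close>

lemma masked_inverse:
  fixes A :: "('a \<Rightarrow> real) \<Rightarrow> ('a \<Rightarrow> real)"
  assumes A: "\<And>v. v \<in> L2 M \<Longrightarrow> A v \<in> L2 M"
    and lin: "\<And>u v c. u \<in> L2 M \<Longrightarrow> v \<in> L2 M \<Longrightarrow> AE x in M. A (\<lambda>x. u x + c * v x) x = A u x + c * A v x"
    and bdd: "\<And>v. v \<in> L2 M \<Longrightarrow> L2_norm M (A v) \<le> K * L2_norm M v" and K: "K \<ge> 0"
    and sym: "\<And>u v. u \<in> L2 M \<Longrightarrow> v \<in> L2 M \<Longrightarrow> L2_inner M (A u) v = L2_inner M u (A v)"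
    and pos: "\<And>v. v \<in> L2 M \<Longrightarrow> 0 \<le> L2_inner M (A v) v"
    and F: "F \<in> sets M" and \<nu>: "\<nu> > 0"
  shows "\<exists>N. L2_bounded_linear M M N \<and> (\<forall>v\<in>L2 M.
    eq_ae M (N (\<lambda>x. \<nu> * v x + indicator F x * A v x)) v \<and>
    eq_ae M (\<lambda>x. \<nu> * N v x + indicator F x * A (N v) x) v \<and>
    L2_norm M (N v) \<le> (2 + K / \<nu>) / \<nu> * L2_norm M v)"
proof -
  define \<pi> where "\<pi> v x = indicator F x * v x" for v :: "'a \<Rightarrow> real" and x
  have \<pi>L: "\<pi> v \<in> L2 M" if "v \<in> L2 M" for v
    unfolding \<pi>_def[abs_def] by (rule L2_indicator_real[OF that F])
  have \<pi>n: "L2_norm M (\<pi> v) \<le> L2_norm M v" if "v \<in> L2 M" for v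
    unfolding \<pi>_def[abs_def] by (rule L2_norm_indicator_le[OF that F])
  have \<pi>sym: "L2_inner M (\<pi> u) v = L2_inner M u (\<pi> v)" for u v
    by (simp add: L2_inner_def \<pi>_def mult_ac)
  have \<pi>lin: "\<pi> (\<lambda>x. u x + c * v x) = (\<lambda>x. \<pi> u x + c * \<pi> v x)" for u v c
    by (simp add: \<pi>_def fun_eq_iff algebra_simps)
  have lc: "L2_inner M (\<lambda>x. u x + c * v x) w = L2_inner M u w + c * L2_inner M v w"
    if "u \<in> L2 M" "v \<in> L2 M" "w \<in> L2 M" for u v w :: "'a \<Rightarrow> real" and c
    using L2_inner_add(1)[OF that(1) L2_mult[OF that(2)] that(3), of c] by (simp add: L2_inner_cmult)
  define ip where "ip v w = \<nu> * L2_inner M v w + L2_inner M (A (\<pi> v)) (\<pi> w)" for v w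
  have ip_lc: "ip (\<lambda>x. u x + c * v x) w = ip u w + c * ip v w" if "u \<in> L2 M" "v \<in> L2 M" "w \<in> L2 M" for u v w c
  proof -
    have uv: "(\<lambda>x. \<pi> u x + c * \<pi> v x) \<in> L2 M" by (intro L2_add L2_mult \<pi>L that)
    have "L2_inner M (A (\<lambda>x. \<pi> u x + c * \<pi> v x)) (\<pi> w) = L2_inner M (\<lambda>x. A (\<pi> u) x + c * A (\<pi> v) x) (\<pi> w)"
      by (rule L2_norm_cong_diff(1)[OF A[OF uv] L2_add[OF A L2_mult[OF A]] _ lin]) (intro \<pi>L that)+
    then show ?thesis unfolding ip_def \<pi>lin
      using lc[OF that] lc[OF A[OF \<pi>L[OF that(1)]] A[OF \<pi>L[OF that(2)]] \<pi>L[OF that(3)]] by (simp add: algebra_simps)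
  qed
  have z: "(\<lambda>x. 0) \<in> L2 M" by (rule L2_zero)
  have ip0: "ip (\<lambda>x. 0) w = 0" if "w \<in> L2 M" for w using ip_lc[OF z z that, of 1] by simp
  have coer: "\<nu> * L2_inner M v v \<le> ip v v" and ip_up: "ip v v \<le> (\<nu> + K) * L2_inner M v v" if v: "v \<in> L2 M" for v
  proof -
    show "\<nu> * L2_inner M v v \<le> ip v v" using pos[OF \<pi>L[OF v]] by (simp add: ip_def)
    have "L2_inner M (A (\<pi> v)) (\<pi> v) \<le> L2_norm M (A (\<pi> v)) * L2_norm M (\<pi> v)"
      using L2_cauchy_schwarz[OF A[OF \<pi>L[OF v]] \<pi>L[OF v]] by simp
    also have "\<dots> \<le> (K * L2_norm M v) * L2_norm M v"
      using order_trans[OF bdd[OF \<pi>L[OF v]] mult_left_mono[OF \<pi>n[OF v] K]] \<pi>n[OF v] K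
      by (intro mult_mono) (auto simp: L2_norm_nonneg)
    also have "\<dots> = K * L2_inner M v v" by (simp add: L2_norm_sq[symmetric] power2_eq_square)
    finally show "ip v v \<le> (\<nu> + K) * L2_inner M v v" by (simp add: ip_def algebra_simps)
  qed
  \<comment> \<open>Coercivity and boundedness make this form equivalent to the L^2 inner product,
    so completeness is inherited.\<close>
  interpret H: semi_hilbert "L2 M :: ('a \<Rightarrow> real) set" ip
  proof
    fix f g h :: "'a \<Rightarrow> real" and c :: real
    assume f: "f \<in> L2 M"
    show "(\<lambda>x. c *\<^sub>R f x) \<in> L2 M" by (rule L2_scaleR[OF f])
    show "0 \<le> ip f f" using coer[OF f] mult_nonneg_nonneg[OF less_imp_le[OF \<nu>] L2_inner_self_nonneg[of M f]] by linarith
    assume g: "g \<in> L2 M"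
    show "(\<lambda>x. f x + g x) \<in> L2 M" by (rule L2_add[OF f g])
    show "ip f g = ip g f"
      unfolding ip_def using sym[OF \<pi>L[OF f] \<pi>L[OF g]] by (simp add: L2_inner_sym)
    show "ip (\<lambda>x. c *\<^sub>R f x) g = c * ip f g" using ip_lc[OF z f g, of c] ip0[OF g] by simp
    assume h: "h \<in> L2 M"
    show "ip (\<lambda>x. f x + g x) h = ip f h + ip g h" using ip_lc[OF f g h, of 1] by simp
  next
    fix X :: "nat \<Rightarrow> 'a \<Rightarrow> real"
    assume X: "\<And>n. X n \<in> L2 M"
      and cauchy: "\<And>e. 0 < e \<Longrightarrow> \<exists>N. \<forall>m\<ge>N. \<forall>n\<ge>N. ip (\<lambda>x. X m x - X n x) (\<lambda>x. X m x - X n x) < e"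
    have "\<exists>N. \<forall>m\<ge>N. \<forall>n\<ge>N. L2_inner M (\<lambda>x. X m x - X n x) (\<lambda>x. X m x - X n x) < e" if "e > 0" for e
    proof -
      have "\<nu> * e > 0" using \<nu> that by simp
      from cauchy[OF this] obtain N where N: "\<And>m n. m \<ge> N \<Longrightarrow> n \<ge> N \<Longrightarrow> ip (\<lambda>x. X m x - X n x) (\<lambda>x. X m x - X n x) < \<nu> * e" by blast
      have "L2_inner M (\<lambda>x. X m x - X n x) (\<lambda>x. X m x - X n x) < e" if "m \<ge> N" "n \<ge> N" for m n
        using le_less_trans[OF coer[OF L2_diff[OF X X]] N[OF that]] \<nu> by simp
      then show ?thesis by blast
    qed
    from L2_complete[OF X this] obtain f where f: "f \<in> L2 M"
      "(\<lambda>n. L2_inner M (\<lambda>x. X n x - f x) (\<lambda>x. X n x - f x)) \<longlonglongrightarrow> 0" by blast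
    have lim: "(\<lambda>n. (\<nu> + K) * L2_inner M (\<lambda>x. X n x - f x) (\<lambda>x. X n x - f x)) \<longlonglongrightarrow> 0" by (rule tendsto_mult_right_zero[OF f(2)])
    have "(\<lambda>n. ip (\<lambda>x. X n x - f x) (\<lambda>x. X n x - f x)) \<longlonglongrightarrow> 0"
    proof (rule tendsto_sandwich[OF always_eventually always_eventually tendsto_const lim]; intro allI)
      fix n
      note d = L2_diff[OF X[of n] f(1)]
      show "0 \<le> ip (\<lambda>x. X n x - f x) (\<lambda>x. X n x - f x)"
        using coer[OF d] mult_nonneg_nonneg[OF less_imp_le[OF \<nu>] L2_inner_self_nonneg[of M "\<lambda>x. X n x - f x"]] by linarith
      show "ip (\<lambda>x. X n x - f x) (\<lambda>x. X n x - f x) \<le> (\<nu> + K) * L2_inner M (\<lambda>x. X n x - f x) (\<lambda>x. X n x - f x)"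
        by (rule ip_up[OF d])
    qed
    with f(1) show "\<exists>f\<in>L2 M. (\<lambda>n. ip (\<lambda>x. X n x - f x) (\<lambda>x. X n x - f x)) \<longlonglongrightarrow> 0" by blast
  qed (rule z)
  have solve_sym: "\<exists>v\<in>L2 M. (AE x in M. \<nu> * v x + \<pi> (A (\<pi> v)) x = f x) \<and> L2_norm M v \<le> L2_norm M f / \<nu>"
    if f: "f \<in> L2 M" for f
  proof -
    have nn: "L2_norm M w \<le> H.nrm w / sqrt \<nu>" if w: "w \<in> L2 M" for w
      using real_sqrt_le_mono[OF coer[OF w]] \<nu> by (simp add: real_sqrt_mult L2_norm_def pos_le_divide_eq mult.commute)
    have "\<exists>X g. (\<forall>n::nat. X n \<in> L2 M) \<and> g \<in> L2 M \<and> (\<lambda>n. H.nrm (\<lambda>x. X n x - g x)) \<longlonglongrightarrow> 0 \<and>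
        (\<forall>w\<in>L2 M. ip g w = L2_inner M f w) \<and> H.nrm g \<le> L2_norm M f / sqrt \<nu>"
    proof (rule H.riesz)
      show "\<bar>L2_inner M f w\<bar> \<le> L2_norm M f / sqrt \<nu> * H.nrm w" if w: "w \<in> L2 M" for w
        using order_trans[OF L2_cauchy_schwarz[OF f w] mult_left_mono[OF nn[OF w] L2_norm_nonneg[of M f]]] by simp
      show "L2_inner M f (\<lambda>x. v x + w x) = L2_inner M f v + L2_inner M f w" if "v \<in> L2 M" "w \<in> L2 M" for v w
        by (rule L2_inner_add(2)[OF that f])
    qed (use \<nu> in \<open>auto intro: L2_zero L2_add L2_mult simp: L2_norm_nonneg L2_inner_cmult\<close>)
    then obtain v where v: "v \<in> L2 M" "\<And>w. w \<in> L2 M \<Longrightarrow> ip v w = L2_inner M f w" "H.nrm v \<le> L2_norm M f / sqrt \<nu>" by blast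
    note AL = A[OF \<pi>L[OF v(1)]]
    let ?r = "\<lambda>x. \<nu> * v x + \<pi> (A (\<pi> v)) x"
    have r: "?r \<in> L2 M" by (intro L2_add L2_mult v \<pi>L AL)
    let ?d = "\<lambda>x. ?r x - f x"
    have d: "?d \<in> L2 M" by (rule L2_diff[OF r f])
    have "L2_inner M ?d ?d = L2_inner M ?r ?d - L2_inner M f ?d" by (rule L2_inner_add(3)[OF r f d])
    also have "L2_inner M ?r ?d = ip v ?d"
      using L2_inner_add(1)[OF L2_mult[OF v(1)] \<pi>L[OF AL] d, of \<nu>] by (simp add: ip_def L2_inner_cmult \<pi>sym)
    finally have "AE x in M. ?d x = 0" using L2_eq_ae_zero[OF d] v(2)[OF d] by simp
    moreover have "L2_norm M v \<le> L2_norm M f / \<nu>"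
      using order_trans[OF nn[OF v(1)] divide_right_mono[OF v(3)]] \<nu> by simp
    ultimately show ?thesis using v(1) by (intro bexI[of _ v]) auto
  qed
  define P where "P y x = \<nu> * y x + indicator F x * A y x" for y x
  have PL: "P y \<in> L2 M" if "y \<in> L2 M" for y
    unfolding P_def[abs_def] by (intro L2_add L2_mult L2_indicator_real A F that)
  have P_lc: "AE x in M. P (\<lambda>x. u x + c * v x) x = P u x + c * P v x" if "u \<in> L2 M" "v \<in> L2 M" for u v c
    using lin[OF that, of c] by eventually_elim (simp add: P_def algebra_simps)
  have solve: "\<exists>y\<in>L2 M. (AE x in M. P y x = g x) \<and> L2_norm M y \<le> (2 + K / \<nu>) / \<nu> * L2_norm M g" if g: "g \<in> L2 M" for g
  proof -
    \<comment> \<open>Off F the equation reads \<nu> y = g, so y is h / \<nu> there, where h is g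
      restricted to the complement of F. Moving the image of this part under A to the right-hand
      side leaves a problem on F with datum f. The bounds (1 + K / \<nu>) / \<nu> on F and 1 / \<nu>
      off F add up to the constant in the statement.\<close>
    let ?h = "\<lambda>x. g x + (-1) * \<pi> g x"
    have h: "?h \<in> L2 M" by (intro L2_add L2_mult \<pi>L g)
    have hn: "L2_norm M ?h \<le> L2_norm M g"
      by (rule L2_norm_mono[OF h g]) (intro AE_I2, simp add: \<pi>_def indicator_def)
    let ?f = "\<lambda>x. \<pi> g x + (- 1 / \<nu>) * \<pi> (A ?h) x"
    have f1: "(\<lambda>x. (- 1 / \<nu>) * \<pi> (A ?h) x) \<in> L2 M" by (rule L2_mult[OF \<pi>L[OF A[OF h]]])
    have f: "?f \<in> L2 M" by (rule L2_add[OF \<pi>L[OF g] f1])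
    have fn: "L2_norm M ?f \<le> L2_norm M g + K / \<nu> * L2_norm M g"
    proof -
      have "L2_norm M ?f \<le> L2_norm M (\<pi> g) + L2_norm M (\<lambda>x. (- 1 / \<nu>) * \<pi> (A ?h) x)" by (rule L2_norm_triangle(1)[OF \<pi>L[OF g] f1])
      also have "L2_norm M (\<lambda>x. (- 1 / \<nu>) * \<pi> (A ?h) x) = 1 / \<nu> * L2_norm M (\<pi> (A ?h))" using L2_norm_cmult[OF \<pi>L[OF A[OF h]], of "- 1 / \<nu>"] \<nu> by simp
      also have "L2_norm M (\<pi> (A ?h)) \<le> K * L2_norm M g"
        using \<pi>n[OF A[OF h]] bdd[OF h] mult_left_mono[OF hn K] by linarith
      finally show ?thesis using \<pi>n[OF g] \<nu> by (simp add: divide_right_mono)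
    qed
    obtain v where v: "v \<in> L2 M" "AE x in M. \<nu> * v x + \<pi> (A (\<pi> v)) x = ?f x" "L2_norm M v \<le> L2_norm M ?f / \<nu>"
      using solve_sym[OF f] by blast
    have vs: "AE x in M. v x = \<pi> v x"
      using v(2) by eventually_elim (use \<nu> in \<open>auto simp: \<pi>_def indicator_def split: if_splits\<close>)
    have Av: "AE x in M. A v x = A (\<pi> v) x" by (rule lincomb_cong[OF A lin bdd v(1) \<pi>L[OF v(1)] vs])
    let ?y = "\<lambda>x. v x + (1 / \<nu>) * ?h x"
    have y: "?y \<in> L2 M" by (rule L2_add[OF v(1) L2_mult[OF h]])
    have "AE x in M. P ?y x = g x"
      using v(2) Av lin[OF v(1) h, of "1 / \<nu>"]
      by eventually_elim (use \<nu> in \<open>auto simp: P_def \<pi>_def indicator_def field_simps split: if_splits\<close>)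
    moreover have "L2_norm M ?y \<le> (2 + K / \<nu>) / \<nu> * L2_norm M g"
    proof -
      have "L2_norm M ?y \<le> L2_norm M v + L2_norm M (\<lambda>x. (1 / \<nu>) * ?h x)" by (rule L2_norm_triangle(1)[OF v(1) L2_mult[OF h]])
      also have "\<dots> \<le> (L2_norm M g + K / \<nu> * L2_norm M g) / \<nu> + 1 / \<nu> * L2_norm M g"
        using v(3) divide_right_mono[OF fn less_imp_le[OF \<nu>]] divide_right_mono[OF hn less_imp_le[OF \<nu>]] L2_norm_cmult[OF h, of "1 / \<nu>"] \<nu>
        by (intro add_mono) (auto intro: order_trans)
      also have "\<dots> = (2 + K / \<nu>) / \<nu> * L2_norm M g" using \<nu> by (simp add: field_simps)
      finally show ?thesis .
    qed
    ultimately show ?thesis using y by blast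
  qed
  \<comment> \<open>If P d = 0, then d vanishes off F, so A d = A (\<pi> d) and the coercive form of
    d with itself is 0.\<close>
  have inj: "AE x in M. y x = y' x" if y: "y \<in> L2 M" "y' \<in> L2 M" and eq: "AE x in M. P y x = P y' x" for y y'
  proof -
    let ?d = "\<lambda>x. y x + (-1) * y' x"
    have d: "?d \<in> L2 M" by (intro L2_add L2_mult y)
    have P0: "AE x in M. P ?d x = 0" using P_lc[OF y, of "-1"] eq by eventually_elim simp
    then have ds: "AE x in M. ?d x = \<pi> ?d x" by eventually_elim (use \<nu> in \<open>auto simp: P_def \<pi>_def indicator_def split: if_splits\<close>)
    have Ad: "AE x in M. A ?d x = A (\<pi> ?d) x" by (rule lincomb_cong[OF A lin bdd d \<pi>L[OF d] ds])
    have r: "(\<lambda>x. \<nu> * ?d x + \<pi> (A (\<pi> ?d)) x) \<in> L2 M" by (intro L2_add[of "\<lambda>x. \<nu> * ?d x"] L2_mult d \<pi>L A)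
    have "ip ?d ?d = L2_inner M (\<lambda>x. \<nu> * ?d x + \<pi> (A (\<pi> ?d)) x) ?d"
      using L2_inner_add(1)[OF L2_mult[OF d] \<pi>L[OF A[OF \<pi>L[OF d]]] d, of \<nu>] by (simp add: ip_def L2_inner_cmult \<pi>sym)
    also have "\<dots> = L2_inner M (\<lambda>x. 0) ?d"
    proof (rule L2_norm_cong_diff(1)[OF r z d])
      show "AE x in M. \<nu> * ?d x + \<pi> (A (\<pi> ?d)) x = 0" using P0 Ad by eventually_elim (simp add: P_def \<pi>_def)
    qed
    finally have "\<nu> * L2_inner M ?d ?d \<le> 0" using coer[OF d] by (simp add: L2_inner_def)
    then have "L2_inner M ?d ?d \<le> 0" using \<nu> by (simp add: mult_le_0_iff)
    from L2_eq_ae_zero[OF d this] show ?thesis by eventually_elim simp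
  qed
  define N where "N g = (SOME y. y \<in> L2 M \<and> (AE x in M. P y x = g x) \<and> L2_norm M y \<le> (2 + K / \<nu>) / \<nu> * L2_norm M g)" for g
  have N: "N g \<in> L2 M \<and> (AE x in M. P (N g) x = g x) \<and> L2_norm M (N g) \<le> (2 + K / \<nu>) / \<nu> * L2_norm M g" if "g \<in> L2 M" for g
    unfolding N_def by (rule someI_ex[of "\<lambda>y. y \<in> L2 M \<and> (AE x in M. P y x = g x) \<and> L2_norm M y \<le> (2 + K / \<nu>) / \<nu> * L2_norm M g"])
      (use solve[OF that] in blast)
  have N_lin: "AE x in M. N (\<lambda>x. u x + c * v x) x = N u x + c * N v x" if uv: "u \<in> L2 M" "v \<in> L2 M" for u v c
  proof -
    have w: "(\<lambda>x. u x + c * v x) \<in> L2 M" by (intro L2_add L2_mult uv)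
    have NL: "N u \<in> L2 M" "N v \<in> L2 M" using N uv by auto
    have "AE x in M. P (N (\<lambda>x. u x + c * v x)) x = u x + c * v x" "AE x in M. P (N u) x = u x" "AE x in M. P (N v) x = v x"
      using N[OF w] N[OF uv(1)] N[OF uv(2)] by auto
    then have eq: "AE x in M. P (N (\<lambda>x. u x + c * v x)) x = P (\<lambda>x. N u x + c * N v x) x"
      using P_lc[OF NL, of c] by eventually_elim simp
    show ?thesis by (rule inj[OF conjunct1[OF N[OF w]] L2_add[OF NL(1) L2_mult[OF NL(2)]] eq])
  qed
  have "L2_bounded_linear M M N" by (rule L2_bounded_linearI[OF _ N_lin, where C = "(2 + K / \<nu>) / \<nu>"]) (use N in auto)
  moreover have "eq_ae M (N (P v)) v" if v: "v \<in> L2 M" for v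
    unfolding eq_ae_def using N[OF PL[OF v]] inj[of "N (P v)" v] v by blast
  moreover have "eq_ae M (P (N v)) v" if v: "v \<in> L2 M" for v using N[OF v] by (simp add: eq_ae_def)
  ultimately have "L2_bounded_linear M M N \<and> (\<forall>v\<in>L2 M. eq_ae M (N (P v)) v \<and> eq_ae M (P (N v)) v \<and>
      L2_norm M (N v) \<le> (2 + K / \<nu>) / \<nu> * L2_norm M v)" using N by simp
  then show ?thesis unfolding P_def[abs_def] by (rule exI[of _ N])
qed

subsection \<open>The regularised control problem\<close>

lemma L2_pos_part:
  fixes f :: "'a \<Rightarrow> real" assumes f: "f \<in> L2 M" shows "(\<lambda>x. max 0 (f x)) \<in> L2 M"
proof -
  have "(\<lambda>x. max 0 (f x)) \<in> borel_measurable M" using L2_measurable[OF f] by measurable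
  then show ?thesis by (rule L2_bound[OF f, of _ 1]) auto
qed

lemma L2_min:
  fixes f g :: "'a \<Rightarrow> real" assumes "f \<in> L2 M" "g \<in> L2 M" shows "(\<lambda>x. min (f x) (g x)) \<in> L2 M"
proof -
  have "(\<lambda>x. min (f x) (g x)) = (\<lambda>x. f x - max 0 (f x - g x))" by (auto simp: fun_eq_iff)
  then show ?thesis using L2_diff[OF assms(1) L2_pos_part[OF L2_diff[OF assms]]] by simp
qed

text \<open>All that the Newton analysis retains of the elliptic problem: two bounded, mutually
  adjoint, uniformly integrable operators between finite measure spaces. The data \<mu> and b are
  square integrable after multiplication with the indicator of W, since they are given on the
  closure of \<omega> alone.\<close>

locale control =
  fixes \<Gamma> :: "'a measure" and \<Omega> :: "'b measure"
    and S :: "('a \<Rightarrow> real) \<Rightarrow> ('b \<Rightarrow> real)" and T :: "('b \<Rightarrow> real) \<Rightarrow> ('a \<Rightarrow> real)"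
    and W :: "'b set" and yd \<mu> b :: "'b \<Rightarrow> real" and \<beta> :: "'a \<Rightarrow> real" and \<gamma> \<nu> C :: real
  assumes finite_measures: "finite_measure \<Gamma>" "finite_measure \<Omega>"
    and S_L2: "\<And>u. u \<in> L2 \<Gamma> \<Longrightarrow> S u \<in> L2 \<Omega>" and T_L2: "\<And>z. z \<in> L2 \<Omega> \<Longrightarrow> T z \<in> L2 \<Gamma>"
    and adjoint: "\<And>u z. u \<in> L2 \<Gamma> \<Longrightarrow> z \<in> L2 \<Omega> \<Longrightarrow> L2_inner \<Omega> (S u) z = L2_inner \<Gamma> u (T z)"
    and S_bdd: "\<And>u. u \<in> L2 \<Gamma> \<Longrightarrow> L2_norm \<Omega> (S u) \<le> C * L2_norm \<Gamma> u"
    and T_bdd: "\<And>z. z \<in> L2 \<Omega> \<Longrightarrow> L2_norm \<Gamma> (T z) \<le> C * L2_norm \<Omega> z"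
    and C: "C \<ge> 0" and S_equi: "equi_L2 \<Gamma> \<Omega> S" and T_equi: "equi_L2 \<Omega> \<Gamma> T"
    and W: "W \<in> sets \<Omega>" and \<gamma>: "\<gamma> > 0" and \<nu>: "\<nu> > 0"
    and yd: "yd \<in> L2 \<Omega>" and \<beta>: "\<beta> \<in> L2 \<Gamma>"
    and \<mu>: "(\<lambda>x. indicator W x * \<mu> x) \<in> L2 \<Omega>" and b: "(\<lambda>x. indicator W x * b x) \<in> L2 \<Omega>"
begin

text \<open>The argument of max, cut off to W. Since max 0 0 = 0, the cutoff can be moved inside the
  maximum, which makes \<open>penalty\<close> the positive part of a single L^2 function.\<close>

definition shift :: "('a \<Rightarrow> real) \<Rightarrow> 'b \<Rightarrow> real" where
  "shift u z = indicator W z * (\<mu> z + \<gamma> * (S u z - b z))"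

definition penalty :: "('a \<Rightarrow> real) \<Rightarrow> 'b \<Rightarrow> real" where
  "penalty u z = indicator W z * max 0 (\<mu> z + \<gamma> * (S u z - b z))"

definition multiplier :: "('a \<Rightarrow> real) \<Rightarrow> 'a \<Rightarrow> real" where
  "multiplier u x = - T (S u) x + T yd x - T (penalty u) x"

definition residual :: "('a \<Rightarrow> real) \<Rightarrow> 'a \<Rightarrow> real" where
  "residual u x = \<nu> * u x - min (\<nu> * \<beta> x) (multiplier u x)"

definition act :: "('a \<Rightarrow> real) \<Rightarrow> 'b set" where
  "act u = {z \<in> W. \<mu> z + \<gamma> * (S u z - b z) > 0}"

definition free :: "('a \<Rightarrow> real) \<Rightarrow> 'a set" where
  "free u = space \<Gamma> - {x \<in> space \<Gamma>. multiplier u x > \<nu> * \<beta> x}"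

definition hess :: "('a \<Rightarrow> real) \<Rightarrow> ('a \<Rightarrow> real) \<Rightarrow> 'a \<Rightarrow> real" where
  "hess u v x = \<nu> * v x + indicator (free u) x * T (\<lambda>z. (1 + \<gamma> * indicator (act u) z) * S v z) x"

definition cost :: "('a \<Rightarrow> real) \<Rightarrow> real" where
  "cost u = 1/2 * L2_inner \<Omega> (\<lambda>z. S u z - yd z) (\<lambda>z. S u z - yd z) + \<nu>/2 * L2_inner \<Gamma> u u
     + 1/(2*\<gamma>) * L2_inner \<Omega> (penalty u) (penalty u)"

lemma penalty_alt: "penalty u = (\<lambda>z. max 0 (shift u z))"
  by (auto simp: fun_eq_iff penalty_def shift_def indicator_def)

lemma indicator_act: "indicator (act u) z = (if shift u z > 0 then 1 else (0::real))"
  by (auto simp: act_def shift_def indicator_def)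

lemma shift_L2: assumes u: "u \<in> L2 \<Gamma>" shows "shift u \<in> L2 \<Omega>"
proof -
  have "shift u = (\<lambda>z. indicator W z * \<mu> z + \<gamma> * (indicator W z * S u z - indicator W z * b z))"
    by (auto simp: fun_eq_iff shift_def indicator_def)
  also have "\<dots> \<in> L2 \<Omega>" by (intro L2_add \<mu> L2_mult L2_diff b L2_indicator_real S_L2 u W)
  finally show ?thesis .
qed

lemma penalty_L2: "u \<in> L2 \<Gamma> \<Longrightarrow> penalty u \<in> L2 \<Omega>"
  unfolding penalty_alt by (intro L2_pos_part shift_L2)

lemma multiplier_L2: "u \<in> L2 \<Gamma> \<Longrightarrow> multiplier u \<in> L2 \<Gamma>"
  unfolding multiplier_def[abs_def] by (intro L2_add L2_diff L2_minus T_L2 S_L2 yd penalty_L2)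

lemma residual_L2: "u \<in> L2 \<Gamma> \<Longrightarrow> residual u \<in> L2 \<Gamma>"
  unfolding residual_def[abs_def] by (intro L2_diff L2_mult L2_min \<beta> multiplier_L2)

lemma W_sub: "z \<in> W \<Longrightarrow> z \<in> space \<Omega>" using sets.sets_into_space[OF W] by auto

lemma act_sets: assumes u: "u \<in> L2 \<Gamma>" shows "act u \<in> sets \<Omega>"
proof -
  note [measurable] = L2_measurable[OF shift_L2[OF u]]
  have "act u = {z \<in> space \<Omega>. shift u z > 0}"
    by (auto simp: act_def shift_def indicator_def W_sub split: if_splits)
  also have "\<dots> \<in> sets \<Omega>" by measurable
  finally show ?thesis .
qed

lemma free_sets: assumes u: "u \<in> L2 \<Gamma>" shows "free u \<in> sets \<Gamma>"
proof -
  note [measurable] = L2_measurable[OF multiplier_L2[OF u]] L2_measurable[OF \<beta>]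
  show ?thesis unfolding free_def by measurable
qed

lemma S_lin: "u \<in> L2 \<Gamma> \<Longrightarrow> v \<in> L2 \<Gamma> \<Longrightarrow> AE x in \<Omega>. S (\<lambda>x. u x + c * v x) x = S u x + c * S v x"
  by (rule adjoint_lincomb[OF S_L2 T_L2 adjoint])

lemma T_lin: "z \<in> L2 \<Omega> \<Longrightarrow> w \<in> L2 \<Omega> \<Longrightarrow> AE x in \<Gamma>. T (\<lambda>x. z x + c * w x) x = T z x + c * T w x"
  by (rule adjoint_lincomb[OF T_L2 S_L2]) (auto simp: adjoint L2_inner_sym[of \<Gamma> "T _"] L2_inner_sym[of \<Omega> _ "S _"])

lemma T_diff:
  assumes "z \<in> L2 \<Omega>" "w \<in> L2 \<Omega>" shows "AE x in \<Gamma>. T (\<lambda>x. z x - w x) x = T z x - T w x"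
  using T_lin[OF assms, of "-1"] by simp

lemma S_diff:
  assumes "u \<in> L2 \<Gamma>" "v \<in> L2 \<Gamma>" shows "AE x in \<Omega>. S (\<lambda>x. u x - v x) x = S u x - S v x"
  using S_lin[OF assms, of "-1"] by simp

lemma S_cong: "u \<in> L2 \<Gamma> \<Longrightarrow> v \<in> L2 \<Gamma> \<Longrightarrow> AE x in \<Gamma>. u x = v x \<Longrightarrow> AE x in \<Omega>. S u x = S v x"
  by (rule lincomb_cong[OF S_L2 S_lin S_bdd])

lemma T_cong: "z \<in> L2 \<Omega> \<Longrightarrow> w \<in> L2 \<Omega> \<Longrightarrow> AE x in \<Omega>. z x = w x \<Longrightarrow> AE x in \<Gamma>. T z x = T w x"
  by (rule lincomb_cong[OF T_L2 T_lin T_bdd])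

lemma state_cong:
  assumes "u \<in> L2 \<Gamma>" "v \<in> L2 \<Gamma>" "AE x in \<Gamma>. u x = v x"
  shows "AE x in \<Omega>. shift u x = shift v x"
  using S_cong[OF assms] by eventually_elim (simp add: shift_def)

lemma multiplier_cong:
  assumes uv: "u \<in> L2 \<Gamma>" "v \<in> L2 \<Gamma>" "AE x in \<Gamma>. u x = v x"
  shows "AE x in \<Gamma>. multiplier u x = multiplier v x"
proof -
  have "AE x in \<Omega>. penalty u x = penalty v x"
    using state_cong[OF uv] by eventually_elim (simp add: penalty_alt)
  then have "AE x in \<Gamma>. T (penalty u) x = T (penalty v) x"
    using T_cong[of "penalty u" "penalty v"] penalty_L2 uv by blast
  moreover have "AE x in \<Gamma>. T (S u) x = T (S v) x"
    using T_cong[of "S u" "S v"] S_L2 uv S_cong[OF uv] by blast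
  ultimately show ?thesis by eventually_elim (simp add: multiplier_def)
qed

text \<open>The two u-dependent terms to which T is applied in the multiplier, combined, so that an
  increment of the multiplier is T of a single function.\<close>

definition state :: "('a \<Rightarrow> real) \<Rightarrow> 'b \<Rightarrow> real" where
  "state u z = S u z + penalty u z"

lemma state_L2: "u \<in> L2 \<Gamma> \<Longrightarrow> state u \<in> L2 \<Omega>"
  unfolding state_def[abs_def] by (intro L2_add S_L2 penalty_L2)

lemma multiplier_state:
  assumes u: "u \<in> L2 \<Gamma>" shows "AE x in \<Gamma>. multiplier u x = T yd x - T (state u) x"
  using T_lin[OF S_L2[OF u] penalty_L2[OF u], of 1]
  by (auto simp: multiplier_def state_def[abs_def] elim: eventually_mono)

lemma multiplier_diff:
  assumes "u \<in> L2 \<Gamma>" "v \<in> L2 \<Gamma>"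
  shows "AE x in \<Gamma>. multiplier v x - multiplier u x = T (\<lambda>z. state u z - state v z) x"
  using multiplier_state[OF assms(1)] multiplier_state[OF assms(2)] T_diff[OF state_L2[OF assms(1)] state_L2[OF assms(2)]]
  by eventually_elim simp

lemma S_diff_norm:
  assumes "u \<in> L2 \<Gamma>" "v \<in> L2 \<Gamma>"
  shows "L2_norm \<Omega> (\<lambda>z. S u z - S v z) \<le> C * L2_norm \<Gamma> (\<lambda>x. u x - v x)"
  using L2_norm_cong_diff(3)[OF S_L2[OF L2_diff[OF assms]] L2_diff[OF S_L2[OF assms(1)] S_L2[OF assms(2)]]
      S_L2[OF assms(1)] S_diff[OF assms]] S_bdd[OF L2_diff[OF assms]] by simp

lemma shift_diff: "shift v z - shift u z = indicator W z * (\<gamma> * (S v z - S u z))"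
  by (simp add: shift_def algebra_simps)

lemma state_lipschitz:
  assumes uv: "u \<in> L2 \<Gamma>" "v \<in> L2 \<Gamma>"
  shows "L2_norm \<Omega> (\<lambda>z. state u z - state v z) \<le> (1 + \<gamma>) * C * L2_norm \<Gamma> (\<lambda>x. u x - v x)"
proof -
  have d: "(\<lambda>z. S u z - S v z) \<in> L2 \<Omega>" by (intro L2_diff S_L2 uv)
  have "\<bar>state u z - state v z\<bar> \<le> \<bar>(1 + \<gamma>) * (S u z - S v z)\<bar>" for z
  proof -
    have "\<bar>penalty u z - penalty v z\<bar> \<le> \<bar>shift u z - shift v z\<bar>" by (auto simp: penalty_alt)
    also have "\<dots> \<le> \<bar>\<gamma> * (S u z - S v z)\<bar>" unfolding shift_diff by (simp add: indicator_def)
    finally show ?thesis using \<gamma> by (simp add: state_def abs_mult distrib_right)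
  qed
  then have "L2_norm \<Omega> (\<lambda>z. state u z - state v z) \<le> L2_norm \<Omega> (\<lambda>z. (1 + \<gamma>) * (S u z - S v z))"
    by (intro L2_norm_mono L2_diff state_L2 L2_mult[OF d] uv) auto
  also have "\<dots> = (1 + \<gamma>) * L2_norm \<Omega> (\<lambda>z. S u z - S v z)" using L2_norm_cmult[OF d, of "1 + \<gamma>"] \<gamma> by simp
  also have "\<dots> \<le> (1 + \<gamma>) * (C * L2_norm \<Gamma> (\<lambda>x. u x - v x))" using \<gamma> by (intro mult_left_mono S_diff_norm uv) auto
  finally show ?thesis by simp
qed

text \<open>The slant derivative of \<open>state\<close> at u in direction v.\<close>

definition weight :: "('a \<Rightarrow> real) \<Rightarrow> ('a \<Rightarrow> real) \<Rightarrow> 'b \<Rightarrow> real" where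
  "weight u v z = (1 + \<gamma> * indicator (act u) z) * S v z"

lemma hess_alt: "hess u v = (\<lambda>x. \<nu> * v x + indicator (free u) x * T (weight u v) x)"
  by (simp add: fun_eq_iff hess_def weight_def[abs_def])

lemma weight_L2: assumes "u \<in> L2 \<Gamma>" "v \<in> L2 \<Gamma>" shows "weight u v \<in> L2 \<Omega>"
proof -
  have "weight u v = (\<lambda>z. S v z + \<gamma> * (indicator (act u) z * S v z))"
    by (simp add: fun_eq_iff weight_def algebra_simps)
  also have "\<dots> \<in> L2 \<Omega>" by (intro L2_add L2_mult L2_indicator_real act_sets S_L2 assms)
  finally show ?thesis .
qed

lemma weight_bdd:
  assumes u: "u \<in> L2 \<Gamma>" and v: "v \<in> L2 \<Gamma>" shows "L2_norm \<Omega> (weight u v) \<le> (1 + \<gamma>) * C * L2_norm \<Gamma> v"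
proof -
  have "L2_norm \<Omega> (weight u v) \<le> L2_norm \<Omega> (\<lambda>z. (1 + \<gamma>) * S v z)"
  proof (rule L2_norm_mono[OF weight_L2[OF u v] L2_mult[OF S_L2[OF v]]], rule AE_I2)
    show "norm (weight u v z) \<le> norm ((1 + \<gamma>) * S v z)" for z
      unfolding weight_def norm_mult by (rule mult_right_mono) (use \<gamma> in \<open>auto simp: indicator_def\<close>)
  qed
  also have "\<dots> = (1 + \<gamma>) * L2_norm \<Omega> (S v)" using L2_norm_cmult[OF S_L2[OF v], of "1 + \<gamma>"] \<gamma> by simp
  also have "\<dots> \<le> (1 + \<gamma>) * (C * L2_norm \<Gamma> v)" using \<gamma> by (intro mult_left_mono S_bdd v) auto
  finally show ?thesis by simp
qed

lemma TS_L2: "u \<in> L2 \<Gamma> \<Longrightarrow> v \<in> L2 \<Gamma> \<Longrightarrow> T (weight u v) \<in> L2 \<Gamma>"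
  by (intro T_L2 weight_L2)

lemma TS_bdd:
  assumes u: "u \<in> L2 \<Gamma>" and v: "v \<in> L2 \<Gamma>"
  shows "L2_norm \<Gamma> (T (weight u v)) \<le> C * ((1 + \<gamma>) * C) * L2_norm \<Gamma> v"
  using order_trans[OF T_bdd[OF weight_L2[OF u v]] mult_left_mono[OF weight_bdd[OF u v] C]] by (simp add: mult_ac)

lemma TS_lin:
  assumes u: "u \<in> L2 \<Gamma>" and v: "v \<in> L2 \<Gamma>" "w \<in> L2 \<Gamma>"
  shows "AE x in \<Gamma>. T (weight u (\<lambda>x. v x + c * w x)) x = T (weight u v) x + c * T (weight u w) x"
proof -
  have vw: "(\<lambda>x. v x + c * w x) \<in> L2 \<Gamma>" by (intro L2_add L2_mult v)
  have "AE z in \<Omega>. weight u (\<lambda>x. v x + c * w x) z = weight u v z + c * weight u w z"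
    using S_lin[OF v, of c] by eventually_elim (simp add: weight_def algebra_simps)
  from T_cong[OF weight_L2[OF u vw] L2_add[OF weight_L2[OF u v(1)] L2_mult[OF weight_L2[OF u v(2)]]] this]
    T_lin[OF weight_L2[OF u v(1)] weight_L2[OF u v(2)], of c]
  show ?thesis by eventually_elim simp
qed

lemma TS_form:
  assumes u: "u \<in> L2 \<Gamma>" and v: "v \<in> L2 \<Gamma>" and w: "w \<in> L2 \<Gamma>"
  shows "L2_inner \<Gamma> (T (weight u v)) w = L2_inner \<Omega> (weight u v) (S w)"
  using adjoint[OF w weight_L2[OF u v]] L2_inner_sym[of \<Gamma> w] L2_inner_sym[of \<Omega> "S w"] by simp

text \<open>The form of v \<mapsto> T (weight u v) is the integral of S v S w against a weight with
  values in {1, 1 + \<gamma>}, so it is symmetric and nonnegative. The values of the weight also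
  give an operator bound independent of the active sets, and thus of u.\<close>

lemma hess_inverse:
  assumes u: "u \<in> L2 \<Gamma>"
  shows "\<exists>N. L2_bounded_linear \<Gamma> \<Gamma> N \<and> (\<forall>v\<in>L2 \<Gamma>. eq_ae \<Gamma> (N (hess u v)) v \<and> eq_ae \<Gamma> (hess u (N v)) v \<and>
    L2_norm \<Gamma> (N v) \<le> (2 + C * ((1 + \<gamma>) * C) / \<nu>) / \<nu> * L2_norm \<Gamma> v)"
  unfolding hess_alt
proof (rule masked_inverse[OF TS_L2[OF u] TS_lin[OF u] TS_bdd[OF u] _ _ _ free_sets[OF u] \<nu>])
  show "0 \<le> C * ((1 + \<gamma>) * C)" using C \<gamma> by simp
  show "L2_inner \<Gamma> (T (weight u v)) w = L2_inner \<Gamma> v (T (weight u w))" if "v \<in> L2 \<Gamma>" "w \<in> L2 \<Gamma>" for v w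
    unfolding TS_form[OF u that] L2_inner_sym[of \<Gamma> v] TS_form[OF u that(2,1)]
    by (simp add: L2_inner_def weight_def mult_ac)
  show "0 \<le> L2_inner \<Gamma> (T (weight u v)) v" if "v \<in> L2 \<Gamma>" for v
    using \<gamma> by (subst TS_form[OF u that that], unfold L2_inner_def, intro Bochner_Integration.integral_nonneg)
      (simp add: weight_def mult.assoc)
qed

lemma hess_bounded_linear: assumes u: "u \<in> L2 \<Gamma>" shows "L2_bounded_linear \<Gamma> \<Gamma> (hess u)"
proof (rule L2_bounded_linearI)
  show hL: "hess u v \<in> L2 \<Gamma>" if "v \<in> L2 \<Gamma>" for v
    unfolding hess_alt by (intro L2_add L2_mult L2_indicator_real TS_L2 free_sets u that)
  show "AE x in \<Gamma>. hess u (\<lambda>x. v x + c * w x) x = hess u v x + c * hess u w x" if "v \<in> L2 \<Gamma>" "w \<in> L2 \<Gamma>" for v w c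
    using TS_lin[OF u that, of c] by eventually_elim (simp add: hess_alt algebra_simps)
  show "L2_norm \<Gamma> (hess u v) \<le> (\<nu> + C * ((1 + \<gamma>) * C)) * L2_norm \<Gamma> v" if v: "v \<in> L2 \<Gamma>" for v
  proof -
    have "L2_norm \<Gamma> (hess u v) \<le> L2_norm \<Gamma> (\<lambda>x. \<nu> * v x) + L2_norm \<Gamma> (T (weight u v))"
      by (rule L2_norm_le_add[OF hL[OF v] L2_mult[OF v] TS_L2[OF u v]])
        (intro AE_I2, auto simp: hess_alt indicator_def intro: order_trans[OF abs_triangle_ineq])
    then show ?thesis using L2_norm_cmult[OF v, of \<nu>] TS_bdd[OF u v] \<nu> by (simp add: distrib_right)
  qed
qed

lemma hess_cong:
  assumes uv: "u \<in> L2 \<Gamma>" "v \<in> L2 \<Gamma>" "AE x in \<Gamma>. u x = v x" and w: "w \<in> L2 \<Gamma>"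
  shows "AE x in \<Gamma>. hess u w x = hess v w x"
proof -
  have "AE z in \<Omega>. weight u w z = weight v w z"
    using state_cong[OF uv] by eventually_elim (simp add: weight_def indicator_act)
  from T_cong[OF weight_L2[OF uv(1) w] weight_L2[OF uv(2) w] this] multiplier_cong[OF uv]
  show ?thesis by eventually_elim (simp add: hess_alt free_def indicator_def)
qed

text \<open>The remainder splits into two errors. If z is the decrease of \<open>state\<close> from
  u to u + d, then the multiplier increases by T z, and linearising min costs something only where
  the multiplier is close to \<nu> \<beta> relative to T z. The sum of z and the weight is the
  linearisation error of max, which T maps boundedly. Each error is governed by
  \<open>level_set_error\<close>, once for T and once for S.\<close>

lemma residual_slant: "slant_differential \<Gamma> \<Gamma> residual hess"
  unfolding slant_differential_def L2_map_def eq_ae_def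
proof (intro conjI ballI impI allI)
  show "residual u \<in> L2 \<Gamma>" if "u \<in> L2 \<Gamma>" for u by (rule residual_L2[OF that])
  show "AE x in \<Gamma>. residual u x = residual v x" if "u \<in> L2 \<Gamma>" "v \<in> L2 \<Gamma>" "AE x in \<Gamma>. u x = v x" for u v
    using multiplier_cong[OF that] that(3) by eventually_elim (simp add: residual_def)
  show "AE x in \<Gamma>. hess u w x = hess v w x" if "u \<in> L2 \<Gamma>" "v \<in> L2 \<Gamma>" "AE x in \<Gamma>. u x = v x" "w \<in> L2 \<Gamma>" for u v w
    by (rule hess_cong[OF that])
  show "L2_bounded_linear \<Gamma> \<Gamma> (hess u)" if "u \<in> L2 \<Gamma>" for u by (rule hess_bounded_linear[OF that])
  fix u :: "'a \<Rightarrow> real" and \<epsilon> :: real assume u: "u \<in> L2 \<Gamma>" and \<epsilon>: "\<epsilon> > 0"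
  \<comment> \<open>A Lipschitz constant of \<open>state\<close>, enlarged by 1 to be positive. It
    converts smallness of d into smallness of z.\<close>
  define K where "K = (1 + \<gamma>) * C + 1"
  have K: "K > 0" using C \<gamma> by (simp add: K_def add_nonneg_pos)
  define w1 where "w1 x = multiplier u x - \<nu> * \<beta> x" for x
  \<comment> \<open>Division by \<gamma> accounts for the argument of max changing by at most
    \<gamma> |S d|.\<close>
  define w2 where "w2 z = shift u z / \<gamma>" for z
  have w1m: "w1 \<in> borel_measurable \<Gamma>" unfolding w1_def[abs_def]
    by (intro L2_measurable L2_diff L2_mult multiplier_L2 u \<beta>)
  have w2m: "w2 \<in> borel_measurable \<Omega>" unfolding w2_def[abs_def]
    using L2_measurable[OF shift_L2[OF u]] by measurable
  have "\<epsilon> / (2 * K) > 0" using \<epsilon> K by simp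
  from level_set_error[OF finite_measures(1) T_L2 T_equi T_bdd C w1m this]
  obtain \<delta>1 where \<delta>1: "\<delta>1 > 0" "\<And>z. z \<in> L2 \<Omega> \<Longrightarrow> L2_norm \<Omega> z < \<delta>1 \<Longrightarrow>
    L2_norm \<Gamma> (\<lambda>x. indicator {x \<in> space \<Gamma>. 0 < \<bar>w1 x\<bar> \<and> \<bar>w1 x\<bar> \<le> \<bar>T z x\<bar>} x * T z x) \<le> \<epsilon> / (2 * K) * L2_norm \<Omega> z"
    by blast
  have "\<epsilon> / (2 * (C * \<gamma> + 1)) > 0" using \<epsilon> C \<gamma> by (simp add: add_nonneg_pos)
  from level_set_error[OF finite_measures(2) S_L2 S_equi S_bdd C w2m this]
  obtain \<delta>2 where \<delta>2: "\<delta>2 > 0" "\<And>d. d \<in> L2 \<Gamma> \<Longrightarrow> L2_norm \<Gamma> d < \<delta>2 \<Longrightarrow>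
    L2_norm \<Omega> (\<lambda>z. indicator {z \<in> space \<Omega>. 0 < \<bar>w2 z\<bar> \<and> \<bar>w2 z\<bar> \<le> \<bar>S d z\<bar>} z * S d z) \<le> \<epsilon> / (2 * (C * \<gamma> + 1)) * L2_norm \<Gamma> d"
    by blast
  show "\<exists>\<delta>>0. \<forall>d\<in>L2 \<Gamma>. L2_norm \<Gamma> d < \<delta> \<longrightarrow>
      L2_norm \<Gamma> (\<lambda>x. residual (\<lambda>z. u z + d z) x - residual u x - hess (\<lambda>z. u z + d z) d x) \<le> \<epsilon> * L2_norm \<Gamma> d"
  proof (rule exI[of _ "min (\<delta>1 / K) \<delta>2"], intro conjI ballI impI)
    show "0 < min (\<delta>1 / K) \<delta>2" using \<delta>1(1) \<delta>2(1) K by simp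
    fix d :: "'a \<Rightarrow> real" assume d: "d \<in> L2 \<Gamma>" and small: "L2_norm \<Gamma> d < min (\<delta>1 / K) \<delta>2"
    let ?u = "\<lambda>z. u z + d z"
    have u': "?u \<in> L2 \<Gamma>" by (rule L2_add[OF u d])
    let ?z = "\<lambda>z. state u z - state ?u z"
    let ?k = "\<lambda>z. ?z z + weight ?u d z"
    let ?A = "{x \<in> space \<Gamma>. 0 < \<bar>w1 x\<bar> \<and> \<bar>w1 x\<bar> \<le> \<bar>T ?z x\<bar>}" and ?B = "{z \<in> space \<Omega>. 0 < \<bar>w2 z\<bar> \<and> \<bar>w2 z\<bar> \<le> \<bar>S d z\<bar>}"
    have z: "?z \<in> L2 \<Omega>" by (intro L2_diff state_L2 u u')
    have k: "?k \<in> L2 \<Omega>" by (intro L2_add z weight_L2 u' d)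
    note [measurable] = w1m w2m L2_measurable[OF T_L2[OF z]] L2_measurable[OF S_L2[OF d]]
    have A: "?A \<in> sets \<Gamma>" and B: "?B \<in> sets \<Omega>" by measurable
    have zn: "L2_norm \<Omega> ?z \<le> K * L2_norm \<Gamma> d"
      using state_lipschitz[OF u u'] L2_norm_nonneg[of \<Gamma> d] by (simp add: L2_norm_minus K_def distrib_right)
    also have "\<dots> < \<delta>1" using small K by (simp add: pos_less_divide_eq mult.commute)
    finally have outer: "L2_norm \<Gamma> (\<lambda>x. indicator ?A x * T ?z x) \<le> \<epsilon> / (2 * K) * L2_norm \<Omega> ?z" by (rule \<delta>1(2)[OF z])
    also have "\<dots> \<le> \<epsilon> / (2 * K) * (K * L2_norm \<Gamma> d)" using \<epsilon> K by (intro mult_left_mono zn) auto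
    also have "\<dots> = \<epsilon> / 2 * L2_norm \<Gamma> d" using K by simp
    finally have outer: "L2_norm \<Gamma> (\<lambda>x. indicator ?A x * T ?z x) \<le> \<epsilon> / 2 * L2_norm \<Gamma> d" .
    have Sd: "AE z in \<Omega>. S ?u z = S u z + S d z" using S_lin[OF u d, of 1] by simp
    have "AE z in \<Omega>. \<bar>?k z\<bar> \<le> \<bar>\<gamma> * (indicator ?B z * S d z)\<bar>"
      using Sd AE_space
    proof eventually_elim
      case (elim z)
      define t where "t = indicator W z * (\<gamma> * S d z)"
      have sh: "shift ?u z = shift u z + t" using shift_diff[of ?u z u] elim(1) by (simp add: t_def)
      have gt: "\<gamma> * indicator (act ?u) z * S d z = (if shift u z + t > 0 then t else 0)"
        by (simp add: indicator_act sh t_def) (auto simp: indicator_def shift_def sh[symmetric])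
      have pen: "penalty ?u z = max 0 (shift u z + t)" by (simp only: penalty_alt sh)
      have wt: "weight ?u d z = S d z + (if shift u z + t > 0 then t else 0)"
        by (simp only: weight_def distrib_right mult_1 gt)
      have "?k z = - (max 0 (shift u z + t) - max 0 (shift u z) - (if shift u z + t > 0 then t else 0))"
        unfolding state_def pen wt elim(1) by (simp add: penalty_alt)
      then have "\<bar>?k z\<bar> = \<bar>max 0 (shift u z + t) - max 0 (shift u z) - (if shift u z + t > 0 then t else 0)\<bar>"
        by (simp only: abs_minus_cancel)
      also have "\<dots> \<le> (if 0 < \<bar>shift u z\<bar> \<and> \<bar>shift u z\<bar> \<le> \<bar>t\<bar> then \<bar>t\<bar> else 0)" by (rule max_slant_error)
      also have "\<dots> \<le> \<bar>\<gamma> * (indicator ?B z * S d z)\<bar>"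
        using elim(2) \<gamma> by (auto simp: t_def w2_def indicator_def abs_mult pos_divide_le_eq mult.commute)
      finally show ?case .
    qed
    then have "L2_norm \<Omega> ?k \<le> L2_norm \<Omega> (\<lambda>z. \<gamma> * (indicator ?B z * S d z))"
      by (intro L2_norm_mono[OF k] L2_mult L2_indicator_real S_L2 d B) simp
    also have "\<dots> = \<gamma> * L2_norm \<Omega> (\<lambda>z. indicator ?B z * S d z)"
      using L2_norm_cmult[OF L2_indicator_real[OF S_L2[OF d] B], of \<gamma>] \<gamma> by simp
    also have "\<dots> \<le> \<gamma> * (\<epsilon> / (2 * (C * \<gamma> + 1)) * L2_norm \<Gamma> d)"
      using \<gamma> small by (intro mult_left_mono \<delta>2(2)[OF d]) auto
    finally have "C * L2_norm \<Omega> ?k \<le> C * (\<gamma> * (\<epsilon> / (2 * (C * \<gamma> + 1)) * L2_norm \<Gamma> d))" by (rule mult_left_mono[OF _ C])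
    also have "\<dots> = (C * \<gamma> / (C * \<gamma> + 1)) * (\<epsilon> / 2 * L2_norm \<Gamma> d)" by (simp add: mult_ac)
    also have "\<dots> \<le> 1 * (\<epsilon> / 2 * L2_norm \<Gamma> d)"
      using C \<gamma> \<epsilon> by (intro mult_right_mono) (auto simp: L2_norm_nonneg divide_le_eq_1 add_nonneg_pos)
    finally have inner: "L2_norm \<Gamma> (T ?k) \<le> \<epsilon> / 2 * L2_norm \<Gamma> d" using T_bdd[OF k] by linarith
    have Tk: "AE x in \<Gamma>. T ?k x = T ?z x + T (weight ?u d) x" using T_lin[OF z weight_L2[OF u' d], of 1] by simp
    let ?e = "\<lambda>x. residual ?u x - residual u x - hess ?u d x"
    have e: "?e \<in> L2 \<Gamma>" unfolding hess_alt
      by (intro L2_diff residual_L2 u u' L2_add L2_mult d L2_indicator_real TS_L2 free_sets)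
    have "AE x in \<Gamma>. \<bar>?e x\<bar> \<le> \<bar>indicator ?A x * T ?z x\<bar> + \<bar>T ?k x\<bar>"
      using Tk multiplier_diff[OF u u'] AE_space
    proof eventually_elim
      case (elim x)
      let ?c = "\<nu> * \<beta> x" and ?q = "multiplier u x" and ?q' = "multiplier ?u x"
      \<comment> \<open>On the free set \<open>hess\<close> contributes T (weight) = T k - T z, and
        T z is the increment of the multiplier. What remains is the linearisation error of min and,
        on the free set, T k.\<close>
      have "\<bar>?e x\<bar> \<le> \<bar>min ?c ?q' - min ?c ?q - (if ?q' > ?c then 0 else ?q' - ?q)\<bar> + \<bar>T ?k x\<bar>"
        using elim by (auto simp: residual_def hess_alt free_def indicator_def algebra_simps)
      also have "\<dots> \<le> (if 0 < \<bar>?q - ?c\<bar> \<and> \<bar>?q - ?c\<bar> \<le> \<bar>?q' - ?q\<bar> then \<bar>?q' - ?q\<bar> else 0) + \<bar>T ?k x\<bar>"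
        using min_slant_error[of ?c ?q' ?q] by simp
      also have "\<dots> = \<bar>indicator ?A x * T ?z x\<bar> + \<bar>T ?k x\<bar>"
        using elim by (simp add: w1_def indicator_def)
      finally show ?case .
    qed
    from L2_norm_le_add[OF e L2_indicator_real[OF T_L2[OF z] A] T_L2[OF k] this]
    show "L2_norm \<Gamma> ?e \<le> \<epsilon> * L2_norm \<Gamma> d" using outer inner by (simp add: field_simps)
  qed
qed

end

subsection \<open>Optimality conditions\<close>

text \<open>The square of the positive part is convex with derivative 2 max 0 a, which is Lipschitz
  with constant 2. So the tangent bounds it from below and the tangent plus a square from
  above.\<close>

lemma max_square_bounds:
  fixes a a' :: real
  shows "2 * max 0 a * (a' - a) \<le> (max 0 a')\<^sup>2 - (max 0 a)\<^sup>2"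
    and "(max 0 a')\<^sup>2 - (max 0 a)\<^sup>2 \<le> 2 * max 0 a * (a' - a) + (a' - a)\<^sup>2"
proof -
  have "(max 0 a')\<^sup>2 - (max 0 a)\<^sup>2 - 2 * max 0 a * (a' - a) = (max 0 a' - max 0 a)\<^sup>2 + 2 * max 0 a * (max 0 a' - a' - (max 0 a - a))"
    by (simp add: power2_eq_square algebra_simps)
  moreover have "0 \<le> max 0 a * (max 0 a' - a' - (max 0 a - a))" by (cases "a > 0") (auto simp: max_def)
  ultimately show "2 * max 0 a * (a' - a) \<le> (max 0 a')\<^sup>2 - (max 0 a)\<^sup>2"
    using zero_le_power2[of "max 0 a' - max 0 a"] by linarith
  show "(max 0 a')\<^sup>2 - (max 0 a)\<^sup>2 \<le> 2 * max 0 a * (a' - a) + (a' - a)\<^sup>2"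
  proof (cases "a > 0")
    case True
    then show ?thesis using zero_le_power2[of a'] by (cases "a' > 0") (auto simp: max_def power2_eq_square algebra_simps)
  next
    case False
    have "(max 0 a')\<^sup>2 \<le> (a' - a)\<^sup>2" using False by (intro abs_le_square_iff[THEN iffD1]) auto
    then show ?thesis using False by simp
  qed
qed

lemma inner_square_add:
  fixes f g :: "'a \<Rightarrow> real"
  assumes f: "f \<in> L2 M" and g: "g \<in> L2 M"
  shows "L2_inner M g g = L2_inner M f f + 2 * L2_inner M f (\<lambda>x. g x - f x) + L2_inner M (\<lambda>x. g x - f x) (\<lambda>x. g x - f x)"
  using L2_inner_add(4)[OF g f f] L2_inner_add(4)[OF g f L2_diff[OF g f]] L2_inner_add(3)[OF g f g] L2_inner_add(3)[OF g f f]
    L2_inner_sym[of M f g] by simp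

context control
begin

text \<open>The gradient of \<open>cost\<close> in L^2(\<Gamma>), as \<open>cost_bounds\<close>
  shows.\<close>

definition deriv_cost :: "('a \<Rightarrow> real) \<Rightarrow> 'a \<Rightarrow> real" where
  "deriv_cost u x = \<nu> * u x - multiplier u x"

lemma deriv_cost_L2: "u \<in> L2 \<Gamma> \<Longrightarrow> deriv_cost u \<in> L2 \<Gamma>"
  unfolding deriv_cost_def[abs_def] by (intro L2_diff L2_mult multiplier_L2)

lemma penalty_bounds:
  assumes u: "u \<in> L2 \<Gamma>" and v: "v \<in> L2 \<Gamma>"
  defines "e \<equiv> \<lambda>z. S v z - S u z"
  shows "L2_inner \<Omega> (penalty u) (penalty u) + 2 * \<gamma> * L2_inner \<Omega> (penalty u) e \<le> L2_inner \<Omega> (penalty v) (penalty v)"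
    and "L2_inner \<Omega> (penalty v) (penalty v) \<le> L2_inner \<Omega> (penalty u) (penalty u) + 2 * \<gamma> * L2_inner \<Omega> (penalty u) e + \<gamma>\<^sup>2 * L2_inner \<Omega> e e"
proof -
  have e: "e \<in> L2 \<Omega>" unfolding e_def by (intro L2_diff S_L2 u v)
  note int = L2_inner_integrable[OF penalty_L2[OF u] penalty_L2[OF u], simplified] L2_inner_integrable[OF penalty_L2[OF v] penalty_L2[OF v], simplified]
    L2_inner_integrable[OF penalty_L2[OF u] e, simplified] L2_inner_integrable[OF e e, simplified]
  have pz: "penalty w z = max 0 (shift w z)" for w z by (simp add: penalty_alt)
  have pe: "2 * penalty u z * (shift v z - shift u z) = 2 * \<gamma> * (penalty u z * e z)" for z
    by (simp add: shift_diff e_def penalty_def indicator_def)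
  have ee: "(shift v z - shift u z)\<^sup>2 \<le> \<gamma>\<^sup>2 * (e z * e z)" for z
    by (simp add: shift_diff e_def indicator_def power2_eq_square)
  have "L2_inner \<Omega> (penalty u) (penalty u) + 2 * \<gamma> * L2_inner \<Omega> (penalty u) e = (LINT z|\<Omega>. penalty u z * penalty u z + 2 * \<gamma> * (penalty u z * e z))"
    using int by (simp add: L2_inner_def)
  also have "\<dots> \<le> (LINT z|\<Omega>. penalty v z * penalty v z)"
  proof (intro integral_mono)
    show "penalty u z * penalty u z + 2 * \<gamma> * (penalty u z * e z) \<le> penalty v z * penalty v z" for z
      using max_square_bounds(1)[of "shift u z" "shift v z", folded pz] pe[of z] unfolding power2_eq_square by linarith
  qed (use int in auto)
  finally show "L2_inner \<Omega> (penalty u) (penalty u) + 2 * \<gamma> * L2_inner \<Omega> (penalty u) e \<le> L2_inner \<Omega> (penalty v) (penalty v)"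
    by (simp add: L2_inner_def)
  have "(LINT z|\<Omega>. penalty v z * penalty v z) \<le> (LINT z|\<Omega>. penalty u z * penalty u z + 2 * \<gamma> * (penalty u z * e z) + \<gamma>\<^sup>2 * (e z * e z))"
  proof (intro integral_mono)
    show "penalty v z * penalty v z \<le> penalty u z * penalty u z + 2 * \<gamma> * (penalty u z * e z) + \<gamma>\<^sup>2 * (e z * e z)" for z
      using max_square_bounds(2)[of "shift v z" "shift u z", folded pz] pe[of z] ee[of z] unfolding power2_eq_square by linarith
  qed (use int in auto)
  also have "\<dots> = L2_inner \<Omega> (penalty u) (penalty u) + 2 * \<gamma> * L2_inner \<Omega> (penalty u) e + \<gamma>\<^sup>2 * L2_inner \<Omega> e e"
    using int by (simp add: L2_inner_def)
  finally show "L2_inner \<Omega> (penalty v) (penalty v) \<le> L2_inner \<Omega> (penalty u) (penalty u) + 2 * \<gamma> * L2_inner \<Omega> (penalty u) e + \<gamma>\<^sup>2 * L2_inner \<Omega> e e"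
    by (simp add: L2_inner_def)
qed

text \<open>The adjoint carries the derivatives of the tracking term and of the penalty from the
  domain to the boundary.\<close>

lemma state_pairing:
  assumes u: "u \<in> L2 \<Gamma>" and v: "v \<in> L2 \<Gamma>"
  shows "L2_inner \<Omega> (\<lambda>z. S u z - yd z) (\<lambda>z. S v z - S u z) + L2_inner \<Omega> (penalty u) (\<lambda>z. S v z - S u z)
    = - L2_inner \<Gamma> (multiplier u) (\<lambda>x. v x - u x)"
proof -
  have e: "(\<lambda>z. S v z - S u z) \<in> L2 \<Omega>" and d: "(\<lambda>x. v x - u x) \<in> L2 \<Gamma>" by (intro L2_diff S_L2 u v)+
  have q: "(\<lambda>z. state u z - yd z) \<in> L2 \<Omega>" by (intro L2_diff state_L2 u yd)
  have eq: "AE x in \<Gamma>. T (\<lambda>z. state u z - yd z) x = - multiplier u x"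
    using T_diff[OF state_L2[OF u] yd] multiplier_state[OF u] by eventually_elim simp
  have "L2_inner \<Omega> (\<lambda>z. S u z - yd z) (\<lambda>z. S v z - S u z) + L2_inner \<Omega> (penalty u) (\<lambda>z. S v z - S u z)
      = L2_inner \<Omega> (\<lambda>z. (S u z - yd z) + penalty u z) (\<lambda>z. S v z - S u z)"
    by (rule L2_inner_add(1)[symmetric]) (intro L2_diff S_L2 u v yd penalty_L2)+
  also have "\<dots> = L2_inner \<Omega> (\<lambda>z. state u z - yd z) (\<lambda>z. S v z - S u z)" by (simp add: state_def algebra_simps)
  also have "\<dots> = L2_inner \<Gamma> v (T (\<lambda>z. state u z - yd z)) - L2_inner \<Gamma> u (T (\<lambda>z. state u z - yd z))"
    using L2_inner_add(4)[OF S_L2[OF v] S_L2[OF u] q] adjoint[OF v q] adjoint[OF u q] by (simp add: L2_inner_sym[of \<Omega> _ "S _"])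
  also have "\<dots> = L2_inner \<Gamma> (\<lambda>x. v x - u x) (T (\<lambda>z. state u z - yd z))" by (rule L2_inner_add(3)[OF v u T_L2[OF q], symmetric])
  also have "\<dots> = L2_inner \<Gamma> (\<lambda>x. v x - u x) (\<lambda>x. - multiplier u x)"
    by (rule L2_norm_cong_diff(2)[OF T_L2[OF q] L2_minus[OF multiplier_L2[OF u]] d eq])
  finally show ?thesis by (simp add: L2_inner_minus L2_inner_sym[of \<Gamma> "multiplier u"])
qed

text \<open>The quadratic terms are expanded exactly, and the penalty lies between its tangent and a
  parabola. The lower bound expresses strong convexity with modulus \<nu>; the upper one makes the
  first-order condition necessary.\<close>

lemma cost_bounds:
  assumes u: "u \<in> L2 \<Gamma>" and v: "v \<in> L2 \<Gamma>"
  defines "d \<equiv> \<lambda>x. v x - u x"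
  shows "cost u + L2_inner \<Gamma> (deriv_cost u) d + \<nu>/2 * L2_inner \<Gamma> d d \<le> cost v"
    and "cost v \<le> cost u + L2_inner \<Gamma> (deriv_cost u) d + ((1 + \<gamma>) / 2 * C\<^sup>2 + \<nu>/2) * L2_inner \<Gamma> d d"
proof -
  let ?e = "\<lambda>z. S v z - S u z"
  have d: "d \<in> L2 \<Gamma>" unfolding d_def by (rule L2_diff[OF v u])
  have e: "?e \<in> L2 \<Omega>" by (intro L2_diff S_L2 u v)
  have s: "(\<lambda>z. S u z - yd z) \<in> L2 \<Omega>" "(\<lambda>z. S v z - yd z) \<in> L2 \<Omega>" by (intro L2_diff S_L2 u v yd)+
  have "L2_norm \<Omega> ?e \<le> C * L2_norm \<Gamma> d" unfolding d_def by (rule S_diff_norm[OF v u])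
  then have "(L2_norm \<Omega> ?e)\<^sup>2 \<le> (C * L2_norm \<Gamma> d)\<^sup>2" by (intro power_mono L2_norm_nonneg)
  then have ee: "L2_inner \<Omega> ?e ?e \<le> C\<^sup>2 * L2_inner \<Gamma> d d" by (simp add: L2_norm_sq power_mult_distrib)
  have dc: "L2_inner \<Gamma> (deriv_cost u) d = \<nu> * L2_inner \<Gamma> u d - L2_inner \<Gamma> (multiplier u) d"
    using L2_inner_add(3)[OF L2_mult[OF u] multiplier_L2[OF u] d, of \<nu>] by (simp add: deriv_cost_def[abs_def] L2_inner_cmult)
  define P where "P w = 1/(2*\<gamma>) * L2_inner \<Omega> (penalty w) (penalty w)" for w
  have P: "P u + L2_inner \<Omega> (penalty u) ?e \<le> P v" "P v \<le> P u + L2_inner \<Omega> (penalty u) ?e + \<gamma>/2 * L2_inner \<Omega> ?e ?e"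
    using mult_left_mono[OF penalty_bounds(1)[OF u v], of "1/(2*\<gamma>)"] mult_left_mono[OF penalty_bounds(2)[OF u v], of "1/(2*\<gamma>)"] \<gamma>
    by (simp_all add: P_def distrib_left power2_eq_square)
  have diff: "cost v - cost u - L2_inner \<Gamma> (deriv_cost u) d
      = 1/2 * L2_inner \<Omega> ?e ?e + \<nu>/2 * L2_inner \<Gamma> d d + (P v - P u - L2_inner \<Omega> (penalty u) ?e)"
    using inner_square_add[OF s] inner_square_add[OF u v] state_pairing[OF u v] dc
    by (simp add: cost_def P_def d_def[symmetric] algebra_simps)
  show "cost u + L2_inner \<Gamma> (deriv_cost u) d + \<nu>/2 * L2_inner \<Gamma> d d \<le> cost v"
    using diff P(1) L2_inner_self_nonneg[of \<Omega> ?e] by linarith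
  have "(1 + \<gamma>) / 2 * L2_inner \<Omega> ?e ?e \<le> (1 + \<gamma>) / 2 * (C\<^sup>2 * L2_inner \<Gamma> d d)" using \<gamma> by (intro mult_left_mono ee) simp
  moreover have "1/2 * L2_inner \<Omega> ?e ?e + \<gamma>/2 * L2_inner \<Omega> ?e ?e = (1 + \<gamma>) / 2 * L2_inner \<Omega> ?e ?e" by (simp add: field_simps)
  moreover have "((1 + \<gamma>) / 2 * C\<^sup>2 + \<nu>/2) * L2_inner \<Gamma> d d = (1 + \<gamma>) / 2 * (C\<^sup>2 * L2_inner \<Gamma> d d) + \<nu>/2 * L2_inner \<Gamma> d d"
    by (simp add: algebra_simps)
  ultimately show "cost v \<le> cost u + L2_inner \<Gamma> (deriv_cost u) d + ((1 + \<gamma>) / 2 * C\<^sup>2 + \<nu>/2) * L2_inner \<Gamma> d d"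
    using diff P(2) by linarith
qed

definition adm :: "('a \<Rightarrow> real) set" where
  "adm = {u \<in> L2 \<Gamma>. AE x in \<Gamma>. u x \<le> \<beta> x}"

lemma adm_segment:
  assumes u: "u \<in> adm" and v: "v \<in> adm" and t: "0 \<le> t" "t \<le> 1"
  shows "(\<lambda>x. u x + t * (v x - u x)) \<in> adm"
proof -
  have "AE x in \<Gamma>. u x + t * (v x - u x) \<le> \<beta> x"
    using conjunct2[OF u[unfolded adm_def mem_Collect_eq]] conjunct2[OF v[unfolded adm_def mem_Collect_eq]]
  proof eventually_elim
    case (elim x)
    have "u x + t * (v x - u x) = (1 - t) * u x + t * v x" by (simp add: algebra_simps)
    also have "\<dots> \<le> (1 - t) * \<beta> x + t * \<beta> x" using elim t by (intro add_mono mult_left_mono) auto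
    finally show ?case by (simp add: algebra_simps)
  qed
  moreover have "(\<lambda>x. u x + t * (v x - u x)) \<in> L2 \<Gamma>"
    using u v by (auto simp: adm_def intro!: L2_add[of u] L2_mult L2_diff)
  ultimately show ?thesis by (simp add: adm_def)
qed

text \<open>Strong convexity makes minimising sequences converge in norm, and \<beta> itself is
  admissible. The constraint passes to the limit because the excess of u over \<beta> is pointwise
  at most |X n - u|; the tangent bound at u gives lower semicontinuity.\<close>

lemma minimizer_exists: "\<exists>u\<in>adm. \<forall>v\<in>adm. cost u \<le> cost v"
proof -
  interpret V: semi_hilbert "L2 \<Gamma> :: ('a \<Rightarrow> real) set" "L2_inner \<Gamma>" by (rule semi_hilbert_L2)
  have sub: "adm \<subseteq> L2 \<Gamma>" by (auto simp: adm_def)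
  \<comment> \<open>At the midpoint m the linear terms cancel, and u - m and v - m have half the
    length of u - v, so twice \<nu>/2 times 1/4 is left.\<close>
  have mid: "\<exists>w\<in>adm. 2 * cost w + \<nu>/4 * L2_inner \<Gamma> (\<lambda>x. u x - v x) (\<lambda>x. u x - v x) \<le> cost u + cost v"
    if u: "u \<in> adm" and v: "v \<in> adm" for u v
  proof -
    let ?m = "\<lambda>x. u x + 1/2 * (v x - u x)" and ?d = "\<lambda>x. u x - v x"
    have m: "?m \<in> adm" by (rule adm_segment[OF u v]) auto
    note L = subsetD[OF sub u] subsetD[OF sub v] subsetD[OF sub m]
    have h: "(\<lambda>x. u x - ?m x) = (\<lambda>x. 1/2 * ?d x)" "(\<lambda>x. v x - ?m x) = (\<lambda>x. (- 1/2) * ?d x)"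
      by (simp_all add: fun_eq_iff field_simps)
    show ?thesis
      using cost_bounds(1)[OF L(3,1)] cost_bounds(1)[OF L(3,2)] unfolding h L2_inner_cmult
      by (intro bexI[OF _ m]) linarith
  qed
  have pos: "0 \<le> cost u" for u
    unfolding cost_def using \<gamma> \<nu> by (intro add_nonneg_nonneg mult_nonneg_nonneg L2_inner_self_nonneg) auto
  have "adm \<noteq> {}" using \<beta> by (auto simp: adm_def)
  then have "\<exists>X u m. (\<forall>n::nat. X n \<in> adm) \<and> u \<in> L2 \<Gamma> \<and> (\<lambda>n. V.nrm (\<lambda>x. X n x - u x)) \<longlonglongrightarrow> 0 \<and>
      (\<lambda>n. cost (X n)) \<longlonglongrightarrow> m \<and> (\<forall>v\<in>adm. m \<le> cost v)"
    by (rule V.uniformly_convex_minimizing_sequence[OF sub _ _ mid pos]) (use \<nu> in simp)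
  then obtain X :: "nat \<Rightarrow> 'a \<Rightarrow> real" and u m where X: "\<And>n. X n \<in> adm" and u: "u \<in> L2 \<Gamma>" and lim: "(\<lambda>n. L2_norm \<Gamma> (\<lambda>x. X n x - u x)) \<longlonglongrightarrow> 0"
    and m: "(\<lambda>n. cost (X n)) \<longlonglongrightarrow> m" "\<And>v. v \<in> adm \<Longrightarrow> m \<le> cost v"
    unfolding L2_norm_def by blast
  note XL = subsetD[OF sub X]
  let ?p = "\<lambda>x. max 0 (u x - \<beta> x)"
  have p: "?p \<in> L2 \<Gamma>" by (intro L2_pos_part L2_diff u \<beta>)
  have "L2_norm \<Gamma> ?p \<le> L2_norm \<Gamma> (\<lambda>x. X n x - u x)" for n
  proof (rule L2_norm_mono[OF p L2_diff[OF XL u]])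
    have "AE x in \<Gamma>. X n x \<le> \<beta> x" using X[of n] by (simp add: adm_def)
    then show "AE x in \<Gamma>. norm (?p x) \<le> norm (X n x - u x)" by eventually_elim auto
  qed
  then have "L2_norm \<Gamma> ?p \<le> 0" by (intro tendsto_lowerbound[OF lim]) auto
  then have "AE x in \<Gamma>. ?p x = 0" using L2_norm_eq_zero[OF p] L2_norm_nonneg[of \<Gamma> ?p] by simp
  then have "AE x in \<Gamma>. u x \<le> \<beta> x" by eventually_elim (simp add: max_def split: if_splits)
  with u have u_adm: "u \<in> adm" by (simp add: adm_def)
  let ?f = "L2_norm \<Gamma> (deriv_cost u)"
  have "cost u \<le> cost (X n) + ?f * L2_norm \<Gamma> (\<lambda>x. X n x - u x)" for n
  proof -
    have d: "(\<lambda>x. X n x - u x) \<in> L2 \<Gamma>" by (rule L2_diff[OF XL u])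
    have "0 \<le> \<nu>/2 * L2_inner \<Gamma> (\<lambda>x. X n x - u x) (\<lambda>x. X n x - u x)" using \<nu> by (intro mult_nonneg_nonneg L2_inner_self_nonneg) auto
    then show ?thesis using cost_bounds(1)[OF u XL[of n]] L2_cauchy_schwarz[OF deriv_cost_L2[OF u] d] by linarith
  qed
  moreover have "(\<lambda>n. cost (X n) + ?f * L2_norm \<Gamma> (\<lambda>x. X n x - u x)) \<longlonglongrightarrow> m + ?f * 0" by (intro tendsto_intros m(1) lim)
  ultimately have "cost u \<le> m + ?f * 0" by (intro tendsto_lowerbound[of _ "m + ?f * 0" sequentially]) auto
  with m(2) u_adm show ?thesis by force
qed

text \<open>Comparison with u + t (v - u) for t = 1 / (n + 1), divided by t; by the quadratic upper
  bound the error is of order t.\<close>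

lemma minimizer_variational:
  assumes u: "u \<in> adm" and min: "\<And>v. v \<in> adm \<Longrightarrow> cost u \<le> cost v" and v: "v \<in> adm"
  shows "0 \<le> L2_inner \<Gamma> (deriv_cost u) (\<lambda>x. v x - u x)"
proof -
  let ?d = "\<lambda>x. v x - u x"
  define A where "A = L2_inner \<Gamma> (deriv_cost u) ?d"
  define B where "B = ((1 + \<gamma>) / 2 * C\<^sup>2 + \<nu>/2) * L2_inner \<Gamma> ?d ?d"
  have "0 \<le> A + B * (1 / real (Suc n))" for n
  proof -
    define t where "t = 1 / real (Suc n)"
    have t: "0 < t" "t \<le> 1" by (simp_all add: t_def)
    let ?w = "\<lambda>x. u x + t * ?d x"
    have w: "?w \<in> adm" by (rule adm_segment[OF u v]) (use t in auto)
    have uL: "u \<in> L2 \<Gamma>" and wL: "?w \<in> L2 \<Gamma>" using u w by (simp_all add: adm_def)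
    have h: "(\<lambda>x. ?w x - u x) = (\<lambda>x. t * ?d x)" by simp
    have "0 \<le> t * A + t * (t * B)"
      using cost_bounds(2)[OF uL wL] min[OF w] unfolding h L2_inner_cmult A_def B_def by (simp add: algebra_simps)
    then have "0 \<le> t * (A + B * t)" by (simp add: algebra_simps)
    then have "0 \<le> A + B * t" using t by (simp add: zero_le_mult_iff)
    then show ?thesis by (simp only: t_def)
  qed
  moreover have "(\<lambda>n. A + B * (1 / real (Suc n))) \<longlonglongrightarrow> A + B * 0"
    by (intro tendsto_intros LIMSEQ_Suc[OF lim_1_over_n])
  ultimately have "0 \<le> A + B * 0" by (intro tendsto_lowerbound[of _ "A + B * 0" sequentially]) auto
  then show ?thesis by (simp add: A_def)
qed

text \<open>The inequality is tested with the pointwise projection v = min \<beta> (multiplier /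
  \<nu>). Then the pairing is at most - \<nu> \<parallel>v - u\<parallel>^2, so u equals this
  projection, which is the equation for the residual divided by \<nu>.\<close>

lemma variational_residual:
  assumes u: "u \<in> adm" and vi: "\<And>v. v \<in> adm \<Longrightarrow> 0 \<le> L2_inner \<Gamma> (deriv_cost u) (\<lambda>x. v x - u x)"
  shows "AE x in \<Gamma>. residual u x = 0"
proof -
  have uL: "u \<in> L2 \<Gamma>" and le: "AE x in \<Gamma>. u x \<le> \<beta> x" using u by (simp_all add: adm_def)
  let ?p = "\<lambda>x. (1 / \<nu>) * multiplier u x"
  let ?v = "\<lambda>x. min (\<beta> x) (?p x)"
  let ?d = "\<lambda>x. ?v x - u x"
  have vL: "?v \<in> L2 \<Gamma>" by (intro L2_min \<beta> L2_mult multiplier_L2 uL)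
  then have v: "?v \<in> adm" by (simp add: adm_def)
  have dL: "?d \<in> L2 \<Gamma>" by (rule L2_diff[OF vL uL])
  have "L2_inner \<Gamma> (deriv_cost u) ?d \<le> - \<nu> * L2_inner \<Gamma> ?d ?d"
  proof -
    have "(LINT x|\<Gamma>. deriv_cost u x \<bullet> ?d x) \<le> (LINT x|\<Gamma>. - \<nu> * (?d x \<bullet> ?d x))"
    proof (rule integral_mono_AE)
      show "integrable \<Gamma> (\<lambda>x. deriv_cost u x \<bullet> ?d x)" by (rule L2_inner_integrable[OF deriv_cost_L2[OF uL] dL])
      show "integrable \<Gamma> (\<lambda>x. - \<nu> * (?d x \<bullet> ?d x))" by (rule integrable_mult_right[OF L2_inner_integrable[OF dL dL]])
      show "AE x in \<Gamma>. deriv_cost u x \<bullet> ?d x \<le> - \<nu> * (?d x \<bullet> ?d x)"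
        using le
      proof eventually_elim
        case (elim x)
        define v where "v = min (\<beta> x) (?p x)"
        have dc: "deriv_cost u x = \<nu> * (u x - ?p x)" using \<nu> by (simp add: deriv_cost_def algebra_simps)
        have "0 \<le> (?p x - v) * (v - u x)"
          using elim by (cases "?p x \<le> \<beta> x") (auto simp: v_def min_def intro!: mult_nonneg_nonneg)
        then have "0 \<le> \<nu> * ((?p x - v) * (v - u x))" using \<nu> by simp
        also have "\<dots> = - \<nu> * ((v - u x) * (v - u x)) - \<nu> * (u x - ?p x) * (v - u x)" by algebra
        finally show ?case unfolding dc v_def[symmetric] inner_real_def by linarith
      qed
    qed
    then show ?thesis by (simp add: L2_inner_def)
  qed
  then have "\<nu> * L2_inner \<Gamma> ?d ?d \<le> 0" using vi[OF v] by linarith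
  then have "L2_inner \<Gamma> ?d ?d \<le> 0" using \<nu> by (simp add: mult_le_0_iff)
  from L2_eq_ae_zero[OF dL this] show ?thesis
    by eventually_elim (use \<nu> in \<open>auto simp: residual_def min_def field_simps split: if_splits\<close>)
qed

text \<open>At almost every point of a root either the gradient is zero, or u = \<beta> and the
  gradient is negative; in both cases it has a nonnegative product with v - u. Strong convexity
  upgrades this to quadratic growth, which yields uniqueness of minimisers and of roots
  alike.\<close>

lemma residual_growth:
  assumes u: "u \<in> L2 \<Gamma>" and res: "AE x in \<Gamma>. residual u x = 0"
  shows "u \<in> adm" and "\<And>v. v \<in> adm \<Longrightarrow> cost u + \<nu>/2 * L2_inner \<Gamma> (\<lambda>x. v x - u x) (\<lambda>x. v x - u x) \<le> cost v"
proof -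
  have "AE x in \<Gamma>. u x \<le> \<beta> x"
    using res
  proof eventually_elim
    case (elim x)
    then have "\<nu> * u x \<le> \<nu> * \<beta> x" by (simp add: residual_def)
    then show ?case using \<nu> by simp
  qed
  with u show "u \<in> adm" by (simp add: adm_def)
  fix v assume v: "v \<in> adm"
  then have vL: "v \<in> L2 \<Gamma>" and "AE x in \<Gamma>. v x \<le> \<beta> x" by (simp_all add: adm_def)
  from this(2) res have "AE x in \<Gamma>. 0 \<le> deriv_cost u x \<bullet> (v x - u x)"
  proof eventually_elim
    case (elim x)
    show ?case
    proof (cases "multiplier u x \<le> \<nu> * \<beta> x")
      case True
      then show ?thesis using elim by (simp add: residual_def deriv_cost_def)
    next
      case False
      then have "u x = \<beta> x" using elim \<nu> by (simp add: residual_def)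
      then show ?thesis using elim False by (simp add: deriv_cost_def mult_nonpos_nonpos)
    qed
  qed
  then have "0 \<le> L2_inner \<Gamma> (deriv_cost u) (\<lambda>x. v x - u x)" unfolding L2_inner_def by (rule integral_nonneg_AE)
  with cost_bounds(1)[OF u vL] show "cost u + \<nu>/2 * L2_inner \<Gamma> (\<lambda>x. v x - u x) (\<lambda>x. v x - u x) \<le> cost v" by linarith
qed

theorem semismooth_newton:
  "\<exists>w\<in>adm. (\<forall>v\<in>adm. cost w \<le> cost v) \<and>
     (\<forall>u\<in>adm. (\<forall>v\<in>adm. cost u \<le> cost v) \<longrightarrow> eq_ae \<Gamma> u w) \<and>
     eq_ae \<Gamma> (residual w) (\<lambda>x. 0) \<and>
     (\<forall>u\<in>L2 \<Gamma>. eq_ae \<Gamma> (residual u) (\<lambda>x. 0) \<longrightarrow> eq_ae \<Gamma> u w) \<and>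
     (\<exists>\<delta>>0. \<forall>u0\<in>L2 \<Gamma>. L2_norm \<Gamma> (\<lambda>x. u0 x - w x) < \<delta> \<longrightarrow>
        (\<exists>u. newton_sequence \<Gamma> residual hess u \<and> u 0 = u0) \<and>
        (\<forall>u. newton_sequence \<Gamma> residual hess u \<and> u 0 = u0 \<longrightarrow> q_superlinear_convergence \<Gamma> u w))"
proof -
  obtain w where w: "w \<in> adm" and min: "\<And>v. v \<in> adm \<Longrightarrow> cost w \<le> cost v" using minimizer_exists by blast
  have wL: "w \<in> L2 \<Gamma>" using w by (simp add: adm_def)
  have res: "AE x in \<Gamma>. residual w x = 0" by (rule variational_residual[OF w minimizer_variational[OF w min]])
  have uniq: "AE x in \<Gamma>. u x = w x" if u: "u \<in> adm" and le: "cost u \<le> cost w" for u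
  proof -
    have d: "(\<lambda>x. u x - w x) \<in> L2 \<Gamma>" using u wL by (intro L2_diff) (simp_all add: adm_def)
    have "\<nu>/2 * L2_inner \<Gamma> (\<lambda>x. u x - w x) (\<lambda>x. u x - w x) \<le> 0" using residual_growth(2)[OF wL res u] le by linarith
    then have "L2_inner \<Gamma> (\<lambda>x. u x - w x) (\<lambda>x. u x - w x) \<le> 0" using \<nu> by (simp add: mult_le_0_iff)
    from L2_eq_ae_zero[OF d this] show ?thesis by eventually_elim simp
  qed
  have uniq_res: "AE x in \<Gamma>. u x = w x" if u: "u \<in> L2 \<Gamma>" and "AE x in \<Gamma>. residual u x = 0" for u
  proof (rule uniq)
    note g = residual_growth[OF that]
    show "u \<in> adm" by (rule g(1))
    have "0 \<le> \<nu>/2 * L2_inner \<Gamma> (\<lambda>x. w x - u x) (\<lambda>x. w x - u x)" using \<nu> by (intro mult_nonneg_nonneg L2_inner_self_nonneg) auto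
    with g(2)[OF w] show "cost u \<le> cost w" by linarith
  qed
  have "\<exists>\<delta>>0. \<forall>u0\<in>L2 \<Gamma>. L2_norm \<Gamma> (\<lambda>x. u0 x - w x) < \<delta> \<longrightarrow>
        (\<exists>u. newton_sequence \<Gamma> residual hess u \<and> u 0 = u0) \<and>
        (\<forall>u. newton_sequence \<Gamma> residual hess u \<and> u 0 = u0 \<longrightarrow> q_superlinear_convergence \<Gamma> u w)"
    by (rule newton_superlinear[OF residual_slant hess_inverse wL]) (use res in \<open>simp_all add: eq_ae_def\<close>)
  with w min uniq res uniq_res show ?thesis by (intro bexI[OF _ w]) (auto simp: eq_ae_def)
qed

end

section \<open>Transfer to the polygon\<close>

lemma L2_restrict_space:
  fixes f :: "'a \<Rightarrow> real"
  assumes W: "W \<in> sets M" and f: "f \<in> L2 (restrict_space M W)"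
  shows "(\<lambda>x. indicator W x * f x) \<in> L2 M"
proof -
  have W': "W \<inter> space M \<in> sets M" using W by auto
  have "(\<lambda>x. indicator W x *\<^sub>R f x) \<in> borel_measurable M"
    by (rule borel_measurable_restrict_space_iff[OF W', THEN iffD1, OF L2_measurable[OF f]])
  moreover have "integrable M (\<lambda>x. indicator W x *\<^sub>R (norm (f x))\<^sup>2)"
    by (rule integrable_restrict_space[OF W', THEN iffD1, OF L2_sq_integrable[OF f]])
  then have "integrable M (\<lambda>x. (norm (indicator W x * f x))\<^sup>2)"
    by (rule Bochner_Integration.integrable_cong[THEN iffD1, rotated 2]) (auto simp: indicator_def)
  ultimately show ?thesis by (simp add: Lp2_iff)
qed

text \<open>Pointwise |f|^2 \<le> 1 + |f|^q, and constants are integrable because the measure is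
  finite.\<close>

lemma Lp_subset_L2:
  fixes f :: "'a \<Rightarrow> 'b::euclidean_space"
  assumes "finite_measure M" and "q \<ge> 2" and f: "f \<in> Lp q M"
  shows "f \<in> L2 M"
proof -
  interpret finite_measure M by fact
  have f': "f \<in> borel_measurable M" "integrable M (\<lambda>x. norm (f x) powr q)" using f by (simp_all add: Lp_def)
  have "integrable M (\<lambda>x. (norm (f x))\<^sup>2)"
  proof (rule Bochner_Integration.integrable_bound)
    show "integrable M (\<lambda>x. 1 + norm (f x) powr q)" using f'(2) by simp
    show "(\<lambda>x. (norm (f x))\<^sup>2) \<in> borel_measurable M" using f'(1) by measurable
    have "(norm (f x))\<^sup>2 \<le> 1 + norm (f x) powr q" for x
    proof (cases "norm (f x) \<le> 1")
      case True
      then have "(norm (f x))\<^sup>2 \<le> 1" by (simp add: power_le_one)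
      then show ?thesis using powr_ge_zero[of "norm (f x)" q] by linarith
    next
      case False
      then have "norm (f x) powr 2 \<le> norm (f x) powr q" using \<open>q \<ge> 2\<close> by (intro powr_mono) auto
      then show ?thesis by (simp add: powr_numeral)
    qed
    then show "AE x in M. norm ((norm (f x))\<^sup>2) \<le> norm (1 + norm (f x) powr q)"
      by (intro AE_I2) (auto intro: order_trans[OF _ abs_ge_self])
  qed
  with f'(1) show ?thesis by (simp add: Lp2_iff)
qed

theorem theorem6p1:
  fixes \<Omega> \<omega> :: "(real^2) set"
    and y\<^sub>d \<beta> b \<mu> :: "real^2 \<Rightarrow> real"
    and \<gamma> \<nu> q :: real
  assumes "convex_polygonal_domain \<Omega>"
    and "open \<omega>" and "connected \<omega>" and "\<omega> \<noteq> {}" and "closure \<omega> \<subseteq> \<Omega>"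
    and "\<gamma> > 0"
    and "y\<^sub>d \<in> L2 (lebesgue_on \<Omega>)"
    and "continuous_on (frontier \<Omega>) \<beta>"
    and "continuous_on (closure \<omega>) b"
    and "q > 2" and "\<mu> \<in> Lp q (lebesgue_on (closure \<omega>))"
    and "\<nu> > 0"
  defines "\<Gamma> \<equiv> boundary_measure \<Omega>"
  defines "G \<equiv> G_map \<Omega> \<omega> y\<^sub>d \<beta> b \<mu> \<gamma> \<nu>"
  defines "M \<equiv> M_map \<Omega> \<omega> y\<^sub>d \<beta> b \<mu> \<gamma> \<nu>"
  shows "slantly_differentiable \<Gamma> \<Gamma> G \<and>
         slant_differential \<Gamma> \<Gamma> G M \<and>
         (\<exists>C. \<forall>u\<in>L2 \<Gamma>. \<exists>N. L2_bounded_linear \<Gamma> \<Gamma> N \<and>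
           (\<forall>v\<in>L2 \<Gamma>. eq_ae \<Gamma> (N (M u v)) v \<and> eq_ae \<Gamma> (M u (N v)) v \<and>
              L2_norm \<Gamma> (N v) \<le> C * L2_norm \<Gamma> v)) \<and>
         (\<exists>u\<^sub>\<gamma>. is_minimizer \<Omega> \<omega> y\<^sub>d \<beta> b \<mu> \<gamma> \<nu> u\<^sub>\<gamma> \<and>
           (\<forall>w. is_minimizer \<Omega> \<omega> y\<^sub>d \<beta> b \<mu> \<gamma> \<nu> w \<longrightarrow> eq_ae \<Gamma> w u\<^sub>\<gamma>) \<and>
           eq_ae \<Gamma> (G u\<^sub>\<gamma>) (\<lambda>x. 0) \<and>
           (\<forall>w\<in>L2 \<Gamma>. eq_ae \<Gamma> (G w) (\<lambda>x. 0) \<longrightarrow> eq_ae \<Gamma> w u\<^sub>\<gamma>) \<and>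
           (\<exists>\<delta>>0. \<forall>u0\<in>L2 \<Gamma>. L2_norm \<Gamma> (\<lambda>x. u0 x - u\<^sub>\<gamma> x) < \<delta> \<longrightarrow>
              (\<exists>u. newton_sequence \<Gamma> G M u \<and> u 0 = u0) \<and>
              (\<forall>u. newton_sequence \<Gamma> G M u \<and> u 0 = u0 \<longrightarrow>
                 q_superlinear_convergence \<Gamma> u u\<^sub>\<gamma>)))"
proof -
  obtain H where H: "finite H" "closure \<Omega> = {x. \<forall>(a, c)\<in>H. a \<bullet> x \<le> c}" "\<Omega> = {x. \<forall>(a, c)\<in>H. a \<bullet> x < c}"
    "\<forall>(a, c)\<in>H. a \<noteq> 0 \<and> (\<exists>(p, q)\<in>sides \<Omega>. closure \<Omega> \<inter> {x. a \<bullet> x = c} = closed_segment p q)"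
    using halfplane_representation[OF assms(1)] by (elim exE conjE)
  interpret P: polygon \<Omega> H
  proof
    show "open \<Omega>" "bounded \<Omega>" using assms(1) by (simp_all add: convex_polygonal_domain_def)
    show "a \<noteq> 0 \<and> (\<exists>(p, q)\<in>sides \<Omega>. closure \<Omega> \<inter> {x. a \<bullet> x = c} = closed_segment p q)" if "(a, c) \<in> H" for a c
      using bspec[OF H(4) that] unfolding prod.case .
  qed (rule assms(1) H(1-3))+
  let ?W = "closure \<omega>" and ?M = "lebesgue_on \<Omega>"
  have W: "?W \<in> sets lebesgue" by auto
  have W\<Omega>: "?W \<in> sets ?M" using assms(5) W by (simp add: sets_restrict_space_iff P.dom_sets)
  \<comment> \<open>Since the closure of \<omega> lies in \<Omega>, its Lebesgue measure is a
    restriction of the one on \<Omega>, and functions on it can be extended by zero.\<close>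
  have Wr: "lebesgue_on ?W = restrict_space ?M ?W"
    using restrict_restrict_space[of \<Omega> lebesgue ?W] P.dom_sets(2) W assms(5) by (simp add: Int_absorb1)
  have comp: "compact ?W" using P.bounded_dom assms(5) by (auto simp: compact_eq_bounded_closed intro: bounded_subset)
  have fin: "finite_measure (lebesgue_on ?W)"
    unfolding Wr by (rule finite_measure_restrict_space[OF P.finite_M\<Omega> W\<Omega>])
  have \<mu>L: "(\<lambda>x. indicator ?W x * \<mu> x) \<in> L2 ?M"
    by (rule L2_restrict_space[OF W\<Omega> Lp_subset_L2[of _ q]]) (use fin assms(10,11) in \<open>simp_all add: Wr\<close>)
  have bL: "(\<lambda>x. indicator ?W x * b x) \<in> L2 ?M"
  proof (rule L2_restrict_space[OF W\<Omega>])
    obtain B where B: "\<And>x. x \<in> ?W \<Longrightarrow> norm (b x) \<le> B"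
      using compact_imp_bounded[OF compact_continuous_image[OF assms(9) comp]] by (auto simp: bounded_iff)
    show "b \<in> L2 (restrict_space ?M ?W)"
      unfolding Wr[symmetric]
      by (rule L2_bounded[OF fin continuous_imp_measurable_on_sets_lebesgue[OF assms(9) W]])
        (intro AE_I2, use B in simp)
  qed
  obtain C1 where C1: "C1 \<ge> 0" "\<And>u. u \<in> L2 \<Gamma> \<Longrightarrow> L2_norm ?M (S_op \<Omega> u) \<le> C1 * L2_norm \<Gamma> u"
    using P.S_op_bounded unfolding \<Gamma>_def by blast
  obtain C2 where C2: "C2 \<ge> 0" "\<And>z. z \<in> L2 ?M \<Longrightarrow> L2_norm \<Gamma> (S_adj \<Omega> z) \<le> C2 * L2_norm ?M z"
    using P.S_adj_bounded unfolding \<Gamma>_def by blast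
  interpret E: control \<Gamma> ?M "S_op \<Omega>" "S_adj \<Omega>" ?W y\<^sub>d \<mu> b \<beta> \<gamma> \<nu> "max C1 C2"
  proof (rule control.intro)
    show "L2_norm ?M (S_op \<Omega> u) \<le> max C1 C2 * L2_norm \<Gamma> u" if "u \<in> L2 \<Gamma>" for u
      by (rule order_trans[OF C1(2)[OF that]]) (intro mult_right_mono L2_norm_nonneg, simp)
    show "L2_norm \<Gamma> (S_adj \<Omega> z) \<le> max C1 C2 * L2_norm ?M z" if "z \<in> L2 ?M" for z
      by (rule order_trans[OF C2(2)[OF that]]) (intro mult_right_mono L2_norm_nonneg, simp)
    show "finite_measure \<Gamma>" "finite_measure ?M" unfolding \<Gamma>_def by (rule P.finite_\<Gamma> P.finite_M\<Omega>)+
    show "equi_L2 \<Gamma> ?M (S_op \<Omega>)" "equi_L2 ?M \<Gamma> (S_adj \<Omega>)"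
      unfolding \<Gamma>_def by (rule P.equi_L2_S_op P.equi_L2_S_adj)+
    show "\<beta> \<in> L2 \<Gamma>" unfolding \<Gamma>_def by (rule P.continuous_L2_\<Gamma>[OF assms(8)])
    show "S_op \<Omega> u \<in> L2 ?M" if "u \<in> L2 \<Gamma>" for u using P.S_op_adjoint(1) that unfolding \<Gamma>_def .
    show "S_adj \<Omega> z \<in> L2 \<Gamma>" if "z \<in> L2 ?M" for z using P.S_adj_L2[OF that] unfolding \<Gamma>_def .
    show "L2_inner ?M (S_op \<Omega> u) z = L2_inner \<Gamma> u (S_adj \<Omega> z)" if "u \<in> L2 \<Gamma>" "z \<in> L2 ?M" for u z
      using P.S_op_adjoint(2) that unfolding \<Gamma>_def by blast
  qed (use C1(1) in \<open>auto intro: W\<Omega> assms(6,7,12) \<mu>L bL\<close>)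
  \<comment> \<open>The concrete maps coincide with the abstract ones as functions, not merely
    almost everywhere, so the abstract conclusions apply after rewriting.\<close>
  have mult: "multiplier_term \<Omega> \<omega> y\<^sub>d b \<mu> \<gamma> u = E.multiplier u" for u
    by (simp add: fun_eq_iff multiplier_term_def E.multiplier_def E.penalty_def[abs_def])
  have G: "G = E.residual" by (simp add: fun_eq_iff G_def G_map_def E.residual_def mult)
  have space_\<Gamma>: "space \<Gamma> = frontier \<Omega>" by (simp add: \<Gamma>_def space_boundary_measure)
  have free: "control_free_set \<Omega> \<omega> y\<^sub>d \<beta> b \<mu> \<gamma> \<nu> u = E.free u" for u
    by (simp add: control_free_set_def control_active_set_def E.free_def mult space_\<Gamma>)
  have M: "M = E.hess"
    by (simp add: fun_eq_iff M_def M_map_def E.hess_def free state_active_set_def E.act_def)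
  have adm: "admissible \<Omega> \<beta> = E.adm" unfolding admissible_def E.adm_def by (simp only: \<Gamma>_def)
  have cost: "objective \<Omega> \<omega> y\<^sub>d b \<mu> \<gamma> \<nu> u = E.cost u" for u
  proof -
    have "(LINT x|lebesgue_on ?W. (max 0 (\<mu> x + \<gamma> * (S_op \<Omega> u x - b x)))\<^sup>2)
        = (LINT x|?M. indicator ?W x *\<^sub>R (max 0 (\<mu> x + \<gamma> * (S_op \<Omega> u x - b x)))\<^sup>2)"
      unfolding Wr using W\<Omega> by (intro integral_restrict_space) auto
    also have "\<dots> = L2_inner ?M (E.penalty u) (E.penalty u)"
      unfolding L2_inner_def by (intro Bochner_Integration.integral_cong refl)
        (auto simp: E.penalty_def indicator_def power2_eq_square)
    finally show ?thesis by (simp add: objective_def \<Gamma>_def[symmetric] E.cost_def L2_norm_sq)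
  qed
  have min: "is_minimizer \<Omega> \<omega> y\<^sub>d \<beta> b \<mu> \<gamma> \<nu> u \<longleftrightarrow> u \<in> E.adm \<and> (\<forall>v\<in>E.adm. E.cost u \<le> E.cost v)" for u
    by (simp add: is_minimizer_def adm cost)
  show ?thesis
    unfolding min G M slantly_differentiable_def using E.residual_slant E.hess_inverse E.semismooth_newton by blast
qed

end
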